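(* Let $T>0$, $n\ge 1$, and let $F:[0,T]\times\mathbb{R}^n\times\mathbb{R}\times\mathbb{R}^n\times S^n\to\mathbb{R}$ satisfy the structural assumptions (A0)–(A3) listed in the context. Let $u:[0,T)\times\mathbb{R}^n\to\mathbb{R}$ be bounded and upper semicontinuous and $v:[0,T)\times\mathbb{R}^n\to\mathbb{R}$ be bounded and lower semicontinuous, and extend them to $[0,T]\times\mathbb{R}^n$ by $$u(T,x)=\limsup_{\substack{(t,y)\in[0,T)\times\mathbb{R}^n\\ t\to T,\ y\to x}}u(t,y),\qquad v(T,x)=\liminf_{\substack{(t,y)\in[0,T)\times\mathbb{R}^n\\ t\to T,\ y\to x}}v(t,y).$$ Assume that, in the sense of parabolic viscosity sub- and supersolutions, $$\partial_t u-F(t,x,u,Du,D^2u)\le 0\le \partial_t v-F(t,x,v,Dv,D^2v)\quad\text{on }(0,T)\times\mathbb{R}^n. \qquad ( * )$$ Then: (i) The inequalities $( * )$ hold, in the viscosity sense, on $(0,T]\times\mathbb{R}^n$ (that is, $u$ is a viscosity subsolution and $v$ is a viscosity supersolution of $\partial_t-F=0$ on $(0,T]\times\mathbb{R}^n$). (ii) If $u_0:=u(0,\cdot)$ and $v_0:=v(0,\cdot)$ are bounded and uniformly continuous on $\mathbb{R}^n$ and $u_0\le v_0$ on $\mathbb{R}^n$, then there is a function $l:(0,\infty)\to\mathbb{R}$, not depending on $(t,x,y)$, with $l(\alpha)\to 0$ as $\alpha\to\infty$, such that for all $(t,x,y)\in[0,T]\times\mathbb{R}^n\times\mathbb{R}^n$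 $$u(t,x)-v(t,y)\le\inf_{\alpha>0}\left[\frac{\alpha}{2}|x-y|^2+l(\alpha)\right].$$
   Context: $S^n$ is the space of real symmetric $n\times n$ matrices with its usual partial order; $I$ is the identity matrix. Structural assumptions on $F=F(t,x,u,p,X)$: (A0) $F$ is continuous and degenerate elliptic, i.e. non-decreasing in $X$: $F(t,x,u,p,X)\le F(t,x,u,p,X+B)$ whenever $B\ge 0$. (A1) There is $\gamma\in\mathbb{R}$ such that, for all $t,x,p,X$, $\gamma(u-v)\le F(t,x,v,p,X)-F(t,x,u,p,X)$ whenever $v\le u$. (A2) For every $R>0$ there is a function $\theta_R:[0,\infty]\to[0,\infty]$ with $\theta_R(0+)=0$ such that $$F(t,x,r,\alpha(x-\tilde x),X)-F(t,\tilde x,r,\alpha(x-\tilde x),Y)\le\theta_R\left(\alpha|x-\tilde x|^2+|x-\tilde x|\right)$$ for all $t\in[0,T]$, $x,\tilde x\in\mathbb{R}^n$, $r\in[-R,R]$, $\alpha>0$ and all $X,Y\in S^n$ satisfying $$-3\alpha\begin{pmatrix}I&0\\0&I\end{pmatrix}\le\begin{pmatrix}X&0\\0&-Y\end{pmatrix}\le 3\alpha\begin{pmatrix}I&-I\\-I&I\end{pmatrix}.$$ (A3) For every $R>0$, the restriction of $F$ to $[0,T]\times\mathbb{R}^n\times[-R,R]\times B_R\times M_R$ is uniformly continuous, where $B_R\subset\mathbb{R}^n$ and $M_R\subset S^n$ are the open balls of radius $R$ centered at $0$. Viscosity notions: let $D$ be $(0,T)\times\mathbb{R}^n$ or $(0,T]\times\mathbb{R}^n$.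 An upper semicontinuous function $u$ is a (parabolic) viscosity subsolution on $D$, written $\partial_tu-F(t,x,u,Du,D^2u)\le 0$ on $D$, if for every $(\bar t,\bar x)\in D$ and every test function $\varphi$ (of class $C^1$ in $t$ and $C^2$ in $x$, defined in an open neighbourhood of $(\bar t,\bar x)$ in $\mathbb{R}\times\mathbb{R}^n$) such that $u-\varphi$ has a local maximum relative to $D$ at $(\bar t,\bar x)$, one has $\partial_t\varphi(\bar t,\bar x)-F(\bar t,\bar x,u(\bar t,\bar x),D\varphi(\bar t,\bar x),D^2\varphi(\bar t,\bar x))\le 0$. A lower semicontinuous function $v$ is a viscosity supersolution on $D$ if the same holds with "local maximum" replaced by "local minimum" and "$\le 0$" by "$\ge 0$". *)

theory Defs
  imports "HOL-Analysis.Analysis"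
begin

definition sym_matrices :: "(real ^ 'n ^ 'n) set" where
  "sym_matrices = {X. transpose X = X}"

text \<open>Used for symmetric matrices only; on other matrices this is not antisymmetric.\<close>

definition loewner_le :: "real ^ 'n ^ 'n \<Rightarrow> real ^ 'n ^ 'n \<Rightarrow> bool" (infix \<open>\<preceq>\<close> 50) where
  "X \<preceq> Y \<longleftrightarrow> (\<forall>\<xi>. \<xi> \<bullet> (X *v \<xi>) \<le> \<xi> \<bullet> (Y *v \<xi>))"

text \<open>The \<open>2 \<times> 2\<close> block matrix with rows \<open>(A, B)\<close> and \<open>(C, E)\<close>; its index type is the sum type.\<close>

definition block_matrix ::
  "real ^ 'n ^ 'n \<Rightarrow> real ^ 'n ^ 'n \<Rightarrow> real ^ 'n ^ 'n \<Rightarrow> real ^ 'n ^ 'n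
    \<Rightarrow> real ^ ('n + 'n) ^ ('n + 'n)" where
  "block_matrix A B C E = (\<chi> i j. case i of
      Inl k \<Rightarrow> (case j of Inl l \<Rightarrow> A $ k $ l | Inr l \<Rightarrow> B $ k $ l)
    | Inr k \<Rightarrow> (case j of Inl l \<Rightarrow> C $ k $ l | Inr l \<Rightarrow> E $ k $ l))"

text \<open>
  The nonlinearity is written \<open>F t x u p X\<close>. As HOL functions are total, its domain
  \<open>[0,T] \<times> \<real>\<^sup>n \<times> \<real> \<times> \<real>\<^sup>n \<times> S\<^sup>n\<close> is imposed through the ranges of the quantifiers.
\<close>

type_synonym 'n nonlinearity =
  "real \<Rightarrow> real ^ 'n \<Rightarrow> real \<Rightarrow> real ^ 'n \<Rightarrow> real ^ 'n ^ 'n \<Rightarrow> real"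

definition degenerate_elliptic :: "real \<Rightarrow> 'n::finite nonlinearity \<Rightarrow> bool" where
  "degenerate_elliptic T F \<longleftrightarrow>
    (\<forall>t\<in>{0..T}. \<forall>x u p. \<forall>X\<in>sym_matrices. \<forall>B\<in>sym_matrices. 0 \<preceq> B \<longrightarrow>
       F t x u p X \<le> F t x u p (X + B))"

definition assumption_A0 :: "real \<Rightarrow> 'n::finite nonlinearity \<Rightarrow> bool" where
  "assumption_A0 T F \<longleftrightarrow>
    continuous_on ({0..T} \<times> UNIV \<times> UNIV \<times> UNIV \<times> sym_matrices)
      (\<lambda>(t, x, u, p, X). F t x u p X) \<and>
    degenerate_elliptic T F"

definition assumption_A1 :: "real \<Rightarrow> 'n::finite nonlinearity \<Rightarrow> bool" where
  "assumption_A1 T F \<longleftrightarrow>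
    (\<exists>\<gamma>. \<forall>t\<in>{0..T}. \<forall>x p. \<forall>X\<in>sym_matrices. \<forall>u v. v \<le> u \<longrightarrow>
       \<gamma> * (u - v) \<le> F t x v p X - F t x u p X)"

definition assumption_A2 :: "real \<Rightarrow> 'n::finite nonlinearity \<Rightarrow> bool" where
  "assumption_A2 T F \<longleftrightarrow>
    (\<forall>R>0. \<exists>\<theta> :: ereal \<Rightarrow> ereal. \<theta> \<in> {0..\<infinity>} \<rightarrow> {0..\<infinity>} \<and> (\<theta> \<longlongrightarrow> 0) (at_right 0) \<and>
      (\<forall>t\<in>{0..T}. \<forall>x x'. \<forall>r\<in>{-R..R}. \<forall>\<alpha>>0. \<forall>X\<in>sym_matrices. \<forall>Y\<in>sym_matrices.
         (-3 * \<alpha>) *\<^sub>R block_matrix (mat 1) 0 0 (mat 1) \<preceq> block_matrix X 0 0 (- Y) \<and>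
         block_matrix X 0 0 (- Y) \<preceq>
           (3 * \<alpha>) *\<^sub>R block_matrix (mat 1) (- mat 1) (- mat 1) (mat 1) \<longrightarrow>
         ereal (F t x r (\<alpha> *\<^sub>R (x - x')) X - F t x' r (\<alpha> *\<^sub>R (x - x')) Y)
           \<le> \<theta> (ereal (\<alpha> * (norm (x - x'))\<^sup>2 + norm (x - x')))))"

text \<open>The norm on matrices is the Frobenius norm; since the radius is arbitrary,
  the choice of norm is immaterial.\<close>

definition assumption_A3 :: "real \<Rightarrow> 'n::finite nonlinearity \<Rightarrow> bool" where
  "assumption_A3 T F \<longleftrightarrow>
    (\<forall>R>0. uniformly_continuous_on
       ({0..T} \<times> UNIV \<times> {-R..R} \<times> ball 0 R \<times> (ball 0 R \<inter> sym_matrices))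
       (\<lambda>(t, x, u, p, X). F t x u p X))"

definition usc_on :: "'a::topological_space set \<Rightarrow> ('a \<Rightarrow> real) \<Rightarrow> bool" where
  "usc_on D u \<longleftrightarrow> (\<forall>z\<in>D. \<forall>a>u z. \<forall>\<^sub>F w in at z within D. u w < a)"

definition lsc_on :: "'a::topological_space set \<Rightarrow> ('a \<Rightarrow> real) \<Rightarrow> bool" where
  "lsc_on D v \<longleftrightarrow> (\<forall>z\<in>D. \<forall>a<v z. \<forall>\<^sub>F w in at z within D. a < v w)"

text \<open>
  \<open>\<phi>\<close> is of class \<open>C\<^sup>1\<close> in \<open>t\<close> and \<open>C\<^sup>2\<close> in \<open>x\<close> on the open set \<open>U\<close>, and \<open>\<phi>\<^sub>t\<close>, \<open>G\<close>, \<open>H\<close> are its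
  time derivative, spatial gradient and spatial Hessian. Joint continuity of \<open>\<phi>\<close> follows from
  that of \<open>\<phi>\<^sub>t\<close> and \<open>G\<close>, and symmetry of \<open>H\<close> from its continuity.
\<close>

definition C12_on ::
  "(real \<times> (real ^ 'n)) set \<Rightarrow> (real \<times> (real ^ 'n) \<Rightarrow> real) \<Rightarrow> (real \<times> (real ^ 'n) \<Rightarrow> real)
    \<Rightarrow> (real \<times> (real ^ 'n) \<Rightarrow> real ^ 'n) \<Rightarrow> (real \<times> (real ^ 'n) \<Rightarrow> real ^ 'n ^ 'n) \<Rightarrow> bool" where
  "C12_on U \<phi> \<phi>\<^sub>t G H \<longleftrightarrow>
    open U \<and>
    (\<forall>(t, x)\<in>U.
       ((\<lambda>s. \<phi> (s, x)) has_real_derivative \<phi>\<^sub>t (t, x)) (at t) \<and>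
       ((\<lambda>y. \<phi> (t, y)) has_derivative (\<lambda>h. G (t, x) \<bullet> h)) (at x) \<and>
       ((\<lambda>y. G (t, y)) has_derivative (\<lambda>h. H (t, x) *v h)) (at x)) \<and>
    continuous_on U \<phi>\<^sub>t \<and> continuous_on U G \<and> continuous_on U H"

definition viscosity_subsolution ::
  "'n::finite nonlinearity \<Rightarrow> (real \<times> (real ^ 'n)) set \<Rightarrow> (real \<times> (real ^ 'n) \<Rightarrow> real) \<Rightarrow> bool" where
  "viscosity_subsolution F D u \<longleftrightarrow>
    usc_on D u \<and>
    (\<forall>(t, x)\<in>D. \<forall>U \<phi> \<phi>\<^sub>t G H.
       (t, x) \<in> U \<and> C12_on U \<phi> \<phi>\<^sub>t G H \<and>
       (\<forall>\<^sub>F w in at (t, x) within D. u w - \<phi> w \<le> u (t, x) - \<phi> (t, x)) \<longrightarrow>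
       \<phi>\<^sub>t (t, x) - F t x (u (t, x)) (G (t, x)) (H (t, x)) \<le> 0)"

definition viscosity_supersolution ::
  "'n::finite nonlinearity \<Rightarrow> (real \<times> (real ^ 'n)) set \<Rightarrow> (real \<times> (real ^ 'n) \<Rightarrow> real) \<Rightarrow> bool" where
  "viscosity_supersolution F D v \<longleftrightarrow>
    lsc_on D v \<and>
    (\<forall>(t, x)\<in>D. \<forall>U \<phi> \<phi>\<^sub>t G H.
       (t, x) \<in> U \<and> C12_on U \<phi> \<phi>\<^sub>t G H \<and>
       (\<forall>\<^sub>F w in at (t, x) within D. v w - \<phi> w \<ge> v (t, x) - \<phi> (t, x)) \<longrightarrow>
       \<phi>\<^sub>t (t, x) - F t x (v (t, x)) (G (t, x)) (H (t, x)) \<ge> 0)"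

end

theory Submission
  imports Defs
begin

text \<open>
  The first part is local. Let \<open>u - \<phi>\<close> have a maximum at a point \<open>(T, x0)\<close>. As \<open>u (T, x0)\<close> is a limit of
  values at earlier times, the maximum, once it is made strict by a small perturbation of \<open>\<phi>\<close>, is a
  limit of maxima at times before \<open>T\<close> of \<open>u - \<phi> - \<eta> / (T - t)\<close> with \<open>\<eta>\<close> tending to \<open>0\<close>. The equation holds at these, the time derivative of the
  barrier \<open>\<eta> / (T - t)\<close> has the favourable sign, and the inequality passes to the limit
  (\<open>subsolution_up_to_terminal_time\<close>). Supersolutions are reduced to subsolutions by
  \<open>viscosity_supersolution_iff_dual\<close>.

  The second part is a doubling of variables. With a discount factor \<open>exp (- l t)\<close> the equation becomes
  strictly monotone in the unknown. Suppose that the discounted gap between \<open>u (t, x)\<close> and \<open>v (t, y)\<close>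
  exceeded \<open>\<alpha> / 2 |x - y|\<^sup>2 + \<sigma>\<close> somewhere for every \<open>\<alpha>\<close>. Choose \<open>\<alpha>\<close> so large that the penalty
  \<open>\<alpha> |x - y|\<^sup>2\<close> is small where the penalised gap is nearly maximal, and add \<open>\<delta> (|x|\<^sup>2 + |y|\<^sup>2)\<close> to make
  the maximum attained. As \<open>u \<le> v\<close> at time \<open>0\<close> and \<open>v (0, \<cdot>)\<close> is
  uniformly continuous, the maximum is not at time \<open>0\<close>. At later
  times the inequalities for \<open>u\<close> and \<open>v\<close> may be subtracted, with matrices as in the structure condition
  (\<open>equal_time_maximum\<close>), and together with monotonicity they bound the gap by less than it is
  (\<open>proper_gap_estimate\<close>). Hence for each \<open>\<sigma>\<close> some \<open>\<alpha>\<close> satisfies \<open>u (t, x) - v (t, y) \<le> \<alpha> / 2 |x - y|\<^sup>2 + \<sigma>\<close>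
  everywhere (\<open>comparison_up_to_error\<close>). So the suprema of \<open>u (t, x) - v (t, y) - \<alpha> / 2 |x - y|\<^sup>2\<close>, replaced
  by \<open>0\<close> where negative, tend to \<open>0\<close> as \<open>\<alpha>\<close> grows, and they serve as \<open>l \<alpha>\<close>.

  To subtract the two inequalities one needs second-order information at a maximum of
  \<open>f \<xi> + g \<eta> - \<alpha> / 2 |\<xi> - \<eta>|\<^sup>2\<close> for semicontinuous \<open>f\<close> and \<open>g\<close>, the theorem on sums of Crandall and Ishii
  (\<open>theorem_on_sums\<close>). As usual, supremum convolutions reduce it to semiconvex functions. For these it
  suffices that near a strict maximum some point has, at some small scale, a second-order expansion
  with small relative error (\<open>quadratic_expansion_near_strict_maximum\<close>). To find it, consider the
  points where the graph is touched from above by a hyperplane of small slope. The slopes fill a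
  ball and depend on the touching point in a Lipschitz way, so these points form a set of positive
  measure; around suitable points and at suitable small scales it is therefore an arbitrarily fine
  net. Hence the limits of the second-order difference quotients at such points form a compact set
  of functions that is again closed under forming such quotients, at arbitrary points and scales.
  A compact set of this kind contains a quadratic form (\<open>blowup_class_contains_quadratic_form\<close>): a
  member with the largest possible value at a unit vector \<open>e\<close> leads to a member that is quadratic in
  the direction of \<open>e\<close>, and one continues in the orthogonal complement.

  The time variable is doubled as well. It is rescaled so that the theorem on sums applies to space
  and time at once, and the two times are then made to coincide in the limit.
\<close>

section \<open>Quadratic forms in classes closed under blow-up\<close>

text \<open>
  A second-order difference quotient at \<open>z\<close> with the linear part \<open>q\<close> removed. If \<open>f\<close> has a
  second-order expansion at \<open>z\<close> with gradient \<open>q\<close>, the quotients converge to its quadratic term as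
  \<open>r\<close> tends to \<open>0\<close>.
\<close>

definition rescale :: "('a::euclidean_space \<Rightarrow> real) \<Rightarrow> 'a \<Rightarrow> 'a \<Rightarrow> real \<Rightarrow> 'a \<Rightarrow> real" where
  "rescale f z q r h = (f (z + r *\<^sub>R h) - f z - r * (q \<bullet> h)) / r\<^sup>2"

text \<open>
  The model is the set of limits of blow-ups of one function. Closedness refers to pointwise
  convergence. The slope \<open>q\<close> is left existential because it is determined by the quadratic bound.
\<close>

definition blowup_class :: "real \<Rightarrow> ('a::euclidean_space \<Rightarrow> real) set \<Rightarrow> bool" where
  "blowup_class a \<F> \<longleftrightarrow> closed \<F> \<and> \<F> \<noteq> {} \<and> (\<forall>f\<in>\<F>. \<forall>h. \<bar>f h\<bar> \<le> a * (norm h)\<^sup>2) \<and>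
    (\<forall>f\<in>\<F>. \<forall>z. \<forall>r>0. \<exists>q. rescale f z q r \<in> \<F>)"

lemma compact_pointwise_bounded:
  fixes \<F> :: "('a \<Rightarrow> real) set"
  assumes "closed \<F>" and "\<And>f x. f \<in> \<F> \<Longrightarrow> \<bar>f x\<bar> \<le> c x"
  shows "compact \<F>"
proof -
  have "compactin (product_topology (\<lambda>i::'a. euclidean::real topology) UNIV)
          (Pi\<^sub>E UNIV (\<lambda>x. {- c x..c x}))"
    unfolding compactin_PiE by auto
  then have "compact (Pi\<^sub>E UNIV (\<lambda>x. {- c x..c x}))"
    by (simp add: euclidean_product_topology)
  then have "compact (Pi\<^sub>E UNIV (\<lambda>x. {- c x..c x}) \<inter> \<F>)"
    using assms(1) by (rule compact_Int_closed)
  moreover have "Pi\<^sub>E UNIV (\<lambda>x. {- c x..c x}) \<inter> \<F> = \<F>"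
  proof -
    have "f x \<in> {- c x..c x}" if "f \<in> \<F>" for f x
      using assms(2)[OF that, of x] by (simp add: abs_le_iff)
    then show ?thesis by (auto simp: PiE_iff)
  qed
  ultimately show ?thesis by simp
qed

lemma compact_decreasing_nonempty:
  fixes C :: "nat \<Rightarrow> 'a::topological_space set"
  assumes "compact S" and "\<And>n. closed (C n)" and "\<And>n. C (Suc n) \<subseteq> C n"
    and "\<And>n. S \<inter> C n \<noteq> {}"
  shows "\<exists>x\<in>S. \<forall>n. x \<in> C n"
proof -
  have dec: "C n \<subseteq> C m" if "m \<le> n" for m n
    using that assms(3) by (rule lift_Suc_antimono_le[rotated])
  have "S \<inter> (\<Inter>n\<in>UNIV. C n) \<noteq> {}"
  proof (rule compact_imp_fip_image[OF assms(1)])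
    fix I :: "nat set" assume "finite I"
    then have "C (Max (insert 0 I)) \<subseteq> (\<Inter>n\<in>I. C n)"
      by (intro INT_greatest dec) simp
    then show "S \<inter> (\<Inter>n\<in>I. C n) \<noteq> {}" using assms(4) by blast
  qed (use assms(2) in auto)
  then show ?thesis by auto
qed

text \<open>
  Apply the bound to small multiples of \<open>h\<close>: the left side decays linearly, the right side
  quadratically.
\<close>

lemma inner_eq_0_of_quadratic_bound:
  fixes p :: "'a::euclidean_space"
  assumes "subspace V" "\<And>h. h \<in> V \<Longrightarrow> p \<bullet> h \<le> c * (norm h)\<^sup>2" "h \<in> V"
  shows "p \<bullet> h = 0"
proof (rule ccontr)
  assume nz: "p \<bullet> h \<noteq> 0"
  have *: "p \<bullet> k \<le> 0" if k: "k \<in> V" for k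
  proof (rule tendsto_lowerbound)
    show "((\<lambda>t. t * (c * (norm k)\<^sup>2)) \<longlongrightarrow> 0) (at_right 0)"
      by (rule tendsto_eq_intros refl | simp)+
    show "\<forall>\<^sub>F t in at_right 0. p \<bullet> k \<le> t * (c * (norm k)\<^sup>2)"
      using eventually_at_right_less[of 0]
    proof (eventually_elim)
      case (elim t)
      have "p \<bullet> (t *\<^sub>R k) \<le> c * (norm (t *\<^sub>R k))\<^sup>2"
        using assms(1) k by (intro assms(2)) (simp add: subspace_scale)
      then have "t * (p \<bullet> k) \<le> t * (t * (c * (norm k)\<^sup>2))"
        using elim by (simp add: power_mult_distrib power2_eq_square algebra_simps)
      then show ?case using elim by simp
    qed
  qed simp
  show False using *[OF assms(3)] *[of "- h"] assms(1,3) nz by (simp add: subspace_neg)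
qed

text \<open>
  The slopes belonging to two scales differ by a linear function with a quadratic bound, so that
  one slope serves all scales.
\<close>

lemma blowup_class_gradient:
  assumes cls: "blowup_class a \<F>" and f: "f \<in> \<F>"
  obtains q where "\<And>r. r > 0 \<Longrightarrow> rescale f z q r \<in> \<F>"
    "\<And>h. \<bar>f (z + h) - f z - q \<bullet> h\<bar> \<le> a * (norm h)\<^sup>2"
proof -
  have bd: "\<bar>f (z + h) - f z - q \<bullet> h\<bar> \<le> a * (norm h)\<^sup>2"
    if "rescale f z q r \<in> \<F>" "r > 0" for q r h
  proof -
    have "\<bar>rescale f z q r ((1/r) *\<^sub>R h)\<bar> \<le> a * (norm ((1/r) *\<^sub>R h))\<^sup>2"
      using cls that unfolding blowup_class_def by blast
    then show ?thesis
      using that(2) by (simp add: rescale_def field_simps power2_eq_square)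
  qed
  have ex: "\<exists>q. rescale f z q r \<in> \<F>" if "r > 0" for r
    using cls f that unfolding blowup_class_def by blast
  obtain q where q: "rescale f z q 1 \<in> \<F>" using ex[of 1] by auto
  have "rescale f z q r \<in> \<F>" if r: "r > 0" for r
  proof -
    obtain q' where q': "rescale f z q' r \<in> \<F>" using ex[OF r] by auto
    have "(q - q') \<bullet> h \<le> (2 * a) * (norm h)\<^sup>2" for h
      using bd[OF q, of h] bd[OF q' r, of h] by (simp add: inner_diff_left)
    then have "(q - q') \<bullet> (q - q') = 0"
      by (rule inner_eq_0_of_quadratic_bound[OF subspace_UNIV, of "q - q'" "2 * a"]) simp
    then show ?thesis using q' by simp
  qed
  with bd[OF q] show ?thesis by (intro that) auto
qed

lemma blowup_class_zero: "blowup_class a \<F> \<Longrightarrow> f \<in> \<F> \<Longrightarrow> f 0 = 0"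
  unfolding blowup_class_def by (metis abs_le_zero_iff mult_zero_right norm_zero power2_eq_square)

text \<open>
  Equi-continuity near the unit ball, for the maximum of \<open>f h\<close> over both \<open>f\<close> and the unit
  vectors \<open>h\<close> to be attained.
\<close>

lemma blowup_class_Lipschitz:
  assumes cls: "blowup_class a \<F>" and f: "f \<in> \<F>" and "norm z \<le> 1"
  shows "\<bar>f (z + h) - f z\<bar> \<le> 6 * a * norm h + a * (norm h)\<^sup>2"
proof -
  have bd: "\<bar>f h\<bar> \<le> a * (norm h)\<^sup>2" for h
    using cls f unfolding blowup_class_def by blast
  obtain q where q: "\<And>h. \<bar>f (z + h) - f z - q \<bullet> h\<bar> \<le> a * (norm h)\<^sup>2"
    using blowup_class_gradient[OF cls f, of z] by blast
  obtain b :: 'a where b: "norm b = 1" using vector_choose_size[of 1] by auto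
  have a0: "a \<ge> 0" using bd[of b] b by simp
  have nq: "norm q \<le> 6 * a"
  proof (cases "q = 0")
    case False
    let ?k = "(1 / norm q) *\<^sub>R q"
    have k: "norm ?k = 1" using False by simp
    have "norm (z + ?k) \<le> 2" using norm_triangle_ineq[of z ?k] k assms(3) by linarith
    then have "(norm (z + ?k))\<^sup>2 \<le> 2\<^sup>2" by (intro power_mono) auto
    then have "a * (norm (z + ?k))\<^sup>2 \<le> a * 4" using a0 by (intro mult_left_mono) auto
    moreover have "(norm z)\<^sup>2 \<le> 1\<^sup>2" using assms(3) by (intro power_mono) auto
    then have "a * (norm z)\<^sup>2 \<le> a * 1" using a0 by (intro mult_left_mono) auto
    moreover have "a * (norm ?k)\<^sup>2 = a" using k by simp
    ultimately have "q \<bullet> ?k \<le> 6 * a"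
      using bd[of "z + ?k"] bd[of z] q[of ?k] by linarith
    then show ?thesis using False by (simp add: power2_norm_eq_inner[symmetric] power2_eq_square)
  qed (use a0 in simp)
  have "\<bar>q \<bullet> h\<bar> \<le> 6 * a * norm h"
    using Cauchy_Schwarz_ineq2[of q h] mult_right_mono[OF nq, of "norm h"] by simp
  then show ?thesis using q[of h] by linarith
qed

lemma blowup_class_max_attained:
  assumes cls: "blowup_class a \<F>" and V: "subspace V" "V \<noteq> {0}"
  obtains f e where "f \<in> \<F>" "e \<in> V" "norm e = 1"
    "\<And>g h. g \<in> \<F> \<Longrightarrow> h \<in> V \<Longrightarrow> norm h = 1 \<Longrightarrow> g h \<le> f e"
proof -
  have cmp: "compact \<F>"
    using cls unfolding blowup_class_def by (intro compact_pointwise_bounded) auto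
  have "\<exists>f\<in>\<F>. \<forall>g\<in>\<F>. g h \<le> f h" for h
  proof (rule continuous_attains_sup[OF cmp])
    show "\<F> \<noteq> {}" using cls unfolding blowup_class_def by simp
    show "continuous_on \<F> (\<lambda>f. f h)"
      by (rule continuous_on_subset[OF continuous_on_product_coordinates]) simp
  qed
  then obtain m where m: "\<And>h. m h \<in> \<F>" "\<And>h g. g \<in> \<F> \<Longrightarrow> g h \<le> m h h" by metis
  define S where "S = V \<inter> sphere 0 1"
  have cS: "compact S" unfolding S_def using V(1) by (simp add: closed_subspace closed_Int_compact)
  have "0 \<in> V" using V(1) by (rule subspace_0)
  then obtain v where v: "v \<in> V" "v \<noteq> 0" using V(2) by auto
  then have "(1 / norm v) *\<^sub>R v \<in> S"
    using V(1) unfolding S_def by (simp add: subspace_scale)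
  then have ne: "S \<noteq> {}" by auto
  have le: "m x x - m y y \<le> 6 * a * dist x y + a * (dist x y)\<^sup>2" if "x \<in> S" "y \<in> S" for x y
  proof -
    have "\<bar>m x (y + (x - y)) - m x y\<bar> \<le> 6 * a * norm (x - y) + a * (norm (x - y))\<^sup>2"
      using that(2) by (intro blowup_class_Lipschitz[OF cls m(1)]) (simp add: S_def)
    then show ?thesis using m(2)[OF m(1), of x y] by (simp add: dist_norm)
  qed
  have "continuous_on S (\<lambda>h. m h h)"
    unfolding continuous_on_def
  proof (intro ballI)
    fix x assume x: "x \<in> S"
    have "((\<lambda>y. 6 * a * dist y x + a * (dist y x)\<^sup>2) \<longlongrightarrow> 6 * a * dist x x + a * (dist x x)\<^sup>2) (at x within S)"
      by (intro tendsto_intros)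
    then have l0: "((\<lambda>y. 6 * a * dist y x + a * (dist y x)\<^sup>2) \<longlongrightarrow> 0) (at x within S)" by simp
    have "((\<lambda>y. m y y - m x x) \<longlongrightarrow> 0) (at x within S)"
    proof (rule Lim_null_comparison[OF _ l0])
      show "\<forall>\<^sub>F y in at x within S. norm (m y y - m x x) \<le> 6 * a * dist y x + a * (dist y x)\<^sup>2"
        unfolding eventually_at_filter
      proof (rule always_eventually, intro allI impI)
        fix y assume y: "y \<in> S"
        show "norm (m y y - m x x) \<le> 6 * a * dist y x + a * (dist y x)\<^sup>2"
          using le[OF x y] le[OF y x] by (simp add: dist_commute)
      qed
    qed
    then show "((\<lambda>h. m h h) \<longlongrightarrow> m x x) (at x within S)" by (simp add: LIM_zero_iff)
  qed
  then obtain e where "e \<in> S" "\<And>h. h \<in> S \<Longrightarrow> m h h \<le> m e e"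
    using continuous_attains_sup[OF cS ne] by blast
  note e = this
  show ?thesis
  proof (rule that[of "m e" e])
    fix g h assume "g \<in> \<F>" "h \<in> V" "norm h = 1"
    then have "g h \<le> m h h" "m h h \<le> m e e" using m(2) e(2) by (auto simp: S_def)
    then show "g h \<le> m e e" by linarith
  qed (use m(1) e(1) in \<open>auto simp: S_def\<close>)
qed

text \<open>
  Let \<open>\<mu>\<close> be the largest value that members take at unit vectors of \<open>V\<close>, attained by \<open>f\<close> at \<open>e\<close>. As
  second difference quotients of members are again members, \<open>\<mu>\<close> bounds all of them, and
  \<open>\<mu> |x|\<^sup>2 - g x\<close> is convex along \<open>V\<close> for every member \<open>g\<close>. For \<open>f\<close> this convex function is
  nonnegative and vanishes at \<open>0\<close> and \<open>e\<close>, hence on the segment between them. Blowing up at the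
  midpoint gives a member for which it vanishes on the whole line through \<open>e\<close>; and a convex function
  that vanishes on a line is constant along all parallels to it.
\<close>

lemma blowup_class_new_direction:
  assumes cls: "blowup_class a \<F>" and V: "subspace V" "V \<noteq> {0}"
  obtains e \<mu> f where "e \<in> V" "norm e = 1" "f \<in> \<F>"
    "\<And>x t. x \<in> V \<Longrightarrow> f (x + t *\<^sub>R e) = f x + \<mu> * (2 * t * (x \<bullet> e) + t\<^sup>2)"
proof -
  obtain f e where f: "f \<in> \<F>" and e: "e \<in> V" "norm e = 1"
    and max: "\<And>g h. g \<in> \<F> \<Longrightarrow> h \<in> V \<Longrightarrow> norm h = 1 \<Longrightarrow> g h \<le> f e"
    by (rule blowup_class_max_attained[OF cls V]) blast
  define \<mu> where "\<mu> = f e"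
  have ee: "e \<bullet> e = 1" using e(2) by (simp add: norm_eq_1)
  have sup: "g (z + h) - g z - q \<bullet> h \<le> \<mu> * (norm h)\<^sup>2"
    if "g \<in> \<F>" "h \<in> V" "\<And>r. r > 0 \<Longrightarrow> rescale g z q r \<in> \<F>" for g z q h
  proof (cases "h = 0")
    case False
    then have "rescale g z q (norm h) ((1 / norm h) *\<^sub>R h) \<le> \<mu>"
      unfolding \<mu>_def using that V(1) by (intro max that(3)) (auto simp: subspace_scale)
    then show ?thesis using False by (simp add: rescale_def field_simps)
  qed simp
  (* In the directions of V every psi g = mu |.|^2 - g has a subgradient at every point. *)
  define \<psi> where "\<psi> g x = \<mu> * (norm x)\<^sup>2 - g x" for g :: "'a \<Rightarrow> real" and x
  have subgr: "\<exists>s. (\<forall>h\<in>V. \<psi> g (z + h) \<ge> \<psi> g z + s \<bullet> h) \<and>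
      (\<forall>r>0. rescale g z ((2 * \<mu>) *\<^sub>R z - s) r \<in> \<F>) \<and>
      (\<forall>h. \<psi> g (z + h) - \<psi> g z - s \<bullet> h \<le> (\<bar>\<mu>\<bar> + a) * (norm h)\<^sup>2)"
    if g: "g \<in> \<F>" for g z
  proof -
    obtain q where q: "\<And>r. r > 0 \<Longrightarrow> rescale g z q r \<in> \<F>"
      "\<And>h. \<bar>g (z + h) - g z - q \<bullet> h\<bar> \<le> a * (norm h)\<^sup>2"
      using blowup_class_gradient[OF cls g, of z] by blast
    have ex: "\<psi> g (z + h) - \<psi> g z - ((2 * \<mu>) *\<^sub>R z - q) \<bullet> h
        = \<mu> * (norm h)\<^sup>2 - (g (z + h) - g z - q \<bullet> h)" for h
      by (simp add: \<psi>_def power2_norm_eq_inner inner_simps inner_commute algebra_simps)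
    show ?thesis
    proof (intro exI[of _ "(2 * \<mu>) *\<^sub>R z - q"] conjI ballI allI impI)
      fix h assume "h \<in> V"
      show "\<psi> g (z + h) \<ge> \<psi> g z + ((2 * \<mu>) *\<^sub>R z - q) \<bullet> h"
        using sup[OF g \<open>h \<in> V\<close> q(1)] ex[of h] by simp
    next
      fix h :: 'a
      have "\<mu> * (norm h)\<^sup>2 \<le> \<bar>\<mu>\<bar> * (norm h)\<^sup>2" by (intro mult_right_mono) auto
      then show "\<psi> g (z + h) - \<psi> g z - ((2 * \<mu>) *\<^sub>R z - q) \<bullet> h \<le> (\<bar>\<mu>\<bar> + a) * (norm h)\<^sup>2"
        using q(2)[of h] ex[of h] by (simp add: algebra_simps)
    qed (use q(1) in simp)
  qed
  have \<psi>0: "\<psi> g h \<ge> 0" if g: "g \<in> \<F>" and h: "h \<in> V" for g h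
  proof -
    have "\<bar>g k\<bar> \<le> a * (norm k)\<^sup>2" for k
      using cls g unfolding blowup_class_def by blast
    moreover have "g k \<le> \<mu> * (norm k)\<^sup>2" if "k \<in> V" for k
    proof -
      obtain q where q: "\<And>r. r > 0 \<Longrightarrow> rescale g 0 q r \<in> \<F>"
        "\<And>h. \<bar>g (0 + h) - g 0 - q \<bullet> h\<bar> \<le> a * (norm h)\<^sup>2"
        using blowup_class_gradient[OF cls g, of 0] by blast
      have "q \<bullet> h \<le> 2 * a * (norm h)\<^sup>2" for h
        using q(2)[of h] calculation[of h] blowup_class_zero[OF cls g] by simp
      then have "q \<bullet> k = 0"
        by (rule inner_eq_0_of_quadratic_bound[OF subspace_UNIV, of q "2 * a"]) simp
      then show ?thesis using sup[OF g that q(1)] blowup_class_zero[OF cls g] by simp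
    qed
    ultimately show ?thesis using h by (simp add: \<psi>_def)
  qed
  have seg: "\<psi> f (t *\<^sub>R e) = 0" if t: "0 \<le> t" "t \<le> 1" for t
  proof -
    obtain s where s: "\<And>h. h \<in> V \<Longrightarrow> \<psi> f (t *\<^sub>R e + h) \<ge> \<psi> f (t *\<^sub>R e) + s \<bullet> h"
      using subgr[OF f, of "t *\<^sub>R e"] by blast
    have z: "\<psi> f 0 = 0" "\<psi> f e = 0"
      using blowup_class_zero[OF cls f] e(2) by (auto simp: \<psi>_def \<mu>_def)
    have "\<psi> f (t *\<^sub>R e) - t * (s \<bullet> e) \<le> 0"
      using s[of "- t *\<^sub>R e"] z e(1) V(1) by (simp add: subspace_scale subspace_neg)
    moreover have "\<psi> f (t *\<^sub>R e) + (1 - t) * (s \<bullet> e) \<le> 0"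
      using s[of "(1 - t) *\<^sub>R e"] z e(1) V(1) subspace_scale[OF V(1) e(1), of "1 - t"]
      by (simp add: algebra_simps)
    ultimately have "(1 - t) * (\<psi> f (t *\<^sub>R e) - t * (s \<bullet> e)) \<le> 0"
      "t * (\<psi> f (t *\<^sub>R e) + (1 - t) * (s \<bullet> e)) \<le> 0"
      using t by (simp_all only: mult_nonneg_nonpos diff_ge_0_iff_ge)
    then have "(1 - t) * (\<psi> f (t *\<^sub>R e) - t * (s \<bullet> e))
        + t * (\<psi> f (t *\<^sub>R e) + (1 - t) * (s \<bullet> e)) \<le> 0"
      by (rule add_nonpos_nonpos)
    then have "\<psi> f (t *\<^sub>R e) \<le> 0" by (simp add: algebra_simps)
    moreover have "\<psi> f (t *\<^sub>R e) \<ge> 0"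
      by (rule \<psi>0[OF f]) (use e(1) V(1) in \<open>simp add: subspace_scale\<close>)
    ultimately show ?thesis by simp
  qed
  (* Blowing up at the interior point e/2 of the segment turns the segment into the line. *)
  obtain s where s: "\<And>h. h \<in> V \<Longrightarrow> \<psi> f ((1/2) *\<^sub>R e + h) \<ge> \<psi> f ((1/2) *\<^sub>R e) + s \<bullet> h"
    and sF: "\<And>r. r > 0 \<Longrightarrow> rescale f ((1/2) *\<^sub>R e) ((2 * \<mu>) *\<^sub>R ((1/2) *\<^sub>R e) - s) r \<in> \<F>"
    and sb: "\<And>h. \<psi> f ((1/2) *\<^sub>R e + h) - \<psi> f ((1/2) *\<^sub>R e) - s \<bullet> h \<le> (\<bar>\<mu>\<bar> + a) * (norm h)\<^sup>2"
    using subgr[OF f, of "(1/2) *\<^sub>R e"] by blast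
  have half: "\<psi> f ((1/2) *\<^sub>R e) = 0" by (rule seg) auto
  have "s \<bullet> h = 0" if "h \<in> V" for h
  proof -
    have "(- s) \<bullet> k \<le> (\<bar>\<mu>\<bar> + a) * (norm k)\<^sup>2" if k: "k \<in> V" for k
    proof -
      have "0 \<le> \<psi> f ((1/2) *\<^sub>R e + k)"
        using e(1) V(1) k by (intro \<psi>0[OF f]) (simp add: subspace_scale subspace_add)
      then show ?thesis using sb[of k] half by simp
    qed
    then have "(- s) \<bullet> h = 0" using that by (rule inner_eq_0_of_quadratic_bound[OF V(1)])
    then show ?thesis by simp
  qed
  then have se: "s \<bullet> e = 0" using e(1) .
  define C where "C n = {g \<in> \<F>. \<forall>t. \<bar>t\<bar> \<le> real n \<longrightarrow> g (t *\<^sub>R e) = \<mu> * t\<^sup>2}" for n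
  have cmp: "compact \<F>"
    using cls unfolding blowup_class_def by (intro compact_pointwise_bounded) auto
  have "\<exists>g\<in>\<F>. \<forall>n. g \<in> C n"
  proof (rule compact_decreasing_nonempty[OF cmp])
    fix n
    have "C n = \<F> \<inter> (\<Inter>t\<in>{- real n..real n}. {g. g (t *\<^sub>R e) = \<mu> * t\<^sup>2})"
      by (auto simp: C_def abs_le_iff)
    moreover have "closed {g :: 'a \<Rightarrow> real. g (t *\<^sub>R e) = \<mu> * t\<^sup>2}" for t
      by (intro closed_Collect_eq continuous_on_const continuous_on_product_coordinates)
    ultimately show "closed (C n)" using cls unfolding blowup_class_def by (simp add: closed_INT closed_Int)
    show "C (Suc n) \<subseteq> C n" by (auto simp: C_def)
    define r where "r = 1 / (2 * real n + 1)"
    have r: "r > 0" by (simp add: r_def)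
    let ?g = "rescale f ((1/2) *\<^sub>R e) ((2 * \<mu>) *\<^sub>R ((1/2) *\<^sub>R e) - s) r"
    have "?g (t *\<^sub>R e) = \<mu> * t\<^sup>2" if t: "\<bar>t\<bar> \<le> real n" for t
    proof -
      have "\<bar>r * t\<bar> \<le> 1/2"
        using t r by (simp add: abs_mult r_def field_simps)
      then have "\<psi> f ((1/2 + r * t) *\<^sub>R e) = 0" by (intro seg) auto
      then have 1: "f ((1/2) *\<^sub>R e + (r * t) *\<^sub>R e) = \<mu> * (1/2 + r * t)\<^sup>2"
        using e(2) by (simp add: \<psi>_def scaleR_left_distrib[symmetric])
      have 2: "f ((1/2) *\<^sub>R e) = \<mu> * (1/2)\<^sup>2" using half e(2) by (simp add: \<psi>_def power2_eq_square)
      show ?thesis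
        unfolding rescale_def scaleR_scaleR 1 2
        using r by (simp add: inner_simps se ee power2_eq_square field_simps)
    qed
    then show "\<F> \<inter> C n \<noteq> {}" using sF[OF r] unfolding C_def by blast
  qed
  then obtain g where g: "g \<in> \<F>" and gC: "\<And>n. g \<in> C n" by blast
  have line: "g (t *\<^sub>R e) = \<mu> * t\<^sup>2" for t
  proof -
    obtain n where "\<bar>t\<bar> \<le> real n" using real_arch_simple by blast
    then show ?thesis using gC[of n] by (simp add: C_def)
  qed
  then have line0: "\<psi> g (t *\<^sub>R e) = 0" for t by (simp add: \<psi>_def e(2) power_mult_distrib)
  have le: "\<psi> g (x + t *\<^sub>R e) \<le> \<psi> g x" if x: "x \<in> V" for x t
  proof -
    let ?z = "x + t *\<^sub>R e"
    obtain s where s: "\<And>h. h \<in> V \<Longrightarrow> \<psi> g (?z + h) \<ge> \<psi> g ?z + s \<bullet> h"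
      using subgr[OF g, of ?z] by blast
    have z: "?z \<in> V" using x e(1) V(1) by (simp add: subspace_add subspace_scale)
    (* A linear function that stays below a constant along the whole line vanishes on it. *)
    have b: "\<tau> * (s \<bullet> e) \<le> s \<bullet> ?z - \<psi> g ?z" for \<tau>
    proof -
      have "\<psi> g (?z + (\<tau> *\<^sub>R e - ?z)) \<ge> \<psi> g ?z + s \<bullet> (\<tau> *\<^sub>R e - ?z)"
        using z e(1) V(1) by (intro s) (simp add: subspace_diff subspace_scale)
      then show ?thesis using line0[of \<tau>] by (simp add: inner_diff_right)
    qed
    have "s \<bullet> e = 0"
    proof (rule ccontr)
      assume "s \<bullet> e \<noteq> 0"
      then show False using b[of "(s \<bullet> ?z - \<psi> g ?z + 1) / (s \<bullet> e)"] by simp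
    qed
    moreover have "\<psi> g (?z + (- t) *\<^sub>R e) \<ge> \<psi> g ?z + s \<bullet> ((- t) *\<^sub>R e)"
      by (intro s) (use e(1) V(1) in \<open>simp only: subspace_scale\<close>)
    ultimately show ?thesis by simp
  qed
  have "g (x + t *\<^sub>R e) = g x + \<mu> * (2 * t * (x \<bullet> e) + t\<^sup>2)" if x: "x \<in> V" for x t
  proof -
    have "x + t *\<^sub>R e \<in> V" using x e(1) V(1) by (simp add: subspace_add subspace_scale)
    from le[OF this, of "- t"] le[OF x, of t] have "\<psi> g (x + t *\<^sub>R e) = \<psi> g x" by simp
    moreover have "(norm (x + t *\<^sub>R e))\<^sup>2 = (norm x)\<^sup>2 + (2 * t * (x \<bullet> e) + t\<^sup>2)"
      unfolding power2_norm_eq_inner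
      by (simp add: inner_simps ee inner_commute power2_eq_square algebra_simps)
    ultimately show ?thesis by (simp add: \<psi>_def algebra_simps)
  qed
  then show ?thesis by (rule that[OF e g])
qed

text \<open>
  The quadratic form arises one direction at a time: a member that is already quadratic along an
  orthonormal set \<open>B\<close> is not changed by blow-ups in that respect, so these members form a class
  of the same kind, to which the previous lemma applies on the orthogonal complement of \<open>B\<close>.
\<close>

definition quadratic_along :: "'a::euclidean_space set \<Rightarrow> ('a \<Rightarrow> real) \<Rightarrow> ('a \<Rightarrow> real) set" where
  "quadratic_along B l = {f. \<forall>e\<in>B. \<forall>x t. f (x + t *\<^sub>R e) = f x + l e * (2 * t * (x \<bullet> e) + t\<^sup>2)}"

lemma closed_quadratic_along: "closed (quadratic_along B l)"
proof -
  have "quadratic_along B l = (\<Inter>e\<in>B. \<Inter>x. \<Inter>t. {f. f (x + t *\<^sub>R e) = f x + l e * (2 * t * (x \<bullet> e) + t\<^sup>2)})"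
    by (auto simp: quadratic_along_def)
  then show ?thesis
    by (simp, intro closed_INT ballI closed_Collect_eq continuous_intros continuous_on_product_coordinates)
qed

lemma blowup_class_quadratic_along:
  assumes cls: "blowup_class a \<F>" and ne: "\<F> \<inter> quadratic_along B l \<noteq> {}"
    and B: "\<And>e. e \<in> B \<Longrightarrow> norm e = 1"
  shows "blowup_class a (\<F> \<inter> quadratic_along B l)"
  unfolding blowup_class_def
proof (intro conjI ballI allI impI ne)
  show "closed (\<F> \<inter> quadratic_along B l)"
    using cls closed_quadratic_along unfolding blowup_class_def by (intro closed_Int) auto
  show "\<bar>f h\<bar> \<le> a * (norm h)\<^sup>2" if "f \<in> \<F> \<inter> quadratic_along B l" for f h
    using cls that unfolding blowup_class_def by blast
  fix f z and r :: real assume f: "f \<in> \<F> \<inter> quadratic_along B l" and r: "r > 0"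
  obtain q where q: "\<And>r. r > 0 \<Longrightarrow> rescale f z q r \<in> \<F>"
    "\<And>h. \<bar>f (z + h) - f z - q \<bullet> h\<bar> \<le> a * (norm h)\<^sup>2"
    using blowup_class_gradient[OF cls, of f z] f by blast
  have inv: "f (x + t *\<^sub>R e) = f x + l e * (2 * t * (x \<bullet> e) + t\<^sup>2)" if "e \<in> B" for e x t
    using f that by (simp add: quadratic_along_def)
  have qe: "q \<bullet> e = 2 * l e * (z \<bullet> e)" if e: "e \<in> B" for e
  proof -
    have ee: "e \<bullet> e = 1" using B[OF e] by (simp add: norm_eq_1)
    have "((q \<bullet> e - 2 * l e * (z \<bullet> e)) *\<^sub>R e) \<bullet> e = 0"
    proof (rule inner_eq_0_of_quadratic_bound[of "span {e}" _ "a + \<bar>l e\<bar>"])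
      fix h assume "h \<in> span {e}"
      then obtain t where h: "h = t *\<^sub>R e" by (auto simp: span_singleton)
      have "\<bar>l e * (2 * t * (z \<bullet> e) + t\<^sup>2) - t * (q \<bullet> e)\<bar> \<le> a * t\<^sup>2"
        using q(2)[of h] inv[OF e, of z t] B[OF e] by (simp add: h power_mult_distrib)
      moreover have "\<bar>l e * t\<^sup>2\<bar> = \<bar>l e\<bar> * t\<^sup>2" by (simp add: abs_mult)
      ultimately have "(q \<bullet> e - 2 * l e * (z \<bullet> e)) * t \<le> (a + \<bar>l e\<bar>) * t\<^sup>2"
        by (simp add: algebra_simps abs_le_iff) linarith
      then show "((q \<bullet> e - 2 * l e * (z \<bullet> e)) *\<^sub>R e) \<bullet> h \<le> (a + \<bar>l e\<bar>) * (norm h)\<^sup>2"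
        using B[OF e] by (simp add: h ee power_mult_distrib mult.commute)
    qed (auto intro: span_base)
    then show ?thesis by (simp add: ee)
  qed
  have "rescale f z q r (x + t *\<^sub>R e) = rescale f z q r x + l e * (2 * t * (x \<bullet> e) + t\<^sup>2)"
    if e: "e \<in> B" for e x t
  proof -
    have "f (z + r *\<^sub>R (x + t *\<^sub>R e))
        = f (z + r *\<^sub>R x) + l e * (2 * (r * t) * ((z + r *\<^sub>R x) \<bullet> e) + (r * t)\<^sup>2)"
      using inv[OF e, of "z + r *\<^sub>R x" "r * t"] by (simp add: scaleR_add_right add.assoc)
    then show ?thesis
      using r by (simp add: rescale_def inner_simps qe[OF e] field_simps power2_eq_square)
  qed
  then have "rescale f z q r \<in> quadratic_along B l" by (simp add: quadratic_along_def)
  then show "\<exists>q. rescale f z q r \<in> \<F> \<inter> quadratic_along B l" using q(1)[OF r] by blast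
qed

lemma quadratic_along_sum:
  assumes f: "f \<in> quadratic_along B l" and "finite C" "C \<subseteq> B" "pairwise orthogonal B"
  shows "f (x + (\<Sum>b\<in>C. c b *\<^sub>R b)) = f x + (\<Sum>b\<in>C. l b * (2 * c b * (x \<bullet> b) + (c b)\<^sup>2))"
  using assms(2,3)
proof (induction C)
  case (insert e C)
  have "(\<Sum>b\<in>C. c b *\<^sub>R b) \<bullet> e = 0"
    unfolding inner_sum_left
  proof (rule sum.neutral, intro ballI)
    fix b assume "b \<in> C"
    then have "b \<noteq> e" "b \<in> B" "e \<in> B" using insert by auto
    then show "(c b *\<^sub>R b) \<bullet> e = 0"
      using assms(4) by (simp add: pairwise_def orthogonal_def)
  qed
  then have "(x + (\<Sum>b\<in>C. c b *\<^sub>R b)) \<bullet> e = x \<bullet> e" by (simp add: inner_add_left)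
  moreover have "f ((x + (\<Sum>b\<in>C. c b *\<^sub>R b)) + c e *\<^sub>R e) = f (x + (\<Sum>b\<in>C. c b *\<^sub>R b))
      + l e * (2 * c e * ((x + (\<Sum>b\<in>C. c b *\<^sub>R b)) \<bullet> e) + (c e)\<^sup>2)"
    using f insert.prems by (simp add: quadratic_along_def)
  ultimately show ?case using insert by (simp add: algebra_simps)
qed simp

lemma blowup_class_quadratic_step:
  assumes cls: "blowup_class a \<F>" and B: "finite B" "pairwise orthogonal B" "\<And>e. e \<in> B \<Longrightarrow> norm e = 1"
    and ne: "\<F> \<inter> quadratic_along B l \<noteq> {}" and card: "card B < DIM('a::euclidean_space)"
  shows "\<exists>e \<mu>. e \<notin> B \<and> pairwise orthogonal (insert (e::'a) B) \<and> norm e = 1 \<and>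
    \<F> \<inter> quadratic_along (insert e B) (l(e := \<mu>)) \<noteq> {}"
proof -
  have BB: "b \<bullet> b = 1" if "b \<in> B" for b using B(3)[OF that] by (simp add: norm_eq_1)
  define V where "V = {x. \<forall>b\<in>B. x \<bullet> b = 0}"
  have V: "subspace V" by (auto simp: V_def subspace_def inner_simps)
  have "dim B < DIM('a)" using dim_le_card'[OF B(1)] card by simp
  then obtain x where x: "x \<noteq> 0" "\<And>y. y \<in> span B \<Longrightarrow> orthogonal x y"
    using orthogonal_to_subspace_exists[of B] by blast
  have "x \<in> V" unfolding V_def using x(2)[OF span_base] by (simp add: orthogonal_def)
  then have V0: "V \<noteq> {0}" using x(1) by auto
  obtain e \<mu> f where e: "e \<in> V" "norm e = 1" and f: "f \<in> \<F> \<inter> quadratic_along B l"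
    and fe: "\<And>x t. x \<in> V \<Longrightarrow> f (x + t *\<^sub>R e) = f x + \<mu> * (2 * t * (x \<bullet> e) + t\<^sup>2)"
    by (rule blowup_class_new_direction[OF blowup_class_quadratic_along[OF cls ne B(3)] V V0]) blast+
  have eB: "e \<notin> B"
  proof
    assume "e \<in> B"
    then have "e \<bullet> e = 0" using e(1) by (simp add: V_def)
    then show False using e(2) by simp
  qed
  have fq: "f \<in> quadratic_along B l" using f by simp
  have general: "f (x + t *\<^sub>R e) = f x + \<mu> * (2 * t * (x \<bullet> e) + t\<^sup>2)" for x t
  proof -
    let ?s = "\<Sum>b\<in>B. (x \<bullet> b) *\<^sub>R b"
    define y where "y = x - ?s"
    have sb: "?s \<bullet> b = x \<bullet> b" if b: "b \<in> B" for b
    proof -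
      have "?s \<bullet> b = (\<Sum>c\<in>B. if c = b then x \<bullet> b else 0)"
        unfolding inner_sum_left
      proof (rule sum.cong)
        fix c assume "c \<in> B"
        then show "((x \<bullet> c) *\<^sub>R c) \<bullet> b = (if c = b then x \<bullet> b else 0)"
          using B(2) b BB by (auto simp: pairwise_def orthogonal_def)
      qed simp
      then show ?thesis using B(1) b by simp
    qed
    have y: "y \<in> V" using sb by (simp add: V_def y_def inner_diff_left)
    have yt: "y + t *\<^sub>R e \<in> V" using y e(1) V by (simp add: subspace_add subspace_scale)
    have "?s \<bullet> e = 0" unfolding inner_sum_left
      by (rule sum.neutral) (use e(1) in \<open>simp add: V_def inner_commute\<close>)
    then have ye: "y \<bullet> e = x \<bullet> e" by (simp add: y_def inner_diff_left)
    have exp: "f (w + ?s) = f w + (\<Sum>b\<in>B. l b * (x \<bullet> b)\<^sup>2)" if w: "w \<in> V" for w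
      using quadratic_along_sum[OF fq B(1) subset_refl B(2), of w "\<lambda>b. x \<bullet> b"] w
      by (simp add: V_def)
    have "f (x + t *\<^sub>R e) = f ((y + t *\<^sub>R e) + ?s)" by (simp add: y_def algebra_simps)
    also have "\<dots> = f (y + ?s) + \<mu> * (2 * t * (x \<bullet> e) + t\<^sup>2)"
      using exp[OF yt] exp[OF y] fe[OF y] ye by simp
    finally show ?thesis by (simp add: y_def)
  qed
  have "f \<in> quadratic_along (insert e B) (l(e := \<mu>))"
    using fq general eB by (auto simp: quadratic_along_def)
  moreover have "pairwise orthogonal (insert e B)"
    using B(2) e(1) by (auto simp: pairwise_insert V_def orthogonal_def inner_commute)
  ultimately show ?thesis using f e(2) eB by blast
qed

text \<open>
  With \<open>B\<close> an orthonormal basis, quadratic dependence along each element of \<open>B\<close> determines the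
  function. This is how second derivatives are found below: the limits of blow-ups of a semiconvex
  function form a class of this kind.
\<close>

lemma blowup_class_contains_quadratic_form:
  fixes \<F> :: "('a::euclidean_space \<Rightarrow> real) set"
  assumes cls: "blowup_class a \<F>"
  obtains L where "linear L" "\<And>x y. L x \<bullet> y = x \<bullet> L y" "(\<lambda>x. x \<bullet> L x) \<in> \<F>"
proof -
  have basis: "\<exists>B l. finite B \<and> card B = n \<and> pairwise orthogonal B \<and> (\<forall>e\<in>B. norm e = 1) \<and>
      \<F> \<inter> quadratic_along B l \<noteq> {}" if "n \<le> DIM('a)" for n
    using that
  proof (induction n)
    case 0
    have "\<F> \<inter> quadratic_along {} l \<noteq> {}" for l
      using cls by (simp add: blowup_class_def quadratic_along_def)
    then show ?case by (intro exI[of _ "{}"]) auto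
  next
    case (Suc n)
    then obtain B l where B: "finite B" "card B = n" "pairwise orthogonal B" "\<forall>e\<in>B. norm e = 1"
      "\<F> \<inter> quadratic_along B l \<noteq> {}" by auto
    obtain e \<mu> where "e \<notin> B" "pairwise orthogonal (insert e B)" "norm e = 1"
      "\<F> \<inter> quadratic_along (insert e B) (l(e := \<mu>)) \<noteq> {}"
      using blowup_class_quadratic_step[OF cls B(1,3) _ B(5)] B(2,4) Suc.prems by auto
    then show ?case
      using B(1,2,4) by (intro exI[of _ "insert e B"] exI[of _ "l(e := \<mu>)"]) (auto simp del: fun_upd_apply)
  qed
  obtain B l where B: "finite B" "card B = DIM('a)" "pairwise orthogonal B" "\<forall>e\<in>B. norm e = 1"
    and ne: "\<F> \<inter> quadratic_along B l \<noteq> {}" using basis[of "DIM('a)"] by auto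
  then obtain f where f: "f \<in> \<F>" "f \<in> quadratic_along B l" by auto
  have "0 \<notin> B" using B(4) by auto
  then have "independent B" using pairwise_orthogonal_independent[OF B(3)] by simp
  then have sp: "UNIV \<subseteq> span B" using B(2) by (intro card_ge_dim_independent) auto
  define L where "L x = (\<Sum>b\<in>B. (l b * (x \<bullet> b)) *\<^sub>R b)" for x
  have repr: "(\<Sum>b\<in>B. (x \<bullet> b) *\<^sub>R b) = x" for x
  proof -
    let ?y = "x - (\<Sum>b\<in>B. (x \<bullet> b) *\<^sub>R b)"
    have "?y \<bullet> c = 0" if c: "c \<in> B" for c
    proof -
      have "c \<bullet> c = 1" using B(4) c by (simp add: norm_eq_1)
      then have "(\<Sum>b\<in>B. (x \<bullet> b) *\<^sub>R b) \<bullet> c = (\<Sum>b\<in>B. if b = c then x \<bullet> c else 0)"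
        unfolding inner_sum_left using B(3) c
        by (intro sum.cong) (auto simp: pairwise_def orthogonal_def)
      then show ?thesis using B(1) c by (simp add: inner_diff_left)
    qed
    then have "orthogonal ?y ?y"
      using sp by (intro orthogonal_to_span[of ?y B ?y]) (auto simp: orthogonal_def)
    then show ?thesis by (simp add: orthogonal_self)
  qed
  have "f x = x \<bullet> L x" for x
  proof -
    have "f (0 + (\<Sum>b\<in>B. (x \<bullet> b) *\<^sub>R b)) = f 0 + (\<Sum>b\<in>B. l b * (x \<bullet> b)\<^sup>2)"
      using quadratic_along_sum[OF f(2) B(1) subset_refl B(3), of 0 "\<lambda>b. x \<bullet> b"] by simp
    then show ?thesis
      using blowup_class_zero[OF cls f(1)]
      by (simp add: repr L_def inner_sum_right power2_eq_square mult.assoc)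
  qed
  then have "(\<lambda>x. x \<bullet> L x) = f" by auto
  moreover have "linear L"
    by (rule linearI) (simp_all add: L_def inner_simps algebra_simps sum.distrib scaleR_sum_right)
  moreover have "L x \<bullet> y = x \<bullet> L y" for x y
    by (simp add: L_def inner_sum_left inner_sum_right inner_commute algebra_simps)
  ultimately show ?thesis using f(1) that by metis
qed

section \<open>Sets of positive measure contain arbitrarily fine nets of some ball\<close>

text \<open>
  Suppose that around every point of \<open>K\<close>, at every small scale \<open>r\<close>, some ball of radius \<open>\<delta> r\<close> misses
  \<open>K\<close>. Then \<open>K\<close> occupies at most a fixed fraction \<open>q < 1\<close> of each of the balls of a Vitali covering
  inside an open set that is hardly larger than \<open>K\<close>, and so has smaller measure than itself.
\<close>

lemma nonnegligible_compact_thick: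
  fixes K :: "'a::euclidean_space set"
  assumes K: "compact K" "\<not> negligible K" and \<delta>: "\<delta> > 0" and R: "R > 0"
  shows "\<exists>z\<in>K. \<exists>r. 0 < r \<and> r < R \<and> (\<forall>y\<in>ball z r. \<exists>k\<in>K. dist k y < \<delta> * r)"
proof (rule ccontr)
  assume "\<not> ?thesis"
  then have "\<forall>z r. \<exists>y. z \<in> K \<longrightarrow> 0 < r \<longrightarrow> r < R \<longrightarrow> y \<in> ball z r \<and> (\<forall>k\<in>K. dist k y \<ge> \<delta> * r)"
    by (meson not_le)
  then obtain y where y: "\<And>z r. z \<in> K \<Longrightarrow> 0 < r \<Longrightarrow> r < R \<Longrightarrow> y z r \<in> ball z r"
    "\<And>z r k. z \<in> K \<Longrightarrow> 0 < r \<Longrightarrow> r < R \<Longrightarrow> k \<in> K \<Longrightarrow> dist k (y z r) \<ge> \<delta> * r"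
    by metis
  define d where "d = min \<delta> 1"
  have d: "0 < d" "d \<le> 1" "d \<le> \<delta>" using \<delta> by (auto simp: d_def)
  let ?N = "DIM('a)"
  let ?\<mu> = "measure lebesgue"
  define q where "q = 1 - (d / 2) ^ ?N"
  have "(d / 2) ^ ?N \<le> 1" using d by (intro power_le_one) auto
  then have q: "0 \<le> q" "q < 1" using d by (auto simp: q_def)
  have Km: "K \<in> lmeasurable" using K(1) by (rule lmeasurable_compact)
  have Kpos: "?\<mu> K > 0" using K(2) Km by (simp add: negligible_iff_measure zero_less_measure_iff)
  (* The slack e is chosen so that an open set U of measure at most |K| + e gives q |U| < |K|. *)
  define e where "e = (1 - q) * ?\<mu> K"
  have e: "e > 0" using q Kpos by (simp add: e_def)
  obtain U where U: "open U" "K \<subseteq> U" "U - K \<in> lmeasurable" "emeasure lebesgue (U - K) < ennreal e"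
    using sets_lebesgue_outer_open[OF fmeasurableD[OF Km] e] by blast
  define I where "I = {(z, r). z \<in> K \<and> 0 < r \<and> r < R \<and> ball z (2 * r) \<subseteq> U}"
  obtain C where C: "countable C" "C \<subseteq> I"
    and disj: "pairwise (\<lambda>i j. disjnt (ball (fst i) (2 * snd i)) (ball (fst j) (2 * snd j))) C"
    and neg: "negligible (K - (\<Union>i\<in>C. ball (fst i) (2 * snd i)))"
  proof (rule Vitali_covering_theorem_balls[of K I fst "\<lambda>i. 2 * snd i"])
    fix x D :: 'a and t :: real assume x: "x \<in> K" and t: "0 < t"
    obtain \<rho> where \<rho>: "\<rho> > 0" "ball x \<rho> \<subseteq> U" using U(1,2) x by (meson open_contains_ball subsetD)
    define r where "r = min (\<rho> / 2) (min (R / 2) (t / 4))"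
    have r: "0 < r" "2 * r \<le> \<rho>" "r < R" "2 * r < t" using \<rho>(1) R t by (auto simp: r_def min_def)
    have "ball x (2 * r) \<subseteq> U" using \<rho>(2) r(2) by (meson order_trans subset_ball)
    then have "(x, r) \<in> I" using x r by (simp add: I_def)
    then show "\<exists>i. i \<in> I \<and> x \<in> ball (fst i) (2 * snd i) \<and> 2 * snd i < t"
      using r by (intro exI[of _ "(x, r)"]) auto
  qed blast
  define B where "B i = ball (fst i) (2 * snd i)" for i :: "'a \<times> real"
  have piece: "emeasure lebesgue (K \<inter> B i) \<le> ennreal q * emeasure lebesgue (B i)" if i: "i \<in> C" for i
  proof -
    obtain z r where zr: "i = (z, r)" "z \<in> K" "0 < r" "r < R"
      using i C(2) by (auto simp: I_def)
    let ?b = "ball (y z r) (d * r)"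
    have sub: "?b \<subseteq> B i"
    proof
      fix w assume "w \<in> ?b"
      moreover have "dist z (y z r) < r" using y(1)[OF zr(2-4)] by simp
      moreover have "d * r \<le> r" using d zr(3) by simp
      ultimately show "w \<in> B i"
        using dist_triangle[of z w "y z r"] by (simp add: B_def zr(1))
    qed
    have "K \<inter> ?b = {}"
    proof (rule ccontr)
      assume "K \<inter> ?b \<noteq> {}"
      then obtain k where k: "k \<in> K" "dist (y z r) k < d * r" by auto
      have "\<delta> * r \<le> dist k (y z r)" by (rule y(2)[OF zr(2-4) k(1)])
      moreover have "d * r \<le> \<delta> * r" using d(3) zr(3) by simp
      ultimately show False using k(2) by (simp add: dist_commute)
    qed
    then have "?\<mu> (K \<inter> B i) \<le> ?\<mu> (B i - ?b)"
      by (intro measure_mono_fmeasurable) (auto simp: B_def fmeasurable.Diff intro: fmeasurableD[OF Km])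
    also have "\<dots> = ?\<mu> (B i) - ?\<mu> ?b"
      by (intro measurable_measure_Diff sub) (auto simp: B_def)
    also have "?\<mu> ?b = (d / 2) ^ ?N * ?\<mu> (B i)"
      using d zr(3) by (simp add: B_def zr(1) content_ball power_mult_distrib power_divide)
    finally have "?\<mu> (K \<inter> B i) \<le> q * ?\<mu> (B i)" by (simp add: q_def algebra_simps)
    then have "ennreal (?\<mu> (K \<inter> B i)) \<le> ennreal q * ennreal (?\<mu> (B i))"
      using q by (simp add: ennreal_mult[symmetric] ennreal_leI)
    moreover have "K \<inter> B i \<in> lmeasurable" using Km by (auto simp: B_def fmeasurable.Int)
    ultimately show ?thesis by (simp add: emeasure_eq_measure2 B_def)
  qed
  have "disjoint_family_on B C" using disj
    by (auto simp: disjoint_family_on_def pairwise_def disjnt_def B_def)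
  then have dj: "disjoint_family_on B C" "disjoint_family_on (\<lambda>i. K \<inter> B i) C"
    unfolding disjoint_family_on_def by blast+
  have m1: "(\<Union>i\<in>C. K \<inter> B i) \<in> sets lebesgue"
    using fmeasurableD[OF Km] C(1) by (intro sets.countable_UN') (auto simp: B_def)
  have m2: "K - (\<Union>i\<in>C. B i) \<in> null_sets lebesgue"
    using neg by (simp add: B_def negligible_iff_null_sets)
  have "emeasure lebesgue K \<le> emeasure lebesgue ((\<Union>i\<in>C. K \<inter> B i) \<union> (K - (\<Union>i\<in>C. B i)))"
  proof (rule emeasure_mono)
    show "(\<Union>i\<in>C. K \<inter> B i) \<union> (K - (\<Union>i\<in>C. B i)) \<in> sets lebesgue"
      using m1 m2 by (intro sets.Un) auto
  qed auto
  also have "\<dots> = emeasure lebesgue (\<Union>i\<in>C. K \<inter> B i)"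
    using m1 m2 by (rule emeasure_Un_null_set)
  also have "\<dots> = (\<integral>\<^sup>+i. emeasure lebesgue (K \<inter> B i) \<partial>count_space C)"
    using Km dj(2) C(1) by (intro emeasure_UN_countable) (auto simp: B_def intro!: sets.Int fmeasurableD)
  also have "\<dots> \<le> (\<integral>\<^sup>+i. ennreal q * emeasure lebesgue (B i) \<partial>count_space C)"
    by (intro nn_integral_mono) (simp add: piece)
  also have "\<dots> = ennreal q * emeasure lebesgue (\<Union>i\<in>C. B i)"
    using dj(1) C(1) by (subst nn_integral_cmult, simp, subst emeasure_UN_countable) (auto simp: B_def)
  also have "\<dots> \<le> ennreal q * emeasure lebesgue U"
  proof (intro mult_left_mono emeasure_mono UN_least)
    show "B i \<subseteq> U" if "i \<in> C" for i
      using subsetD[OF C(2) that] by (auto simp: B_def I_def split: prod.splits)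
  qed (use U(1) in auto)
  also have "emeasure lebesgue U \<le> emeasure lebesgue K + emeasure lebesgue (U - K)"
    using U Km by (subst plus_emeasure) (auto intro!: fmeasurableD emeasure_mono simp: Un_absorb1)
  also have "\<dots> \<le> ennreal (?\<mu> K) + ennreal e"
    using U(4) Km by (intro add_mono) (auto simp: emeasure_eq_measure2)
  also have "\<dots> = ennreal (?\<mu> K + e)" using e by (simp add: ennreal_plus)
  finally have "ennreal (?\<mu> K) \<le> ennreal (q * (?\<mu> K + e))"
    using q e by (simp add: emeasure_eq_measure2[OF Km] ennreal_mult mult_left_mono)
  then have "?\<mu> K \<le> q * (?\<mu> K + e)" using q e by (subst (asm) ennreal_le_iff) auto
  then have "(1 - q) * ?\<mu> K \<le> q * e" by (simp add: algebra_simps)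
  then have "e \<le> q * e" by (simp add: e_def)
  then show False using q e by simp
qed

section \<open>Second-order expansions at contact points\<close>

lemma closed_pointwise_limit:
  fixes g :: "'a \<Rightarrow> real"
  assumes "closed S" "\<forall>\<^sub>F n in sequentially. f n \<in> S" "\<And>x. (\<lambda>n. f n x) \<longlonglongrightarrow> g x"
  shows "g \<in> S"
proof -
  have "limitin (product_topology (\<lambda>i::'a. euclidean::real topology) UNIV) f g sequentially"
    using assms(3) by (simp add: limitin_componentwise)
  then have "f \<longlonglongrightarrow> g" by (simp add: euclidean_product_topology)
  then show ?thesis by (rule Lim_in_closed_set[OF assms(1,2)  sequentially_bot])
qed

lemma closure_pointwise_finite:
  fixes g :: "'a \<Rightarrow> real"
  assumes "g \<in> closure S" "finite X" "\<epsilon> > 0"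
  shows "\<exists>f\<in>S. \<forall>x\<in>X. \<bar>f x - g x\<bar> < \<epsilon>"
proof -
  let ?O = "{f :: 'a \<Rightarrow> real. \<forall>x\<in>X. f (id x) \<in> ball (g x) \<epsilon>}"
  have "open ?O" using assms(2) by (intro product_topology_basis') auto
  moreover have "g \<in> ?O" using assms(3) by simp
  ultimately have "?O \<inter> S \<noteq> {}" using assms(1) by (meson open_Int_closure_eq_empty disjoint_iff)
  then show ?thesis by (auto simp: dist_real_def abs_minus_commute)
qed

text \<open>
  A lower paraboloid of fixed opening at every point makes a function that is bounded above
  locally Lipschitz: the slope of the paraboloid cannot be large without the paraboloid leaving the
  bound.
\<close>

lemma lower_paraboloid_slope_bound:
  fixes q :: "'a::euclidean_space"
  assumes "\<And>h. w (z + h) \<ge> w z + q \<bullet> h - a * (norm h)\<^sup>2" and "\<And>z. w z \<le> 0" and "a \<ge> 0"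
  shows "norm q \<le> a - w z"
proof (cases "q = 0")
  case False
  have "q \<bullet> ((1 / norm q) *\<^sub>R q) = norm q"
    using False by (simp add: power2_norm_eq_inner[symmetric] power2_eq_square)
  then show ?thesis
    using assms(1)[of "(1 / norm q) *\<^sub>R q"] assms(2)[of "z + (1 / norm q) *\<^sub>R q"] False by simp
qed (use assms(2)[of z] assms(3) in simp)

lemma lower_paraboloid_Lipschitz:
  fixes w :: "'a::euclidean_space \<Rightarrow> real"
  assumes "\<And>z. \<exists>q. \<forall>h. w (z + h) \<ge> w z + q \<bullet> h - a * (norm h)\<^sup>2" and "\<And>z. w z \<le> 0" and "a \<ge> 0"
  shows "w (z + h) \<ge> w z - (a - w z) * norm h - a * (norm h)\<^sup>2"
proof -
  obtain q where q: "\<And>h. w (z + h) \<ge> w z + q \<bullet> h - a * (norm h)\<^sup>2" using assms(1) by blast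
  have "norm q \<le> a - w z" by (rule lower_paraboloid_slope_bound[OF q assms(2,3)])
  then have "norm q * norm h \<le> (a - w z) * norm h" by (simp add: mult_right_mono)
  then show ?thesis using q[of h] Cauchy_Schwarz_ineq2[of q h] by linarith
qed

lemma lower_paraboloid_continuous:
  fixes w :: "'a::euclidean_space \<Rightarrow> real"
  assumes "\<And>z. \<exists>q. \<forall>h. w (z + h) \<ge> w z + q \<bullet> h - a * (norm h)\<^sup>2" and "\<And>z. w z \<le> 0" and "a \<ge> 0"
  shows "continuous_on UNIV w"
proof -
  note lip = lower_paraboloid_Lipschitz[OF assms]
  have "(w \<longlongrightarrow> w x) (at x)" for x
  proof (rule real_tendsto_sandwich)
    show "\<forall>\<^sub>F y in at x. w x - (a - w x) * norm (y - x) - a * (norm (y - x))\<^sup>2 \<le> w y"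
      using lip[of x "y - x" for y] by (intro always_eventually allI) simp
    show "\<forall>\<^sub>F y in at x. w y \<le> (w x + a * norm (y - x) + a * (norm (y - x))\<^sup>2) / (1 + norm (y - x))"
    proof (intro always_eventually allI)
      fix y
      have "w y - (a - w y) * norm (x - y) - a * (norm (x - y))\<^sup>2 \<le> w x" using lip[of y "x - y"] by simp
      moreover have "1 + norm (y - x) > 0" by (smt (verit) norm_ge_zero)
      ultimately show "w y \<le> (w x + a * norm (y - x) + a * (norm (y - x))\<^sup>2) / (1 + norm (y - x))"
        by (simp add: pos_le_divide_eq norm_minus_commute algebra_simps)
    qed
    have "((\<lambda>y. w x - (a - w x) * norm (y - x) - a * (norm (y - x))\<^sup>2) \<longlongrightarrow>
        w x - (a - w x) * norm (x - x) - a * (norm (x - x))\<^sup>2) (at x)"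
      by (intro tendsto_intros)
    then show "((\<lambda>y. w x - (a - w x) * norm (y - x) - a * (norm (y - x))\<^sup>2) \<longlongrightarrow> w x) (at x)" by simp
    have "((\<lambda>y. (w x + a * norm (y - x) + a * (norm (y - x))\<^sup>2) / (1 + norm (y - x))) \<longlongrightarrow>
        (w x + a * norm (x - x) + a * (norm (x - x))\<^sup>2) / (1 + norm (x - x))) (at x)"
      by (intro tendsto_intros) simp
    then show "((\<lambda>y. (w x + a * norm (y - x) + a * (norm (y - x))\<^sup>2) / (1 + norm (y - x))) \<longlongrightarrow> w x) (at x)"
      by simp
  qed
  then show ?thesis by (simp add: continuous_on_def)
qed

text \<open>
  The touching is global and the slope is small: below a strict paraboloid both together keep the
  contact points close to the maximum and make their set compact.
\<close>

definition contact_slope :: "('a::euclidean_space \<Rightarrow> real) \<Rightarrow> real \<Rightarrow> 'a \<Rightarrow> 'a \<Rightarrow> bool" where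
  "contact_slope w s z p \<longleftrightarrow> norm p \<le> s \<and> (\<forall>z'. w z' \<le> w z + p \<bullet> (z' - z))"

definition contact_set :: "('a::euclidean_space \<Rightarrow> real) \<Rightarrow> real \<Rightarrow> 'a set" where
  "contact_set w s = {z. \<exists>p. contact_slope w s z p}"

text \<open>
  At a contact point the slopes of the hyperplane above and of the paraboloid below agree, since
  their difference is bounded by a quadratic function.
\<close>

lemma contact_slope_expansion:
  fixes w :: "'a::euclidean_space \<Rightarrow> real"
  assumes low: "\<exists>q. \<forall>h. w (z + h) \<ge> w z + q \<bullet> h - A h" and A: "\<And>h. A h \<le> a * (norm h)\<^sup>2"
    and p: "contact_slope w s z p"
  shows "w (z + h) - w z - p \<bullet> h \<in> {- A h..0}"
proof -
  obtain q where q: "\<And>h. w (z + h) \<ge> w z + q \<bullet> h - A h" using low by blast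
  have p': "w (z + h) \<le> w z + p \<bullet> h" for h
    using p unfolding contact_slope_def by (metis add_diff_cancel_left')
  have "(q - p) \<bullet> h \<le> a * (norm h)\<^sup>2" for h
    using q[of h] p'[of h] A[of h] by (simp add: inner_diff_left)
  then have "(q - p) \<bullet> (q - p) = 0"
    by (rule inner_eq_0_of_quadratic_bound[OF subspace_UNIV, of "q - p" a]) simp
  then have "q = p" by simp
  then show ?thesis using q[of h] p'[of h] by simp
qed

text \<open>
  Between a supporting hyperplane and a paraboloid of opening \<open>a\<close> there is room only for slopes
  that vary with Lipschitz constant \<open>2 a\<close>.
\<close>

lemma contact_slope_Lipschitz:
  fixes w :: "'a::euclidean_space \<Rightarrow> real"
  assumes low: "\<And>z. \<exists>q. \<forall>h. w (z + h) \<ge> w z + q \<bullet> h - a * (norm h)\<^sup>2"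
    and p: "contact_slope w s z1 p1" "contact_slope w s z2 p2"
  shows "norm (p2 - p1) \<le> 2 * a * norm (z2 - z1)"
proof (cases "z1 = z2 \<or> p1 = p2")
  case True
  have 1: "w (z1 + h) - w z1 - p1 \<bullet> h \<in> {- (a * (norm h)\<^sup>2)..0}" for h
    by (rule contact_slope_expansion[OF low order_refl p(1)])
  obtain b :: 'a where "norm b = 1" using vector_choose_size[of 1] by auto
  then have a0: "a \<ge> 0" using 1[of b] by simp
  have "p1 = p2" if eq: "z1 = z2"
  proof -
    have 2: "w (z1 + h) - w z1 - p2 \<bullet> h \<in> {- (a * (norm h)\<^sup>2)..0}" for h
      by (rule contact_slope_expansion[OF low order_refl]) (use p(2) eq in simp)
    have "(p2 - p1) \<bullet> h \<le> a * (norm h)\<^sup>2" for h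
      using 1[of h] 2[of h] by (simp add: inner_diff_left)
    then have "(p2 - p1) \<bullet> (p2 - p1) = 0"
      by (rule inner_eq_0_of_quadratic_bound[OF subspace_UNIV, of "p2 - p1" a]) simp
    then show ?thesis by simp
  qed
  then show ?thesis using True a0 by auto
next
  case False
  define D where "D = norm (z2 - z1)"
  define h where "h = (D / norm (p2 - p1)) *\<^sub>R (p2 - p1)"
  have D: "D > 0" using False by (auto simp: D_def)
  have nh: "norm h = D" using False D by (auto simp: h_def)
  have "w (z2 + h) - w z2 - p2 \<bullet> h \<ge> - (a * (norm h)\<^sup>2)"
    using contact_slope_expansion[OF low order_refl p(2), of h] by simp
  moreover have "w z2 - w z1 - p1 \<bullet> (z2 - z1) \<ge> - (a * D\<^sup>2)"
    using contact_slope_expansion[OF low order_refl p(1), of "z2 - z1"] by (simp add: D_def)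
  moreover have "w (z2 + h) - w z1 - p1 \<bullet> (z2 - z1 + h) \<le> 0"
    using contact_slope_expansion[OF low order_refl p(1), of "z2 - z1 + h"] by simp
  ultimately have "(p2 - p1) \<bullet> h \<le> 2 * a * D\<^sup>2"
    by (simp add: nh inner_diff_left inner_add_right)
  moreover have "(p2 - p1) \<bullet> h = norm (p2 - p1) * D"
    using False by (simp add: h_def power2_norm_eq_inner[symmetric] power2_eq_square)
  ultimately have "norm (p2 - p1) * D \<le> (2 * a * D) * D" by (simp add: power2_eq_square)
  then show ?thesis using D by (simp add: D_def)
qed

text \<open>
  Every small slope is the slope at some contact point, and slopes depend in a Lipschitz way on
  the contact point; a negligible contact set would therefore have a negligible set of slopes.
\<close>

lemma contact_set_compact_nonnegligible:
  fixes w :: "'a::euclidean_space \<Rightarrow> real"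
  assumes low: "\<And>z. \<exists>q. \<forall>h. w (z + h) \<ge> w z + q \<bullet> h - a * (norm h)\<^sup>2" and a: "a \<ge> 0"
    and up: "\<And>z. w z \<le> - \<kappa> * (norm z)\<^sup>2" and w0: "w 0 = 0" and \<kappa>: "\<kappa> > 0" and s: "s > 0"
  shows "compact (contact_set w s)" "\<not> negligible (contact_set w s)"
    "\<And>z. z \<in> contact_set w s \<Longrightarrow> norm z \<le> s / \<kappa>"
proof -
  have "- \<kappa> * (norm z)\<^sup>2 \<le> 0" for z :: 'a using \<kappa> by simp
  then have neg: "w z \<le> 0" for z using up[of z] by (meson order_trans)
  have cont: "continuous_on UNIV w" by (rule lower_paraboloid_continuous[OF low neg a])
  show bound: "norm z \<le> s / \<kappa>" if z: "z \<in> contact_set w s" for z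
  proof -
    obtain p where p: "norm p \<le> s" "\<And>z'. w z' \<le> w z + p \<bullet> (z' - z)"
      using z unfolding contact_set_def contact_slope_def by auto
    have "0 \<le> w z - p \<bullet> z" using p(2)[of 0] w0 by simp
    moreover have "- (p \<bullet> z) \<le> s * norm z"
      using Cauchy_Schwarz_ineq2[of p z] mult_right_mono[OF p(1), of "norm z"] by simp
    ultimately have "\<kappa> * (norm z)\<^sup>2 \<le> s * norm z" using up[of z] by simp
    then show ?thesis
      using \<kappa> s by (cases "z = 0") (simp_all add: power2_eq_square pos_le_divide_eq mult.commute)
  qed
  have "contact_set w s = fst ` ((cball 0 (s / \<kappa>) \<times> cball 0 s) \<inter>
      (\<Inter>z'. {(z, p). w z' \<le> w z + p \<bullet> (z' - z)}))" (is "_ = fst ` (?B \<inter> ?C)")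
    using bound unfolding contact_set_def contact_slope_def by (force simp: image_iff)
  moreover have "closed ?C"
  proof (intro closed_INT ballI)
    fix z'
    have "continuous_on UNIV (\<lambda>x. w (fst x))"
      by (rule continuous_on_compose2[OF cont]) (auto intro!: continuous_intros)
    then have "closed {x. w z' \<le> w (fst x) + snd x \<bullet> (z' - fst x)}"
      by (intro closed_Collect_le continuous_intros)
    then show "closed {(z, p). w z' \<le> w z + p \<bullet> (z' - z)}" by (simp add: case_prod_unfold)
  qed
  then have "compact (?B \<inter> ?C)" by (intro compact_Int_closed compact_Times) auto
  ultimately show "compact (contact_set w s)"
    by (simp only:) (intro compact_continuous_image continuous_intros)
  show "\<not> negligible (contact_set w s)"
  proof
    assume ng: "negligible (contact_set w s)"
    define P where "P z = (SOME p. contact_slope w s z p)" for z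
    have P: "contact_slope w s z (P z)" if "z \<in> contact_set w s" for z
      using that unfolding P_def contact_set_def by (auto intro: someI_ex)
    have "negligible (P ` contact_set w s)"
    proof (rule negligible_locally_Lipschitz_image[OF order_refl ng])
      fix z assume "z \<in> contact_set w s"
      then show "\<exists>T B. open T \<and> z \<in> T \<and> (\<forall>y\<in>contact_set w s \<inter> T. norm (P y - P z) \<le> B * norm (y - z))"
        using contact_slope_Lipschitz[OF low P P]
        by (intro exI[of _ UNIV] exI[of _ "2 * a"]) auto
    qed
    moreover have "ball 0 s \<subseteq> P ` contact_set w s"
    proof
      fix p :: 'a assume "p \<in> ball 0 s"
      then have p: "norm p \<le> s" by simp
      have "\<exists>z\<in>cball 0 (s / \<kappa>). \<forall>y\<in>cball 0 (s / \<kappa>). w y - p \<bullet> y \<le> w z - p \<bullet> z"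
      proof (intro continuous_attains_sup continuous_intros continuous_on_subset[OF cont])
        have "0 \<in> cball (0::'a) (s / \<kappa>)" using s \<kappa> by simp
        then show "cball (0::'a) (s / \<kappa>) \<noteq> {}" by blast
      qed auto
      then obtain z where "\<forall>y\<in>cball 0 (s / \<kappa>). w y - p \<bullet> y \<le> w z - p \<bullet> z" by blast
      then have z: "w y - p \<bullet> y \<le> w z - p \<bullet> z" if "norm y \<le> s / \<kappa>" for y
        using that by (simp add: Ball_def)
      have "w y - p \<bullet> y \<le> w z - p \<bullet> z" for y
      proof (cases "norm y \<le> s / \<kappa>")
        case False
        then have "s \<le> \<kappa> * norm y" using \<kappa> by (simp add: field_simps)
        then have "s * norm y \<le> \<kappa> * (norm y)\<^sup>2"
          by (simp add: power2_eq_square mult_right_mono mult.assoc[symmetric])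
        moreover have "- (p \<bullet> y) \<le> s * norm y"
          using Cauchy_Schwarz_ineq2[of p y] mult_right_mono[OF p, of "norm y"] by simp
        ultimately have "w y - p \<bullet> y \<le> w 0 - p \<bullet> 0" using up[of y] w0 by simp
        also have "\<dots> \<le> w z - p \<bullet> z" using s \<kappa> by (intro z) simp
        finally show ?thesis .
      qed (rule z)
      then have c: "contact_slope w s z p"
        unfolding contact_slope_def using p by (simp add: inner_diff_right algebra_simps)
      then have zc: "z \<in> contact_set w s" by (auto simp: contact_set_def)
      have "norm (p - P z) \<le> 2 * a * norm (z - z)"
        by (rule contact_slope_Lipschitz[OF low P[OF zc] c])
      then have "p = P z" by simp
      then show "p \<in> P ` contact_set w s" using zc by blast
    qed
    ultimately have "negligible (ball (0::'a) s)" by (rule negligible_subset)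
    then show False using s open_not_negligible[of "ball (0::'a) s"] by simp
  qed
qed

text \<open>
  A closed set of functions that contains the blow-ups at contact points. On bounded sets its
  elements are equicontinuous, so that pointwise approximation in it is uniform there.
\<close>

definition quadratically_Lipschitz :: "real \<Rightarrow> ('a::real_normed_vector \<Rightarrow> real) set" where
  "quadratically_Lipschitz a =
    {f. \<forall>h k. f (h + k) \<ge> f h - a * (1 + (norm h)\<^sup>2) * norm k - a * (norm k)\<^sup>2}"

lemma closed_quadratically_Lipschitz: "closed (quadratically_Lipschitz a)"
proof -
  have "quadratically_Lipschitz a = (\<Inter>h. \<Inter>k. {f :: 'a \<Rightarrow> real.
      f h - a * (1 + (norm h)\<^sup>2) * norm k - a * (norm k)\<^sup>2 \<le> f (h + k)})"
    by (auto simp: quadratically_Lipschitz_def)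
  then show ?thesis
    by (simp, intro closed_INT ballI closed_Collect_le continuous_intros continuous_on_product_coordinates)
qed

lemma quadratically_Lipschitz_bound:
  assumes f: "f \<in> quadratically_Lipschitz a" and a: "a \<ge> 0" and h: "norm h \<le> \<rho>" "norm h' \<le> \<rho>"
  shows "\<bar>f h' - f h\<bar> \<le> a * (1 + \<rho>\<^sup>2) * norm (h' - h) + a * (norm (h' - h))\<^sup>2"
proof -
  have "f (x + (y - x)) \<ge> f x - a * (1 + \<rho>\<^sup>2) * norm (y - x) - a * (norm (y - x))\<^sup>2" if "norm x \<le> \<rho>" for x y
  proof -
    have "(norm x)\<^sup>2 \<le> \<rho>\<^sup>2" using that by (intro power_mono) auto
    then have "a * (1 + (norm x)\<^sup>2) * norm (y - x) \<le> a * (1 + \<rho>\<^sup>2) * norm (y - x)"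
      using a by (intro mult_right_mono mult_left_mono) auto
    moreover have "f (x + (y - x)) \<ge> f x - a * (1 + (norm x)\<^sup>2) * norm (y - x) - a * (norm (y - x))\<^sup>2"
      using f unfolding quadratically_Lipschitz_def by blast
    ultimately show ?thesis by linarith
  qed
  from this[OF h(1), of h'] this[OF h(2), of h] show ?thesis
    by (simp add: norm_minus_commute[of h h'] abs_le_iff)
qed

lemma quadratically_Lipschitz_isCont:
  assumes f: "f \<in> quadratically_Lipschitz a" and a: "a \<ge> 0"
  shows "isCont f x"
proof -
  let ?\<rho> = "norm x + 1"
  let ?b = "\<lambda>y. a * (1 + ?\<rho>\<^sup>2) * norm (y - x) + a * (norm (y - x))\<^sup>2"
  have "(?b \<longlongrightarrow> ?b x) (at x)" by (intro tendsto_intros)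
  then have "(?b \<longlongrightarrow> 0) (at x)" by simp
  moreover have "\<forall>\<^sub>F y in at x. norm (f y - f x) \<le> ?b y"
    unfolding eventually_at
  proof (intro exI[of _ 1] conjI ballI impI)
    fix y assume "y \<noteq> x \<and> dist y x < 1"
    then have "norm y \<le> ?\<rho>" using norm_triangle_ineq2[of y x] by (simp add: dist_norm)
    then show "norm (f y - f x) \<le> ?b y"
      using quadratically_Lipschitz_bound[OF f a, of x ?\<rho> y] by simp
  qed simp
  ultimately have "((\<lambda>y. f y - f x) \<longlongrightarrow> 0) (at x)" by (rule Lim_null_comparison[rotated])
  then show ?thesis by (simp add: isCont_def LIM_zero_iff)
qed

lemma quadratically_Lipschitz_uniform_approximation:
  fixes f :: "'a::euclidean_space \<Rightarrow> real"
  assumes X: "X \<subseteq> quadratically_Lipschitz a" and a: "a \<ge> 0" and f: "f \<in> closure X" and e: "\<epsilon> > 0"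
  shows "\<exists>b\<in>X. \<forall>h\<in>cball 0 \<rho>. \<bar>b h - f h\<bar> < \<epsilon>"
proof -
  have fQ: "f \<in> quadratically_Lipschitz a"
    using closure_minimal[OF X closed_quadratically_Lipschitz] f by blast
  define c where "c = a * (1 + \<rho>\<^sup>2) + a + 1"
  define d where "d = min 1 (\<epsilon> / (3 * c))"
  have c: "c > 0" using a by (simp add: c_def add_nonneg_pos)
  have d: "d > 0" using e c by (simp add: d_def)
  obtain N where N: "finite N" "N \<subseteq> cball (0::'a) \<rho>" "cball 0 \<rho> \<subseteq> (\<Union>x\<in>N. ball x d)"
    using seq_compact_imp_totally_bounded[OF compact_imp_seq_compact[OF compact_cball[of "0::'a" \<rho>]],
      rule_format, OF d] by auto
  obtain b where b: "b \<in> X" "\<And>x. x \<in> N \<Longrightarrow> \<bar>b x - f x\<bar> < \<epsilon> / 3"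
    using closure_pointwise_finite[OF f N(1) divide_pos_pos[OF e, of 3]] by auto
  have "\<bar>b h - f h\<bar> < \<epsilon>" if h: "h \<in> cball 0 \<rho>" for h
  proof -
    have "h \<in> (\<Union>x\<in>N. ball x d)" using N(3) h by (rule subsetD)
    then obtain x where x: "x \<in> N" "dist x h < d" unfolding UN_iff mem_ball by blast
    have close: "\<bar>g h - g x\<bar> < \<epsilon> / 3" if g: "g \<in> quadratically_Lipschitz a" for g
    proof -
      have nd: "norm (h - x) < d" using x(2) by (simp add: dist_norm norm_minus_commute)
      have sq: "(norm (h - x))\<^sup>2 \<le> norm (h - x)"
      proof -
        have "norm (h - x) * norm (h - x) \<le> norm (h - x) * 1"
          using nd by (intro mult_left_mono) (auto simp: d_def)
        then show ?thesis by (simp add: power2_eq_square)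
      qed
      have "norm x \<le> \<rho>" "norm h \<le> \<rho>" using x(1) N(2) h by auto
      then have "\<bar>g h - g x\<bar> \<le> a * (1 + \<rho>\<^sup>2) * norm (h - x) + a * (norm (h - x))\<^sup>2"
        by (rule quadratically_Lipschitz_bound[OF g a])
      also have "\<dots> \<le> a * (1 + \<rho>\<^sup>2) * norm (h - x) + a * norm (h - x)"
        using sq a by (intro add_left_mono mult_left_mono)
      also have "\<dots> \<le> c * norm (h - x)" by (simp add: c_def algebra_simps)
      also have "\<dots> < c * d" using nd c by (rule mult_strict_left_mono)
      also have "\<dots> \<le> c * (\<epsilon> / (3 * c))" using c by (intro mult_left_mono) (auto simp: d_def)
      also have "\<dots> = \<epsilon> / 3" using c by simp
      finally show ?thesis .
    qed
    show ?thesis using close[OF fQ] close[OF subsetD[OF X b(1)]] b(2)[OF x(1)] by linarith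
  qed
  then show ?thesis using b(1) by blast
qed

text \<open>The blow-ups of \<open>w\<close> at contact points around which, at the scale of the blow-up, the contact
  set is a fine net of a large ball.\<close>

definition thick_blowups :: "('a::euclidean_space \<Rightarrow> real) \<Rightarrow> real \<Rightarrow> real \<Rightarrow> ('a \<Rightarrow> real) set" where
  "thick_blowups w s \<eta> = {rescale w z p r | z p r. contact_slope w s z p \<and> 0 < r \<and> r < \<eta> \<and>
     (\<forall>y\<in>ball z (r / \<eta>). \<exists>k\<in>contact_set w s. dist k y < \<eta> * r)}"

lemma thick_blowups_mono:
  assumes "0 < \<eta>" "\<eta> \<le> \<eta>'"
  shows "thick_blowups w s \<eta> \<subseteq> thick_blowups w s \<eta>'"
proof
  fix b assume "b \<in> thick_blowups w s \<eta>"
  then obtain z p r where b: "b = rescale w z p r" "contact_slope w s z p" "0 < r" "r < \<eta>"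
    "\<And>y. y \<in> ball z (r / \<eta>) \<Longrightarrow> \<exists>k\<in>contact_set w s. dist k y < \<eta> * r"
    unfolding thick_blowups_def by blast
  have "r / \<eta>' \<le> r / \<eta>" using assms b(3) by (intro divide_left_mono) auto
  moreover have "\<eta> * r \<le> \<eta>' * r" using assms b(3) by simp
  ultimately have "\<exists>k\<in>contact_set w s. dist k y < \<eta>' * r" if y: "y \<in> ball z (r / \<eta>')" for y
    using b(5)[of y] y by (meson less_le_trans subsetD subset_ball)
  moreover have "r < \<eta>'" using b(4) assms by simp
  ultimately show "b \<in> thick_blowups w s \<eta>'"
    unfolding thick_blowups_def using b(1-3) by blast
qed

lemma thick_blowups_bounds:
  fixes w :: "'a::euclidean_space \<Rightarrow> real"
  assumes low: "\<And>z. \<exists>q. \<forall>h. w (z + h) \<ge> w z + q \<bullet> h - A h"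
    and A: "\<And>h. A h \<le> a * (norm h)\<^sup>2" "\<And>r h. A (r *\<^sub>R h) = r\<^sup>2 * A h" and a: "a \<ge> 0"
    and b: "b \<in> thick_blowups w s \<eta>"
  shows "b h \<in> {- A h..0}" "b \<in> quadratically_Lipschitz a"
proof -
  obtain z p r where zpr: "b = rescale w z p r" "contact_slope w s z p" "0 < r"
    using b unfolding thick_blowups_def by blast
  have bd: "b h \<in> {- A h..0}" for h
    using contact_slope_expansion[OF low A(1) zpr(2), of "r *\<^sub>R h"] zpr(3)
    by (simp add: zpr(1) rescale_def A(2) divide_le_0_iff pos_le_divide_eq mult.commute)
  then show "b h \<in> {- A h..0}" .
  have neg: "b h \<le> 0" for h using bd by simp
  have "\<exists>q. \<forall>k. b (h + k) \<ge> b h + q \<bullet> k - a * (norm k)\<^sup>2" for h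
  proof -
    obtain q where q: "\<And>k. w ((z + r *\<^sub>R h) + k) \<ge> w (z + r *\<^sub>R h) + q \<bullet> k - A k"
      using low by blast
    have "b (h + k) \<ge> b h + ((1 / r) *\<^sub>R (q - p)) \<bullet> k - a * (norm k)\<^sup>2" for k
    proof -
      have "w (z + r *\<^sub>R (h + k)) \<ge> w (z + r *\<^sub>R h) + r * (q \<bullet> k) - r\<^sup>2 * A k"
        using q[of "r *\<^sub>R k"] by (simp add: A(2) scaleR_add_right add.assoc)
      then have "(w (z + r *\<^sub>R h) + r * (q \<bullet> k) - r\<^sup>2 * A k - w z - r * (p \<bullet> (h + k))) / r\<^sup>2 \<le> b (h + k)"
        unfolding zpr(1) rescale_def by (intro divide_right_mono) auto
      moreover have "(w (z + r *\<^sub>R h) + r * (q \<bullet> k) - r\<^sup>2 * A k - w z - r * (p \<bullet> (h + k))) / r\<^sup>2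
          = b h + ((1 / r) *\<^sub>R (q - p)) \<bullet> k - A k"
        using zpr(3) by (simp add: zpr(1) rescale_def inner_simps field_simps power2_eq_square)
      ultimately show ?thesis using A(1)[of k] by linarith
    qed
    then show ?thesis by blast
  qed
  note lip = lower_paraboloid_Lipschitz[OF this neg a]
  have "b (h + k) \<ge> b h - a * (1 + (norm h)\<^sup>2) * norm k - a * (norm k)\<^sup>2" for h k
  proof -
    have "a - b h \<le> a * (1 + (norm h)\<^sup>2)" using bd[of h] A(1)[of h] by (simp add: algebra_simps)
    then have "(a - b h) * norm k \<le> a * (1 + (norm h)\<^sup>2) * norm k" by (rule mult_right_mono) simp
    then show ?thesis using lip[of h k] by linarith
  qed
  then show "b \<in> quadratically_Lipschitz a" by (simp add: quadratically_Lipschitz_def)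
qed

text \<open>
  Re-centring a blow-up at the point \<open>x\<close> needs a nearby contact point as its new centre, and the
  net supplies one.
\<close>

lemma thick_blowups_recentre:
  fixes w :: "'a::euclidean_space \<Rightarrow> real"
  assumes low: "\<And>z. \<exists>q. \<forall>h. w (z + h) \<ge> w z + q \<bullet> h - a * (norm h)\<^sup>2" and a: "a \<ge> 0"
    and b: "b \<in> thick_blowups w s \<eta>" and r: "r > 0" and \<eta>: "0 < \<eta>" "\<eta> \<le> 1" and \<eta>': "\<eta>' > 0"
    and small: "\<eta> \<le> r * \<eta>'" "\<eta> * r \<le> \<eta>'" "\<eta> * (norm x + 1 + r / \<eta>') \<le> 1"
  shows "\<exists>y q. norm (y - x) < \<eta> \<and> norm q \<le> 2 * a * (norm x + 1) \<and> rescale b y q r \<in> thick_blowups w s \<eta>'"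
proof -
  obtain z p r0 where b: "b = rescale w z p r0" "contact_slope w s z p" "0 < r0" "r0 < \<eta>"
    and net: "\<And>y. y \<in> ball z (r0 / \<eta>) \<Longrightarrow> \<exists>k\<in>contact_set w s. dist k y < \<eta> * r0"
    using b unfolding thick_blowups_def by blast
  have "r / \<eta>' > 0" using r \<eta>' by simp
  then have "\<eta> * norm x < \<eta> * (norm x + 1 + r / \<eta>')" using \<eta>(1) by (intro mult_strict_left_mono) auto
  then have "norm x < 1 / \<eta>" using small(3) \<eta>(1) by (simp add: field_simps)
  then have "r0 * norm x < r0 * (1 / \<eta>)" using b(3) by (rule mult_strict_left_mono)
  then have "z + r0 *\<^sub>R x \<in> ball z (r0 / \<eta>)" using b(3) by (simp add: dist_norm)
  from net[OF this] obtain k p' where k: "k \<in> contact_set w s" "dist k (z + r0 *\<^sub>R x) < \<eta> * r0"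
    "contact_slope w s k p'" by (auto simp: contact_set_def)
  define y where "y = (1 / r0) *\<^sub>R (k - z)"
  define q where "q = (1 / r0) *\<^sub>R (p' - p)"
  have ky: "k = z + r0 *\<^sub>R y" using b(3) by (simp add: y_def)
  have "r0 * norm (y - x) < r0 * \<eta>"
  proof -
    have "norm (r0 *\<^sub>R (y - x)) < \<eta> * r0" using k(2) by (simp add: ky dist_norm scaleR_diff_right)
    then show ?thesis using b(3) by (simp add: mult.commute)
  qed
  then have yx: "norm (y - x) < \<eta>" using b(3) by simp
  then have ny: "norm y < norm x + \<eta>" using norm_triangle_ineq2[of y x] by simp
  have "norm (p' - p) \<le> 2 * a * norm (k - z)" by (rule contact_slope_Lipschitz[OF low b(2) k(3)])
  moreover have "norm (p' - p) = r0 * norm q" using b(3) by (simp add: q_def)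
  ultimately have "r0 * norm q \<le> r0 * (2 * a * norm y)" using b(3) by (simp add: ky algebra_simps)
  then have "norm q \<le> 2 * a * norm y" using b(3) by simp
  also have "\<dots> \<le> 2 * a * (norm x + 1)" using ny \<eta>(2) a by (intro mult_left_mono) auto
  finally have nq: "norm q \<le> 2 * a * (norm x + 1)" .
  have eq: "rescale b y q r = rescale w k p' (r0 * r)"
  proof
    fix h
    have e1: "z + r0 *\<^sub>R (y + r *\<^sub>R h) = k + (r0 * r) *\<^sub>R h" by (simp add: ky scaleR_add_right)
    have 1: "b (y + r *\<^sub>R h) = (w (k + (r0 * r) *\<^sub>R h) - w z - r0 * (p \<bullet> (y + r *\<^sub>R h))) / r0\<^sup>2"
      by (simp only: b(1) rescale_def e1)
    have 2: "b y = (w k - w z - r0 * (p \<bullet> y)) / r0\<^sup>2"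
      by (simp only: b(1) rescale_def ky)
    have 3: "(b (y + r *\<^sub>R h) - b y - r * (q \<bullet> h)) * (r0 * r0) =
        w (k + (r0 * r) *\<^sub>R h) - w k - (r0 * r) * (p' \<bullet> h)"
      unfolding 1 2 using b(3) by (simp add: q_def inner_simps field_simps power2_eq_square)
    show "rescale b y q r h = rescale w k p' (r0 * r) h"
      unfolding rescale_def 3[symmetric] using b(3) by (simp add: power2_eq_square)
  qed
  have "\<exists>c\<in>contact_set w s. dist c v < \<eta>' * (r0 * r)" if v: "v \<in> ball k (r0 * r / \<eta>')" for v
  proof -
    have "dist z v \<le> dist z k + dist k v" by (rule dist_triangle)
    also have "dist z k = r0 * norm y" using b(3) by (simp add: ky dist_norm)
    also have "r0 * norm y \<le> r0 * (norm x + 1)" using ny \<eta>(2) b(3) by simp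
    also have "dist k v < r0 * r / \<eta>'" using v by simp
    finally have "dist z v < r0 * (norm x + 1 + r / \<eta>')" by (simp add: algebra_simps)
    also have "\<dots> \<le> r0 * (1 / \<eta>)"
      using small(3) \<eta>(1) b(3) by (intro mult_left_mono) (auto simp: field_simps)
    finally have "v \<in> ball z (r0 / \<eta>)" by simp
    from net[OF this] obtain c where c: "c \<in> contact_set w s" "dist c v < \<eta> * r0" by blast
    have "\<eta> * r0 \<le> (r * \<eta>') * r0" using small(1) b(3) by simp
    then show ?thesis using c by (intro bexI[of _ c]) (auto simp: algebra_simps)
  qed
  moreover have "r0 * r < \<eta>'"
  proof -
    have "r0 * r < \<eta> * r" using b(4) r by simp
    then show ?thesis using small(2) by simp
  qed
  moreover have "0 < r0 * r" using b(3) r by simp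
  ultimately have "rescale b y q r \<in> thick_blowups w s \<eta>'"
    unfolding eq thick_blowups_def using k(3) by blast
  then show ?thesis using yx nq by blast
qed

text \<open>
  The intersection is nonempty by compactness, because the contact set has positive measure and
  hence is a fine net of some ball at arbitrarily small scales. It is closed under rescaling at any
  point because blow-ups can be re-centred at contact points, and the displacement of the centre
  disappears in the limit.
\<close>

lemma thick_blowups_limits:
  fixes w :: "'a::euclidean_space \<Rightarrow> real"
  assumes low: "\<And>z. \<exists>q. \<forall>h. w (z + h) \<ge> w z + q \<bullet> h - A h"
    and A: "\<And>h. A h \<le> a * (norm h)\<^sup>2" "\<And>r h. A (r *\<^sub>R h) = r\<^sup>2 * A h" and a: "a \<ge> 0"
    and up: "\<And>z. w z \<le> - \<kappa> * (norm z)\<^sup>2" and w0: "w 0 = 0" and \<kappa>: "\<kappa> > 0" and s: "s > 0"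
  shows "blowup_class a (\<Inter>n. closure (thick_blowups w s (1 / Suc n)))"
proof -
  define \<F> where "\<F> = (\<Inter>n. closure (thick_blowups w s (1 / Suc n)))"
  have low': "\<exists>q. \<forall>h. w (z + h) \<ge> w z + q \<bullet> h - a * (norm h)\<^sup>2" for z
  proof -
    obtain q where "\<And>h. w (z + h) \<ge> w z + q \<bullet> h - A h" using low by blast
    then have "w (z + h) \<ge> w z + q \<bullet> h - a * (norm h)\<^sup>2" for h
      using A(1)[of h] by (smt (verit))
    then show ?thesis by blast
  qed
  note bnd = thick_blowups_bounds[where w = w and A = A and a = a, OF low A a]
  note K = contact_set_compact_nonnegligible[OF low' a up w0 \<kappa> s]
  have sub: "thick_blowups w s \<eta> \<subseteq> quadratically_Lipschitz a" for \<eta> using bnd(2) by blast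
  have FL: "\<F> \<subseteq> quadratically_Lipschitz a"
    unfolding \<F>_def using closure_minimal[OF sub[of "1 / Suc 0"] closed_quadratically_Lipschitz] by blast
  have le: "\<bar>f h\<bar> \<le> a * (norm h)\<^sup>2" if "f \<in> closure (thick_blowups w s \<eta>)" for f h \<eta>
  proof -
    have "closed {f :: 'a \<Rightarrow> real. \<bar>f h\<bar> \<le> a * (norm h)\<^sup>2}"
      by (intro closed_Collect_le continuous_intros continuous_on_product_coordinates)
    moreover have "thick_blowups w s \<eta> \<subseteq> {f. \<bar>f h\<bar> \<le> a * (norm h)\<^sup>2}"
    proof
      fix f assume "f \<in> thick_blowups w s \<eta>"
      then show "f \<in> {f. \<bar>f h\<bar> \<le> a * (norm h)\<^sup>2}" using bnd(1)[of f s \<eta> h] A(1)[of h] by auto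
    qed
    ultimately have "closure (thick_blowups w s \<eta>) \<subseteq> {f. \<bar>f h\<bar> \<le> a * (norm h)\<^sup>2}"
      by (intro closure_minimal)
    then show ?thesis using that by blast
  qed
  have ne: "thick_blowups w s \<eta> \<noteq> {}" if \<eta>: "\<eta> > 0" for \<eta>
  proof -
    obtain z R where z: "z \<in> contact_set w s" "0 < R" "R < 1"
      "\<And>y. y \<in> ball z R \<Longrightarrow> \<exists>k\<in>contact_set w s. dist k y < \<eta>\<^sup>2 * R"
      using nonnegligible_compact_thick[OF K(1,2), of "\<eta>\<^sup>2" 1] \<eta> by auto
    obtain p where p: "contact_slope w s z p" using z(1) by (auto simp: contact_set_def)
    have "rescale w z p (\<eta> * R) \<in> thick_blowups w s \<eta>"
      unfolding thick_blowups_def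
    proof (intro CollectI exI conjI ballI)
      fix y assume "y \<in> ball z (\<eta> * R / \<eta>)"
      then have "y \<in> ball z R" using \<eta> by simp
      from z(4)[OF this] show "\<exists>k\<in>contact_set w s. dist k y < \<eta> * (\<eta> * R)"
        by (simp add: power2_eq_square mult.assoc)
    qed (use p \<eta> z in auto)
    then show ?thesis by blast
  qed
  have "\<exists>f\<in>closure (thick_blowups w s 1). \<forall>n. f \<in> closure (thick_blowups w s (1 / Suc n))"
  proof (rule compact_decreasing_nonempty)
    show "compact (closure (thick_blowups w s 1))"
      by (rule compact_pointwise_bounded[OF closed_closure, where c = "\<lambda>h. a * (norm h)\<^sup>2"]) (rule le)
    fix n
    show "closure (thick_blowups w s (1 / Suc (Suc n))) \<subseteq> closure (thick_blowups w s (1 / Suc n))"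
      by (intro closure_mono thick_blowups_mono divide_left_mono) auto
    have "thick_blowups w s (1 / Suc n) \<subseteq> thick_blowups w s 1"
      by (intro thick_blowups_mono) auto
    moreover have "thick_blowups w s (1 / Suc n) \<noteq> {}" by (rule ne) simp
    ultimately show "closure (thick_blowups w s 1) \<inter> closure (thick_blowups w s (1 / Suc n)) \<noteq> {}"
      using closure_subset by blast
  qed simp
  then have F_ne: "\<F> \<noteq> {}" unfolding \<F>_def by blast
  have "\<exists>q. rescale f x q r \<in> \<F>" if f: "f \<in> \<F>" and r: "r > 0" for f x r
  proof -
    have fQ: "f \<in> quadratically_Lipschitz a" using f FL by blast
    have "\<exists>y q b. norm (y - x) < r / Suc n \<and> norm q \<le> 2 * a * (norm x + 1) \<and>
      (\<forall>h\<in>cball 0 (real n). \<bar>b h - f h\<bar> < 1 / Suc n) \<and> rescale b y q r \<in> thick_blowups w s (1 / Suc n)" for n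
    proof -
      let ?\<eta>' = "1 / real (Suc n)"
      define \<eta> where "\<eta> = min (min 1 (r * ?\<eta>')) (min (?\<eta>' / r) (1 / (norm x + 1 + r / ?\<eta>')))"
      have pos: "norm x + 1 + r / ?\<eta>' > 0" using r by (intro add_nonneg_pos add_pos_pos) (auto simp: add_nonneg_pos)
      have \<eta>: "0 < \<eta>" "\<eta> \<le> 1" "\<eta> \<le> r * ?\<eta>'" "\<eta> \<le> ?\<eta>' / r" "\<eta> \<le> 1 / (norm x + 1 + r / ?\<eta>')"
        using r pos by (auto simp: \<eta>_def)
      obtain m where m: "1 / real (Suc m) < \<eta>" using \<eta>(1) nat_approx_posE by metis
      have "f \<in> closure (thick_blowups w s (1 / Suc m))" using f by (simp add: \<F>_def)
      then have "f \<in> closure (thick_blowups w s \<eta>)"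
        using closure_mono[OF thick_blowups_mono[of "1 / Suc m" \<eta> w s]] m by auto
      then obtain b where b: "b \<in> thick_blowups w s \<eta>" "\<forall>h\<in>cball 0 (real n). \<bar>b h - f h\<bar> < 1 / Suc n"
        using quadratically_Lipschitz_uniform_approximation[OF sub a, of f \<eta> "1 / Suc n" "real n"] by auto
      have "\<eta> * r \<le> ?\<eta>'" using \<eta>(4) r by (simp only: pos_le_divide_eq)
      moreover have "\<eta> * (norm x + 1 + r / ?\<eta>') \<le> 1" using \<eta>(5) pos by (simp only: pos_le_divide_eq)
      ultimately obtain y q where "norm (y - x) < \<eta>" "norm q \<le> 2 * a * (norm x + 1)"
        "rescale b y q r \<in> thick_blowups w s ?\<eta>'"
        using thick_blowups_recentre[OF low' a b(1) r \<eta>(1,2) _ \<eta>(3), of x] by (auto simp del: of_nat_Suc)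
      moreover have "\<eta> \<le> r / Suc n" using \<eta>(3) by simp
      ultimately show ?thesis using b(2) by (intro exI[of _ y] exI[of _ q] exI[of _ b]) auto
    qed
    then obtain y q b where y: "\<And>n. norm (y n - x) < r / Suc n"
      and q: "\<And>n. norm (q n) \<le> 2 * a * (norm x + 1)"
      and b: "\<And>n h. norm h \<le> real n \<Longrightarrow> \<bar>b n h - f h\<bar> < 1 / Suc n"
      and rb: "\<And>n. rescale (b n) (y n) (q n) r \<in> thick_blowups w s (1 / Suc n)"
      unfolding Ball_def mem_cball_0 by metis
    have "q n \<in> cball 0 (2 * a * (norm x + 1))" for n using q by simp
    then obtain q' \<sigma> where \<sigma>: "strict_mono \<sigma>" and q': "(q \<circ> \<sigma>) \<longlonglongrightarrow> q'"
      using compact_imp_seq_compact[OF compact_cball] unfolding seq_compact_def by metis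
    have "(\<lambda>n. r / Suc n) \<longlonglongrightarrow> 0"
      using LIMSEQ_Suc[OF lim_const_over_n[of r]] by simp
    then have "(\<lambda>n. y n - x) \<longlonglongrightarrow> 0"
      by (rule Lim_null_comparison[rotated]) (use y in \<open>auto intro!: always_eventually less_imp_le\<close>)
    then have ylim: "y \<longlonglongrightarrow> x" by (simp add: LIM_zero_iff)
    have blim: "(\<lambda>n. b n (y n + k)) \<longlonglongrightarrow> f (x + k)" for k
    proof -
      have yk: "(\<lambda>n. y n + k) \<longlonglongrightarrow> x + k" by (intro tendsto_intros ylim)
      have 1: "(\<lambda>n. f (y n + k)) \<longlonglongrightarrow> f (x + k)"
        by (rule isCont_tendsto_compose[OF quadratically_Lipschitz_isCont[OF fQ a] yk])
      obtain M where M: "\<And>n. norm (y n + k) \<le> M"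
        using convergent_imp_Bseq[OF convergentI[OF yk]] unfolding Bseq_def by blast
      have "\<forall>\<^sub>F n in sequentially. M \<le> real n"
        using filterlim_real_sequentially by (simp add: filterlim_at_top)
      then have "\<forall>\<^sub>F n in sequentially. norm (b n (y n + k) - f (y n + k)) \<le> 1 / Suc n"
      proof eventually_elim
        case (elim n)
        then show ?case using b[of "y n + k" n] M[of n] by simp
      qed
      moreover have "(\<lambda>n. 1 / real (Suc n)) \<longlonglongrightarrow> 0" by (rule LIMSEQ_Suc[OF lim_1_over_n])
      ultimately have "(\<lambda>n. b n (y n + k) - f (y n + k)) \<longlonglongrightarrow> 0" by (rule Lim_null_comparison)
      from tendsto_add[OF this 1] show ?thesis by simp
    qed
    have "rescale f x q' r \<in> closure (thick_blowups w s (1 / Suc m))" for m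
    proof (rule closed_pointwise_limit)
      show "\<forall>\<^sub>F n in sequentially. rescale (b (\<sigma> n)) (y (\<sigma> n)) (q (\<sigma> n)) r
          \<in> closure (thick_blowups w s (1 / Suc m))"
        using eventually_ge_at_top[of m]
      proof eventually_elim
        case (elim n)
        then have "m \<le> \<sigma> n" using seq_suble[OF \<sigma>, of n] by simp
        then have "thick_blowups w s (1 / Suc (\<sigma> n)) \<subseteq> thick_blowups w s (1 / Suc m)"
          by (intro thick_blowups_mono divide_left_mono) auto
        then show ?case using rb[of "\<sigma> n"] closure_subset by blast
      qed
      fix h
      have 1: "(\<lambda>n. b (\<sigma> n) (y (\<sigma> n) + k)) \<longlonglongrightarrow> f (x + k)" for k
        using LIMSEQ_subseq_LIMSEQ[OF blim[of k] \<sigma>] by (simp add: comp_def)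
      have "(\<lambda>n. (b (\<sigma> n) (y (\<sigma> n) + r *\<^sub>R h) - b (\<sigma> n) (y (\<sigma> n) + 0) - r * ((q \<circ> \<sigma>) n \<bullet> h)) / r\<^sup>2)
        \<longlonglongrightarrow> (f (x + r *\<^sub>R h) - f (x + 0) - r * (q' \<bullet> h)) / r\<^sup>2"
        by (intro tendsto_intros 1 q') (use r in simp)
      then show "(\<lambda>n. rescale (b (\<sigma> n)) (y (\<sigma> n)) (q (\<sigma> n)) r h) \<longlonglongrightarrow> rescale f x q' r h"
        by (simp add: rescale_def)
    qed simp
    then show ?thesis unfolding \<F>_def by blast
  qed
  moreover have "\<bar>f h\<bar> \<le> a * (norm h)\<^sup>2" if "f \<in> \<F>" for f h
    using that le[of f "1 / Suc 0" h] unfolding \<F>_def by blast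
  ultimately have "blowup_class a \<F>"
    using F_ne unfolding blowup_class_def by (auto simp: \<F>_def)
  then show ?thesis by (simp add: \<F>_def)
qed

text \<open>
  The dense form of the theorems of Alexandrov and Jensen: near a strict maximum of a semiconvex
  function there is a contact point around which the function is, at some small scale, as close to
  a quadratic polynomial as desired.
\<close>

lemma quadratic_expansion_near_strict_maximum:
  fixes w :: "'a::euclidean_space \<Rightarrow> real"
  assumes low: "\<And>z. \<exists>q. \<forall>h. w (z + h) \<ge> w z + q \<bullet> h - A h"
    and A: "\<And>h. A h \<le> a * (norm h)\<^sup>2" "\<And>r h. A (r *\<^sub>R h) = r\<^sup>2 * A h" and a: "a \<ge> 0"
    and up: "\<And>z. w z \<le> - \<kappa> * (norm z)\<^sup>2" and w0: "w 0 = 0" and \<kappa>: "\<kappa> > 0" and \<epsilon>: "\<epsilon> > 0"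
  obtains z p r L where "norm z < \<epsilon>" "norm p < \<epsilon>" "0 < r" "r < \<epsilon>"
    "linear L" "\<And>x y. L x \<bullet> y = x \<bullet> L y" "\<And>h. h \<bullet> L h \<in> {- A h..0}"
    "\<And>h. norm h \<le> 1 \<Longrightarrow> \<bar>w (z + r *\<^sub>R h) - w z - r * (p \<bullet> h) - r\<^sup>2 * (h \<bullet> L h)\<bar> \<le> \<epsilon> * r\<^sup>2"
proof -
  define s where "s = min \<epsilon> (\<kappa> * \<epsilon>) / 2"
  have s: "0 < s" "s < \<epsilon>" "s / \<kappa> < \<epsilon>" using \<epsilon> \<kappa> by (auto simp: s_def min_def field_simps)
  have low': "\<exists>q. \<forall>h. w (z + h) \<ge> w z + q \<bullet> h - a * (norm h)\<^sup>2" for z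
  proof -
    obtain q where "\<And>h. w (z + h) \<ge> w z + q \<bullet> h - A h" using low by blast
    then have "w (z + h) \<ge> w z + q \<bullet> h - a * (norm h)\<^sup>2" for h
      using A(1)[of h] by (smt (verit))
    then show ?thesis by blast
  qed
  note bnd = thick_blowups_bounds[where w = w and A = A and a = a, OF low A a]
  obtain L where L: "linear L" "\<And>x y. L x \<bullet> y = x \<bullet> L y"
    "(\<lambda>x. x \<bullet> L x) \<in> (\<Inter>n. closure (thick_blowups w s (1 / Suc n)))"
    using blowup_class_contains_quadratic_form[OF thick_blowups_limits[where w = w and A = A, OF low A a up w0 \<kappa> s(1)]]
    by blast
  obtain m where m: "1 / real (Suc m) < \<epsilon>" using \<epsilon> nat_approx_posE by metis
  have cl: "(\<lambda>x. x \<bullet> L x) \<in> closure (thick_blowups w s (1 / Suc m))" using L(3) by blast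
  have Lh: "h \<bullet> L h \<in> {- A h..0}" for h
  proof -
    have "closed {f :: 'a \<Rightarrow> real. - A h \<le> f h} \<and> closed {f :: 'a \<Rightarrow> real. f h \<le> 0}"
      by (intro conjI closed_Collect_le continuous_intros continuous_on_product_coordinates)
    then have "closed ({f :: 'a \<Rightarrow> real. - A h \<le> f h} \<inter> {f. f h \<le> 0})" by (simp add: closed_Int)
    moreover have "thick_blowups w s (1 / Suc m) \<subseteq> {f. - A h \<le> f h} \<inter> {f. f h \<le> 0}"
      using bnd(1)[of _ s "1 / Suc m" h] by auto
    ultimately have "closure (thick_blowups w s (1 / Suc m)) \<subseteq> {f. - A h \<le> f h} \<inter> {f. f h \<le> 0}"
      by (rule closure_minimal[rotated])
    then show ?thesis using cl by auto
  qed
  have "thick_blowups w s (1 / Suc m) \<subseteq> quadratically_Lipschitz a" using bnd(2) by blast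
  from quadratically_Lipschitz_uniform_approximation[OF this a cl \<epsilon>, of 1]
  obtain b where b: "b \<in> thick_blowups w s (1 / Suc m)" "\<And>h. norm h \<le> 1 \<Longrightarrow> \<bar>b h - h \<bullet> L h\<bar> < \<epsilon>"
    by auto
  obtain z p r where zpr: "b = rescale w z p r" "contact_slope w s z p" "0 < r" "r < 1 / Suc m"
    using b(1) unfolding thick_blowups_def by blast
  show ?thesis
  proof (rule that[of z p r L])
    have "z \<in> contact_set w s" using zpr(2) by (auto simp: contact_set_def)
    then show "norm z < \<epsilon>"
      using contact_set_compact_nonnegligible(3)[OF low' a up w0 \<kappa> s(1)] s(3) by fastforce
    show "norm p < \<epsilon>" using zpr(2) s(2) by (simp add: contact_slope_def)
    show "r < \<epsilon>" using zpr(4) m by simp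
    fix h :: 'a assume "norm h \<le> 1"
    then have "\<bar>b h - h \<bullet> L h\<bar> * r\<^sup>2 \<le> \<epsilon> * r\<^sup>2"
      using b(2) by (intro mult_right_mono) (auto simp: less_imp_le)
    moreover have "w (z + r *\<^sub>R h) - w z - r * (p \<bullet> h) - r\<^sup>2 * (h \<bullet> L h) = (b h - h \<bullet> L h) * r\<^sup>2"
      using zpr(3) by (simp add: zpr(1) rescale_def field_simps)
    ultimately show "\<bar>w (z + r *\<^sub>R h) - w z - r * (p \<bullet> h) - r\<^sup>2 * (h \<bullet> L h)\<bar> \<le> \<epsilon> * r\<^sup>2"
      by (simp add: abs_mult)
  qed (use zpr(3) L Lh in auto)
qed

section \<open>Semicontinuous functions\<close>

lemma usc_on_iff_openin:
  "usc_on D f \<longleftrightarrow> (\<forall>a. openin (top_of_set D) {z \<in> D. f z < a})"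
proof
  assume f: "usc_on D f"
  show "\<forall>a. openin (top_of_set D) {z \<in> D. f z < a}"
  proof
    fix a
    show "openin (top_of_set D) {z \<in> D. f z < a}"
    proof (subst openin_subopen, intro ballI)
      fix z assume z: "z \<in> {z \<in> D. f z < a}"
      then have "\<forall>\<^sub>F w in at z within D. f w < a" using f by (simp add: usc_on_def)
      then obtain S where S: "open S" "z \<in> S" "\<And>w. w \<in> S \<Longrightarrow> w \<noteq> z \<Longrightarrow> w \<in> D \<Longrightarrow> f w < a"
        unfolding eventually_at_topological by blast
      have "openin (top_of_set D) (D \<inter> S)" using S(1) by (rule openin_open_Int)
      moreover have "z \<in> D \<inter> S" "D \<inter> S \<subseteq> {z \<in> D. f z < a}" using S z by auto
      ultimately show "\<exists>U. openin (top_of_set D) U \<and> z \<in> U \<and> U \<subseteq> {z \<in> D. f z < a}" by blast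
    qed
  qed
next
  assume f: "\<forall>a. openin (top_of_set D) {z \<in> D. f z < a}"
  show "usc_on D f"
    unfolding usc_on_def
  proof (intro ballI allI impI)
    fix z a assume z: "z \<in> D" "f z < a"
    obtain S where S: "open S" "{z \<in> D. f z < a} = D \<inter> S" using f by (auto simp: openin_open)
    then show "\<forall>\<^sub>F w in at z within D. f w < a"
      unfolding eventually_at_topological using z by blast
  qed
qed

lemma usc_onD:
  assumes "usc_on D f" "z \<in> D" "f z < a"
  obtains S where "open S" "z \<in> S" "\<And>w. w \<in> S \<Longrightarrow> w \<in> D \<Longrightarrow> f w < a"
proof -
  obtain S where S: "open S" "{z \<in> D. f z < a} = D \<inter> S"
    using assms(1) unfolding usc_on_iff_openin openin_open by blast
  show ?thesis by (rule that[OF S(1)]) (use S(2) assms(2,3) in blast)+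
qed

lemma usc_onI:
  assumes "\<And>z a. z \<in> D \<Longrightarrow> f z < a \<Longrightarrow> \<exists>S. open S \<and> z \<in> S \<and> (\<forall>w\<in>S \<inter> D. f w < a)"
  shows "usc_on D f"
  unfolding usc_on_def eventually_at_topological
proof (intro ballI allI impI)
  fix z a assume "z \<in> D" "f z < a"
  then obtain S where "open S" "z \<in> S" "\<forall>w\<in>S \<inter> D. f w < a" using assms by blast
  then show "\<exists>S. open S \<and> z \<in> S \<and> (\<forall>w\<in>S. w \<noteq> z \<longrightarrow> w \<in> D \<longrightarrow> f w < a)" by blast
qed

lemma usc_on_subset: "usc_on D f \<Longrightarrow> S \<subseteq> D \<Longrightarrow> usc_on S f"
  unfolding usc_on_iff_openin
proof
  assume D: "\<forall>a. openin (top_of_set D) {z \<in> D. f z < a}" and S: "S \<subseteq> D"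
  fix a
  obtain U where "open U" "{z \<in> D. f z < a} = D \<inter> U" using D unfolding openin_open by blast
  then have "{z \<in> S. f z < a} = S \<inter> U" using S by blast
  then show "openin (top_of_set S) {z \<in> S. f z < a}" using \<open>open U\<close> by (simp add: openin_open_Int)
qed

lemma usc_on_compose:
  assumes f: "usc_on D f" and h: "continuous_on S h" "h ` S \<subseteq> D"
  shows "usc_on S (\<lambda>x. f (h x))"
  unfolding usc_on_iff_openin
proof
  fix a
  have "openin (top_of_set S) (S \<inter> h -` {z \<in> D. f z < a})"
    using f h unfolding usc_on_iff_openin by (intro continuous_openin_preimage[of S h D]) auto
  moreover have "S \<inter> h -` {z \<in> D. f z < a} = {x \<in> S. f (h x) < a}" using h(2) by auto
  ultimately show "openin (top_of_set S) {x \<in> S. f (h x) < a}" by simp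
qed

lemma usc_on_add:
  assumes f: "usc_on D f" and g: "usc_on D g"
  shows "usc_on D (\<lambda>x. f x + g x)"
proof (rule usc_onI)
  fix z a assume z: "z \<in> D" "f z + g z < a"
  define d where "d = (a - f z - g z) / 2"
  obtain S where S: "open S" "z \<in> S" "\<And>w. w \<in> S \<Longrightarrow> w \<in> D \<Longrightarrow> f w < f z + d"
    by (rule usc_onD[OF f z(1), of "f z + d"]) (use z(2) in \<open>auto simp: d_def\<close>)
  obtain S' where S': "open S'" "z \<in> S'" "\<And>w. w \<in> S' \<Longrightarrow> w \<in> D \<Longrightarrow> g w < g z + d"
    by (rule usc_onD[OF g z(1), of "g z + d"]) (use z(2) in \<open>auto simp: d_def\<close>)
  have "f w + g w < a" if "w \<in> S \<inter> S'" "w \<in> D" for w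
    using S(3)[of w] S'(3)[of w] that by (simp add: d_def field_simps)
  then show "\<exists>S. open S \<and> z \<in> S \<and> (\<forall>w\<in>S \<inter> D. f w + g w < a)"
    using S S' by (intro exI[of _ "S \<inter> S'"]) (auto simp: open_Int)
qed

lemma usc_on_continuous:
  fixes f :: "'a::topological_space \<Rightarrow> real"
  assumes "continuous_on D f"
  shows "usc_on D f"
  unfolding usc_on_def using assms by (auto simp: continuous_on_def dest: order_tendstoD(2))

lemma usc_on_attains_sup:
  assumes S: "compact S" "S \<noteq> {}" and f: "usc_on S f"
  shows "\<exists>x\<in>S. \<forall>y\<in>S. f y \<le> f x"
proof (rule ccontr)
  assume "\<not> ?thesis"
  then have "\<forall>x\<in>S. \<exists>y\<in>S. f x < f y" by (meson not_le)
  then obtain Y where Y: "\<And>x. x \<in> S \<Longrightarrow> Y x \<in> S" "\<And>x. x \<in> S \<Longrightarrow> f x < f (Y x)" by metis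
  have "\<forall>y. \<exists>U. open U \<and> {x \<in> S. f x < f y} = S \<inter> U"
    using f unfolding usc_on_iff_openin openin_open by blast
  then obtain U where U: "\<And>y. open (U y)" "\<And>y. {x \<in> S. f x < f y} = S \<inter> U y" by metis
  have "S \<subseteq> (\<Union>x\<in>S. U (Y x))" using Y(2) U(2) by blast
  then obtain C where C: "C \<subseteq> S" "finite C" "S \<subseteq> (\<Union>x\<in>C. U (Y x))"
    by (rule compactE_image[OF S(1) U(1)])
  have "C \<noteq> {}" using C(3) S(2) by auto
  then have "Max ((\<lambda>x. f (Y x)) ` C) \<in> (\<lambda>x. f (Y x)) ` C" using C(2) by (intro Max_in) auto
  then obtain c where c: "c \<in> C" "Max ((\<lambda>x. f (Y x)) ` C) = f (Y c)" by blast
  have cS: "Y c \<in> S" using c(1) C(1) Y(1) by blast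
  then obtain x where x: "x \<in> C" "Y c \<in> U (Y x)" using C(3) by blast
  then have "f (Y c) < f (Y x)" using U(2)[of "Y x"] cS by blast
  moreover have "f (Y x) \<le> Max ((\<lambda>x. f (Y x)) ` C)" using x(1) C(2) by (intro Max_ge) auto
  ultimately show False using c(2) by simp
qed

lemma usc_on_sequentially:
  assumes f: "usc_on D f" and z: "z \<in> D" "f z < a" and X: "X \<longlonglongrightarrow> z" "\<forall>\<^sub>F n in sequentially. X n \<in> D"
  shows "\<forall>\<^sub>F n in sequentially. f (X n) < a"
proof -
  obtain S where S: "open S" "z \<in> S" "\<And>w. w \<in> S \<Longrightarrow> w \<in> D \<Longrightarrow> f w < a"
    by (rule usc_onD[OF f z]) blast
  have "\<forall>\<^sub>F n in sequentially. X n \<in> S" using X(1) S(1,2) by (rule topological_tendstoD)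
  with X(2) show ?thesis by eventually_elim (rule S(3))
qed

section \<open>The theorem on sums\<close>

text \<open>
  Polarisation with the vector \<open>y\<close> parallel to \<open>M x\<close> and as long as \<open>x\<close>.
\<close>

lemma selfadjoint_norm_bound:
  fixes M :: "'a::euclidean_space \<Rightarrow> 'a"
  assumes M: "linear M" "\<And>x y. M x \<bullet> y = x \<bullet> M y" and C: "\<And>x. \<bar>x \<bullet> M x\<bar> \<le> C * (norm x)\<^sup>2"
  shows "norm (M x) \<le> C * norm x"
proof (cases "M x = 0")
  case True
  have "0 \<le> C * norm x"
  proof (cases "x = 0")
    case False
    have "0 \<le> C * (norm x)\<^sup>2" using C[of x] by linarith
    then show ?thesis using False by (simp add: zero_le_mult_iff)
  qed simp
  then show ?thesis using True by simp
next
  case False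
  then have x: "x \<noteq> 0" using linear_0[OF M(1)] by auto
  define y where "y = (norm x / norm (M x)) *\<^sub>R M x"
  have ny: "norm y = norm x" using False by (simp add: y_def)
  have "4 * (M x \<bullet> y) = (x + y) \<bullet> M (x + y) - (x - y) \<bullet> M (x - y)"
    using M(2)[of x y] M(2)[of y x]
    by (simp add: linear_add[OF M(1)] linear_diff[OF M(1)] inner_simps inner_commute)
  also have "\<dots> \<le> C * (norm (x + y))\<^sup>2 + C * (norm (x - y))\<^sup>2"
    using C[of "x + y"] C[of "x - y"] by linarith
  also have "\<dots> = 4 * (C * (norm x)\<^sup>2)"
    using ny by (simp add: power2_norm_eq_inner inner_simps inner_commute norm_eq algebra_simps)
  finally have "M x \<bullet> y \<le> C * (norm x)\<^sup>2" by simp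
  moreover have "M x \<bullet> y = norm x * norm (M x)"
    using False by (simp add: y_def power2_norm_eq_inner[symmetric] power2_eq_square)
  ultimately have "norm x * norm (M x) \<le> norm x * (C * norm x)" by (simp add: power2_eq_square algebra_simps)
  then show ?thesis using x by simp
qed

lemma power2_norm_add_le: "(norm (x + y))\<^sup>2 \<le> 2 * (norm x)\<^sup>2 + 2 * (norm (y::'a::real_inner))\<^sup>2"
proof -
  have "0 \<le> (norm (x - y))\<^sup>2" by simp
  then show ?thesis by (simp add: power2_norm_eq_inner inner_simps inner_commute)
qed

lemma power2_norm_sum3_le:
  "(norm (x + y + z))\<^sup>2 \<le> 3 * ((norm x)\<^sup>2 + (norm y)\<^sup>2 + (norm (z::'a::real_inner))\<^sup>2)"
proof -
  have "0 \<le> (norm (x - y))\<^sup>2 + (norm (y - z))\<^sup>2 + (norm (x - z))\<^sup>2" by simp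
  then show ?thesis by (simp add: power2_norm_eq_inner inner_simps inner_commute)
qed

text \<open>
  The supremum convolution, described by a maximising point for every \<open>x\<close>. The opening
  \<open>3\<alpha>/2\<close> is the one for which three-term Cauchy-Schwarz turns the penalty \<open>\<alpha>/2 |\<xi> - \<eta>|\<^sup>2\<close> on the
  maximising points into \<open>3\<alpha>/2 |x - y|\<^sup>2\<close>.
\<close>

lemma sup_convolution_attained:
  fixes f :: "'a::euclidean_space \<Rightarrow> real"
  assumes f: "usc_on UNIV f" "f 0 = 0" "\<And>\<xi>. f \<xi> \<le> \<alpha> / 2 * (norm \<xi>)\<^sup>2" and \<alpha>: "\<alpha> > 0"
  shows "\<exists>m. (\<forall>\<xi>. f \<xi> - 3 * \<alpha> / 2 * (norm (x - \<xi>))\<^sup>2 \<le> f m - 3 * \<alpha> / 2 * (norm (x - m))\<^sup>2) \<and>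
    norm m \<le> 4 * norm x"
proof -
  let ?F = "\<lambda>\<xi>. f \<xi> - 3 * \<alpha> / 2 * (norm (x - \<xi>))\<^sup>2"
  have far: "?F \<xi> \<le> ?F 0" if "norm (x - \<xi>) \<ge> 3 * norm x" for \<xi>
  proof -
    have "(norm \<xi>)\<^sup>2 \<le> 2 * (norm x)\<^sup>2 + 2 * (norm (x - \<xi>))\<^sup>2"
      using power2_norm_add_le[of x "\<xi> - x"] by (simp add: norm_minus_commute)
    then have "\<alpha> / 2 * (norm \<xi>)\<^sup>2 \<le> \<alpha> / 2 * (2 * (norm x)\<^sup>2 + 2 * (norm (x - \<xi>))\<^sup>2)"
      using \<alpha> by (intro mult_left_mono) auto
    then have "?F \<xi> \<le> \<alpha> * (norm x)\<^sup>2 - \<alpha> / 2 * (norm (x - \<xi>))\<^sup>2"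
      using f(3)[of \<xi>] by (simp add: algebra_simps)
    moreover have "(3 * norm x)\<^sup>2 \<le> (norm (x - \<xi>))\<^sup>2" using that by (intro power_mono) auto
    then have "\<alpha> / 2 * (9 * (norm x)\<^sup>2) \<le> \<alpha> / 2 * (norm (x - \<xi>))\<^sup>2"
      using \<alpha> by (intro mult_left_mono) (auto simp: power_mult_distrib)
    moreover have "0 \<le> \<alpha> * (norm x)\<^sup>2" using \<alpha> by simp
    ultimately show ?thesis using f(2) by (simp add: algebra_simps)
  qed
  have usc: "usc_on (cball x (3 * norm x)) (\<lambda>\<xi>. f \<xi> + (- (3 * \<alpha> / 2 * (norm (x - \<xi>))\<^sup>2)))"
    by (rule usc_on_add[OF usc_on_subset[OF f(1)] usc_on_continuous]) (auto intro!: continuous_intros)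
  have "cball x (3 * norm x) \<noteq> {}" by simp
  from usc_on_attains_sup[OF compact_cball this usc]
  obtain m where m: "m \<in> cball x (3 * norm x)" "\<forall>\<xi>\<in>cball x (3 * norm x). ?F \<xi> \<le> ?F m"
    unfolding diff_conv_add_uminus[symmetric] by blast
  have "0 \<in> cball x (3 * norm x)" by (simp add: dist_norm)
  then have "?F 0 \<le> ?F m" using m(2) by blast
  then have "?F \<xi> \<le> ?F m" for \<xi>
  proof (cases "norm (x - \<xi>) \<ge> 3 * norm x")
    case False
    then show ?thesis using m(2) by (simp add: dist_norm)
  qed (use far[of \<xi>] in linarith)
  moreover have "norm m \<le> 4 * norm x"
    using m(1) norm_triangle_ineq2[of m x] by (simp add: dist_norm norm_minus_commute)
  ultimately show ?thesis by blast
qed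

text \<open>
  An approximate expansion on one ball already yields an exact touching from above: after adding
  \<open>2\<delta>|h|\<^sup>2\<close> to the quadratic polynomial the difference has an interior maximum in the ball. The
  touching polynomial of the supremum convolution also touches the original function at the
  maximising point, because translating both arguments leaves the penalty unchanged.
\<close>

lemma sup_convolution_touching:
  fixes f F :: "'a::euclidean_space \<Rightarrow> real"
  assumes ge: "\<And>x \<xi>. f \<xi> - c * (norm (x - \<xi>))\<^sup>2 \<le> F x"
    and att: "\<And>x. F x = f (m x) - c * (norm (x - m x))\<^sup>2" "\<And>x. norm (m x) \<le> 4 * norm x"
    and f0: "f 0 = 0" and c: "c \<ge> 0" and cont: "continuous_on UNIV F"
    and M: "linear M" "\<And>x y. M x \<bullet> y = x \<bullet> M y" "\<And>h. \<bar>h \<bullet> M h\<bar> \<le> C * (norm h)\<^sup>2"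
    and r: "r > 0" and \<delta>: "\<delta> > 0"
    and exp: "\<And>\<xi>. norm \<xi> \<le> 1 \<Longrightarrow> F (x + r *\<^sub>R \<xi>) \<le> F x + r * (p \<bullet> \<xi>) + r\<^sup>2 * (\<xi> \<bullet> M \<xi>) + \<delta> * r\<^sup>2"
  shows "\<exists>x' p'. norm x' \<le> 4 * (norm x + r) \<and> norm (p' - p) \<le> 2 * r * (C + 2 * \<delta>) \<and>
    f x' \<ge> - c * (norm x + r)\<^sup>2 \<and>
    (\<forall>\<^sub>F h in nhds 0. f (x' + h) \<le> f x' + p' \<bullet> h + h \<bullet> M h + 2 * \<delta> * (norm h)\<^sup>2)"
proof -
  define P where "P \<xi> = r * (p \<bullet> \<xi>) + r\<^sup>2 * (\<xi> \<bullet> M \<xi>) + 2 * \<delta> * r\<^sup>2 * (norm \<xi>)\<^sup>2" for \<xi>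
  have cM: "continuous_on S M" for S by (rule linear_continuous_on[OF linear_conv_bounded_linear[THEN iffD1, OF M(1)]])
  have "\<exists>\<xi>\<in>cball 0 1. \<forall>\<zeta>\<in>cball 0 1. F (x + r *\<^sub>R \<zeta>) - P \<zeta> \<le> F (x + r *\<^sub>R \<xi>) - P \<xi>"
    unfolding P_def
    by (intro continuous_attains_sup continuous_intros cM continuous_on_compose2[OF cont]) auto
  then obtain \<xi> where \<xi>: "norm \<xi> \<le> 1"
    "\<And>\<zeta>. norm \<zeta> \<le> 1 \<Longrightarrow> F (x + r *\<^sub>R \<zeta>) - P \<zeta> \<le> F (x + r *\<^sub>R \<xi>) - P \<xi>"
    unfolding Ball_def Bex_def mem_cball_0 by blast
  have "norm \<xi> \<noteq> 1"
  proof
    assume n: "norm \<xi> = 1"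
    have "F x - P 0 \<le> F (x + r *\<^sub>R \<xi>) - P \<xi>" using \<xi>(2)[of 0] by simp
    also have "\<dots> \<le> F x - \<delta> * r\<^sup>2" using exp[of \<xi>] n by (simp add: P_def)
    finally show False using \<delta> r linear_0[OF M(1)] by (simp add: P_def mult_le_0_iff)
  qed
  then have \<xi>1: "norm \<xi> < 1" using \<xi>(1) by simp
  define x1 where "x1 = x + r *\<^sub>R \<xi>"
  define p' where "p' = p + (2 * r) *\<^sub>R (M \<xi> + (2 * \<delta>) *\<^sub>R \<xi>)"
  have nx1: "norm x1 \<le> norm x + r"
  proof -
    have "norm (r *\<^sub>R \<xi>) \<le> r" using \<xi>(1) r by (simp add: mult_left_le)
    then show ?thesis using norm_triangle_ineq[of x "r *\<^sub>R \<xi>"] unfolding x1_def by linarith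
  qed
  have touch: "F (x1 + h) \<le> F x1 + p' \<bullet> h + h \<bullet> M h + 2 * \<delta> * (norm h)\<^sup>2"
    if h: "norm h < r * (1 - norm \<xi>)" for h
  proof -
    define \<zeta> where "\<zeta> = (1 / r) *\<^sub>R h"
    have hz: "h = r *\<^sub>R \<zeta>" using r by (simp add: \<zeta>_def)
    have "norm \<zeta> < 1 - norm \<xi>" using h r by (simp add: hz)
    then have "norm (\<xi> + \<zeta>) \<le> 1" using norm_triangle_ineq[of \<xi> \<zeta>] by linarith
    from \<xi>(2)[OF this] have "F (x1 + h) \<le> F x1 + (P (\<xi> + \<zeta>) - P \<xi>)"
      by (simp add: x1_def hz scaleR_add_right add.assoc)
    also have "P (\<xi> + \<zeta>) - P \<xi> = p' \<bullet> h + h \<bullet> M h + 2 * \<delta> * (norm h)\<^sup>2"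
      unfolding P_def p'_def hz power2_norm_eq_inner
      using M(2)[of \<xi> \<zeta>] M(2)[of \<zeta> \<xi>]
      by (simp add: linear_add[OF M(1)] linear_scale[OF M(1)] inner_simps inner_commute power2_eq_square algebra_simps)
    finally show ?thesis by simp
  qed
  have np: "norm (p' - p) \<le> 2 * r * (C + 2 * \<delta>)"
  proof -
    have "norm (M \<xi>) \<le> C * norm \<xi>" by (rule selfadjoint_norm_bound[OF M])
    have "C \<ge> 0"
    proof -
      obtain b :: 'a where "norm b = 1" using vector_choose_size[of 1] by auto
      then show ?thesis using M(3)[of b] by simp
    qed
    have "norm (M \<xi> + (2 * \<delta>) *\<^sub>R \<xi>) \<le> C * norm \<xi> + 2 * \<delta> * norm \<xi>"
      using norm_triangle_ineq[of "M \<xi>" "(2 * \<delta>) *\<^sub>R \<xi>"] \<open>norm (M \<xi>) \<le> C * norm \<xi>\<close> \<delta> by simp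
    also have "\<dots> \<le> C + 2 * \<delta>"
      using \<xi>(1) \<open>C \<ge> 0\<close> \<delta> by (intro add_mono mult_left_le) auto
    finally have "2 * r * norm (M \<xi> + (2 * \<delta>) *\<^sub>R \<xi>) \<le> 2 * r * (C + 2 * \<delta>)" using r by simp
    then show ?thesis using r by (simp add: p'_def)
  qed
  define x' where "x' = m x1"
  have Fx1: "F x1 = f x' - c * (norm (x1 - x'))\<^sup>2" by (simp add: att(1) x'_def)
  have "f x' \<ge> F x1" using Fx1 c by simp
  also have "F x1 \<ge> - c * (norm x1)\<^sup>2" using ge[of 0 x1] f0 by simp
  moreover have "(norm x1)\<^sup>2 \<le> (norm x + r)\<^sup>2" using nx1 by (intro power_mono) auto
  then have "c * (norm x1)\<^sup>2 \<le> c * (norm x + r)\<^sup>2" using c by (rule mult_left_mono)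
  ultimately have fx': "f x' \<ge> - c * (norm x + r)\<^sup>2" by simp
  have "\<forall>\<^sub>F h in nhds 0. f (x' + h) \<le> f x' + p' \<bullet> h + h \<bullet> M h + 2 * \<delta> * (norm h)\<^sup>2"
    unfolding eventually_nhds_metric
  proof (intro exI[of _ "r * (1 - norm \<xi>)"] conjI allI impI)
    show "0 < r * (1 - norm \<xi>)" using r \<xi>1 by simp
    fix h :: 'a assume "dist h 0 < r * (1 - norm \<xi>)"
    then have "F (x1 + h) \<le> F x1 + p' \<bullet> h + h \<bullet> M h + 2 * \<delta> * (norm h)\<^sup>2" by (intro touch) simp
    moreover have "f (x' + h) - c * (norm (x1 - x'))\<^sup>2 \<le> F (x1 + h)"
      using ge[of "x' + h" "x1 + h"] by simp
    ultimately show "f (x' + h) \<le> f x' + p' \<bullet> h + h \<bullet> M h + 2 * \<delta> * (norm h)\<^sup>2" using Fx1 by linarith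
  qed
  moreover have "norm x' \<le> 4 * (norm x + r)" using att(2)[of x1] nx1 by (simp add: x'_def)
  ultimately show ?thesis using np fx' by blast
qed

lemma norm_prod_power2: "(norm z)\<^sup>2 = (norm (fst z))\<^sup>2 + (norm (snd z))\<^sup>2"
  by (cases z) (simp add: norm_Pair)

text \<open>
  The supremum convolutions \<open>F\<close> and \<open>G\<close> are semiconvex, and \<open>F x + G y - c |x - y|\<^sup>2\<close> has a maximum
  at the origin. At a nearby point this difference, made strict by a small quadratic term, has an
  approximate second-order expansion with a form \<open>L\<close> on the product space. Restricting it to the two
  factors gives the touching polynomials. The upper matrix bound says that \<open>L\<close> is nonpositive at a
  maximum, the lower one is the semiconvexity; both concern the diagonal blocks only, because the
  off-diagonal part of \<open>L\<close> is that of the known function \<open>- c |x - y|\<^sup>2\<close>.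
\<close>

lemma theorem_on_sums_origin:
  fixes f g :: "'a::euclidean_space \<Rightarrow> real"
  assumes f: "usc_on UNIV f" "f 0 = 0" and g: "usc_on UNIV g" "g 0 = 0"
    and sum: "\<And>h k. f h + g k \<le> \<alpha> / 2 * (norm (h - k))\<^sup>2" and \<alpha>: "\<alpha> > 0" and \<epsilon>: "\<epsilon> > 0"
  shows "\<exists>x y p q L M. norm x < \<epsilon> \<and> norm y < \<epsilon> \<and> norm p < \<epsilon> \<and> norm q < \<epsilon> \<and> f x + g y > - \<epsilon> \<and>
    linear L \<and> (\<forall>x y. L x \<bullet> y = x \<bullet> L y) \<and> linear M \<and> (\<forall>x y. M x \<bullet> y = x \<bullet> M y) \<and>
    (\<forall>\<^sub>F h in nhds 0. f (x + h) \<le> f x + p \<bullet> h + 1 / 2 * (h \<bullet> L h)) \<and>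
    (\<forall>\<^sub>F h in nhds 0. g (y + h) \<le> g y + q \<bullet> h + 1 / 2 * (h \<bullet> M h)) \<and>
    (\<forall>h k. - (3 * \<alpha> + \<epsilon>) * ((norm h)\<^sup>2 + (norm k)\<^sup>2) \<le> h \<bullet> L h + k \<bullet> M k \<and>
      h \<bullet> L h + k \<bullet> M k \<le> 3 * \<alpha> * (norm (h - k))\<^sup>2 + \<epsilon> * ((norm h)\<^sup>2 + (norm k)\<^sup>2))"
proof -
  define c where "c = 3 * \<alpha> / 2"
  have c: "c > 0" using \<alpha> by (simp add: c_def)
  have "f h \<le> \<alpha> / 2 * (norm h)\<^sup>2" "g h \<le> \<alpha> / 2 * (norm h)\<^sup>2" for h
    using sum[of h 0] sum[of 0 h] f(2) g(2) by simp_all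
  note attained = sup_convolution_attained[OF f this(1) \<alpha>] sup_convolution_attained[OF g this(2) \<alpha>]
  obtain m where m: "\<And>x \<xi>. f \<xi> - c * (norm (x - \<xi>))\<^sup>2 \<le> f (m x) - c * (norm (x - m x))\<^sup>2"
    "\<And>x. norm (m x) \<le> 4 * norm x" using attained(1) unfolding c_def[symmetric] by metis
  obtain n where n: "\<And>x \<xi>. g \<xi> - c * (norm (x - \<xi>))\<^sup>2 \<le> g (n x) - c * (norm (x - n x))\<^sup>2"
    "\<And>x. norm (n x) \<le> 4 * norm x" using attained(2) unfolding c_def[symmetric] by metis
  define F where "F x = f (m x) - c * (norm (x - m x))\<^sup>2" for x
  define G where "G x = g (n x) - c * (norm (x - n x))\<^sup>2" for x
  have FG_le: "F x + G y \<le> c * (norm (x - y))\<^sup>2" for x y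
  proof -
    have "(norm (m x - n y))\<^sup>2 \<le> 3 * ((norm (x - m x))\<^sup>2 + (norm (x - y))\<^sup>2 + (norm (y - n y))\<^sup>2)"
      using power2_norm_sum3_le[of "m x - x" "x - y" "y - n y"] by (simp add: norm_minus_commute)
    then have "\<alpha> / 2 * (norm (m x - n y))\<^sup>2
        \<le> \<alpha> / 2 * (3 * ((norm (x - m x))\<^sup>2 + (norm (x - y))\<^sup>2 + (norm (y - n y))\<^sup>2))"
      using \<alpha> by (intro mult_left_mono) auto
    then show ?thesis using sum[of "m x" "n y"] by (simp add: F_def G_def c_def algebra_simps)
  qed
  have "0 \<le> F 0" "0 \<le> G 0" using m(1)[of 0 0] n(1)[of 0 0] f(2) g(2) by (auto simp: F_def G_def)
  then have FG0: "F 0 = 0" "G 0 = 0" using FG_le[of 0 0] by auto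
  have parab: "c * (norm (x + h - u))\<^sup>2 = c * (norm (x - u))\<^sup>2 - 2 * c * ((u - x) \<bullet> h) + c * (norm h)\<^sup>2"
    for x h u :: 'a by (simp add: power2_norm_eq_inner inner_simps inner_commute algebra_simps)
  have low: "F (x + h) \<ge> F x + 2 * c * ((m x - x) \<bullet> h) - c * (norm h)\<^sup>2"
    "G (x + h) \<ge> G x + 2 * c * ((n x - x) \<bullet> h) - c * (norm h)\<^sup>2" for x h
    using m(1)[of "m x" "x + h"] n(1)[of "n x" "x + h"] by (simp_all add: F_def G_def parab)
  define \<kappa> where "\<kappa> = \<epsilon> / 8"
  have \<kappa>: "\<kappa> > 0" using \<epsilon> by (simp add: \<kappa>_def)
  (* w has a strict maximum at 0, since F + G stays below the subtracted c |x - y|^2. *)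
  define w where "w z = F (fst z) + G (snd z) - c * (norm (fst z - snd z))\<^sup>2 - \<kappa> * (norm z)\<^sup>2" for z
  define A where "A h = c * (norm h)\<^sup>2 + c * (norm (fst h - snd h))\<^sup>2 + \<kappa> * (norm h)\<^sup>2" for h :: "'a \<times> 'a"
  have A_le: "A h \<le> (3 * c + \<kappa>) * (norm h)\<^sup>2" for h
  proof -
    have "(norm (fst h - snd h))\<^sup>2 \<le> 2 * (norm h)\<^sup>2"
      using power2_norm_add_le[of "fst h" "- snd h"] by (simp add: norm_prod_power2)
    then have "c * (norm (fst h - snd h))\<^sup>2 \<le> c * (2 * (norm h)\<^sup>2)" using c by (intro mult_left_mono) auto
    then show ?thesis by (simp add: A_def algebra_simps)
  qed
  have A_hom: "A (r *\<^sub>R h) = r\<^sup>2 * A h" for r h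
  proof -
    have "fst (r *\<^sub>R h) - snd (r *\<^sub>R h) = r *\<^sub>R (fst h - snd h)" by (simp add: scaleR_diff_right)
    then show ?thesis by (simp only: A_def norm_scaleR power_mult_distrib power2_abs distrib_left mult.left_commute)
  qed
  have w_low: "\<exists>q. \<forall>h. w (z + h) \<ge> w z + q \<bullet> h - A h" for z
  proof -
    let ?x = "fst z" and ?y = "snd z"
    let ?q = "(2 * c) *\<^sub>R (m ?x - ?x, n ?y - ?y) - (2 * c) *\<^sub>R (?x - ?y, ?y - ?x) - (2 * \<kappa>) *\<^sub>R z"
    have "w (z + h) \<ge> w z + ?q \<bullet> h - A h" for h
    proof -
      have 1: "c * (norm ((?x + fst h) - (?y + snd h)))\<^sup>2
          = c * (norm (?x - ?y))\<^sup>2 + 2 * c * ((?x - ?y) \<bullet> (fst h - snd h)) + c * (norm (fst h - snd h))\<^sup>2"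
        by (simp add: power2_norm_eq_inner inner_simps inner_commute algebra_simps)
      have 2: "\<kappa> * (norm (z + h))\<^sup>2 = \<kappa> * (norm z)\<^sup>2 + 2 * \<kappa> * (z \<bullet> h) + \<kappa> * (norm h)\<^sup>2"
        by (simp add: power2_norm_eq_inner inner_simps inner_commute algebra_simps)
      have 3: "?q \<bullet> h = 2 * c * ((m ?x - ?x) \<bullet> fst h) + 2 * c * ((n ?y - ?y) \<bullet> snd h)
          - 2 * c * ((?x - ?y) \<bullet> (fst h - snd h)) - 2 * \<kappa> * (z \<bullet> h)"
        by (simp add: inner_prod_def inner_simps algebra_simps)
      have 4: "c * (norm h)\<^sup>2 = c * (norm (fst h))\<^sup>2 + c * (norm (snd h))\<^sup>2"
        by (simp add: norm_prod_power2 algebra_simps)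
      show ?thesis
        using low(1)[of ?x "fst h"] low(2)[of ?y "snd h"] 1 2 3 4 unfolding w_def A_def fst_add snd_add by linarith
    qed
    then show ?thesis by blast
  qed
  have w_up: "w z \<le> - \<kappa> * (norm z)\<^sup>2" for z using FG_le[of "fst z" "snd z"] by (simp add: w_def)
  have w0: "w 0 = 0" by (simp add: w_def FG0)
  define D where "D = 20 + 8 * c + 4 * \<kappa>"
  define \<delta> where "\<delta> = min 1 (\<epsilon> / (2 * D))"
  have D: "D > 0" using c \<kappa> by (simp add: D_def)
  have \<delta>: "0 < \<delta>" "\<delta> \<le> 1" using \<epsilon> D by (auto simp: \<delta>_def)
  have "\<delta> \<le> \<epsilon> / (2 * D)" by (simp add: \<delta>_def)
  then have "\<delta> * D \<le> \<epsilon> / 2" using D by (simp add: field_simps)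
  then have \<delta>D: "\<delta> * (20 + 8 * c + 4 * \<kappa>) \<le> \<epsilon> / 2" by (simp add: D_def)
  have a0: "3 * c + \<kappa> \<ge> 0" using c \<kappa> by simp
  obtain z p r L where z: "norm z < \<delta>" "norm p < \<delta>" and r: "0 < r" "r < \<delta>"
    and L: "linear L" "\<And>x y. L x \<bullet> y = x \<bullet> L y" and Lb: "\<And>h. h \<bullet> L h \<in> {- A h..0}"
    and exp: "\<And>h. norm h \<le> 1 \<Longrightarrow> \<bar>w (z + r *\<^sub>R h) - w z - r * (p \<bullet> h) - r\<^sup>2 * (h \<bullet> L h)\<bar> \<le> \<delta> * r\<^sup>2"
    using quadratic_expansion_near_strict_maximum[where w = w and A = A, OF w_low A_le A_hom a0 w_up w0 \<kappa> \<delta>(1)]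
    by blast
  obtain x y where xy: "z = (x, y)" by (cases z)
  obtain p1 p2 where pp: "p = (p1, p2)" by (cases p)
  define M1 where "M1 h = fst (L (h, 0)) + (c + \<kappa>) *\<^sub>R h" for h
  define M2 where "M2 h = snd (L (0, h)) + (c + \<kappa>) *\<^sub>R h" for h
  have Ladd: "L (x + x', y + y') = L (x, y) + L (x', y')" for x x' y y'
    using linear_add[OF L(1), of "(x, y)" "(x', y')"] by simp
  have Lscale: "L (r *\<^sub>R x, r *\<^sub>R y) = r *\<^sub>R L (x, y)" for r x y
    using linear_scale[OF L(1), of r "(x, y)"] by simp
  have M: "linear M1" "linear M2"
  proof -
    show "linear M1"
    proof (rule linearI)
      show "M1 (h + k) = M1 h + M1 k" for h k using Ladd[of h k 0 0] by (simp add: M1_def algebra_simps)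
      show "M1 (t *\<^sub>R h) = t *\<^sub>R M1 h" for t h using Lscale[of t h 0] by (simp add: M1_def algebra_simps)
    qed
    show "linear M2"
    proof (rule linearI)
      show "M2 (h + k) = M2 h + M2 k" for h k using Ladd[of 0 0 h k] by (simp add: M2_def algebra_simps)
      show "M2 (t *\<^sub>R h) = t *\<^sub>R M2 h" for t h using Lscale[of t 0 h] by (simp add: M2_def algebra_simps)
    qed
  qed
  have Msym: "M1 h \<bullet> k = h \<bullet> M1 k" "M2 h \<bullet> k = h \<bullet> M2 k" for h k
    using L(2)[of "(h, 0)" "(k, 0)"] L(2)[of "(0, h)" "(0, k)"]
    by (simp_all add: M1_def M2_def inner_simps inner_prod_def)
  have hM: "h \<bullet> M1 h = (h, 0) \<bullet> L (h, 0) + (c + \<kappa>) * (norm h)\<^sup>2"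
    "h \<bullet> M2 h = (0, h) \<bullet> L (0, h) + (c + \<kappa>) * (norm h)\<^sup>2" for h
    by (simp_all add: M1_def M2_def inner_prod_def inner_simps power2_norm_eq_inner algebra_simps)
  have Mb: "\<bar>h \<bullet> M1 h\<bar> \<le> (c + \<kappa>) * (norm h)\<^sup>2" "\<bar>h \<bullet> M2 h\<bar> \<le> (c + \<kappa>) * (norm h)\<^sup>2" for h
  proof -
    have "0 \<le> c * (norm h)\<^sup>2" "0 \<le> \<kappa> * (norm h)\<^sup>2" using c \<kappa> by auto
    then show "\<bar>h \<bullet> M1 h\<bar> \<le> (c + \<kappa>) * (norm h)\<^sup>2" "\<bar>h \<bullet> M2 h\<bar> \<le> (c + \<kappa>) * (norm h)\<^sup>2"
      using Lb[of "(h, 0)"] Lb[of "(0, h)"] unfolding hM A_def by (auto simp: norm_Pair algebra_simps abs_le_iff)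
  qed
  have wcont: "continuous_on UNIV w"
  proof (rule lower_paraboloid_continuous[OF _ _ a0])
    fix z
    obtain q where "\<And>h. w (z + h) \<ge> w z + q \<bullet> h - A h" using w_low by blast
    then have "w (z + h) \<ge> w z + q \<bullet> h - (3 * c + \<kappa>) * (norm h)\<^sup>2" for h
      using A_le[of h] by (smt (verit))
    then show "\<exists>q. \<forall>h. w (z + h) \<ge> w z + q \<bullet> h - (3 * c + \<kappa>) * (norm h)\<^sup>2" by blast
    show "w z \<le> 0" using w_up[of z] \<kappa> by (smt (verit) mult_nonneg_nonneg mult_minus_left zero_le_power2)
  qed
  have "F = (\<lambda>x. w (x, 0) + c * (norm x)\<^sup>2 + \<kappa> * (norm x)\<^sup>2)"
    "G = (\<lambda>y. w (0, y) + c * (norm y)\<^sup>2 + \<kappa> * (norm y)\<^sup>2)"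
    by (auto simp: w_def FG0 norm_Pair)
  moreover have "continuous_on UNIV (\<lambda>x. w (x, 0))" "continuous_on UNIV (\<lambda>y. w (0, y))"
    by (auto intro!: continuous_on_compose2[OF wcont] continuous_intros)
  ultimately have cont: "continuous_on UNIV F" "continuous_on UNIV G"
    by (simp_all add: continuous_intros)
  have sq: "c * (norm (u + r *\<^sub>R h))\<^sup>2 = c * (norm u)\<^sup>2 + 2 * c * r * (u \<bullet> h) + c * r\<^sup>2 * (norm h)\<^sup>2"
    for c and u h :: 'a
    unfolding power2_norm_eq_inner by (simp add: inner_simps inner_commute power2_eq_square algebra_simps)
  define P1 where "P1 = p1 + (2 * c) *\<^sub>R (x - y) + (2 * \<kappa>) *\<^sub>R x"
  define P2 where "P2 = p2 + (2 * c) *\<^sub>R (y - x) + (2 * \<kappa>) *\<^sub>R y"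
  have expF: "F (x + r *\<^sub>R h) \<le> F x + r * (P1 \<bullet> h) + r\<^sup>2 * (h \<bullet> M1 h) + \<delta> * r\<^sup>2" if h: "norm h \<le> 1" for h
  proof -
    have "c * (norm (x + r *\<^sub>R h - y))\<^sup>2
        = c * (norm (x - y))\<^sup>2 + 2 * c * r * ((x - y) \<bullet> h) + c * r\<^sup>2 * (norm h)\<^sup>2"
      using sq[of c "x - y" h] by (simp add: algebra_simps)
    moreover note sq[of \<kappa> x h]
    moreover have "w (x + r *\<^sub>R h, y) - w (x, y) - r * (p1 \<bullet> h) - r\<^sup>2 * ((h, 0) \<bullet> L (h, 0)) \<le> \<delta> * r\<^sup>2"
      using exp[of "(h, 0)"] h by (simp add: xy pp norm_Pair)
    ultimately show ?thesis
      by (simp add: w_def P1_def hM norm_Pair inner_simps algebra_simps)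
  qed
  have expG: "G (y + r *\<^sub>R h) \<le> G y + r * (P2 \<bullet> h) + r\<^sup>2 * (h \<bullet> M2 h) + \<delta> * r\<^sup>2" if h: "norm h \<le> 1" for h
  proof -
    have "c * (norm (x - (y + r *\<^sub>R h)))\<^sup>2
        = c * (norm (x - y))\<^sup>2 + 2 * c * r * ((y - x) \<bullet> h) + c * r\<^sup>2 * (norm h)\<^sup>2"
      using sq[of c "y - x" h] by (simp add: norm_minus_commute[of x] algebra_simps)
    moreover note sq[of \<kappa> y h]
    moreover have "w (x, y + r *\<^sub>R h) - w (x, y) - r * (p2 \<bullet> h) - r\<^sup>2 * ((0, h) \<bullet> L (0, h)) \<le> \<delta> * r\<^sup>2"
      using exp[of "(0, h)"] h by (simp add: xy pp norm_Pair)
    ultimately show ?thesis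
      by (simp add: w_def P2_def hM norm_Pair inner_simps algebra_simps)
  qed
  obtain x' p' where x': "norm x' \<le> 4 * (norm x + r)" "norm (p' - P1) \<le> 2 * r * (c + \<kappa> + 2 * \<delta>)"
    "f x' \<ge> - c * (norm x + r)\<^sup>2"
    "\<forall>\<^sub>F h in nhds 0. f (x' + h) \<le> f x' + p' \<bullet> h + h \<bullet> M1 h + 2 * \<delta> * (norm h)\<^sup>2"
    using sup_convolution_touching[where f = f and F = F and m = m, OF m(1)[folded F_def] F_def m(2) f(2)
        less_imp_le[OF c] cont(1) M(1) Msym(1) Mb(1) r(1) \<delta>(1) expF] by blast
  obtain y' q' where y': "norm y' \<le> 4 * (norm y + r)" "norm (q' - P2) \<le> 2 * r * (c + \<kappa> + 2 * \<delta>)"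
    "g y' \<ge> - c * (norm y + r)\<^sup>2"
    "\<forall>\<^sub>F h in nhds 0. g (y' + h) \<le> g y' + q' \<bullet> h + h \<bullet> M2 h + 2 * \<delta> * (norm h)\<^sup>2"
    using sup_convolution_touching[where f = g and F = G and m = n, OF n(1)[folded G_def] G_def n(2) g(2)
        less_imp_le[OF c] cont(2) M(2) Msym(2) Mb(2) r(1) \<delta>(1) expG] by blast
  have nz: "norm x < \<delta>" "norm y < \<delta>" "norm p1 < \<delta>" "norm p2 < \<delta>"
    using z norm_fst_le[of x y] norm_snd_le[of y x] norm_fst_le[of p1 p2] norm_snd_le[of p2 p1] by (auto simp: xy pp)
  have \<delta>c: "\<delta> * c \<ge> 0" "\<delta> * \<kappa> \<ge> 0" using \<delta> c \<kappa> by auto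
  have small: "norm u < \<epsilon>" if "norm u \<le> 4 * (norm v + r)" "norm v < \<delta>" for u v :: 'a
    using that r(2) \<delta>D \<delta>c \<delta>(1) \<epsilon> by (simp add: algebra_simps)
  have slope: "norm q < \<epsilon>" if q: "norm (q - (s + (2 * c) *\<^sub>R (u - v) + (2 * \<kappa>) *\<^sub>R u)) \<le> 2 * r * (c + \<kappa> + 2 * \<delta>)"
    and n: "norm s < \<delta>" "norm u < \<delta>" "norm v < \<delta>" for q s u v :: 'a
  proof -
    have "norm (u - v) \<le> 2 * \<delta>" using norm_triangle_ineq4[of u v] n by linarith
    then have 1: "norm ((2 * c) *\<^sub>R (u - v)) \<le> 2 * c * (2 * \<delta>)" using c by simp
    have 2: "norm ((2 * \<kappa>) *\<^sub>R u) \<le> 2 * \<kappa> * \<delta>" using n(2) \<kappa> by simp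
    have "2 * r * (c + \<kappa> + 2 * \<delta>) \<le> 2 * \<delta> * (c + \<kappa> + 2)"
      using r \<delta> c \<kappa> by (intro mult_mono) auto
    moreover have "norm q \<le> norm (q - (s + (2 * c) *\<^sub>R (u - v) + (2 * \<kappa>) *\<^sub>R u))
        + (norm s + norm ((2 * c) *\<^sub>R (u - v)) + norm ((2 * \<kappa>) *\<^sub>R u))"
      using norm_triangle_ineq[of "q - (s + (2 * c) *\<^sub>R (u - v) + (2 * \<kappa>) *\<^sub>R u)" "s + (2 * c) *\<^sub>R (u - v) + (2 * \<kappa>) *\<^sub>R u"]
        norm_triangle_ineq[of "s + (2 * c) *\<^sub>R (u - v)" "(2 * \<kappa>) *\<^sub>R u"]
        norm_triangle_ineq[of s "(2 * c) *\<^sub>R (u - v)"] by simp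
    ultimately have "norm q \<le> \<delta> * (5 + 6 * c + 4 * \<kappa>)" using q n(1) 1 2 by (simp add: algebra_simps)
    then show ?thesis using \<delta>D \<delta>c \<delta>(1) \<epsilon> by (simp add: algebra_simps)
  qed
  have val: "c * (norm v + r)\<^sup>2 \<le> 4 * (\<delta> * c)" if v: "norm v < \<delta>" for v :: 'a
  proof -
    have "(norm v + r)\<^sup>2 \<le> (2 * \<delta>)\<^sup>2" using v r by (intro power_mono) auto
    also have "\<dots> \<le> 4 * \<delta>" using \<delta> by (simp add: power2_eq_square mult_left_le)
    finally have "c * (norm v + r)\<^sup>2 \<le> c * (4 * \<delta>)" using c by (intro mult_left_mono) auto
    then show ?thesis by (simp add: algebra_simps)
  qed
  define N1 where "N1 h = 2 *\<^sub>R M1 h + (4 * \<delta>) *\<^sub>R h" for h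
  define N2 where "N2 h = 2 *\<^sub>R M2 h + (4 * \<delta>) *\<^sub>R h" for h
  have Nlin: "linear N1" "linear N2"
    by (auto intro!: linearI simp: N1_def N2_def linear_add[OF M(1)] linear_add[OF M(2)]
        linear_scale[OF M(1)] linear_scale[OF M(2)] algebra_simps)
  have Nsym: "N1 h \<bullet> k = h \<bullet> N1 k" "N2 h \<bullet> k = h \<bullet> N2 k" for h k
    by (simp_all add: N1_def N2_def inner_simps Msym)
  have hN: "1 / 2 * (h \<bullet> N1 h) = h \<bullet> M1 h + 2 * \<delta> * (norm h)\<^sup>2"
    "1 / 2 * (h \<bullet> N2 h) = h \<bullet> M2 h + 2 * \<delta> * (norm h)\<^sup>2" for h
    by (simp_all add: N1_def N2_def inner_simps power2_norm_eq_inner algebra_simps)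
  (* The second mixed difference of F + G vanishes, so the mixed part of L is that of - c |x - y|^2. *)
  have cross: "\<bar>(h, k) \<bullet> L (h, k) - (h, 0) \<bullet> L (h, 0) - (0, k) \<bullet> L (0, k) - 2 * c * (h \<bullet> k)\<bar>
      \<le> 3 * \<delta> * ((norm h)\<^sup>2 + (norm k)\<^sup>2)" for h k
  proof (cases "(h, k) = 0")
    case False
    define t where "t = norm (h, k)"
    have t: "t > 0" using False by (simp add: t_def)
    define h' where "h' = (1 / t) *\<^sub>R h"
    define k' where "k' = (1 / t) *\<^sub>R k"
    have hk: "h = t *\<^sub>R h'" "k = t *\<^sub>R k'" using t by (auto simp: h'_def k'_def)
    have "(h', k') = (1 / t) *\<^sub>R (h, k)" by (simp add: h'_def k'_def)
    then have n1: "norm (h', k') = 1" using t by (simp add: t_def[symmetric] del: scaleR_Pair)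
    have n2: "norm (h', 0::'a) \<le> 1" "norm (0::'a, k') \<le> 1"
    proof -
      have "norm h' \<le> 1" "norm k' \<le> 1" using norm_fst_le[of h' k'] norm_snd_le[of k' h'] n1 by linarith+
      then show "norm (h', 0::'a) \<le> 1" "norm (0::'a, k') \<le> 1" by (simp_all add: norm_Pair)
    qed
    have "w (z + r *\<^sub>R (h', k')) - w (z + r *\<^sub>R (h', 0)) - w (z + r *\<^sub>R (0, k')) + w z = 2 * c * r\<^sup>2 * (h' \<bullet> k')"
      unfolding xy w_def norm_prod_power2 power2_norm_eq_inner
      by (simp add: inner_simps inner_commute power2_eq_square algebra_simps)
    moreover have "p \<bullet> (h', k') = p \<bullet> (h', 0) + p \<bullet> (0, k')" by (simp add: inner_prod_def)
    then have "r * (p \<bullet> (h', k')) = r * (p \<bullet> (h', 0)) + r * (p \<bullet> (0, k'))" by (simp only: distrib_left)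
    ultimately have "\<bar>r\<^sup>2 * ((h', k') \<bullet> L (h', k')) - r\<^sup>2 * ((h', 0) \<bullet> L (h', 0)) - r\<^sup>2 * ((0, k') \<bullet> L (0, k'))
        - 2 * c * r\<^sup>2 * (h' \<bullet> k')\<bar> \<le> 3 * (\<delta> * r\<^sup>2)"
      using exp[of "(h', k')"] exp[OF n2(1)] exp[OF n2(2)] n1 by (simp only: abs_le_iff) linarith
    then have "\<bar>r\<^sup>2 * ((h', k') \<bullet> L (h', k') - (h', 0) \<bullet> L (h', 0) - (0, k') \<bullet> L (0, k') - 2 * c * (h' \<bullet> k'))\<bar>
        \<le> r\<^sup>2 * (3 * \<delta>)"
      by (simp only: right_diff_distrib) (simp add: mult_ac)
    then have main: "\<bar>(h', k') \<bullet> L (h', k') - (h', 0) \<bullet> L (h', 0) - (0, k') \<bullet> L (0, k') - 2 * c * (h' \<bullet> k')\<bar> \<le> 3 * \<delta>"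
      unfolding abs_mult using r by simp
    have e: "(h, k) \<bullet> L (h, k) - (h, 0) \<bullet> L (h, 0) - (0, k) \<bullet> L (0, k) - 2 * c * (h \<bullet> k)
        = t\<^sup>2 * ((h', k') \<bullet> L (h', k') - (h', 0) \<bullet> L (h', 0) - (0, k') \<bullet> L (0, k') - 2 * c * (h' \<bullet> k'))"
      using Lscale[of t h' k'] Lscale[of t h' 0] Lscale[of t 0 k']
      by (simp add: hk inner_prod_def power2_eq_square algebra_simps)
    have tt: "(norm h)\<^sup>2 + (norm k)\<^sup>2 = t\<^sup>2" by (simp add: t_def norm_prod_power2)
    show ?thesis unfolding e tt abs_mult using mult_left_mono[OF main, of "t\<^sup>2"] by (simp add: mult_ac)
  qed (use linear_0[OF L(1)] in \<open>simp add: zero_prod_def\<close>)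
  have bounds: "- (3 * \<alpha> + \<epsilon>) * ((norm h)\<^sup>2 + (norm k)\<^sup>2) \<le> h \<bullet> N1 h + k \<bullet> N2 k \<and>
      h \<bullet> N1 h + k \<bullet> N2 k \<le> 3 * \<alpha> * (norm (h - k))\<^sup>2 + \<epsilon> * ((norm h)\<^sup>2 + (norm k)\<^sup>2)" for h k
  proof -
    define S where "S = (norm h)\<^sup>2 + (norm k)\<^sup>2"
    have S: "S \<ge> 0" by (simp add: S_def)
    have e1: "h \<bullet> N1 h + k \<bullet> N2 k
        = 2 * ((h, 0) \<bullet> L (h, 0)) + 2 * ((0, k) \<bullet> L (0, k)) + 2 * (c * S) + 2 * (\<kappa> * S) + 4 * (\<delta> * S)"
      using hN(1)[of h] hN(2)[of k] hM(1)[of h] hM(2)[of k] by (simp add: S_def algebra_simps)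
    have e2: "c * (norm (h - k))\<^sup>2 = c * S - 2 * (c * (h \<bullet> k))"
      by (simp add: S_def power2_norm_eq_inner inner_simps inner_commute algebra_simps)
    have e3: "- (c * S + c * (norm (h - k))\<^sup>2 + \<kappa> * S) \<le> (h, k) \<bullet> L (h, k)" "(h, k) \<bullet> L (h, k) \<le> 0"
      using Lb[of "(h, k)"] by (simp_all add: A_def norm_prod_power2 S_def)
    have "\<delta> * 20 \<le> \<epsilon> / 2" using \<delta>D \<delta>c by (simp add: algebra_simps)
    then have "\<delta> * 20 * S \<le> \<epsilon> / 2 * S" using S by (rule mult_right_mono)
    then have e4: "40 * (\<delta> * S) \<le> \<epsilon> * S" by (simp add: mult_ac)
    have e5: "8 * (\<kappa> * S) = \<epsilon> * S" by (simp add: \<kappa>_def)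
    have e6: "\<bar>(h, k) \<bullet> L (h, k) - (h, 0) \<bullet> L (h, 0) - (0, k) \<bullet> L (0, k) - 2 * (c * (h \<bullet> k))\<bar> \<le> 3 * (\<delta> * S)"
      using cross[of h k] by (simp add: S_def mult.assoc)
    have e7: "\<delta> * S \<ge> 0" "\<epsilon> * S \<ge> 0" using \<delta> \<epsilon> S by auto
    have e8: "2 * (c * S) = 3 * (\<alpha> * S)" "2 * (c * (norm (h - k))\<^sup>2) = 3 * (\<alpha> * (norm (h - k))\<^sup>2)"
      by (simp_all add: c_def)
    have "- (3 * (\<alpha> * S) + \<epsilon> * S) \<le> h \<bullet> N1 h + k \<bullet> N2 k \<and>
        h \<bullet> N1 h + k \<bullet> N2 k \<le> 3 * (\<alpha> * (norm (h - k))\<^sup>2) + \<epsilon> * S"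
      using e1 e2 e3 e4 e5 e6 e7 e8 unfolding abs_le_iff by linarith
    then show ?thesis unfolding S_def[symmetric] by (simp add: algebra_simps)
  qed
  show ?thesis
  proof (intro exI conjI allI)
    show "norm x' < \<epsilon>" "norm y' < \<epsilon>" using small x'(1) y'(1) nz by blast+
    show "norm p' < \<epsilon>" by (rule slope[OF x'(2)[unfolded P1_def] nz(3,1,2)])
    show "norm q' < \<epsilon>" by (rule slope[OF y'(2)[unfolded P2_def] nz(4,2,1)])
    show "f x' + g y' > - \<epsilon>"
      using x'(3) y'(3) val[OF nz(1)] val[OF nz(2)] \<delta>D \<delta>c \<delta>(1) by (simp add: algebra_simps)
    show "linear N1" "linear N2" by (rule Nlin)+
    show "N1 h \<bullet> k = h \<bullet> N1 k" "N2 h \<bullet> k = h \<bullet> N2 k" for h k by (rule Nsym)+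
    show "\<forall>\<^sub>F h in nhds 0. f (x' + h) \<le> f x' + p' \<bullet> h + 1 / 2 * (h \<bullet> N1 h)"
      using x'(4) unfolding hN by (simp add: add.assoc)
    show "\<forall>\<^sub>F h in nhds 0. g (y' + h) \<le> g y' + q' \<bullet> h + 1 / 2 * (h \<bullet> N2 h)"
      using y'(4) unfolding hN by (simp add: add.assoc)
  qed (use bounds in blast)+
qed

text \<open>
  Subtracting the first-order part of the penalty at the maximum point reduces the general case to
  a maximum at the origin. The touching points lie close to the maximum point rather than at it;
  the limit \<open>\<epsilon> \<rightarrow> 0\<close> is taken later, in the differential inequalities.
\<close>

lemma theorem_on_sums:
  fixes f g :: "'a::euclidean_space \<Rightarrow> real"
  assumes f: "usc_on UNIV f" and g: "usc_on UNIV g" and \<alpha>: "\<alpha> > 0" and \<epsilon>: "\<epsilon> > 0"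
    and max: "\<And>\<xi> \<eta>. f \<xi> + g \<eta> - \<alpha> / 2 * (norm (\<xi> - \<eta>))\<^sup>2 \<le> f x0 + g y0 - \<alpha> / 2 * (norm (x0 - y0))\<^sup>2"
  shows "\<exists>x y p q L M. norm (x - x0) < \<epsilon> \<and> norm (y - y0) < \<epsilon> \<and>
    norm (p - \<alpha> *\<^sub>R (x0 - y0)) < \<epsilon> \<and> norm (q + \<alpha> *\<^sub>R (x0 - y0)) < \<epsilon> \<and> f x + g y > f x0 + g y0 - \<epsilon> \<and>
    linear L \<and> (\<forall>x y. L x \<bullet> y = x \<bullet> L y) \<and> linear M \<and> (\<forall>x y. M x \<bullet> y = x \<bullet> M y) \<and>
    (\<forall>\<^sub>F h in nhds 0. f (x + h) \<le> f x + p \<bullet> h + 1 / 2 * (h \<bullet> L h)) \<and>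
    (\<forall>\<^sub>F h in nhds 0. g (y + h) \<le> g y + q \<bullet> h + 1 / 2 * (h \<bullet> M h)) \<and>
    (\<forall>h k. - (3 * \<alpha> + \<epsilon>) * ((norm h)\<^sup>2 + (norm k)\<^sup>2) \<le> h \<bullet> L h + k \<bullet> M k \<and>
      h \<bullet> L h + k \<bullet> M k \<le> 3 * \<alpha> * (norm (h - k))\<^sup>2 + \<epsilon> * ((norm h)\<^sup>2 + (norm k)\<^sup>2))"
proof -
  define p0 where "p0 = \<alpha> *\<^sub>R (x0 - y0)"
  define f1 where "f1 h = f (x0 + h) + (- f x0 - p0 \<bullet> h)" for h
  define g1 where "g1 h = g (y0 + h) + (- g y0 + p0 \<bullet> h)" for h
  have usc: "usc_on UNIV f1" "usc_on UNIV g1"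
    unfolding f1_def g1_def
    by (intro usc_on_add usc_on_compose[OF f] usc_on_compose[OF g] usc_on_continuous; auto intro!: continuous_intros)+
  have z: "f1 0 = 0" "g1 0 = 0" by (auto simp: f1_def g1_def)
  have sum: "f1 h + g1 k \<le> \<alpha> / 2 * (norm (h - k))\<^sup>2" for h k
  proof -
    have "\<alpha> / 2 * (norm ((x0 + h) - (y0 + k)))\<^sup>2
        = \<alpha> / 2 * (norm (x0 - y0))\<^sup>2 + p0 \<bullet> (h - k) + \<alpha> / 2 * (norm (h - k))\<^sup>2"
      by (simp add: p0_def power2_norm_eq_inner inner_simps inner_commute algebra_simps)
    then show ?thesis
      using max[of "x0 + h" "y0 + k"] unfolding f1_def g1_def inner_diff_right by linarith
  qed
  define \<delta> where "\<delta> = \<epsilon> / (1 + 2 * norm p0)"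
  have pos: "1 + 2 * norm p0 > 0" using norm_ge_zero[of p0] by linarith
  have \<delta>: "\<delta> > 0" "\<delta> \<le> \<epsilon>" using \<epsilon> pos by (auto simp: \<delta>_def field_simps)
  have \<delta>e: "\<delta> + 2 * (norm p0 * \<delta>) = \<epsilon>"
  proof -
    have "\<delta> * (1 + 2 * norm p0) = \<epsilon>" using pos by (simp add: \<delta>_def)
    then show ?thesis by (simp add: algebra_simps)
  qed
  obtain x y p q L M where *: "norm x < \<delta>" "norm y < \<delta>" "norm p < \<delta>" "norm q < \<delta>" "f1 x + g1 y > - \<delta>"
    "linear L" "\<forall>x y. L x \<bullet> y = x \<bullet> L y" "linear M" "\<forall>x y. M x \<bullet> y = x \<bullet> M y"
    and tf: "\<forall>\<^sub>F h in nhds 0. f1 (x + h) \<le> f1 x + p \<bullet> h + 1 / 2 * (h \<bullet> L h)"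
    and tg: "\<forall>\<^sub>F h in nhds 0. g1 (y + h) \<le> g1 y + q \<bullet> h + 1 / 2 * (h \<bullet> M h)"
    and b: "\<forall>h k. - (3 * \<alpha> + \<delta>) * ((norm h)\<^sup>2 + (norm k)\<^sup>2) \<le> h \<bullet> L h + k \<bullet> M k \<and>
      h \<bullet> L h + k \<bullet> M k \<le> 3 * \<alpha> * (norm (h - k))\<^sup>2 + \<delta> * ((norm h)\<^sup>2 + (norm k)\<^sup>2)"
    using theorem_on_sums_origin[OF usc(1) z(1) usc(2) z(2) sum \<alpha> \<delta>(1)] by blast
  show ?thesis
  proof (intro exI conjI allI)
    show "norm ((x0 + x) - x0) < \<epsilon>" "norm ((y0 + y) - y0) < \<epsilon>"
      "norm ((p + p0) - \<alpha> *\<^sub>R (x0 - y0)) < \<epsilon>" "norm ((q - p0) + \<alpha> *\<^sub>R (x0 - y0)) < \<epsilon>"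
      using * \<delta>(2) by (auto simp: p0_def[symmetric])
    have "norm (x - y) \<le> 2 * \<delta>" using norm_triangle_ineq4[of x y] *(1,2) by linarith
    then have "norm p0 * norm (x - y) \<le> norm p0 * (2 * \<delta>)" by (intro mult_left_mono) auto
    then have "\<bar>p0 \<bullet> (x - y)\<bar> \<le> 2 * (norm p0 * \<delta>)"
      using Cauchy_Schwarz_ineq2[of p0 "x - y"] by simp
    then show "f (x0 + x) + g (y0 + y) > f x0 + g y0 - \<epsilon>"
      using *(5) \<delta>e by (simp add: f1_def g1_def inner_simps abs_le_iff)
    show "linear L" "linear M" "L h \<bullet> k = h \<bullet> L k" "M h \<bullet> k = h \<bullet> M k" for h k using * by auto
    show "\<forall>\<^sub>F h in nhds 0. f (x0 + x + h) \<le> f (x0 + x) + (p + p0) \<bullet> h + 1 / 2 * (h \<bullet> L h)"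
      using tf by (simp add: f1_def inner_simps algebra_simps)
    show "\<forall>\<^sub>F h in nhds 0. g (y0 + y + h) \<le> g (y0 + y) + (q - p0) \<bullet> h + 1 / 2 * (h \<bullet> M h)"
      using tg by (simp add: g1_def inner_simps algebra_simps)
    fix h k :: 'a
    have "\<delta> * ((norm h)\<^sup>2 + (norm k)\<^sup>2) \<le> \<epsilon> * ((norm h)\<^sup>2 + (norm k)\<^sup>2)"
      using \<delta>(2) by (intro mult_right_mono) auto
    then show "- (3 * \<alpha> + \<epsilon>) * ((norm h)\<^sup>2 + (norm k)\<^sup>2) \<le> h \<bullet> L h + k \<bullet> M k"
      "h \<bullet> L h + k \<bullet> M k \<le> 3 * \<alpha> * (norm (h - k))\<^sup>2 + \<epsilon> * ((norm h)\<^sup>2 + (norm k)\<^sup>2)"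
      using b[rule_format, of h k] by (simp_all add: algebra_simps)
  qed
qed

section \<open>Test functions\<close>

lemma sym_matrix_inner:
  assumes "X \<in> sym_matrices"
  shows "(X *v x) \<bullet> y = x \<bullet> (X *v y)"
  using assms dot_lmul_matrix[of x X y] transpose_matrix_vector[of X x] by (simp add: sym_matrices_def)

lemma sym_matricesI:
  fixes X :: "real ^ 'n ^ 'n"
  assumes "\<And>h k. h \<bullet> (X *v k) = k \<bullet> (X *v h)"
  shows "X \<in> sym_matrices"
proof -
  have "X $ i $ j = X $ j $ i" for i j
  proof -
    have e: "(X *v axis l 1) $ m = X $ m $ l" for l m
      by (simp add: matrix_vector_mult_basis column_def)
    show ?thesis using assms[of "axis i 1" "axis j 1"] by (simp add: inner_axis' e)
  qed
  then show ?thesis by (simp add: sym_matrices_def transpose_def vec_eq_iff)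
qed

text \<open>The mixed second difference of \<open>\<psi>\<close> along \<open>h\<close> and \<open>k\<close>, computed with the mean value theorem
  first along \<open>h\<close>, sees only the derivative of the gradient along \<open>k\<close>. As the
  difference itself is symmetric in \<open>h\<close> and \<open>k\<close>, so is the Hessian.\<close>

lemma second_difference_estimate:
  fixes \<psi> :: "'a::euclidean_space \<Rightarrow> real"
  assumes d: "d > 0" "\<And>y. norm (y - x) < d \<Longrightarrow> (\<psi> has_derivative (\<lambda>h. G y \<bullet> h)) (at y)"
    and H: "linear H" "\<And>z. norm z < d \<Longrightarrow> norm (G (x + z) - G x - H z) \<le> e * norm z"
    and hk: "norm h + norm k < d" and e: "e \<ge> 0"
  shows "\<bar>\<psi> (x + h + k) - \<psi> (x + h) - \<psi> (x + k) + \<psi> x - h \<bullet> H k\<bar> \<le> 2 * e * (norm h + norm k)\<^sup>2"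
proof -
  let ?g = "\<lambda>\<tau>. \<psi> (x + k + \<tau> *\<^sub>R h) - \<psi> (x + \<tau> *\<^sub>R h)"
  have small: "norm (k + \<tau> *\<^sub>R h) < d" "norm (\<tau> *\<^sub>R h) < d" "norm (k + \<tau> *\<^sub>R h) \<le> norm h + norm k" "norm (\<tau> *\<^sub>R h) \<le> norm h + norm k"
    if "0 \<le> \<tau>" "\<tau> \<le> 1" for \<tau>
  proof -
    have "norm (\<tau> *\<^sub>R h) \<le> norm h" using that by (simp add: mult_left_le_one_le)
    then show "norm (k + \<tau> *\<^sub>R h) < d" "norm (\<tau> *\<^sub>R h) < d" "norm (k + \<tau> *\<^sub>R h) \<le> norm h + norm k" "norm (\<tau> *\<^sub>R h) \<le> norm h + norm k"
      using norm_triangle_ineq[of k "\<tau> *\<^sub>R h"] hk norm_ge_zero[of k] by linarith+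
  qed
  have der: "(?g has_real_derivative (G (x + k + \<tau> *\<^sub>R h) \<bullet> h - G (x + \<tau> *\<^sub>R h) \<bullet> h)) (at \<tau>)"
    if \<tau>: "0 \<le> \<tau>" "\<tau> \<le> 1" for \<tau>
  proof -
    have l: "((\<lambda>\<tau>. y + \<tau> *\<^sub>R h) has_derivative (\<lambda>s. s *\<^sub>R h)) (at \<tau>)" for y
      by (auto intro!: derivative_eq_intros)
    have "((\<lambda>\<tau>. \<psi> (x + k + \<tau> *\<^sub>R h)) has_derivative (\<lambda>s. G (x + k + \<tau> *\<^sub>R h) \<bullet> (s *\<^sub>R h))) (at \<tau>)"
      by (rule has_derivative_compose[OF l]) (rule d(2), use small[OF \<tau>] in \<open>simp add: add.assoc\<close>)
    moreover have "((\<lambda>\<tau>. \<psi> (x + \<tau> *\<^sub>R h)) has_derivative (\<lambda>s. G (x + \<tau> *\<^sub>R h) \<bullet> (s *\<^sub>R h))) (at \<tau>)"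
      by (rule has_derivative_compose[OF l]) (rule d(2), use small[OF \<tau>] in simp)
    ultimately have "(?g has_derivative (\<lambda>s. G (x + k + \<tau> *\<^sub>R h) \<bullet> (s *\<^sub>R h) - G (x + \<tau> *\<^sub>R h) \<bullet> (s *\<^sub>R h))) (at \<tau>)"
      by (rule has_derivative_diff)
    then show ?thesis unfolding has_field_derivative_def
      by (rule has_derivative_eq_rhs) (auto simp: algebra_simps)
  qed
  obtain \<tau> where \<tau>: "0 < \<tau>" "\<tau> < 1" "?g 1 - ?g 0 = (1 - 0) * (G (x + k + \<tau> *\<^sub>R h) \<bullet> h - G (x + \<tau> *\<^sub>R h) \<bullet> h)"
    using MVT2[of 0 1 ?g "\<lambda>\<tau>. G (x + k + \<tau> *\<^sub>R h) \<bullet> h - G (x + \<tau> *\<^sub>R h) \<bullet> h"] der by auto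
  have \<tau>': "0 \<le> \<tau>" "\<tau> \<le> 1" using \<tau> by auto
  let ?r1 = "G (x + (k + \<tau> *\<^sub>R h)) - G x - H (k + \<tau> *\<^sub>R h)" and ?r2 = "G (x + \<tau> *\<^sub>R h) - G x - H (\<tau> *\<^sub>R h)"
  have "e * norm (k + \<tau> *\<^sub>R h) \<le> e * (norm h + norm k)" "e * norm (\<tau> *\<^sub>R h) \<le> e * (norm h + norm k)"
    using small(3,4)[OF \<tau>'] e by (auto intro!: mult_left_mono)
  then have "norm ?r1 \<le> e * (norm h + norm k)" "norm ?r2 \<le> e * (norm h + norm k)"
    using H(2)[OF small(1)[OF \<tau>']] H(2)[OF small(2)[OF \<tau>']] by linarith+
  then have nr: "norm (?r1 - ?r2) \<le> 2 * e * (norm h + norm k)" using norm_triangle_ineq4[of ?r1 ?r2] by linarith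
  have "\<psi> (x + h + k) - \<psi> (x + h) - \<psi> (x + k) + \<psi> x = (H k + (?r1 - ?r2)) \<bullet> h"
    using \<tau>(3) by (simp add: linear_add[OF H(1)] inner_simps algebra_simps)
  then have "\<bar>\<psi> (x + h + k) - \<psi> (x + h) - \<psi> (x + k) + \<psi> x - h \<bullet> H k\<bar> = \<bar>(?r1 - ?r2) \<bullet> h\<bar>"
    by (simp only: inner_add_left) (simp add: inner_commute)
  also have "\<dots> \<le> norm (?r1 - ?r2) * norm h" by (rule Cauchy_Schwarz_ineq2)
  also have "\<dots> \<le> (2 * e * (norm h + norm k)) * (norm h + norm k)"
    using nr e by (intro mult_mono) auto
  finally show ?thesis by (simp add: power2_eq_square algebra_simps)
qed

lemma hessian_symmetric:
  fixes \<psi> :: "real ^ 'n \<Rightarrow> real"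
  assumes U: "open U" "x \<in> U" and G: "\<And>y. y \<in> U \<Longrightarrow> (\<psi> has_derivative (\<lambda>h. G y \<bullet> h)) (at y)"
    and H: "(G has_derivative (\<lambda>h. H *v h)) (at x)"
  shows "H \<in> sym_matrices"
proof (rule sym_matricesI)
  fix h k :: "real ^ 'n"
  let ?s = "norm h + norm k"
  have key: "\<bar>h \<bullet> (H *v k) - k \<bullet> (H *v h)\<bar> \<le> 4 * e * ?s\<^sup>2" if e: "e > 0" for e
  proof -
    obtain d1 where d1: "d1 > 0" "\<And>y. norm (y - x) < d1 \<Longrightarrow> y \<in> U"
      using U by (metis open_dist dist_norm)
    obtain d2 where d2: "d2 > 0" "\<And>y. norm (y - x) < d2 \<Longrightarrow> norm (G y - G x - H *v (y - x)) \<le> e * norm (y - x)"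
      using H e unfolding has_derivative_at_alt by blast
    define d where "d = min d1 d2"
    have d: "d > 0" using d1 d2 by (simp add: d_def)
    define S where "S = ?s + 1"
    define t where "t = d / (2 * S)"
    have S: "S > 0" unfolding S_def using norm_ge_zero[of h] norm_ge_zero[of k] by linarith
    have t: "t > 0" using d S by (simp add: t_def)
    have "t * S = d / 2" using S by (simp add: t_def)
    then have ts: "t * ?s < d" using t d by (simp add: S_def algebra_simps)
    have n: "norm (t *\<^sub>R h) + norm (t *\<^sub>R k) = t * ?s" using t by (simp add: algebra_simps)
    have est: "\<bar>\<psi> (x + t *\<^sub>R a + t *\<^sub>R b) - \<psi> (x + t *\<^sub>R a) - \<psi> (x + t *\<^sub>R b) + \<psi> x - (t *\<^sub>R a) \<bullet> (H *v (t *\<^sub>R b))\<bar>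
        \<le> 2 * e * (t * ?s)\<^sup>2" if "norm (t *\<^sub>R a) + norm (t *\<^sub>R b) = t * ?s" for a b
    proof -
      have "\<bar>\<psi> (x + t *\<^sub>R a + t *\<^sub>R b) - \<psi> (x + t *\<^sub>R a) - \<psi> (x + t *\<^sub>R b) + \<psi> x - (t *\<^sub>R a) \<bullet> (H *v (t *\<^sub>R b))\<bar>
          \<le> 2 * e * (norm (t *\<^sub>R a) + norm (t *\<^sub>R b))\<^sup>2"
      proof (rule second_difference_estimate[OF d, where G = G and H = "\<lambda>h. H *v h"])
        show "(\<psi> has_derivative (\<lambda>h. G y \<bullet> h)) (at y)" if "norm (y - x) < d" for y
          using that d1(2) by (intro G) (simp add: d_def)
        show "linear ((*v) H)" by (rule matrix_vector_mul_linear)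
        show "norm (G (x + z) - G x - H *v z) \<le> e * norm z" if "norm z < d" for z
          using d2(2)[of "x + z"] that by (simp add: d_def)
        show "norm (t *\<^sub>R a) + norm (t *\<^sub>R b) < d" using that ts by simp
      qed (use e in simp)
      then show ?thesis using that by simp
    qed
    have 1: "\<psi> (x + t *\<^sub>R h + t *\<^sub>R k) = \<psi> (x + t *\<^sub>R k + t *\<^sub>R h)" by (simp add: algebra_simps)
    have "\<bar>(t *\<^sub>R h) \<bullet> (H *v (t *\<^sub>R k)) - (t *\<^sub>R k) \<bullet> (H *v (t *\<^sub>R h))\<bar> \<le> 4 * e * (t * ?s)\<^sup>2"
      using est[of h k] est[of k h] n 1 by (simp add: abs_le_iff)
    then have "\<bar>t\<^sup>2 * (h \<bullet> (H *v k) - k \<bullet> (H *v h))\<bar> \<le> t\<^sup>2 * (4 * e * ?s\<^sup>2)"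
      by (simp add: matrix_vector_mult_scaleR power2_eq_square algebra_simps)
    then show ?thesis using t by (simp add: abs_mult)
  qed
  show "h \<bullet> (H *v k) = k \<bullet> (H *v h)"
  proof (rule ccontr)
    assume ne: "h \<bullet> (H *v k) \<noteq> k \<bullet> (H *v h)"
    define D where "D = \<bar>h \<bullet> (H *v k) - k \<bullet> (H *v h)\<bar>"
    have D: "D > 0" using ne by (simp add: D_def)
    define S where "S = ?s\<^sup>2 + 1"
    have S: "S > 0" "?s\<^sup>2 \<le> S" unfolding S_def using zero_le_power2[of ?s] by linarith+
    have e: "D / (8 * S) > 0" using D S by simp
    have "D \<le> 4 * (D / (8 * S)) * ?s\<^sup>2" using key[OF e] by (simp add: D_def)
    also have "\<dots> \<le> 4 * (D / (8 * S)) * S" using S(2) e by (intro mult_left_mono) auto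
    also have "\<dots> = D / 2" using S by simp
    finally show False using D by simp
  qed
qed

lemma C12_hessian_symmetric:
  assumes "C12_on U \<phi> \<phi>t G H" "(t, x) \<in> U"
  shows "H (t, x) \<in> sym_matrices"
proof (rule hessian_symmetric[where U = "{y. (t, y) \<in> U}" and \<psi> = "\<lambda>y. \<phi> (t, y)" and G = "\<lambda>y. G (t, y)"])
  show "open {y. (t, y) \<in> U}"
    using open_vimage[of U "Pair t"] assms(1) by (simp add: C12_on_def vimage_def continuous_intros)
qed (use assms in \<open>auto simp: C12_on_def\<close>)

lemma C12_continuous:
  assumes C: "C12_on U \<phi> \<phi>t G H"
  shows "continuous_on U \<phi>"
proof -
  have "isCont \<phi> (t0, x0)" if z0: "(t0, x0) \<in> U" for t0 x0
  proof -
    have U: "open U" and ct: "continuous_on U \<phi>t" using C by (auto simp: C12_on_def)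
    have "isCont \<phi>t (t0, x0)" using ct U z0 by (simp add: continuous_on_eq_continuous_at)
    then have "\<forall>\<^sub>F w in nhds (t0, x0). dist (\<phi>t w) (\<phi>t (t0, x0)) < 1"
      by (intro tendstoD) (simp_all add: isCont_def tendsto_at_iff_tendsto_nhds)
    moreover have "\<forall>\<^sub>F w in nhds (t0, x0). w \<in> U" using U z0 by (rule eventually_nhds_in_open)
    ultimately have "\<forall>\<^sub>F w in nhds (t0, x0). \<bar>\<phi>t w\<bar> \<le> \<bar>\<phi>t (t0, x0)\<bar> + 1 \<and> w \<in> U"
      by eventually_elim (auto simp: dist_real_def)
    then obtain d where d: "d > 0" "\<And>w. dist w (t0, x0) < d \<Longrightarrow> \<bar>\<phi>t w\<bar> \<le> \<bar>\<phi>t (t0, x0)\<bar> + 1 \<and> w \<in> U"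
      unfolding eventually_nhds_metric by blast
    define B where "B = \<bar>\<phi>t (t0, x0)\<bar> + 1"
    have lip: "\<bar>\<phi> (t, x) - \<phi> (t0, x)\<bar> \<le> B * \<bar>t - t0\<bar>" if w: "dist (t, x) (t0, x0) < d" for t x
    proof -
      have in_ball: "dist (s, x) (t0, x0) < d" if "s \<in> closed_segment t0 t" for s
      proof -
        have "\<bar>s - t0\<bar> \<le> \<bar>t - t0\<bar>" using that by (auto simp: closed_segment_eq_real_ivl split: if_splits)
        then have "sqrt ((dist s t0)\<^sup>2 + (dist x x0)\<^sup>2) \<le> sqrt ((dist t t0)\<^sup>2 + (dist x x0)\<^sup>2)"
          by (intro real_sqrt_le_mono add_mono power_mono) (auto simp: dist_real_def)
        then show ?thesis using w unfolding dist_Pair_Pair by linarith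
      qed
      have "norm (\<phi> (t, x) - \<phi> (t0, x)) \<le> B * norm (t - t0)"
      proof (rule field_differentiable_bound[of "closed_segment t0 t" "\<lambda>s. \<phi> (s, x)" "\<lambda>s. \<phi>t (s, x)"])
        fix s assume s: "s \<in> closed_segment t0 t"
        have "(s, x) \<in> U" using d(2)[OF in_ball[OF s]] by simp
        then show "((\<lambda>s. \<phi> (s, x)) has_field_derivative \<phi>t (s, x)) (at s within closed_segment t0 t)"
          using C by (auto simp: C12_on_def intro: has_field_derivative_at_within)
        show "norm (\<phi>t (s, x)) \<le> B" using d(2)[OF in_ball[OF s]] by (simp add: B_def)
      qed auto
      then show ?thesis by simp
    qed
    have "((\<lambda>y. \<phi> (t0, y)) has_derivative (\<lambda>h. G (t0, x0) \<bullet> h)) (at x0)"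
      using C z0 by (auto simp: C12_on_def)
    then have "isCont (\<lambda>y. \<phi> (t0, y)) x0" by (rule has_derivative_continuous)
    then have 1: "((\<lambda>w. \<phi> (t0, snd w)) \<longlongrightarrow> \<phi> (t0, x0)) (at (t0, x0))"
      by (rule isCont_tendsto_compose) (auto intro!: tendsto_eq_intros)
    have "((\<lambda>w. B * \<bar>fst w - t0\<bar>) \<longlongrightarrow> B * \<bar>t0 - t0\<bar>) (at (t0, x0))"
      by (auto intro!: tendsto_eq_intros)
    then have 2: "((\<lambda>w. B * \<bar>fst w - t0\<bar>) \<longlongrightarrow> 0) (at (t0, x0))" by simp
    have "\<forall>\<^sub>F w in at (t0, x0). norm (\<phi> w - \<phi> (t0, snd w)) \<le> B * \<bar>fst w - t0\<bar>"
      unfolding eventually_at using d(1) lip by (intro exI[of _ d]) auto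
    from Lim_null_comparison[OF this 2] have "((\<lambda>w. \<phi> w - \<phi> (t0, snd w)) \<longlongrightarrow> 0) (at (t0, x0))" .
    from tendsto_add[OF this 1] show ?thesis by (simp add: isCont_def)
  qed
  moreover have "open U" using C by (simp add: C12_on_def)
  ultimately show ?thesis by (auto simp: continuous_on_eq_continuous_at)
qed

section \<open>Viscosity sub- and supersolutions\<close>

text \<open>
  The nonlinearity of the equation satisfied by \<open>- v\<close> when \<open>v\<close> solves the equation for \<open>F\<close>. It turns
  every assertion on supersolutions into one on subsolutions.
\<close>

definition dual_nonlinearity :: "'n::finite nonlinearity \<Rightarrow> 'n nonlinearity" where
  "dual_nonlinearity F t x r p X = - F t x (- r) (- p) (- X)"

lemma C12_on_uminus:
  assumes "C12_on U \<phi> \<phi>t G H"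
  shows "C12_on U (\<lambda>w. - \<phi> w) (\<lambda>w. - \<phi>t w) (\<lambda>w. - G w) (\<lambda>w. - H w)"
proof -
  have neg: "(- A) *v h = - (A *v h)" for A :: "real ^ 'n ^ 'n" and h
    using matrix_vector_mult_diff_rdistrib[of 0 A h] by simp
  show ?thesis
    unfolding C12_on_def
  proof (intro conjI ballI)
    fix w assume "w \<in> U"
    moreover obtain t x where w: "w = (t, x)" by (cases w)
    ultimately have d: "((\<lambda>s. \<phi> (s, x)) has_real_derivative \<phi>t (t, x)) (at t)"
      "((\<lambda>y. \<phi> (t, y)) has_derivative (\<lambda>h. G (t, x) \<bullet> h)) (at x)"
      "((\<lambda>y. G (t, y)) has_derivative (\<lambda>h. H (t, x) *v h)) (at x)"
      using assms by (auto simp: C12_on_def)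
    have e1: "((\<lambda>s. - \<phi> (s, x)) has_real_derivative - \<phi>t (t, x)) (at t)"
      using d(1) by (rule DERIV_minus)
    have e2: "((\<lambda>y. - \<phi> (t, y)) has_derivative (\<lambda>h. (- G (t, x)) \<bullet> h)) (at x)"
      using has_derivative_minus[OF d(2)] by simp
    have e3: "((\<lambda>y. - G (t, y)) has_derivative (\<lambda>h. (- H (t, x)) *v h)) (at x)"
      using has_derivative_minus[OF d(3)] by (simp add: neg)
    show "case w of (t, x) \<Rightarrow> ((\<lambda>s. - \<phi> (s, x)) has_real_derivative - \<phi>t (t, x)) (at t) \<and>
        ((\<lambda>y. - \<phi> (t, y)) has_derivative (\<bullet>) (- G (t, x))) (at x) \<and>
        ((\<lambda>y. - G (t, y)) has_derivative (*v) (- H (t, x))) (at x)"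
      by (simp only: w prod.case) (intro conjI e1 e2 e3)
  qed (use assms in \<open>auto simp: C12_on_def intro!: continuous_intros\<close>)
qed

lemma usc_on_uminus_iff: "usc_on D (\<lambda>w. - v w) \<longleftrightarrow> lsc_on D v"
proof
  assume u: "usc_on D (\<lambda>w. - v w)"
  show "lsc_on D v"
    unfolding lsc_on_def
  proof (intro ballI allI impI)
    fix z a assume "z \<in> D" "a < v z"
    then have "\<forall>\<^sub>F w in at z within D. - v w < - a"
      using u[unfolded usc_on_def, rule_format, of z "- a"] by simp
    then show "\<forall>\<^sub>F w in at z within D. a < v w" by simp
  qed
next
  assume l: "lsc_on D v"
  show "usc_on D (\<lambda>w. - v w)"
    unfolding usc_on_def
  proof (intro ballI allI impI)
    fix z a assume "z \<in> D" "- v z < a"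
    then have "\<forall>\<^sub>F w in at z within D. - a < v w"
      using l[unfolded lsc_on_def, rule_format, of z "- a"] by simp
    then show "\<forall>\<^sub>F w in at z within D. - v w < a" by eventually_elim simp
  qed
qed

lemma viscosity_supersolution_iff_dual:
  "viscosity_supersolution F D v \<longleftrightarrow> viscosity_subsolution (dual_nonlinearity F) D (\<lambda>w. - v w)"
proof
  assume v: "viscosity_supersolution F D v"
  show "viscosity_subsolution (dual_nonlinearity F) D (\<lambda>w. - v w)"
    unfolding viscosity_subsolution_def
  proof (intro conjI ballI, goal_cases)
    case 1
    then show ?case using v by (simp add: viscosity_supersolution_def usc_on_uminus_iff)
  next
    case (2 w)
    obtain t x where w: "w = (t, x)" by (cases w)
    show ?case unfolding w prod.case
    proof (intro allI impI)
      fix U \<phi> \<phi>t G H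
      assume h: "(t, x) \<in> U \<and> C12_on U \<phi> \<phi>t G H \<and>
        (\<forall>\<^sub>F w in at (t, x) within D. - v w - \<phi> w \<le> - v (t, x) - \<phi> (t, x))"
      have "\<forall>\<^sub>F w in at (t, x) within D. v w - (- \<phi> w) \<ge> v (t, x) - (- \<phi> (t, x))"
        using h by (simp add: algebra_simps)
      then have "- \<phi>t (t, x) - F t x (v (t, x)) (- G (t, x)) (- H (t, x)) \<ge> 0"
        using v 2 h C12_on_uminus[of U \<phi> \<phi>t G H] unfolding viscosity_supersolution_def w by blast
      then show "\<phi>t (t, x) - dual_nonlinearity F t x (- v (t, x)) (G (t, x)) (H (t, x)) \<le> 0"
        by (simp add: dual_nonlinearity_def)
    qed
  qed
next
  assume v: "viscosity_subsolution (dual_nonlinearity F) D (\<lambda>w. - v w)"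
  show "viscosity_supersolution F D v"
    unfolding viscosity_supersolution_def
  proof (intro conjI ballI, goal_cases)
    case 1
    then show ?case using v by (simp add: viscosity_subsolution_def usc_on_uminus_iff)
  next
    case (2 w)
    obtain t x where w: "w = (t, x)" by (cases w)
    show ?case unfolding w prod.case
    proof (intro allI impI)
      fix U \<phi> \<phi>t G H
      assume h: "(t, x) \<in> U \<and> C12_on U \<phi> \<phi>t G H \<and>
        (\<forall>\<^sub>F w in at (t, x) within D. v w - \<phi> w \<ge> v (t, x) - \<phi> (t, x))"
      have "\<forall>\<^sub>F w in at (t, x) within D. - v w - (- \<phi> w) \<le> - v (t, x) - (- \<phi> (t, x))"
        using h by (simp add: algebra_simps)
      then have "- \<phi>t (t, x) - dual_nonlinearity F t x (- v (t, x)) (- G (t, x)) (- H (t, x)) \<le> 0"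
        using v 2 h C12_on_uminus[of U \<phi> \<phi>t G H] unfolding viscosity_subsolution_def w by blast
      then show "\<phi>t (t, x) - F t x (v (t, x)) (G (t, x)) (H (t, x)) \<ge> 0"
        by (simp add: dual_nonlinearity_def)
    qed
  qed
qed

lemma dual_nonlinearity_continuous:
  assumes "continuous_on ({0..T} \<times> UNIV \<times> UNIV \<times> UNIV \<times> sym_matrices) (\<lambda>(t, x, u, p, X). F t x u p X)"
  shows "continuous_on ({0..T} \<times> UNIV \<times> UNIV \<times> UNIV \<times> sym_matrices)
    (\<lambda>(t, x, u, p, X). dual_nonlinearity F t x u p X)"
proof -
  let ?h = "\<lambda>w. (fst w, fst (snd w), - fst (snd (snd w)), - fst (snd (snd (snd w))), - snd (snd (snd (snd w))))"
  have "continuous_on ({0..T} \<times> UNIV \<times> UNIV \<times> UNIV \<times> sym_matrices)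
      (\<lambda>w. (\<lambda>(t, x, u, p, X). F t x u p X) (?h w))"
    by (rule continuous_on_compose2[OF assms])
      (auto intro!: continuous_intros simp: sym_matrices_def transpose_def vec_eq_iff)
  from continuous_on_minus[OF this] show ?thesis
    by (simp add: case_prod_unfold dual_nonlinearity_def)
qed

text \<open>
  The exponential factor turns the one-sided bound of the nonlinearity in \<open>u\<close> into strict
  monotonicity later on; it is carried by the test function, so that the equation itself need not
  be transformed.
\<close>

lemma subsolution_quadratic_touching:
  fixes u :: "real \<times> (real ^ 'n) \<Rightarrow> real"
  assumes u: "viscosity_subsolution F D u" and z0: "(t0, x0) \<in> D" and X: "X \<in> sym_matrices"
    and U0: "U0 = exp (- (l * t0)) * u (t0, x0)"
    and touch: "\<forall>\<^sub>F w in at (t0, x0) within D. exp (- (l * fst w)) * u w \<le> U0 + a * (fst w - t0) + b * (fst w - t0)\<^sup>2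
      + p \<bullet> (snd w - x0) + 1 / 2 * ((snd w - x0) \<bullet> (X *v (snd w - x0)))"
  shows "a + l * U0 \<le> exp (- (l * t0)) * F t0 x0 (u (t0, x0)) (exp (l * t0) *\<^sub>R p) (exp (l * t0) *\<^sub>R X)"
proof -
  define Q where "Q t x = U0 + a * (t - t0) + b * (t - t0)\<^sup>2 + p \<bullet> (x - x0) + 1 / 2 * ((x - x0) \<bullet> (X *v (x - x0)))" for t x
  define \<phi> where "\<phi> w = exp (l * fst w) * Q (fst w) (snd w)" for w
  define \<phi>t where "\<phi>t w = exp (l * fst w) * (l * Q (fst w) (snd w) + a + 2 * b * (fst w - t0))" for w
  define G where "G w = exp (l * fst w) *\<^sub>R (p + X *v (snd w - x0))" for w :: "real \<times> (real ^ 'n)"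
  define H where "H w = exp (l * fst w) *\<^sub>R X" for w :: "real \<times> (real ^ 'n)"
  have mv: "bounded_linear ((*v) X)" by (rule matrix_vector_mul_bounded_linear)
  note mvd = bounded_linear.has_derivative[OF mv]
  note mvc = bounded_linear.continuous_on[OF mv]
  have C: "C12_on UNIV \<phi> \<phi>t G H"
    unfolding C12_on_def
  proof (intro conjI ballI open_UNIV)
    show "continuous_on UNIV \<phi>t" "continuous_on UNIV G" "continuous_on UNIV H"
      unfolding \<phi>t_def G_def H_def Q_def by (intro continuous_intros mvc)+
    fix w :: "real \<times> (real ^ 'n)"
    obtain t x where w: "w = (t, x)" by (cases w)
    have 1: "((\<lambda>s. \<phi> (s, x)) has_real_derivative \<phi>t (t, x)) (at t)"
      unfolding \<phi>_def \<phi>t_def Q_def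
      by (auto intro!: derivative_eq_intros simp: algebra_simps)
    have "((\<lambda>y. \<phi> (t, y)) has_derivative (\<lambda>h. exp (l * t) * (p \<bullet> h + 1 / 2 * ((x - x0) \<bullet> (X *v h) + h \<bullet> (X *v (x - x0)))))) (at x)"
      unfolding \<phi>_def Q_def fst_conv snd_conv
      by (rule has_derivative_eq_rhs, (rule derivative_intros mvd)+) (auto simp: algebra_simps)
    then have 2: "((\<lambda>y. \<phi> (t, y)) has_derivative (\<lambda>h. G (t, x) \<bullet> h)) (at x)"
      by (rule has_derivative_eq_rhs)
        (auto simp: G_def inner_simps sym_matrix_inner[OF X] inner_commute[of _ "X *v (x - x0)"])
    have "((\<lambda>y. G (t, y)) has_derivative (\<lambda>h. exp (l * t) *\<^sub>R (X *v h))) (at x)"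
      unfolding G_def fst_conv snd_conv
      by (rule has_derivative_eq_rhs, (rule derivative_intros mvd)+) auto
    then have 3: "((\<lambda>y. G (t, y)) has_derivative (\<lambda>h. H (t, x) *v h)) (at x)"
      by (simp add: H_def scaleR_matrix_vector_assoc)
    from 1 2 3 show "case w of (t, x) \<Rightarrow> ((\<lambda>s. \<phi> (s, x)) has_real_derivative \<phi>t (t, x)) (at t) \<and>
        ((\<lambda>y. \<phi> (t, y)) has_derivative (\<bullet>) (G (t, x))) (at x) \<and>
        ((\<lambda>y. G (t, y)) has_derivative (*v) (H (t, x))) (at x)"
      by (simp add: w)
  qed
  have ex: "exp (l * t) * (exp (- (l * t)) * c) = c" for t c
    by (simp add: exp_minus field_simps)
  have \<phi>0: "\<phi> (t0, x0) = u (t0, x0)" by (simp add: \<phi>_def Q_def U0 ex)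
  have "\<forall>\<^sub>F w in at (t0, x0) within D. u w - \<phi> w \<le> u (t0, x0) - \<phi> (t0, x0)"
    using touch
  proof eventually_elim
    case (elim w)
    then have "exp (l * fst w) * (exp (- (l * fst w)) * u w) \<le> \<phi> w"
      unfolding \<phi>_def Q_def by (intro mult_left_mono) auto
    then show ?case by (simp add: \<phi>0 ex)
  qed
  then have "\<phi>t (t0, x0) - F t0 x0 (u (t0, x0)) (G (t0, x0)) (H (t0, x0)) \<le> 0"
    using u z0 C unfolding viscosity_subsolution_def by blast
  then have "exp (l * t0) * (a + l * U0) \<le> F t0 x0 (u (t0, x0)) (exp (l * t0) *\<^sub>R p) (exp (l * t0) *\<^sub>R X)"
    by (simp add: \<phi>t_def G_def H_def Q_def algebra_simps)
  then have "exp (- (l * t0)) * (exp (l * t0) * (a + l * U0))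
      \<le> exp (- (l * t0)) * F t0 x0 (u (t0, x0)) (exp (l * t0) *\<^sub>R p) (exp (l * t0) *\<^sub>R X)"
    by (intro mult_left_mono) auto
  moreover have "exp (- (l * t0)) * (exp (l * t0) * (a + l * U0)) = a + l * U0"
    using ex[of "- t0"] by simp
  ultimately show ?thesis by simp
qed

section \<open>The equation at the terminal time\<close>

lemma Limsup_eventually_less:
  assumes "ereal l = Limsup F (\<lambda>w. ereal (u w))" "l < a"
  shows "\<forall>\<^sub>F w in F. u w < a"
proof -
  have "Limsup F (\<lambda>w. ereal (u w)) < ereal a" using assms(2) by (simp add: assms(1)[symmetric])
  then have "\<forall>\<^sub>F w in F. ereal (u w) < ereal a" by (rule Limsup_lessD)
  then show ?thesis by simp
qed

lemma Limsup_frequently_greater: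
  assumes "ereal l = Limsup F (\<lambda>w. ereal (u w))" "a < l"
  shows "\<exists>\<^sub>F w in F. a < u w"
proof (rule ccontr)
  assume "\<not> ?thesis"
  then have "\<forall>\<^sub>F w in F. ereal (u w) \<le> ereal a" by (simp add: not_frequently not_less)
  then have "Limsup F (\<lambda>w. ereal (u w)) \<le> ereal a" by (rule Limsup_bounded)
  then show False using assms(2) by (simp add: assms(1)[symmetric])
qed

text \<open>
  Every value at time \<open>T\<close> is approximated by values at earlier times nearby, so that a strict upper
  bound on the earlier part of a neighbourhood extends weakly to its terminal part.
\<close>

lemma usc_on_terminal_extension:
  fixes u :: "real \<times> 'a::metric_space \<Rightarrow> real"
  assumes u: "usc_on ({0..<T} \<times> UNIV) u"
    and lim: "\<And>x. ereal (u (T, x)) = Limsup (at (T, x) within {0..<T} \<times> UNIV) (\<lambda>w. ereal (u w))"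
  shows "usc_on ({0..T} \<times> UNIV) u"
proof (rule usc_onI)
  fix z :: "real \<times> 'a" and a assume z: "z \<in> {0..T} \<times> UNIV" "u z < a"
  show "\<exists>S. open S \<and> z \<in> S \<and> (\<forall>w\<in>S \<inter> ({0..T} \<times> UNIV). u w < a)"
  proof (cases "fst z < T")
    case True
    then have "z \<in> {0..<T} \<times> UNIV" using z(1) by auto
    then obtain S where S: "open S" "z \<in> S" "\<And>w. w \<in> S \<Longrightarrow> w \<in> {0..<T} \<times> UNIV \<Longrightarrow> u w < a"
      using usc_onD[OF u, of z a] z(2) by blast
    have "open {w :: real \<times> 'a. fst w < T}" by (intro open_Collect_less continuous_intros)
    then show ?thesis
      using S True by (intro exI[of _ "S \<inter> {w. fst w < T}"]) (auto simp: open_Int)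
  next
    case False
    then obtain x where zx: "z = (T, x)" using z(1) by (cases z) auto
    obtain b where b: "u z < b" "b < a" using z(2) dense by blast
    have "\<forall>\<^sub>F w in at (T, x) within {0..<T} \<times> UNIV. u w < b"
      using lim b(1) unfolding zx by (rule Limsup_eventually_less)
    then obtain S where S: "open S" "z \<in> S" "\<And>w. w \<in> S \<Longrightarrow> w \<noteq> z \<Longrightarrow> w \<in> {0..<T} \<times> UNIV \<Longrightarrow> u w < b"
      unfolding zx eventually_at_topological by blast
    have "u w < a" if w: "w \<in> S" "w \<in> {0..T} \<times> UNIV" for w
    proof (cases "fst w < T")
      case True
      then have "u w < b" using w zx by (intro S(3)) auto
      then show ?thesis using b(2) by simp
    next
      case False
      then obtain y where wy: "w = (T, y)" using w(2) by (cases w) auto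
      have "\<not> b < u (T, y)"
      proof
        assume "b < u (T, y)"
        then have "\<exists>\<^sub>F v in at (T, y) within {0..<T} \<times> UNIV. b < u v"
          using lim by (rule Limsup_frequently_greater[rotated])
        moreover have "\<forall>\<^sub>F v in at (T, y) within {0..<T} \<times> UNIV. v \<in> S \<and> v \<in> {0..<T} \<times> UNIV"
          unfolding eventually_at_topological using S(1) w(1) wy by blast
        ultimately have "\<exists>\<^sub>F v in at (T, y) within {0..<T} \<times> UNIV. b < u v \<and> v \<in> S \<and> v \<in> {0..<T} \<times> UNIV"
          by (rule frequently_eventually_frequently)
        then obtain v where "b < u v" "v \<in> S" "v \<in> {0..<T} \<times> UNIV" using frequently_ex by blast
        then show False using S(3)[of v] zx by force
      qed
      then show ?thesis using b(2) wy by simp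
    qed
    then show ?thesis using S(1,2) by blast
  qed
qed

text \<open>
  Close to the terminal time the barrier pushes the function below its value at \<open>w1\<close>, so that the
  maximum is taken over a compact cylinder.
\<close>

lemma barrier_max_attained:
  fixes f :: "real \<times> 'a::metric_space \<Rightarrow> real"
  assumes f: "usc_on ({r..<T} \<times> B) f" and B: "compact B" and m: "\<And>w. w \<in> {r..<T} \<times> B \<Longrightarrow> f w \<le> m"
    and \<eta>: "\<eta> > 0" and w1: "w1 \<in> {r..<T} \<times> B"
  shows "\<exists>w\<in>{r..<T} \<times> B. \<forall>w'\<in>{r..<T} \<times> B. f w' - \<eta> / (T - fst w') \<le> f w - \<eta> / (T - fst w)"
proof -
  define c where "c = f w1 - \<eta> / (T - fst w1)"
  have T1: "T - fst w1 > 0" using w1 by auto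
  then have "\<eta> / (T - fst w1) > 0" using \<eta> by simp
  then have mc: "m - c > 0" using m[OF w1] by (simp add: c_def)
  define \<tau> where "\<tau> = min (T - fst w1) (\<eta> / (m - c))"
  have \<tau>: "\<tau> > 0" "\<tau> \<le> T - fst w1" "\<tau> \<le> \<eta> / (m - c)" using T1 \<eta> mc by (auto simp: \<tau>_def)
  define K where "K = {r..T - \<tau>} \<times> B"
  have K: "compact K" unfolding K_def using B by (intro compact_Times) auto
  have KN: "K \<subseteq> {r..<T} \<times> B" using \<tau>(1) by (auto simp: K_def)
  have w1K: "w1 \<in> K" using w1 \<tau>(2) by (auto simp: K_def)
  have usc: "usc_on K (\<lambda>w. f w + (- (\<eta> / (T - fst w))))"
    by (rule usc_on_add[OF usc_on_subset[OF f KN] usc_on_continuous])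
      (use \<tau>(1) in \<open>auto intro!: continuous_intros simp: K_def\<close>)
  have "K \<noteq> {}" using w1K by blast
  from usc_on_attains_sup[OF K this usc]
  obtain w where w: "w \<in> K" "\<And>w'. w' \<in> K \<Longrightarrow> f w' - \<eta> / (T - fst w') \<le> f w - \<eta> / (T - fst w)"
    unfolding diff_conv_add_uminus[symmetric] by blast
  have "f w' - \<eta> / (T - fst w') \<le> f w - \<eta> / (T - fst w)" if w': "w' \<in> {r..<T} \<times> B" for w'
  proof (cases "w' \<in> K")
    case False
    then have t: "0 < T - fst w'" "T - fst w' < \<tau>" using w' by (auto simp: K_def)
    then have "(T - fst w') * (m - c) < \<eta> / (m - c) * (m - c)"
      using \<tau>(3) mc by (intro mult_strict_right_mono) auto
    then have "(T - fst w') * (m - c) < \<eta>" using mc by simp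
    then have "m - c < \<eta> / (T - fst w')" using t(1) by (simp add: field_simps)
    then have "f w' - \<eta> / (T - fst w') \<le> c" using m[OF w'] by simp
    also have "c \<le> f w - \<eta> / (T - fst w)" unfolding c_def by (rule w(2)[OF w1K])
    finally show ?thesis .
  qed (rule w(2))
  then show ?thesis using w(1) KN by blast
qed

text \<open>The perturbation of a test function that keeps the maximum away from the terminal time: the
  barrier \<open>\<eta> / (T - t)\<close> contributes a time derivative of the favourable sign.\<close>

lemma C12_on_barrier_perturbation:
  fixes \<phi> :: "real \<times> (real ^ 'n) \<Rightarrow> real"
  assumes C: "C12_on U \<phi> \<phi>t G H"
  shows "C12_on (U \<inter> {w. fst w < T})
    (\<lambda>w. \<phi> w + \<kappa> * ((norm (snd w - x0))\<^sup>2 + (T - fst w)) + \<eta> / (T - fst w))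
    (\<lambda>w. \<phi>t w - \<kappa> + \<eta> / (T - fst w)\<^sup>2)
    (\<lambda>w. G w + (2 * \<kappa>) *\<^sub>R (snd w - x0)) (\<lambda>w. H w + (2 * \<kappa>) *\<^sub>R mat 1)"
  unfolding C12_on_def
proof (intro conjI ballI)
  have "open {w :: real \<times> (real ^ 'n). fst w < T}" by (intro open_Collect_less continuous_intros)
  then show "open (U \<inter> {w. fst w < T})" using C by (auto simp: C12_on_def open_Int)
  have c: "continuous_on (U \<inter> {w. fst w < T}) \<phi>t" "continuous_on (U \<inter> {w. fst w < T}) G"
    "continuous_on (U \<inter> {w. fst w < T}) H"
    using C by (auto simp: C12_on_def intro: continuous_on_subset)
  show "continuous_on (U \<inter> {w. fst w < T}) (\<lambda>w. \<phi>t w - \<kappa> + \<eta> / (T - fst w)\<^sup>2)"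
    by (intro continuous_intros c) auto
  show "continuous_on (U \<inter> {w. fst w < T}) (\<lambda>w. G w + (2 * \<kappa>) *\<^sub>R (snd w - x0))"
    "continuous_on (U \<inter> {w. fst w < T}) (\<lambda>w. H w + (2 * \<kappa>) *\<^sub>R mat 1)"
    by (intro continuous_intros c)+
  fix w assume wU: "w \<in> U \<inter> {w. fst w < T}"
  obtain t x where w: "w = (t, x)" by (cases w)
  have t: "t < T" "(t, x) \<in> U" using wU w by auto
  have d: "((\<lambda>s. \<phi> (s, x)) has_real_derivative \<phi>t (t, x)) (at t)"
    "((\<lambda>y. \<phi> (t, y)) has_derivative (\<lambda>h. G (t, x) \<bullet> h)) (at x)"
    "((\<lambda>y. G (t, y)) has_derivative (\<lambda>h. H (t, x) *v h)) (at x)"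
    using C t(2) by (auto simp: C12_on_def)
  have 1: "((\<lambda>s. \<phi> (s, x) + \<kappa> * ((norm (x - x0))\<^sup>2 + (T - s)) + \<eta> / (T - s))
      has_real_derivative \<phi>t (t, x) - \<kappa> + \<eta> / (T - t)\<^sup>2) (at t)"
    by (rule derivative_eq_intros d refl | use t(1) in \<open>simp add: power2_eq_square\<close>)+
  have "((\<lambda>y. \<phi> (t, y) + \<kappa> * ((y - x0) \<bullet> (y - x0) + (T - t)) + \<eta> / (T - t))
      has_derivative (\<lambda>h. G (t, x) \<bullet> h + \<kappa> * ((x - x0) \<bullet> h + h \<bullet> (x - x0)))) (at x)"
    by (rule has_derivative_eq_rhs, (rule derivative_intros d)+) (auto simp: algebra_simps)
  then have 2: "((\<lambda>y. \<phi> (t, y) + \<kappa> * ((norm (y - x0))\<^sup>2 + (T - t)) + \<eta> / (T - t))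
      has_derivative (\<lambda>h. (G (t, x) + (2 * \<kappa>) *\<^sub>R (x - x0)) \<bullet> h)) (at x)"
    unfolding power2_norm_eq_inner
    by (rule has_derivative_eq_rhs) (auto simp: inner_add_left inner_commute[of _ "x - x0"])
  have "((\<lambda>y. G (t, y) + (2 * \<kappa>) *\<^sub>R (y - x0)) has_derivative (\<lambda>h. H (t, x) *v h + (2 * \<kappa>) *\<^sub>R h)) (at x)"
    by (rule has_derivative_eq_rhs, (rule derivative_intros d)+) auto
  then have 3: "((\<lambda>y. G (t, y) + (2 * \<kappa>) *\<^sub>R (y - x0)) has_derivative (\<lambda>h. (H (t, x) + (2 * \<kappa>) *\<^sub>R mat 1) *v h)) (at x)"
    by (simp add: matrix_vector_mult_add_rdistrib scaleR_matrix_vector_assoc[symmetric])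
  show "case w of (t, x) \<Rightarrow> ((\<lambda>s. \<phi> (s, x) + \<kappa> * ((norm (snd (s, x) - x0))\<^sup>2 + (T - fst (s, x))) + \<eta> / (T - fst (s, x)))
        has_real_derivative \<phi>t (t, x) - \<kappa> + \<eta> / (T - fst (t, x))\<^sup>2) (at t) \<and>
      ((\<lambda>y. \<phi> (t, y) + \<kappa> * ((norm (snd (t, y) - x0))\<^sup>2 + (T - fst (t, y))) + \<eta> / (T - fst (t, y)))
        has_derivative (\<bullet>) (G (t, x) + (2 * \<kappa>) *\<^sub>R (snd (t, x) - x0))) (at x) \<and>
      ((\<lambda>y. G (t, y) + (2 * \<kappa>) *\<^sub>R (snd (t, y) - x0)) has_derivative (*v) (H (t, x) + (2 * \<kappa>) *\<^sub>R mat 1)) (at x)"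
    using 1 2 3 by (simp add: w)
qed

lemma nonlinearity_tendsto:
  assumes F: "continuous_on ({0..T} \<times> UNIV \<times> UNIV \<times> UNIV \<times> sym_matrices) (\<lambda>(t, x, u, p, X). F t x u p X)"
    and lim: "(t \<longlongrightarrow> t0) A" "(x \<longlongrightarrow> x0) A" "(u \<longlongrightarrow> u0) A" "(p \<longlongrightarrow> p0) A" "(X \<longlongrightarrow> X0) A"
    and dom: "t0 \<in> {0..T}" "X0 \<in> sym_matrices"
      "\<forall>\<^sub>F n in A. t n \<in> {0..T}" "\<forall>\<^sub>F n in A. X n \<in> sym_matrices"
  shows "((\<lambda>n. F (t n) (x n) (u n) (p n) (X n)) \<longlongrightarrow> F t0 x0 u0 p0 X0) A"
proof -
  let ?D = "{0..T} \<times> UNIV \<times> UNIV \<times> UNIV \<times> sym_matrices"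
  have "\<forall>\<^sub>F n in A. (t n, x n, u n, p n, X n) \<in> ?D"
    using dom(3,4) by eventually_elim auto
  from continuous_on_tendsto_compose[OF F _ _ this, of "(t0, x0, u0, p0, X0)"]
  show ?thesis using dom(1,2) by (simp add: lim tendsto_Pair)
qed

lemma viscosity_subsolutionD:
  assumes "viscosity_subsolution F D u" "(t, x) \<in> D" "(t, x) \<in> U" "C12_on U \<phi> \<phi>t G H"
    "\<forall>\<^sub>F w in at (t, x) within D. u w - \<phi> w \<le> u (t, x) - \<phi> (t, x)"
  shows "\<phi>t (t, x) - F t x (u (t, x)) (G (t, x)) (H (t, x)) \<le> 0"
  using assms unfolding viscosity_subsolution_def by blast

text \<open>
  A maximum of \<open>u - \<phi>\<close> at the terminal time is approached by maxima at earlier times of the same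
  difference with a barrier subtracted, because the terminal value of \<open>u\<close> is the limit of values at
  earlier times. At the earlier maxima the equation is known, and the barrier drops out of it with
  the right sign.
\<close>

lemma subsolution_up_to_terminal_time:
  fixes u :: "real \<times> (real ^ 'n) \<Rightarrow> real"
  assumes T: "T > 0"
    and F: "continuous_on ({0..T} \<times> UNIV \<times> UNIV \<times> UNIV \<times> sym_matrices) (\<lambda>(t, x, u, p, X). F t x u p X)"
    and usc: "usc_on ({0..<T} \<times> UNIV) u"
    and lim: "\<And>x. ereal (u (T, x)) = Limsup (at (T, x) within {0..<T} \<times> UNIV) (\<lambda>w. ereal (u w))"
    and sub: "viscosity_subsolution F ({0<..<T} \<times> UNIV) u"
  shows "viscosity_subsolution F ({0<..T} \<times> UNIV) u"
  unfolding viscosity_subsolution_def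
proof (intro conjI ballI)
  show "usc_on ({0<..T} \<times> UNIV) u"
    by (rule usc_on_subset[OF usc_on_terminal_extension[OF usc lim]]) auto
  fix z :: "real \<times> (real ^ 'n)" assume z: "z \<in> {0<..T} \<times> UNIV"
  obtain t x0 where tx: "z = (t, x0)" by (cases z)
  show "case z of (t, x) \<Rightarrow> \<forall>U \<phi> \<phi>t G H. (t, x) \<in> U \<and> C12_on U \<phi> \<phi>t G H \<and>
       (\<forall>\<^sub>F w in at (t, x) within {0<..T} \<times> UNIV. u w - \<phi> w \<le> u (t, x) - \<phi> (t, x)) \<longrightarrow>
       \<phi>t (t, x) - F t x (u (t, x)) (G (t, x)) (H (t, x)) \<le> 0"
    unfolding tx prod.case
  proof (intro allI impI, elim conjE)
    fix U \<phi> \<phi>t G H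
    assume U: "(t, x0) \<in> U" and C: "C12_on U \<phi> \<phi>t G H"
      and max: "\<forall>\<^sub>F w in at (t, x0) within {0<..T} \<times> UNIV. u w - \<phi> w \<le> u (t, x0) - \<phi> (t, x0)"
    show "\<phi>t (t, x0) - F t x0 (u (t, x0)) (G (t, x0)) (H (t, x0)) \<le> 0"
    proof (cases "t < T")
      case True
      then have D: "(t, x0) \<in> {0<..<T} \<times> UNIV" using z tx by auto
      have sb: "({0<..<T} \<times> UNIV :: (real \<times> (real ^ 'n)) set) \<subseteq> {0<..T} \<times> UNIV" by auto
      have "\<forall>\<^sub>F w in at (t, x0) within {0<..<T} \<times> UNIV. u w - \<phi> w \<le> u (t, x0) - \<phi> (t, x0)"
        by (rule filter_leD[OF at_le[OF sb] max])
      then show ?thesis using sub D U C unfolding viscosity_subsolution_def by blast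
    next
      case False
      then have t: "t = T" using z tx by auto
      define m where "m = u (T, x0) - \<phi> (T, x0)"
      have opU: "open U" and cont: "continuous_on U \<phi>t" "continuous_on U G" "continuous_on U H" "continuous_on U \<phi>"
        using C C12_continuous[OF C] by (auto simp: C12_on_def)
      have TU: "(T, x0) \<in> U" using U t by simp
      have limU: "(\<lambda>j. g (y j)) \<longlonglongrightarrow> g (T, x0)" if g: "continuous_on U g" and y: "y \<longlonglongrightarrow> (T, x0)"
        for g :: "real \<times> (real ^ 'n) \<Rightarrow> 'b::topological_space" and y
      proof -
        have "isCont g (T, x0)" using g TU by (simp add: continuous_on_eq_continuous_at[OF opU])
        then show ?thesis using y by (rule isCont_tendsto_compose)
      qed
      obtain d1 where d1: "d1 > 0" "\<And>w. w \<in> {0<..T} \<times> UNIV \<Longrightarrow> w \<noteq> (T, x0) \<Longrightarrow> dist w (T, x0) < d1 \<Longrightarrow> u w - \<phi> w \<le> m"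
        using max unfolding t eventually_at m_def by blast
      obtain d2 where d2: "d2 > 0" "\<And>w. dist w (T, x0) < d2 \<Longrightarrow> w \<in> U"
        using opU TU unfolding open_dist by blast
      define \<rho> where "\<rho> = min (min d1 d2) T / 4"
      have \<rho>: "\<rho> > 0" "2 * \<rho> < d1" "2 * \<rho> < d2" "\<rho> < T"
        using d1(1) d2(1) T by (auto simp: \<rho>_def min_def)
      define N where "N = {T - \<rho>..<T} \<times> cball x0 \<rho>"
      have N: "w \<in> U" "u w - \<phi> w \<le> m" "w \<in> {0<..<T} \<times> UNIV" "fst w < T" if "w \<in> N" for w
      proof -
        obtain s y where w: "w = (s, y)" by (cases w)
        have sy: "T - \<rho> \<le> s" "s < T" "dist x0 y \<le> \<rho>" using that by (auto simp: N_def w)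
        have "dist w (T, x0) \<le> dist s T + dist y x0"
          unfolding w dist_Pair_Pair by (intro sqrt_sum_squares_le_sum) auto
        also have "\<dots> \<le> 2 * \<rho>" using sy by (simp add: dist_real_def dist_commute)
        finally have d: "dist w (T, x0) \<le> 2 * \<rho>" .
        show "w \<in> U" using d d2(2) \<rho>(3) by simp
        show "w \<in> {0<..<T} \<times> UNIV" "fst w < T" using sy \<rho>(4) by (auto simp: w)
        show "u w - \<phi> w \<le> m" using d \<rho> sy by (intro d1(2)) (auto simp: w)
      qed
      have key: "\<phi>t (T, x0) - \<kappa> \<le> F T x0 (u (T, x0)) (G (T, x0)) (H (T, x0) + (2 * \<kappa>) *\<^sub>R mat 1)"
        if \<kappa>: "\<kappa> > 0" for \<kappa>
      proof -
        (* The term with \<kappa> makes the maximum at (T, x0) strict, so that nearby maxima converge to it. *)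
        define f where "f w = u w + (- \<phi> w - \<kappa> * ((norm (snd w - x0))\<^sup>2 + (T - fst w)))" for w
        have fm: "f w \<le> m - \<kappa> * ((norm (snd w - x0))\<^sup>2 + (T - fst w))" if "w \<in> N" for w
          using N(2)[OF that] by (simp add: f_def)
        have pen: "\<kappa> * ((norm (snd w - x0))\<^sup>2 + (T - fst w)) \<ge> 0" if "w \<in> N" for w
          using N(4)[OF that] \<kappa> by simp
        have uf: "usc_on N f"
          unfolding f_def
        proof (rule usc_on_add[OF usc_on_subset[OF usc] usc_on_continuous])
          show "N \<subseteq> {0..<T} \<times> UNIV" using \<rho>(4) by (auto simp: N_def)
          show "continuous_on N (\<lambda>w. - \<phi> w - \<kappa> * ((norm (snd w - x0))\<^sup>2 + (T - fst w)))"
            by (intro continuous_intros continuous_on_subset[OF cont(4)]) (use N(1) in blast)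
        qed
        have "\<exists>w. w \<in> {0..<T} \<times> UNIV \<and> dist w (T, x0) < \<rho> / Suc j \<and> u (T, x0) - 1 / Suc j < u w" for j
        proof -
          have "\<exists>\<^sub>F w in at (T, x0) within {0..<T} \<times> UNIV. u (T, x0) - 1 / Suc j < u w"
            using lim by (rule Limsup_frequently_greater) simp
          moreover have "\<forall>\<^sub>F w in at (T, x0) within {0..<T} \<times> UNIV.
              w \<in> {0..<T} \<times> UNIV \<and> dist w (T, x0) < \<rho> / Suc j"
            unfolding eventually_at using \<rho>(1) by (intro exI[of _ "\<rho> / Suc j"]) auto
          ultimately have "\<exists>\<^sub>F w in at (T, x0) within {0..<T} \<times> UNIV. u (T, x0) - 1 / Suc j < u w \<and>
              w \<in> {0..<T} \<times> UNIV \<and> dist w (T, x0) < \<rho> / Suc j"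
            by (rule frequently_eventually_frequently)
          then show ?thesis using frequently_ex by blast
        qed
        then obtain w where w: "\<And>j. w j \<in> {0..<T} \<times> UNIV" "\<And>j. dist (w j) (T, x0) < \<rho> / Suc j"
          "\<And>j. u (T, x0) - 1 / Suc j < u (w j)" by metis
        have \<rho>lim: "(\<lambda>j. \<rho> / Suc j) \<longlonglongrightarrow> 0" using LIMSEQ_Suc[OF lim_const_over_n[of \<rho>]] by simp
        have "(\<lambda>j. dist (w j) (T, x0)) \<longlonglongrightarrow> 0"
          by (rule tendsto_sandwich[OF _ _ tendsto_const \<rho>lim])
            (auto intro!: always_eventually less_imp_le[OF w(2)] simp del: of_nat_Suc)
        then have wlim: "w \<longlonglongrightarrow> (T, x0)" by (simp add: tendsto_dist_iff[of w])
        have wN: "w j \<in> N" for j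
        proof -
          have "\<rho> / Suc j \<le> \<rho> / 1" using \<rho>(1) by (intro divide_left_mono) auto
          then have "dist (w j) (T, x0) < \<rho>" using w(2)[of j] by simp
          moreover have "dist (fst (w j)) T \<le> dist (w j) (T, x0)" "dist (snd (w j)) x0 \<le> dist (w j) (T, x0)"
            using dist_fst_le[of "w j" "(T, x0)"] dist_snd_le[of "w j" "(T, x0)"] by auto
          ultimately show ?thesis using w(1)[of j] by (auto simp: N_def mem_Times_iff dist_real_def dist_commute)
        qed
        (* With this size the barrier lowers the value at the comparison point w j by 1 / (j + 1) only. *)
        define \<eta> where "\<eta> j = (T - fst (w j)) / Suc j" for j
        have \<eta>: "\<eta> j > 0" for j using N(4)[OF wN] by (simp add: \<eta>_def)
        have "\<exists>v\<in>N. \<forall>w'\<in>N. f w' - \<eta> j / (T - fst w') \<le> f v - \<eta> j / (T - fst v)" for j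
          unfolding N_def
        proof (rule barrier_max_attained[OF _ compact_cball])
          show "usc_on ({T - \<rho>..<T} \<times> cball x0 \<rho>) f" using uf by (simp add: N_def)
          show "f w \<le> m" if "w \<in> {T - \<rho>..<T} \<times> cball x0 \<rho>" for w
            using fm[of w] pen[of w] that unfolding N_def by linarith
          show "w j \<in> {T - \<rho>..<T} \<times> cball x0 \<rho>" using wN by (simp add: N_def)
        qed (rule \<eta>)
        then obtain v where v: "\<And>j. v j \<in> N"
          "\<And>j w'. w' \<in> N \<Longrightarrow> f w' - \<eta> j / (T - fst w') \<le> f (v j) - \<eta> j / (T - fst (v j))" by metis
        define b where "b j = u (T, x0) - 1 / Suc j - \<phi> (w j)
          - \<kappa> * ((norm (snd (w j) - x0))\<^sup>2 + (T - fst (w j))) - 1 / Suc j" for j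
        have one: "(\<lambda>j. 1 / real (Suc j)) \<longlonglongrightarrow> 0" by (rule LIMSEQ_Suc[OF lim_1_over_n])
        have "b \<longlonglongrightarrow> u (T, x0) - 0 - \<phi> (T, x0) - \<kappa> * ((norm (snd (T, x0) - x0))\<^sup>2 + (T - fst (T, x0))) - 0"
          unfolding b_def by (intro tendsto_intros one limU[OF cont(4) wlim] wlim)
        then have blim: "b \<longlonglongrightarrow> m" by (simp add: m_def)
        have fb: "f (v j) \<ge> b j" for j
        proof -
          have "\<eta> j / (T - fst (w j)) = 1 / Suc j" using N(4)[OF wN, of j] by (simp add: \<eta>_def)
          then have "b j \<le> f (w j) - \<eta> j / (T - fst (w j))" using w(3)[of j] by (simp add: b_def f_def)
          also have "\<dots> \<le> f (v j) - \<eta> j / (T - fst (v j))" by (rule v(2)[OF wN])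
          also have "\<dots> \<le> f (v j)" using \<eta>[of j] N(4)[OF v(1), of j] by simp
          finally show ?thesis .
        qed
        have sq: "(norm (snd (v j) - x0))\<^sup>2 + (T - fst (v j)) \<le> (m - b j) / \<kappa>" for j
          using fm[OF v(1), of j] fb[of j] \<kappa> by (simp add: pos_le_divide_eq mult.commute)
        have "(\<lambda>j. (m - b j) / \<kappa>) \<longlonglongrightarrow> (m - m) / \<kappa>" by (intro tendsto_intros blim) (use \<kappa> in simp)
        then have mb: "(\<lambda>j. (m - b j) / \<kappa>) \<longlonglongrightarrow> 0" by simp
        have sp: "(norm (snd (v j) - x0))\<^sup>2 \<le> (m - b j) / \<kappa>" "T - fst (v j) \<le> (m - b j) / \<kappa>" for j
          using sq[of j] N(4)[OF v(1), of j] zero_le_power2[of "norm (snd (v j) - x0)"] by linarith+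
        have "(\<lambda>j. (norm (snd (v j) - x0))\<^sup>2) \<longlonglongrightarrow> 0"
          by (rule tendsto_sandwich[OF _ _ tendsto_const mb]) (auto intro!: always_eventually sp)
        then have "(\<lambda>j. sqrt ((norm (snd (v j) - x0))\<^sup>2)) \<longlonglongrightarrow> sqrt 0" by (rule tendsto_real_sqrt)
        then have "(\<lambda>j. norm (snd (v j) - x0)) \<longlonglongrightarrow> 0" by simp
        then have "(\<lambda>j. snd (v j) - x0) \<longlonglongrightarrow> 0" by (rule tendsto_norm_zero_cancel)
        then have v2: "(\<lambda>j. snd (v j)) \<longlonglongrightarrow> x0" by (rule LIM_zero_cancel)
        have "(\<lambda>j. T - fst (v j)) \<longlonglongrightarrow> 0"
          by (rule tendsto_sandwich[OF _ _ tendsto_const mb])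
            (use N(4)[OF v(1)] in \<open>auto intro!: always_eventually sp simp: less_imp_le\<close>)
        from tendsto_diff[OF tendsto_const this, of T] have v1: "(\<lambda>j. fst (v j)) \<longlonglongrightarrow> T" by simp
        have vlim: "v \<longlonglongrightarrow> (T, x0)" using tendsto_Pair[OF v1 v2] by simp
        have philim: "(\<lambda>j. \<phi> (v j)) \<longlonglongrightarrow> \<phi> (T, x0)" by (rule limU[OF cont(4) vlim])
        have ulim: "(\<lambda>j. u (v j)) \<longlonglongrightarrow> u (T, x0)"
        proof (rule tendsto_sandwich)
          show "\<forall>\<^sub>F j in sequentially. b j + \<phi> (v j) \<le> u (v j)"
          proof (intro always_eventually allI)
            fix j
            show "b j + \<phi> (v j) \<le> u (v j)" using fb[of j] pen[OF v(1), of j] by (simp add: f_def)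
          qed
          show "\<forall>\<^sub>F j in sequentially. u (v j) \<le> m + \<phi> (v j)"
            using N(2)[OF v(1)] by (intro always_eventually allI) (simp add: algebra_simps)
          show "(\<lambda>j. b j + \<phi> (v j)) \<longlonglongrightarrow> u (T, x0)" "(\<lambda>j. m + \<phi> (v j)) \<longlonglongrightarrow> u (T, x0)"
            using tendsto_add[OF blim philim] tendsto_add[OF tendsto_const philim, of m] by (simp_all add: m_def)
        qed
        let ?G = "\<lambda>w. G w + (2 * \<kappa>) *\<^sub>R (snd w - x0)" and ?H = "\<lambda>w. H w + (2 * \<kappa>) *\<^sub>R mat 1"
        let ?O = "{T - \<rho><..<T} \<times> ball x0 \<rho>"
        have pde: "\<phi>t (v j) - \<kappa> \<le> F (fst (v j)) (snd (v j)) (u (v j)) (?G (v j)) (?H (v j))"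
          if vj: "v j \<in> ?O" for j
        proof -
          obtain s y where sy: "v j = (s, y)" by (cases "v j")
          let ?\<psi> = "\<lambda>w. \<phi> w + \<kappa> * ((norm (snd w - x0))\<^sup>2 + (T - fst w)) + \<eta> j / (T - fst w)"
          have "open ?O" by (intro open_Times) auto
          then have "\<forall>\<^sub>F w in at (v j) within {0<..<T} \<times> UNIV. w \<in> ?O"
            using vj by (meson eventually_at_topological)
          then have "\<forall>\<^sub>F w in at (v j) within {0<..<T} \<times> UNIV. u w - ?\<psi> w \<le> u (v j) - ?\<psi> (v j)"
          proof eventually_elim
            case (elim w)
            then have "w \<in> N" by (auto simp: N_def)
            from v(2)[OF this, of j] show ?case by (simp add: f_def)
          qed
          moreover have "v j \<in> U \<inter> {w. fst w < T}" using N(1,4)[OF v(1)] by simp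
          ultimately have "(\<phi>t (s, y) - \<kappa> + \<eta> j / (T - fst (s, y))\<^sup>2) - F s y (u (s, y)) (?G (s, y)) (?H (s, y)) \<le> 0"
            using N(3)[OF v(1)[of j]] unfolding sy
            by (intro viscosity_subsolutionD[OF sub _ _ C12_on_barrier_perturbation[OF C]])
          moreover have "\<eta> j / (T - fst (v j))\<^sup>2 \<ge> 0" using \<eta>[of j] by simp
          ultimately show ?thesis unfolding sy fst_conv snd_conv by linarith
        qed
        have ev: "\<forall>\<^sub>F j in sequentially. v j \<in> ?O"
        proof -
          have "\<forall>\<^sub>F j in sequentially. T - \<rho> < fst (v j)" using v1 \<rho>(1) by (intro order_tendstoD(1)[OF v1]) simp
          moreover have "\<forall>\<^sub>F j in sequentially. dist (snd (v j)) x0 < \<rho>" using v2 \<rho>(1) by (rule tendstoD)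
          ultimately show ?thesis
          proof eventually_elim
            case (elim j)
            then show ?case using N(4)[OF v(1), of j] by (auto simp: mem_Times_iff dist_commute)
          qed
        qed
        have sym: "?H w \<in> sym_matrices" if "w \<in> U" for w
          using C12_hessian_symmetric[OF C, of "fst w" "snd w"] that
          by (auto simp: sym_matrices_def transpose_def vec_eq_iff mat_def)
        have "(\<lambda>j. F (fst (v j)) (snd (v j)) (u (v j)) (?G (v j)) (?H (v j)))
          \<longlonglongrightarrow> F T x0 (u (T, x0)) (G (T, x0) + (2 * \<kappa>) *\<^sub>R (x0 - x0)) (H (T, x0) + (2 * \<kappa>) *\<^sub>R mat 1)"
        proof (rule nonlinearity_tendsto[OF F v1 v2 ulim])
          show "(\<lambda>j. ?G (v j)) \<longlonglongrightarrow> G (T, x0) + (2 * \<kappa>) *\<^sub>R (x0 - x0)"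
            by (intro tendsto_intros limU[OF cont(2) vlim] v2)
          show "(\<lambda>j. ?H (v j)) \<longlonglongrightarrow> H (T, x0) + (2 * \<kappa>) *\<^sub>R mat 1"
            by (intro tendsto_intros limU[OF cont(3) vlim])
          show "H (T, x0) + (2 * \<kappa>) *\<^sub>R mat 1 \<in> sym_matrices" by (rule sym[OF TU])
          show "\<forall>\<^sub>F j in sequentially. ?H (v j) \<in> sym_matrices"
            using sym N(1)[OF v(1)] by (intro always_eventually) blast
          show "\<forall>\<^sub>F j in sequentially. fst (v j) \<in> {0..T}"
            using N(3)[OF v(1)] by (intro always_eventually allI) (auto simp: mem_Times_iff less_imp_le)
        qed (use T in simp)
        moreover have "(\<lambda>j. \<phi>t (v j) - \<kappa>) \<longlonglongrightarrow> \<phi>t (T, x0) - \<kappa>"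
          by (intro tendsto_intros limU[OF cont(1) vlim])
        moreover have "\<forall>\<^sub>F j in sequentially. \<phi>t (v j) - \<kappa> \<le> F (fst (v j)) (snd (v j)) (u (v j)) (?G (v j)) (?H (v j))"
          using ev by eventually_elim (rule pde)
        ultimately have "\<phi>t (T, x0) - \<kappa> \<le> F T x0 (u (T, x0)) (G (T, x0) + (2 * \<kappa>) *\<^sub>R (x0 - x0)) (H (T, x0) + (2 * \<kappa>) *\<^sub>R mat 1)"
          by (rule tendsto_le[OF sequentially_bot])
        then show ?thesis by simp
      qed
      have one: "(\<lambda>j. 1 / real (Suc j)) \<longlonglongrightarrow> 0" by (rule LIMSEQ_Suc[OF lim_1_over_n])
      have symT: "H (T, x0) \<in> sym_matrices" by (rule C12_hessian_symmetric[OF C TU])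
      have "(\<lambda>j. F T x0 (u (T, x0)) (G (T, x0)) (H (T, x0) + (2 * (1 / Suc j)) *\<^sub>R mat 1))
          \<longlonglongrightarrow> F T x0 (u (T, x0)) (G (T, x0)) (H (T, x0))"
      proof (rule nonlinearity_tendsto[OF F tendsto_const tendsto_const tendsto_const tendsto_const])
        have "(\<lambda>j. H (T, x0) + (2 * (1 / real (Suc j))) *\<^sub>R mat 1) \<longlonglongrightarrow> H (T, x0) + (2 * 0) *\<^sub>R mat 1"
          by (intro tendsto_intros one)
        then show "(\<lambda>j. H (T, x0) + (2 * (1 / real (Suc j))) *\<^sub>R mat 1) \<longlonglongrightarrow> H (T, x0)" by simp
        show "\<forall>\<^sub>F j in sequentially. H (T, x0) + (2 * (1 / real (Suc j))) *\<^sub>R mat 1 \<in> sym_matrices"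
          using symT by (auto simp: sym_matrices_def transpose_def vec_eq_iff mat_def)
      qed (use T symT in auto)
      moreover have "(\<lambda>j. \<phi>t (T, x0) - 1 / Suc j) \<longlonglongrightarrow> \<phi>t (T, x0) - 0" by (intro tendsto_intros one)
      moreover have "\<forall>\<^sub>F j in sequentially. \<phi>t (T, x0) - 1 / Suc j
          \<le> F T x0 (u (T, x0)) (G (T, x0)) (H (T, x0) + (2 * (1 / Suc j)) *\<^sub>R mat 1)"
        by (intro always_eventually allI key) simp
      ultimately have "\<phi>t (T, x0) - 0 \<le> F T x0 (u (T, x0)) (G (T, x0)) (H (T, x0))"
        by (rule tendsto_le[OF sequentially_bot])
      then show ?thesis by (simp add: t)
    qed
  qed
qed

lemma Limsup_terminal_bounded:
  fixes u :: "real \<times> (real ^ 'n) \<Rightarrow> real"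
  assumes T: "T > 0" and lim: "ereal (u (T, x)) = Limsup (at (T, x) within {0..<T} \<times> UNIV) (\<lambda>w. ereal (u w))"
    and b: "\<And>w. w \<in> {0..<T} \<times> UNIV \<Longrightarrow> \<bar>u w\<bar> \<le> C"
  shows "\<bar>u (T, x)\<bar> \<le> C"
proof -
  have in_set: "\<forall>\<^sub>F w in at (T, x) within {0..<T} \<times> UNIV. w \<in> {0..<T} \<times> UNIV"
    by (simp add: eventually_at_filter)
  have "u (T, x) \<le> C"
  proof (rule ccontr)
    assume "\<not> u (T, x) \<le> C"
    then have "\<exists>\<^sub>F w in at (T, x) within {0..<T} \<times> UNIV. C < u w"
      using Limsup_frequently_greater[OF lim] by simp
    then have "\<exists>\<^sub>F w in at (T, x) within {0..<T} \<times> UNIV. C < u w \<and> w \<in> {0..<T} \<times> UNIV"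
      using in_set by (rule frequently_eventually_frequently)
    then obtain w where "C < u w" "w \<in> {0..<T} \<times> UNIV" using frequently_ex by blast
    then show False using b[of w] by simp
  qed
  moreover have "- C \<le> u (T, x)"
  proof (rule ccontr)
    assume "\<not> - C \<le> u (T, x)"
    then have "\<forall>\<^sub>F w in at (T, x) within {0..<T} \<times> UNIV. u w < - C"
      using Limsup_eventually_less[OF lim] by simp
    then have "\<forall>\<^sub>F w in at (T, x) within {0..<T} \<times> UNIV. False"
      using in_set
    proof eventually_elim
      case (elim w)
      then show ?case using b[of w] by simp
    qed
    then have "\<not> (T, x) islimpt ({0..<T} \<times> UNIV)"
      by (simp add: trivial_limit_within[symmetric] trivial_limit_def)
    moreover have "(T, x) islimpt ({0..<T} \<times> UNIV)"
      unfolding islimpt_approachable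
    proof (intro allI impI)
      fix e :: real assume "e > 0"
      then show "\<exists>w\<in>{0..<T} \<times> UNIV. w \<noteq> (T, x) \<and> dist w (T, x) < e"
        using T by (intro bexI[of _ "(max 0 (T - e / 2), x)"]) (auto simp: dist_Pair_Pair dist_real_def)
    qed
    ultimately show False by simp
  qed
  ultimately show ?thesis by simp
qed

section \<open>The structure condition on matrices\<close>

lemma sum_UNIV_sum_type:
  fixes f :: "'a::finite + 'b::finite \<Rightarrow> real"
  shows "(\<Sum>i\<in>UNIV. f i) = (\<Sum>k\<in>UNIV. f (Inl k)) + (\<Sum>k\<in>UNIV. f (Inr k))"
  using sum.Plus[of "UNIV :: 'a set" "UNIV :: 'b set" f] by (simp add: UNIV_Plus_UNIV comp_def)

lemma block_matrix_form:
  fixes \<zeta> :: "real ^ ('n::finite + 'n)"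
  defines "x \<equiv> (\<chi> k. \<zeta> $ Inl k)" and "y \<equiv> (\<chi> k. \<zeta> $ Inr k)"
  shows "\<zeta> \<bullet> (block_matrix A B C E *v \<zeta>)
    = x \<bullet> (A *v x) + x \<bullet> (B *v y) + y \<bullet> (C *v x) + y \<bullet> (E *v y)"
  by (simp add: inner_vec_def matrix_vector_mult_def block_matrix_def sum_UNIV_sum_type x_def y_def
      distrib_left sum.distrib)

lemma matrix_uminus_vector: "(- A) *v h = - ((A :: real ^ 'n ^ 'm) *v h)"
  using matrix_vector_mult_diff_rdistrib[of 0 A h] by simp

lemma block_inequalities:
  fixes X Y :: "real ^ 'n ^ 'n"
  assumes b: "\<And>h k. - (3 * \<alpha>) * ((norm h)\<^sup>2 + (norm k)\<^sup>2) \<le> h \<bullet> (X *v h) - k \<bullet> (Y *v k)"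
    "\<And>h k. h \<bullet> (X *v h) - k \<bullet> (Y *v k) \<le> 3 * \<alpha> * (norm (h - k))\<^sup>2"
  shows "(-3 * \<alpha>) *\<^sub>R block_matrix (mat 1) 0 0 (mat 1) \<preceq> block_matrix X 0 0 (- Y)"
    "block_matrix X 0 0 (- Y) \<preceq> (3 * \<alpha>) *\<^sub>R block_matrix (mat 1) (- mat 1) (- mat 1) (mat 1)"
  unfolding loewner_le_def scaleR_matrix_vector_assoc[symmetric] inner_scaleR_right block_matrix_form
proof (safe)
  fix \<zeta> :: "real ^ ('n + 'n)"
  let ?x = "\<chi> k. \<zeta> $ Inl k" and ?y = "\<chi> k. \<zeta> $ Inr k"
  show "- 3 * \<alpha> * (?x \<bullet> (mat 1 *v ?x) + ?x \<bullet> (0 *v ?y) + ?y \<bullet> (0 *v ?x) + ?y \<bullet> (mat 1 *v ?y))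
      \<le> ?x \<bullet> (X *v ?x) + ?x \<bullet> (0 *v ?y) + ?y \<bullet> (0 *v ?x) + ?y \<bullet> (- Y *v ?y)"
    using b(1)[of ?x ?y] by (simp add: matrix_uminus_vector power2_norm_eq_inner algebra_simps)
  have e: "(norm (?x - ?y))\<^sup>2 = ?x \<bullet> ?x - ?x \<bullet> ?y - ?y \<bullet> ?x + ?y \<bullet> ?y"
    unfolding power2_norm_eq_inner inner_diff_left inner_diff_right by linarith
  show "?x \<bullet> (X *v ?x) + ?x \<bullet> (0 *v ?y) + ?y \<bullet> (0 *v ?x) + ?y \<bullet> (- Y *v ?y)
      \<le> 3 * \<alpha> * (?x \<bullet> (mat 1 *v ?x) + ?x \<bullet> (- mat 1 *v ?y) + ?y \<bullet> (- mat 1 *v ?x) + ?y \<bullet> (mat 1 *v ?y))"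
    using b(2)[of ?x ?y, unfolded e] by (simp add: matrix_uminus_vector algebra_simps)
qed

lemma at_right_0_ereal_small:
  fixes \<theta> :: "ereal \<Rightarrow> ereal"
  assumes "(\<theta> \<longlongrightarrow> 0) (at_right 0)" "\<sigma> > 0"
  obtains d :: real where "d > 0" "\<And>s :: real. 0 < s \<Longrightarrow> s < d \<Longrightarrow> \<theta> (ereal s) < ereal \<sigma>"
proof -
  have "\<forall>\<^sub>F s in at_right (0::ereal). \<theta> s < ereal \<sigma>"
    using assms by (intro order_tendstoD(2)) auto
  moreover have "(0::ereal) < 1" by simp
  ultimately obtain b :: ereal where b: "b > 0" "\<And>s. s > 0 \<Longrightarrow> s < b \<Longrightarrow> \<theta> s < ereal \<sigma>"
    unfolding eventually_at_right[OF \<open>(0::ereal) < 1\<close>] by blast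
  obtain d where d: "0 < ereal d" "ereal d < b" using b(1) ereal_dense2[of 0 b] by auto
  show ?thesis
  proof (rule that[of d])
    show "d > 0" using d(1) by simp
    fix s :: real assume "0 < s" "s < d"
    then have "0 < ereal s" "ereal s < ereal d" by simp_all
    then show "\<theta> (ereal s) < ereal \<sigma>" using less_trans[OF _ d(2)] by (intro b(2))
  qed
qed

text \<open>
  The modulus is not controlled at \<open>0\<close> itself, so equal points are treated separately: there the
  matrix inequality on the diagonal reads \<open>X \<le> Y\<close>, and ellipticity gives the sign.
\<close>

lemma structure_condition_modulus:
  fixes F :: "'n::finite nonlinearity"
  assumes A0: "assumption_A0 T F" and A2: "assumption_A2 T F" and R: "R > 0" and \<sigma>: "\<sigma> > 0"
  obtains d where "d > 0"
    "\<And>t x x' r \<alpha> X Y. t \<in> {0..T} \<Longrightarrow> r \<in> {-R..R} \<Longrightarrow> \<alpha> > 0 \<Longrightarrow> X \<in> sym_matrices \<Longrightarrow> Y \<in> sym_matrices \<Longrightarrow>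
      (\<And>h k. - (3 * \<alpha>) * ((norm h)\<^sup>2 + (norm k)\<^sup>2) \<le> h \<bullet> (X *v h) - k \<bullet> (Y *v k)) \<Longrightarrow>
      (\<And>h k. h \<bullet> (X *v h) - k \<bullet> (Y *v k) \<le> 3 * \<alpha> * (norm (h - k))\<^sup>2) \<Longrightarrow>
      \<alpha> * (norm (x - x'))\<^sup>2 + norm (x - x') < d \<Longrightarrow>
      F t x r (\<alpha> *\<^sub>R (x - x')) X - F t x' r (\<alpha> *\<^sub>R (x - x')) Y < \<sigma>"
proof -
  obtain \<theta> :: "ereal \<Rightarrow> ereal" where \<theta>: "(\<theta> \<longlongrightarrow> 0) (at_right 0)"
    and bound: "\<And>t x x' r \<alpha> X Y. t \<in> {0..T} \<Longrightarrow> r \<in> {-R..R} \<Longrightarrow> \<alpha> > 0 \<Longrightarrow> X \<in> sym_matrices \<Longrightarrow> Y \<in> sym_matrices \<Longrightarrow>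
      (-3 * \<alpha>) *\<^sub>R block_matrix (mat 1) 0 0 (mat 1) \<preceq> block_matrix X 0 0 (- Y) \<Longrightarrow>
      block_matrix X 0 0 (- Y) \<preceq> (3 * \<alpha>) *\<^sub>R block_matrix (mat 1) (- mat 1) (- mat 1) (mat 1) \<Longrightarrow>
      ereal (F t x r (\<alpha> *\<^sub>R (x - x')) X - F t x' r (\<alpha> *\<^sub>R (x - x')) Y)
        \<le> \<theta> (ereal (\<alpha> * (norm (x - x'))\<^sup>2 + norm (x - x')))"
    using A2 R unfolding assumption_A2_def by metis
  obtain d where d: "d > 0" "\<And>s :: real. 0 < s \<Longrightarrow> s < d \<Longrightarrow> \<theta> (ereal s) < ereal \<sigma>"
    by (rule at_right_0_ereal_small[OF \<theta> \<sigma>]) blast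
  show ?thesis
  proof (rule that[OF d(1)])
    fix t r \<alpha> :: real and x x' :: "real ^ 'n" and X Y :: "real ^ 'n ^ 'n"
    assume t: "t \<in> {0..T}" and r: "r \<in> {-R..R}" and \<alpha>: "\<alpha> > 0" and X: "X \<in> sym_matrices" and Y: "Y \<in> sym_matrices"
      and b1: "\<And>h k. - (3 * \<alpha>) * ((norm h)\<^sup>2 + (norm k)\<^sup>2) \<le> h \<bullet> (X *v h) - k \<bullet> (Y *v k)"
      and b2: "\<And>h k. h \<bullet> (X *v h) - k \<bullet> (Y *v k) \<le> 3 * \<alpha> * (norm (h - k))\<^sup>2"
      and s: "\<alpha> * (norm (x - x'))\<^sup>2 + norm (x - x') < d"
    show "F t x r (\<alpha> *\<^sub>R (x - x')) X - F t x' r (\<alpha> *\<^sub>R (x - x')) Y < \<sigma>"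
    proof (cases "x = x'")
      case True
      have "0 \<preceq> Y - X"
        unfolding loewner_le_def
      proof
        fix \<xi>
        show "\<xi> \<bullet> (0 *v \<xi>) \<le> \<xi> \<bullet> ((Y - X) *v \<xi>)"
          using b2[of \<xi> \<xi>] by (simp add: matrix_vector_mult_diff_rdistrib inner_diff_right)
      qed
      moreover have "Y - X \<in> sym_matrices" using X Y by (simp add: sym_matrices_def transpose_def vec_eq_iff)
      ultimately have "F t x r 0 X \<le> F t x r 0 (X + (Y - X))"
        using A0 t X unfolding assumption_A0_def degenerate_elliptic_def by blast
      then show ?thesis using True \<sigma> by simp
    next
      case False
      have "0 < \<alpha> * (norm (x - x'))\<^sup>2 + norm (x - x')" using False \<alpha> by (intro add_pos_pos) auto
      then have "\<theta> (ereal (\<alpha> * (norm (x - x'))\<^sup>2 + norm (x - x'))) < ereal \<sigma>" using s by (rule d(2))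
      with bound[OF t r \<alpha> X Y block_inequalities[OF b1 b2], of x x']
      have "ereal (F t x r (\<alpha> *\<^sub>R (x - x')) X - F t x' r (\<alpha> *\<^sub>R (x - x')) Y) < ereal \<sigma>"
        by (rule le_less_trans)
      then show ?thesis by simp
    qed
  qed
qed

lemma matrix_norm_le:
  fixes X :: "real ^ 'n ^ 'n"
  assumes "\<And>h. norm (X *v h) \<le> c * norm h"
  shows "norm X \<le> real CARD('n) * real CARD('n) * c"
proof -
  have e: "\<bar>X $ i $ j\<bar> \<le> c" for i j
  proof -
    have "X $ i $ j = (X *v axis j 1) $ i" by (simp add: matrix_vector_mult_basis column_def)
    also have "\<bar>\<dots>\<bar> \<le> norm (X *v axis j 1)" by (rule component_le_norm_cart)
    also have "\<dots> \<le> c" using assms[of "axis j 1"] by (simp add: norm_axis_1)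
    finally show ?thesis .
  qed
  have "norm (X $ i) \<le> real CARD('n) * c" for i
  proof -
    have "norm (X $ i) \<le> (\<Sum>j\<in>UNIV. \<bar>X $ i $ j\<bar>)" by (rule norm_le_l1_cart)
    also have "\<dots> \<le> (\<Sum>j\<in>(UNIV :: 'n set). c)" by (intro sum_mono e)
    finally show ?thesis by simp
  qed
  then have "(\<Sum>i\<in>UNIV. norm (X $ i)) \<le> (\<Sum>i\<in>(UNIV :: 'n set). real CARD('n) * c)" by (intro sum_mono)
  moreover have "norm X \<le> (\<Sum>i\<in>UNIV. norm (X $ i))"
    unfolding norm_vec_def by (rule L2_set_le_sum) simp
  ultimately show ?thesis by simp
qed

lemma sym_matrix_norm_le:
  fixes X :: "real ^ 'n ^ 'n"
  assumes "X \<in> sym_matrices" "\<And>h. \<bar>h \<bullet> (X *v h)\<bar> \<le> c * (norm h)\<^sup>2"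
  shows "norm X \<le> real CARD('n) * real CARD('n) * c"
proof (rule matrix_norm_le)
  show "norm (X *v h) \<le> c * norm h" for h
    by (rule selfadjoint_norm_bound[OF matrix_vector_mul_linear sym_matrix_inner[OF assms(1)] assms(2)])
qed

lemma closed_sym_matrices: "closed (sym_matrices :: (real ^ 'n ^ 'n) set)"
proof -
  have eq: "sym_matrices = (\<Inter>i. \<Inter>j. {X :: real ^ 'n ^ 'n. X $ i $ j = X $ j $ i})"
    by (auto simp: sym_matrices_def transpose_def vec_eq_iff)
  show ?thesis unfolding eq by (intro closed_INT ballI closed_Collect_eq continuous_intros)
qed

section \<open>The maximum principle at equal times\<close>

lemma usc_on_extend:
  fixes f c :: "'a::topological_space \<Rightarrow> real"
  assumes f: "usc_on D f" and D: "closed D" and c: "continuous_on UNIV c" and cf: "\<And>z. z \<in> D \<Longrightarrow> c z \<le> f z"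
  shows "usc_on UNIV (\<lambda>z. if z \<in> D then f z else c z)"
proof (rule usc_onI)
  fix z a assume a: "(if z \<in> D then f z else c z) < a"
  then have ca: "c z < a" using cf[of z] by (auto split: if_splits)
  obtain S1 where S1: "open S1" "z \<in> S1" "\<And>w. w \<in> S1 \<Longrightarrow> c w < a"
    by (rule usc_onD[OF usc_on_continuous[OF c] UNIV_I ca]) blast
  show "\<exists>S. open S \<and> z \<in> S \<and> (\<forall>w\<in>S \<inter> UNIV. (if w \<in> D then f w else c w) < a)"
  proof (cases "z \<in> D")
    case True
    then have fa: "f z < a" using a by simp
    obtain S2 where "open S2" "z \<in> S2" "\<And>w. w \<in> S2 \<Longrightarrow> w \<in> D \<Longrightarrow> f w < a"
      by (rule usc_onD[OF f True fa]) blast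
    then show ?thesis using S1 by (intro exI[of _ "S1 \<inter> S2"]) (auto simp: open_Int)
  next
    case False
    then show ?thesis using S1 D by (intro exI[of _ "S1 - D"]) (auto simp: open_Diff)
  qed
qed

text \<open>
  The discount factor makes the equation strictly monotone in the unknown function, the quadratic
  term confines maxima to a ball.
\<close>

definition penalised :: "real \<Rightarrow> real \<Rightarrow> (real \<times> (real ^ 'n) \<Rightarrow> real) \<Rightarrow> real \<times> (real ^ 'n) \<Rightarrow> real" where
  "penalised l \<delta> u w = exp (- (l * fst w)) * u w - \<delta> * (norm (snd w))\<^sup>2"

lemma penalised_le:
  fixes l t :: real
  assumes "l \<ge> 0" "t \<ge> 0" "\<bar>u (t, x)\<bar> \<le> C"
  shows "\<bar>exp (- (l * t)) * u (t, x)\<bar> \<le> C"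
proof -
  have "exp (- (l * t)) \<le> 1" using mult_nonneg_nonneg[OF assms(1,2)] by simp
  then have "exp (- (l * t)) * \<bar>u (t, x)\<bar> \<le> 1 * \<bar>u (t, x)\<bar>" by (intro mult_right_mono) auto
  then show ?thesis using assms(3) by (simp add: abs_mult)
qed

lemma shifted_matrix_vector: "((X :: real ^ 'n ^ 'n) + c *\<^sub>R mat 1) *v h = X *v h + c *\<^sub>R h"
proof -
  have "(X + c *\<^sub>R mat 1) *v h = X *v h + (c *\<^sub>R mat 1) *v h"
    by (rule matrix_vector_mult_add_rdistrib)
  also have "(c *\<^sub>R (mat 1 :: real ^ 'n ^ 'n)) *v h = c *\<^sub>R h"
    by (subst scaleR_matrix_vector_assoc[symmetric], subst matrix_vector_mul_lid, rule refl)
  finally show ?thesis .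
qed

lemma spatial_block:
  fixes L :: "real \<times> (real ^ 'n) \<Rightarrow> real \<times> (real ^ 'n)"
  assumes L: "linear L" "\<And>x y. L x \<bullet> y = x \<bullet> L y" and X: "X = matrix (\<lambda>h. snd (L (0, h)))"
  shows "X *v h = snd (L (0, h))" "X \<in> sym_matrices"
proof -
  have "linear (\<lambda>h. snd (L (0, h)))"
  proof (rule linearI)
    show "snd (L (0, h + k)) = snd (L (0, h)) + snd (L (0, k))" for h k
      using linear_add[OF L(1), of "(0, h)" "(0, k)"] by simp
    show "snd (L (0, r *\<^sub>R h)) = r *\<^sub>R snd (L (0, h))" for r h
      using linear_scale[OF L(1), of r "(0, h)"] by simp
  qed
  then have Xv: "X *v h = snd (L (0, h))" for h
    unfolding X by (rule fun_cong[OF matrix_vector_mul(2)])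
  show "X *v h = snd (L (0, h))" by (rule Xv)
  show "X \<in> sym_matrices"
    using L(2)[of "(0, h)" "(0, k)" for h k] by (intro sym_matricesI) (simp add: Xv inner_prod_def inner_commute)
qed

text \<open>
  The time variable enters the theorem on sums rescaled by \<open>\<mu>\<close>. The mixed second-order term of the
  touching polynomial is absorbed by Young's inequality, which costs \<open>\<epsilon> I\<close> in the spatial Hessian and
  a large multiple of the squared time difference; the latter has derivative \<open>0\<close> at the contact point.
\<close>

lemma touching_inequality:
  fixes u :: "real \<times> (real ^ 'n) \<Rightarrow> real" and L :: "real \<times> (real ^ 'n) \<Rightarrow> real \<times> (real ^ 'n)"
  assumes sub: "viscosity_subsolution F ({0<..T} \<times> UNIV) u"
    and f: "\<And>t x. t \<in> {0..T} \<Longrightarrow> f (t, x) = penalised l \<delta> u (t, x)"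
    and L: "linear L" "\<And>x y. L x \<bullet> y = x \<bullet> L y" and \<mu>: "\<mu> > 0" and \<epsilon>: "\<epsilon> > 0"
    and touch: "\<forall>\<^sub>F h in nhds 0. f (\<mu> * (\<tau> + fst h), y + snd h) \<le> f (\<mu> * \<tau>, y) + p \<bullet> h + 1 / 2 * (h \<bullet> L h)"
    and t: "t = \<mu> * \<tau>" "t \<in> {0<..T}" and X: "X = matrix (\<lambda>h. snd (L (0, h)))"
  shows "fst p / \<mu> + l * (exp (- (l * t)) * u (t, y)) \<le> exp (- (l * t)) * F t y (u (t, y))
    (exp (l * t) *\<^sub>R (snd p + (2 * \<delta>) *\<^sub>R y)) (exp (l * t) *\<^sub>R (X + (\<epsilon> + 2 * \<delta>) *\<^sub>R mat 1))"
proof -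
  note Xv = spatial_block(1)[OF L X] and Xsym = spatial_block(2)[OF L X]
  define c0 where "c0 = fst (L (1, 0))"
  define c where "c = snd (L (1, 0))"
  define B where "B = c0 + (norm c)\<^sup>2 / \<epsilon>"
  define b where "b = 1 / 2 * B / \<mu>\<^sup>2"
  have quad: "(\<sigma>, k) \<bullet> L (\<sigma>, k) \<le> B * \<sigma>\<^sup>2 + k \<bullet> (X *v k) + \<epsilon> * (norm k)\<^sup>2" for \<sigma> k
  proof -
    have "L (\<sigma>, k) = \<sigma> *\<^sub>R L (1, 0) + L (0, k)"
      using linear_add[OF L(1), of "\<sigma> *\<^sub>R (1, 0)" "(0, k)"] linear_scale[OF L(1), of \<sigma> "(1, 0)"] by simp
    moreover have "fst (L (0, k)) = c \<bullet> k" using L(2)[of "(1, 0)" "(0, k)"] by (simp add: c_def inner_prod_def)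
    ultimately have e: "(\<sigma>, k) \<bullet> L (\<sigma>, k) = c0 * \<sigma>\<^sup>2 + 2 * \<sigma> * (c \<bullet> k) + k \<bullet> (X *v k)"
      by (simp add: inner_prod_def Xv c0_def c_def inner_simps inner_commute power2_eq_square algebra_simps)
    have "0 \<le> (norm (\<sigma> *\<^sub>R c - \<epsilon> *\<^sub>R k))\<^sup>2" by simp
    also have "(norm (\<sigma> *\<^sub>R c - \<epsilon> *\<^sub>R k))\<^sup>2 = \<sigma>\<^sup>2 * (norm c)\<^sup>2 - \<epsilon> * (2 * \<sigma> * (c \<bullet> k)) + \<epsilon>\<^sup>2 * (norm k)\<^sup>2"
      unfolding power2_norm_eq_inner
      by (simp add: inner_simps inner_commute power2_eq_square algebra_simps)
    finally have "\<epsilon> * (2 * \<sigma> * (c \<bullet> k)) \<le> \<epsilon> * ((norm c)\<^sup>2 / \<epsilon> * \<sigma>\<^sup>2 + \<epsilon> * (norm k)\<^sup>2)"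
      using \<epsilon> by (simp add: distrib_left power2_eq_square algebra_simps)
    then have "2 * \<sigma> * (c \<bullet> k) \<le> (norm c)\<^sup>2 / \<epsilon> * \<sigma>\<^sup>2 + \<epsilon> * (norm k)\<^sup>2"
      using \<epsilon> by (simp only: mult_le_cancel_left_pos)
    then show ?thesis unfolding e B_def by (simp add: algebra_simps)
  qed
  have t0: "t \<in> {0..T}" using t(2) by auto
  define U0 where "U0 = exp (- (l * t)) * u (t, y)"
  have fU0: "f (\<mu> * \<tau>, y) = U0 - \<delta> * (norm y)\<^sup>2"
    using f[OF t0] t(1) by (simp add: U0_def penalised_def)
  define h where "h w = ((fst w - t) / \<mu>, snd w - y)" for w :: "real \<times> (real ^ 'n)"
  have "(h \<longlongrightarrow> ((t - t) / \<mu>, y - y)) (at (t, y) within {0<..T} \<times> UNIV)"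
    unfolding h_def by (rule tendsto_eq_intros refl | use \<mu> in simp)+
  then have "(h \<longlongrightarrow> 0) (at (t, y) within {0<..T} \<times> UNIV)" by (simp add: zero_prod_def)
  then have ev: "\<forall>\<^sub>F w in at (t, y) within {0<..T} \<times> UNIV.
      f (\<mu> * (\<tau> + fst (h w)), y + snd (h w)) \<le> f (\<mu> * \<tau>, y) + p \<bullet> h w + 1 / 2 * (h w \<bullet> L (h w))"
    by (rule eventually_compose_filterlim[OF touch])
  have "\<forall>\<^sub>F w in at (t, y) within {0<..T} \<times> UNIV. w \<in> {0<..T} \<times> UNIV"
    by (simp add: eventually_at_filter)
  with ev have touch': "\<forall>\<^sub>F w in at (t, y) within {0<..T} \<times> UNIV. exp (- (l * fst w)) * u w
      \<le> U0 + fst p / \<mu> * (fst w - t) + b * (fst w - t)\<^sup>2 + (snd p + (2 * \<delta>) *\<^sub>R y) \<bullet> (snd w - y)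
      + 1 / 2 * ((snd w - y) \<bullet> ((X + (\<epsilon> + 2 * \<delta>) *\<^sub>R mat 1) *v (snd w - y)))"
  proof eventually_elim
    case (elim w)
    obtain r z where w: "w = (r, z)" by (cases w)
    have r: "r \<in> {0..T}" using elim(2) w by auto
    have "\<mu> * (\<tau> + fst (h w)) = r" using \<mu> by (simp add: h_def w t(1) field_simps)
    moreover have "y + snd (h w) = z" by (simp add: h_def w)
    ultimately have "exp (- (l * r)) * u (r, z) - \<delta> * (norm z)\<^sup>2
        \<le> U0 - \<delta> * (norm y)\<^sup>2 + p \<bullet> h w + 1 / 2 * (h w \<bullet> L (h w))"
      using elim(1) f[OF r, of z] by (simp add: fU0 penalised_def)
    moreover have "1 / 2 * (h w \<bullet> L (h w)) \<le> 1 / 2 * (B * ((r - t) / \<mu>)\<^sup>2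
        + (z - y) \<bullet> (X *v (z - y)) + \<epsilon> * (norm (z - y))\<^sup>2)"
      using quad[of "(r - t) / \<mu>" "z - y"] by (simp add: h_def w)
    moreover have "1 / 2 * (B * ((r - t) / \<mu>)\<^sup>2 + (z - y) \<bullet> (X *v (z - y)) + \<epsilon> * (norm (z - y))\<^sup>2)
        = b * (r - t)\<^sup>2 + 1 / 2 * ((z - y) \<bullet> (X *v (z - y))) + 1 / 2 * (\<epsilon> * (norm (z - y))\<^sup>2)"
      by (simp add: b_def power_divide distrib_left)
    moreover have "p \<bullet> h w = fst p / \<mu> * (r - t) + snd p \<bullet> (z - y)"
      by (simp add: h_def w inner_prod_def)
    moreover have "\<delta> * (norm z)\<^sup>2 = \<delta> * (norm y)\<^sup>2 + 2 * \<delta> * (y \<bullet> (z - y)) + \<delta> * (norm (z - y))\<^sup>2"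
      by (simp add: power2_norm_eq_inner inner_simps inner_commute algebra_simps)
    moreover have "(z - y) \<bullet> ((X + (\<epsilon> + 2 * \<delta>) *\<^sub>R mat 1) *v (z - y))
        = (z - y) \<bullet> (X *v (z - y)) + \<epsilon> * (norm (z - y))\<^sup>2 + 2 * (\<delta> * (norm (z - y))\<^sup>2)"
      unfolding shifted_matrix_vector power2_norm_eq_inner by (simp add: inner_add_right distrib_right)
    moreover have "(snd p + (2 * \<delta>) *\<^sub>R y) \<bullet> (z - y) = snd p \<bullet> (z - y) + 2 * \<delta> * (y \<bullet> (z - y))"
      by (simp add: inner_add_left)
    ultimately show ?case unfolding w fst_conv snd_conv by linarith
  qed
  have Ysym: "X + (\<epsilon> + 2 * \<delta>) *\<^sub>R mat 1 \<in> sym_matrices"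
    using Xsym by (auto simp: sym_matrices_def transpose_def vec_eq_iff mat_def)
  have "(t, y) \<in> {0<..T} \<times> UNIV" using t(2) by simp
  from subsolution_quadratic_touching[OF sub this Ysym U0_def touch'] show ?thesis by (simp add: U0_def)
qed

lemma usc_on_penalised:
  fixes w :: "real \<times> (real ^ 'n) \<Rightarrow> real"
  assumes w: "usc_on D w"
  shows "usc_on D (penalised l \<delta> w)"
proof (rule usc_onI)
  fix z :: "real \<times> (real ^ 'n)" and a assume z: "z \<in> D" "penalised l \<delta> w z < a"
  let ?a = "\<lambda>z. exp (l * fst z) * (a + \<delta> * (norm (snd z))\<^sup>2)"
  have eq: "penalised l \<delta> w z < a \<longleftrightarrow> w z + - ?a z < 0" for z
  proof -
    have "w z < ?a z \<longleftrightarrow> exp (- (l * fst z)) * w z < exp (- (l * fst z)) * ?a z" by simp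
    also have "exp (- (l * fst z)) * ?a z = a + \<delta> * (norm (snd z))\<^sup>2"
      by (simp add: exp_minus)
    finally show ?thesis by (auto simp: penalised_def)
  qed
  have uu: "usc_on D (\<lambda>z. w z + - ?a z)"
    by (rule usc_on_add[OF w usc_on_continuous]) (intro continuous_intros)
  obtain S where "open S" "z \<in> S" "\<And>w'. w' \<in> S \<Longrightarrow> w' \<in> D \<Longrightarrow> w w' + - ?a w' < 0"
    by (rule usc_onD[where f = "\<lambda>z. w z + - ?a z", OF uu z(1) z(2)[unfolded eq]]) blast
  then show "\<exists>S. open S \<and> z \<in> S \<and> (\<forall>z\<in>S \<inter> D. penalised l \<delta> w z < a)"
    unfolding eq by blast
qed

text \<open>
  Times are doubled with the penalty \<open>\<alpha> / (2 \<mu>\<^sup>2) (t - s)\<^sup>2\<close>. Measured in units of \<open>\<mu>\<close>, the time becomes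
  one more coordinate of the isotropic penalty \<open>\<alpha> / 2 |\<zeta> - \<omega>|\<^sup>2\<close> on \<open>\<real> \<times> \<real>\<^sup>n\<close>, and the theorem on sums
  applies there; its matrix bounds restrict to the spatial blocks \<open>X\<close> and \<open>Y\<close>. The time slopes \<open>a\<close>
  and \<open>b\<close> nearly cancel because the penalty depends on the difference of the times only.
\<close>

lemma doubled_time_touching:
  fixes u v :: "real \<times> (real ^ 'n) \<Rightarrow> real" and \<mu> :: real
  assumes T: "T > 0" and l: "l \<ge> 0" and \<alpha>: "\<alpha> > 0" and \<delta>: "\<delta> > 0" and \<mu>: "0 < \<mu>" "\<mu> \<le> 1"
    and u: "usc_on ({0..T} \<times> UNIV) u" "\<And>w. w \<in> {0..T} \<times> UNIV \<Longrightarrow> \<bar>u w\<bar> \<le> C"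
      "viscosity_subsolution F ({0<..T} \<times> UNIV) u"
    and v: "usc_on ({0..T} \<times> UNIV) v" "\<And>w. w \<in> {0..T} \<times> UNIV \<Longrightarrow> \<bar>v w\<bar> \<le> C"
      "viscosity_subsolution F' ({0<..T} \<times> UNIV) v"
  defines "R \<equiv> sqrt ((4 * C + 1) / \<delta>)" and "f \<equiv> penalised l \<delta> u" and "g \<equiv> penalised l \<delta> v"
  shows "\<exists>t x s y t' x' s' y' p q a b X Y.
    t \<in> {0..T} \<and> s \<in> {0..T} \<and> norm x \<le> R \<and> norm y \<le> R \<and>
    (\<forall>r\<in>{0..T}. \<forall>\<xi> \<eta>. f (r, \<xi>) + g (r, \<eta>) - \<alpha> / 2 * (norm (\<xi> - \<eta>))\<^sup>2
      \<le> f (t, x) + g (s, y) - \<alpha> / 2 * (norm (x - y))\<^sup>2 - \<alpha> / (2 * \<mu>\<^sup>2) * (t - s)\<^sup>2) \<and>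
    t' \<in> {0..T} \<and> s' \<in> {0..T} \<and> \<bar>t' - t\<bar> \<le> \<mu> \<and> \<bar>s' - s\<bar> \<le> \<mu> \<and> norm (x' - x) \<le> \<mu> \<and> norm (y' - y) \<le> \<mu> \<and>
    f (t, x) + g (s, y) - \<mu> \<le> f (t', x') + g (s', y') \<and>
    norm (p - \<alpha> *\<^sub>R (x - y)) \<le> \<mu> \<and> norm (q - \<alpha> *\<^sub>R (y - x)) \<le> \<mu> \<and> \<bar>a + b\<bar> \<le> 2 * \<mu> \<and>
    X \<in> sym_matrices \<and> Y \<in> sym_matrices \<and>
    (\<forall>h k. - (3 * \<alpha> + \<mu>) * ((norm h)\<^sup>2 + (norm k)\<^sup>2) \<le> h \<bullet> (X *v h) + k \<bullet> (Y *v k)) \<and>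
    (\<forall>h k. h \<bullet> (X *v h) + k \<bullet> (Y *v k) \<le> 3 * \<alpha> * (norm (h - k))\<^sup>2 + \<mu> * ((norm h)\<^sup>2 + (norm k)\<^sup>2)) \<and>
    (t' > 0 \<longrightarrow> a + l * (exp (- (l * t')) * u (t', x')) \<le> exp (- (l * t')) * F t' x' (u (t', x'))
      (exp (l * t') *\<^sub>R (p + (2 * \<delta>) *\<^sub>R x')) (exp (l * t') *\<^sub>R (X + (\<mu> + 2 * \<delta>) *\<^sub>R mat 1))) \<and>
    (s' > 0 \<longrightarrow> b + l * (exp (- (l * s')) * v (s', y')) \<le> exp (- (l * s')) * F' s' y' (v (s', y'))
      (exp (l * s') *\<^sub>R (q + (2 * \<delta>) *\<^sub>R y')) (exp (l * s') *\<^sub>R (Y + (\<mu> + 2 * \<delta>) *\<^sub>R mat 1)))"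
proof -
  have T0: "(0, 0) \<in> {0..T} \<times> (UNIV :: (real ^ 'n) set)" using T by auto
  have C0: "C \<ge> 0" using u(2)[OF T0] by linarith
  have R2: "\<delta> * R\<^sup>2 = 4 * C + 1" using C0 \<delta> by (simp add: R_def)
  have R0: "R \<ge> 0" unfolding R_def using C0 \<delta> by simp
  have pen: "penalised l \<delta> w (t, x) \<in> {- C - \<delta> * (norm x)\<^sup>2..C - \<delta> * (norm x)\<^sup>2}"
    if "t \<in> {0..T}" "\<bar>w (t, x)\<bar> \<le> C" for w t and x :: "real ^ 'n"
    using penalised_le[OF l, of t w x C] that by (simp add: penalised_def abs_le_iff)
  (* Outside the time interval the functions are continued by a value too low for the maximum. *)
  define ext where "ext w z = (if z \<in> {0..T} \<times> UNIV then penalised l \<delta> w z else - (4 * C + 3) - \<delta> * (norm (snd z))\<^sup>2)"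
    for w and z :: "real \<times> (real ^ 'n)"
  have ext_in: "ext w (t, x) = penalised l \<delta> w (t, x)" if "t \<in> {0..T}" for w t x using that by (simp add: ext_def)
  have ext_le: "ext w (t, x) \<le> C - \<delta> * (norm x)\<^sup>2" "t \<notin> {0..T} \<Longrightarrow> ext w (t, x) \<le> - (4 * C + 3)"
    if w: "\<And>z. z \<in> {0..T} \<times> UNIV \<Longrightarrow> \<bar>w z\<bar> \<le> C" for w t and x :: "real ^ 'n"
  proof -
    have d: "0 \<le> \<delta> * (norm x)\<^sup>2" using \<delta> by simp
    show "ext w (t, x) \<le> C - \<delta> * (norm x)\<^sup>2"
      using pen[of t w x] w[of "(t, x)"] C0 by (auto simp: ext_def)
    show "t \<notin> {0..T} \<Longrightarrow> ext w (t, x) \<le> - (4 * C + 3)" using d by (auto simp: ext_def)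
  qed
  have usc: "usc_on UNIV (ext w)"
    if w: "usc_on ({0..T} \<times> UNIV) w" "\<And>z. z \<in> {0..T} \<times> UNIV \<Longrightarrow> \<bar>w z\<bar> \<le> C" for w
    unfolding ext_def
  proof (rule usc_on_extend)
    show "usc_on ({0..T} \<times> UNIV) (penalised l \<delta> w)" by (rule usc_on_penalised[OF w(1)])
    show "closed ({0..T} \<times> (UNIV :: (real ^ 'n) set))" by (intro closed_Times) auto
    show "continuous_on UNIV (\<lambda>z :: real \<times> (real ^ 'n). - (4 * C + 3) - \<delta> * (norm (snd z))\<^sup>2)"
      by (intro continuous_intros)
    fix z :: "real \<times> (real ^ 'n)" assume "z \<in> {0..T} \<times> UNIV"
    then show "- (4 * C + 3) - \<delta> * (norm (snd z))\<^sup>2 \<le> penalised l \<delta> w z"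
      using pen[of "fst z" w "snd z"] w(2)[of z] C0 by (auto simp: mem_Times_iff)
  qed
  define f1 where "f1 \<zeta> = ext u (\<mu> * fst \<zeta>, snd \<zeta>)" for \<zeta>
  define g1 where "g1 \<zeta> = ext v (\<mu> * fst \<zeta>, snd \<zeta>)" for \<zeta>
  have usc1: "usc_on UNIV f1" "usc_on UNIV g1"
    unfolding f1_def g1_def
    by (rule usc_on_compose[OF usc[OF u(1,2)]] usc_on_compose[OF usc[OF v(1,2)]]; auto intro!: continuous_intros)+
  define K where "K = {0..T / \<mu>} \<times> cball (0 :: real ^ 'n) R"
  have K: "compact (K \<times> K)" unfolding K_def by (intro compact_Times) auto
  have K0: "0 \<in> K" using T \<mu> R0 by (simp add: K_def zero_prod_def)
  then have Kne: "K \<times> K \<noteq> {}" by blast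
  let ?J = "\<lambda>z. (f1 (fst z) + g1 (snd z)) + (- (\<alpha> / 2 * (norm (fst z - snd z))\<^sup>2))"
  have "usc_on (K \<times> K) ?J"
    by (intro usc_on_add usc_on_compose[OF usc1(1)] usc_on_compose[OF usc1(2)] usc_on_continuous)
      (auto intro!: continuous_intros)
  from usc_on_attains_sup[OF K Kne this]
  obtain \<zeta> \<omega> where z: "\<zeta> \<in> K" "\<omega> \<in> K" and zmax: "\<And>z. z \<in> K \<times> K \<Longrightarrow> ?J z \<le> ?J (\<zeta>, \<omega>)" by blast
  have "- C \<le> f1 0" "- C \<le> g1 0"
    using pen[of 0 u 0] pen[of 0 v 0] u(2)[OF T0] v(2)[OF T0] T by (auto simp: f1_def g1_def ext_in)
  moreover have "?J (0, 0) \<le> ?J (\<zeta>, \<omega>)" by (rule zmax) (use K0 in blast)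
  ultimately have Jge: "- 2 * C \<le> ?J (\<zeta>, \<omega>)" by simp
  have f1_le: "f1 z \<le> C" "g1 z \<le> C" for z
  proof -
    have "0 \<le> \<delta> * (norm (snd z))\<^sup>2" using \<delta> by simp
    then show "f1 z \<le> C" "g1 z \<le> C"
      using ext_le(1)[where w = u, OF u(2), of "\<mu> * fst z" "snd z"] ext_le(1)[where w = v, OF v(2), of "\<mu> * fst z" "snd z"]
      unfolding f1_def g1_def by linarith+
  qed
  have f1_out: "f1 z \<le> - 3 * C - 1" "g1 z \<le> - 3 * C - 1" if z: "z \<notin> K" for z
  proof -
    have "ext w (\<mu> * fst z, snd z) \<le> - 3 * C - 1"
      if w: "\<And>z. z \<in> {0..T} \<times> UNIV \<Longrightarrow> \<bar>w z\<bar> \<le> C" for w :: "real \<times> (real ^ 'n) \<Rightarrow> real"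
    proof (cases "\<mu> * fst z \<in> {0..T}")
      case True
      then have "fst z \<in> {0..T / \<mu>}" using \<mu> by (auto simp: field_simps zero_le_mult_iff)
      then have "norm (snd z) > R" using z by (auto simp: K_def mem_Times_iff)
      then have "R\<^sup>2 \<le> (norm (snd z))\<^sup>2" using R0 by (intro power_mono) auto
      then have "\<delta> * R\<^sup>2 \<le> \<delta> * (norm (snd z))\<^sup>2" using \<delta> by (intro mult_left_mono) auto
      then show ?thesis using ext_le(1)[where w = w and t = "\<mu> * fst z" and x = "snd z", OF w] R2 by linarith
    next
      case False
      then show ?thesis using ext_le(2)[where w = w and x = "snd z", OF w False] C0 by linarith
    qed
    from this[OF u(2)] this[OF v(2)] show "f1 z \<le> - 3 * C - 1" "g1 z \<le> - 3 * C - 1"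
      by (simp_all add: f1_def g1_def)
  qed
  have max: "f1 \<xi> + g1 \<eta> - \<alpha> / 2 * (norm (\<xi> - \<eta>))\<^sup>2 \<le> f1 \<zeta> + g1 \<omega> - \<alpha> / 2 * (norm (\<zeta> - \<omega>))\<^sup>2" for \<xi> \<eta>
  proof (cases "\<xi> \<in> K \<and> \<eta> \<in> K")
    case True
    then show ?thesis using zmax[of "(\<xi>, \<eta>)"] by simp
  next
    case False
    then have "f1 \<xi> + g1 \<eta> \<le> - 2 * C - 1"
      using f1_le(1)[of \<xi>] f1_le(2)[of \<eta>] f1_out(1)[of \<xi>] f1_out(2)[of \<eta>] by fastforce
    moreover have "0 \<le> \<alpha> / 2 * (norm (\<xi> - \<eta>))\<^sup>2" using \<alpha> by simp
    ultimately show ?thesis using Jge by simp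
  qed
  have \<mu>2: "\<mu>\<^sup>2 > 0" "\<mu>\<^sup>2 \<le> \<mu>" "\<mu> * \<mu>\<^sup>2 \<le> \<mu>"
    using \<mu> by (auto simp: power2_eq_square mult_left_le mult_le_one)
  obtain \<zeta>' \<omega>' p q L M where *: "norm (\<zeta>' - \<zeta>) < \<mu>\<^sup>2" "norm (\<omega>' - \<omega>) < \<mu>\<^sup>2"
    "norm (p - \<alpha> *\<^sub>R (\<zeta> - \<omega>)) < \<mu>\<^sup>2" "norm (q + \<alpha> *\<^sub>R (\<zeta> - \<omega>)) < \<mu>\<^sup>2" "f1 \<zeta>' + g1 \<omega>' > f1 \<zeta> + g1 \<omega> - \<mu>\<^sup>2"
    and L: "linear L" "\<forall>x y. L x \<bullet> y = x \<bullet> L y" and M: "linear M" "\<forall>x y. M x \<bullet> y = x \<bullet> M y"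
    and tu: "\<forall>\<^sub>F h in nhds 0. f1 (\<zeta>' + h) \<le> f1 \<zeta>' + p \<bullet> h + 1 / 2 * (h \<bullet> L h)"
    and tv: "\<forall>\<^sub>F h in nhds 0. g1 (\<omega>' + h) \<le> g1 \<omega>' + q \<bullet> h + 1 / 2 * (h \<bullet> M h)"
    and LM: "\<forall>h k. - (3 * \<alpha> + \<mu>\<^sup>2) * ((norm h)\<^sup>2 + (norm k)\<^sup>2) \<le> h \<bullet> L h + k \<bullet> M k \<and>
      h \<bullet> L h + k \<bullet> M k \<le> 3 * \<alpha> * (norm (h - k))\<^sup>2 + \<mu>\<^sup>2 * ((norm h)\<^sup>2 + (norm k)\<^sup>2)"
    using theorem_on_sums[OF usc1 \<alpha> \<mu>2(1) max] by blast
  define t where "t = \<mu> * fst \<zeta>"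
  define s where "s = \<mu> * fst \<omega>"
  define t' where "t' = \<mu> * fst \<zeta>'"
  define s' where "s' = \<mu> * fst \<omega>'"
  define X where "X = matrix (\<lambda>h. snd (L (0, h)))"
  define Y where "Y = matrix (\<lambda>h. snd (M (0, h)))"
  have ts: "t \<in> {0..T}" "s \<in> {0..T}" and xy: "norm (snd \<zeta>) \<le> R" "norm (snd \<omega>) \<le> R"
    using z \<mu> by (auto simp: K_def t_def s_def mem_Times_iff field_simps)
  have f1t: "f1 \<zeta> = f (t, snd \<zeta>)" "g1 \<omega> = g (s, snd \<omega>)"
    using ts by (simp_all add: f1_def g1_def f_def g_def t_def[symmetric] s_def[symmetric] ext_in)
  have pen_nn: "0 \<le> \<alpha> / 2 * (norm (\<zeta> - \<omega>))\<^sup>2" using \<alpha> by simp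
  have \<mu>le1: "\<mu>\<^sup>2 \<le> 1" using \<mu>2(2) \<mu>(2) by linarith
  have inT: "t' \<in> {0..T}" "s' \<in> {0..T}"
  proof -
    have *: "- 2 * C - 1 < f1 \<zeta>' + g1 \<omega>'" using *(5) Jge pen_nn \<mu>le1 by simp
    show "t' \<in> {0..T}"
    proof (rule ccontr)
      assume nt: "t' \<notin> {0..T}"
      have "f1 \<zeta>' \<le> - (4 * C + 3)"
        using ext_le(2)[where w = u and x = "snd \<zeta>'", OF u(2) nt] by (simp add: f1_def t'_def)
      then show False using * f1_le(2)[of \<omega>'] C0 by linarith
    qed
    show "s' \<in> {0..T}"
    proof (rule ccontr)
      assume nt: "s' \<notin> {0..T}"
      have "g1 \<omega>' \<le> - (4 * C + 3)"
        using ext_le(2)[where w = v and x = "snd \<omega>'", OF v(2) nt] by (simp add: g1_def s'_def)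
      then show False using * f1_le(1)[of \<zeta>'] C0 by linarith
    qed
  qed
  have f1t': "f1 \<zeta>' = f (t', snd \<zeta>')" "g1 \<omega>' = g (s', snd \<omega>')"
    using inT by (simp_all add: f1_def g1_def f_def g_def t'_def[symmetric] s'_def[symmetric] ext_in)
  have comp: "\<bar>fst w\<bar> \<le> norm w" "norm (snd w) \<le> norm w" for w :: "real \<times> (real ^ 'n)"
    using norm_fst_le[of "fst w" "snd w"] norm_snd_le[of "snd w" "fst w"] by simp_all
  have "\<bar>fst p - \<alpha> * (fst \<zeta> - fst \<omega>)\<bar> \<le> \<mu>\<^sup>2" "\<bar>fst q + \<alpha> * (fst \<zeta> - fst \<omega>)\<bar> \<le> \<mu>\<^sup>2"
    using comp(1)[of "p - \<alpha> *\<^sub>R (\<zeta> - \<omega>)"] comp(1)[of "q + \<alpha> *\<^sub>R (\<zeta> - \<omega>)"] *(3,4) by simp_all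
  then have "\<bar>fst p + fst q\<bar> \<le> 2 * \<mu>\<^sup>2" by linarith
  then have "\<bar>fst p + fst q\<bar> / \<mu> \<le> 2 * \<mu>\<^sup>2 / \<mu>" using \<mu> by (intro divide_right_mono) auto
  then have ab: "\<bar>fst p / \<mu> + fst q / \<mu>\<bar> \<le> 2 * \<mu>"
    using \<mu> by (simp add: add_divide_distrib[symmetric] power2_eq_square)
  have XYv: "X *v h = snd (L (0, h))" "Y *v h = snd (M (0, h))" for h
    using spatial_block(1)[OF L(1) L(2)[rule_format] X_def] spatial_block(1)[OF M(1) M(2)[rule_format] Y_def] by auto
  have XYsym: "X \<in> sym_matrices" "Y \<in> sym_matrices"
    by (rule spatial_block(2)[OF L(1) L(2)[rule_format] X_def] spatial_block(2)[OF M(1) M(2)[rule_format] Y_def])+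
  have bounds: "- (3 * \<alpha> + \<mu>) * ((norm h)\<^sup>2 + (norm k)\<^sup>2) \<le> h \<bullet> (X *v h) + k \<bullet> (Y *v k)"
    "h \<bullet> (X *v h) + k \<bullet> (Y *v k) \<le> 3 * \<alpha> * (norm (h - k))\<^sup>2 + \<mu> * ((norm h)\<^sup>2 + (norm k)\<^sup>2)" for h k
  proof -
    have m: "\<mu>\<^sup>2 * ((norm h)\<^sup>2 + (norm k)\<^sup>2) \<le> \<mu> * ((norm h)\<^sup>2 + (norm k)\<^sup>2)"
      using \<mu>2(2) by (intro mult_right_mono) auto
    have "- (3 * \<alpha> + \<mu>\<^sup>2) * ((norm h)\<^sup>2 + (norm k)\<^sup>2) \<le> h \<bullet> (X *v h) + k \<bullet> (Y *v k)"
      "h \<bullet> (X *v h) + k \<bullet> (Y *v k) \<le> 3 * \<alpha> * (norm (h - k))\<^sup>2 + \<mu>\<^sup>2 * ((norm h)\<^sup>2 + (norm k)\<^sup>2)"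
      using LM[rule_format, of "(0, h)" "(0, k)"] by (simp_all add: XYv inner_prod_def norm_Pair)
    then show "- (3 * \<alpha> + \<mu>) * ((norm h)\<^sup>2 + (norm k)\<^sup>2) \<le> h \<bullet> (X *v h) + k \<bullet> (Y *v k)"
      "h \<bullet> (X *v h) + k \<bullet> (Y *v k) \<le> 3 * \<alpha> * (norm (h - k))\<^sup>2 + \<mu> * ((norm h)\<^sup>2 + (norm k)\<^sup>2)"
      using m by (simp_all add: algebra_simps)
  qed
  have pde_u: "fst p / \<mu> + l * (exp (- (l * t')) * u (t', snd \<zeta>')) \<le> exp (- (l * t')) * F t' (snd \<zeta>') (u (t', snd \<zeta>'))
      (exp (l * t') *\<^sub>R (snd p + (2 * \<delta>) *\<^sub>R snd \<zeta>')) (exp (l * t') *\<^sub>R (X + (\<mu> + 2 * \<delta>) *\<^sub>R mat 1))" if "t' > 0"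
  proof (rule touching_inequality[OF u(3) _ L(1) _ \<mu>(1) \<mu>(1) _ t'_def _ X_def])
    show "ext u (t, x) = penalised l \<delta> u (t, x)" if "t \<in> {0..T}" for t x using that by (rule ext_in)
    show "L x \<bullet> y = x \<bullet> L y" for x y using L(2) by blast
    show "\<forall>\<^sub>F h in nhds 0. ext u (\<mu> * (fst \<zeta>' + fst h), snd \<zeta>' + snd h)
        \<le> ext u (\<mu> * fst \<zeta>', snd \<zeta>') + p \<bullet> h + 1 / 2 * (h \<bullet> L h)"
      using tu by (simp add: f1_def)
    show "t' \<in> {0<..T}" using inT(1) that by simp
  qed
  have pde_v: "fst q / \<mu> + l * (exp (- (l * s')) * v (s', snd \<omega>')) \<le> exp (- (l * s')) * F' s' (snd \<omega>') (v (s', snd \<omega>'))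
      (exp (l * s') *\<^sub>R (snd q + (2 * \<delta>) *\<^sub>R snd \<omega>')) (exp (l * s') *\<^sub>R (Y + (\<mu> + 2 * \<delta>) *\<^sub>R mat 1))" if "s' > 0"
  proof (rule touching_inequality[OF v(3) _ M(1) _ \<mu>(1) \<mu>(1) _ s'_def _ Y_def])
    show "ext v (t, x) = penalised l \<delta> v (t, x)" if "t \<in> {0..T}" for t x using that by (rule ext_in)
    show "M x \<bullet> y = x \<bullet> M y" for x y using M(2) by blast
    show "\<forall>\<^sub>F h in nhds 0. ext v (\<mu> * (fst \<omega>' + fst h), snd \<omega>' + snd h)
        \<le> ext v (\<mu> * fst \<omega>', snd \<omega>') + q \<bullet> h + 1 / 2 * (h \<bullet> M h)"
      using tv by (simp add: g1_def)
    show "s' \<in> {0<..T}" using inT(2) that by simp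
  qed
  have maxT: "f (r, \<xi>) + g (r, \<eta>) - \<alpha> / 2 * (norm (\<xi> - \<eta>))\<^sup>2
      \<le> f (t, snd \<zeta>) + g (s, snd \<omega>) - \<alpha> / 2 * (norm (snd \<zeta> - snd \<omega>))\<^sup>2 - \<alpha> / (2 * \<mu>\<^sup>2) * (t - s)\<^sup>2"
    if r: "r \<in> {0..T}" for r \<xi> \<eta>
  proof -
    have "f1 (r / \<mu>, \<xi>) = f (r, \<xi>)" "g1 (r / \<mu>, \<eta>) = g (r, \<eta>)"
      using \<mu> r by (simp_all add: f1_def g1_def ext_in f_def g_def)
    moreover have "\<alpha> / 2 * (norm ((r / \<mu>, \<xi>) - (r / \<mu>, \<eta>)))\<^sup>2 = \<alpha> / 2 * (norm (\<xi> - \<eta>))\<^sup>2"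
      by (simp add: norm_Pair)
    moreover have "\<alpha> / 2 * (norm (\<zeta> - \<omega>))\<^sup>2 = \<alpha> / 2 * (norm (snd \<zeta> - snd \<omega>))\<^sup>2 + \<alpha> / (2 * \<mu>\<^sup>2) * (t - s)\<^sup>2"
    proof -
      have "\<alpha> / (2 * \<mu>\<^sup>2) * (t - s)\<^sup>2 = \<alpha> / 2 * (fst \<zeta> - fst \<omega>)\<^sup>2"
        using \<mu> by (simp add: t_def s_def right_diff_distrib[symmetric] power_mult_distrib)
      then show ?thesis by (simp add: norm_prod_power2 distrib_left)
    qed
    ultimately show ?thesis using max[of "(r / \<mu>, \<xi>)" "(r / \<mu>, \<eta>)"] unfolding f1t by linarith
  qed
  have td: "\<bar>t' - t\<bar> \<le> \<mu>" "\<bar>s' - s\<bar> \<le> \<mu>"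
  proof -
    have "\<mu> * \<bar>fst (\<zeta>' - \<zeta>)\<bar> \<le> \<mu> * \<mu>\<^sup>2" "\<mu> * \<bar>fst (\<omega>' - \<omega>)\<bar> \<le> \<mu> * \<mu>\<^sup>2"
      using comp(1)[of "\<zeta>' - \<zeta>"] comp(1)[of "\<omega>' - \<omega>"] *(1,2) \<mu>(1) by (auto intro!: mult_left_mono)
    moreover have "\<bar>t' - t\<bar> = \<mu> * \<bar>fst (\<zeta>' - \<zeta>)\<bar>" "\<bar>s' - s\<bar> = \<mu> * \<bar>fst (\<omega>' - \<omega>)\<bar>"
      using \<mu>(1) by (simp_all add: t_def t'_def s_def s'_def right_diff_distrib[symmetric] abs_mult)
    ultimately show "\<bar>t' - t\<bar> \<le> \<mu>" "\<bar>s' - s\<bar> \<le> \<mu>" using \<mu>2(3) by linarith+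
  qed
  have xd: "norm (snd \<zeta>' - snd \<zeta>) \<le> \<mu>" "norm (snd \<omega>' - snd \<omega>) \<le> \<mu>"
    "norm (snd p - \<alpha> *\<^sub>R (snd \<zeta> - snd \<omega>)) \<le> \<mu>" "norm (snd q - \<alpha> *\<^sub>R (snd \<omega> - snd \<zeta>)) \<le> \<mu>"
    using comp(2)[of "\<zeta>' - \<zeta>"] comp(2)[of "\<omega>' - \<omega>"] comp(2)[of "p - \<alpha> *\<^sub>R (\<zeta> - \<omega>)"]
      comp(2)[of "q + \<alpha> *\<^sub>R (\<zeta> - \<omega>)"] *(1-4) \<mu>2(2) by (simp_all add: algebra_simps)
  have val: "f (t, snd \<zeta>) + g (s, snd \<omega>) - \<mu> \<le> f (t', snd \<zeta>') + g (s', snd \<omega>')"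
    using *(5) \<mu>2(2) unfolding f1t f1t' by linarith
  show ?thesis
    by (rule exI[of _ t], rule exI[of _ "snd \<zeta>"], rule exI[of _ s], rule exI[of _ "snd \<omega>"],
        rule exI[of _ t'], rule exI[of _ "snd \<zeta>'"], rule exI[of _ s'], rule exI[of _ "snd \<omega>'"],
        rule exI[of _ "snd p"], rule exI[of _ "snd q"], rule exI[of _ "fst p / \<mu>"], rule exI[of _ "fst q / \<mu>"],
        rule exI[of _ X], rule exI[of _ Y])
      (intro conjI ballI allI impI ts xy maxT inT td xd val ab XYsym bounds pde_u pde_v)
qed

lemma tendsto_matrix_vector:
  fixes X :: "'a \<Rightarrow> real ^ 'n ^ 'm"
  assumes "(X \<longlongrightarrow> X0) A"
  shows "((\<lambda>n. X n *v h) \<longlongrightarrow> X0 *v h) A"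
  unfolding matrix_vector_mult_def by (intro tendsto_intros assms)

lemma sym_matrices_shift: "X \<in> sym_matrices \<Longrightarrow> e *\<^sub>R (X + c *\<^sub>R mat 1) \<in> sym_matrices"
  by (auto simp: sym_matrices_def transpose_def vec_eq_iff mat_def)

text \<open>
  Neither of two sequences with given asymptotic upper bounds can fall below its bound if their sum
  does not.
\<close>

lemma tendsto_of_split_bounds:
  fixes f g :: "nat \<Rightarrow> real"
  assumes f: "\<And>e. e > 0 \<Longrightarrow> \<forall>\<^sub>F n in sequentially. f n < F + e"
    and g: "\<And>e. e > 0 \<Longrightarrow> \<forall>\<^sub>F n in sequentially. g n < G + e"
    and d: "d \<longlonglongrightarrow> F + G" "\<And>n. d n \<le> f n + g n"
  shows "f \<longlonglongrightarrow> F"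
proof (rule tendstoI)
  fix e :: real assume e: "e > 0"
  have "\<forall>\<^sub>F n in sequentially. F + G - e / 2 < d n"
    using d(1) e by (intro order_tendstoD(1)[OF d(1)]) simp
  moreover have "\<forall>\<^sub>F n in sequentially. f n < F + e" using f[OF e] .
  moreover have "\<forall>\<^sub>F n in sequentially. g n < G + e / 2" using g[of "e / 2"] e by simp
  ultimately show "\<forall>\<^sub>F n in sequentially. dist (f n) F < e"
  proof eventually_elim
    case (elim n)
    then show ?case using d(2)[of n] by (auto simp: dist_real_def)
  qed
qed

text \<open>
  As the rescaling parameter tends to \<open>0\<close> the two times merge. Semicontinuity forces the values at
  the touching points to converge to the values at the limit point, since their sum is at least the
  maximum; so the inequality survives in the limit.
\<close>

lemma equal_time_maximum:
  fixes u v :: "real \<times> (real ^ 'n) \<Rightarrow> real"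
  assumes T: "T > 0" and l: "l \<ge> 0" and \<alpha>: "\<alpha> > 0" and \<delta>: "\<delta> > 0"
    and u: "usc_on ({0..T} \<times> UNIV) u" "\<And>w. w \<in> {0..T} \<times> UNIV \<Longrightarrow> \<bar>u w\<bar> \<le> C"
      "viscosity_subsolution F ({0<..T} \<times> UNIV) u"
    and v: "usc_on ({0..T} \<times> UNIV) v" "\<And>w. w \<in> {0..T} \<times> UNIV \<Longrightarrow> \<bar>v w\<bar> \<le> C"
      "viscosity_subsolution F' ({0<..T} \<times> UNIV) v"
    and F: "continuous_on ({0..T} \<times> UNIV \<times> UNIV \<times> UNIV \<times> sym_matrices) (\<lambda>(t, x, u, p, X). F t x u p X)"
    and F': "continuous_on ({0..T} \<times> UNIV \<times> UNIV \<times> UNIV \<times> sym_matrices) (\<lambda>(t, x, u, p, X). F' t x u p X)"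
  defines "f \<equiv> penalised l \<delta> u" and "g \<equiv> penalised l \<delta> v"
  shows "\<exists>t x y. t \<in> {0..T} \<and>
    (\<forall>r\<in>{0..T}. \<forall>\<xi> \<eta>. f (r, \<xi>) + g (r, \<eta>) - \<alpha> / 2 * (norm (\<xi> - \<eta>))\<^sup>2
      \<le> f (t, x) + g (t, y) - \<alpha> / 2 * (norm (x - y))\<^sup>2) \<and>
    (t > 0 \<longrightarrow> (\<exists>X Y. X \<in> sym_matrices \<and> Y \<in> sym_matrices \<and>
      (\<forall>h k. - (3 * \<alpha>) * ((norm h)\<^sup>2 + (norm k)\<^sup>2) \<le> h \<bullet> (X *v h) + k \<bullet> (Y *v k)) \<and>
      (\<forall>h k. h \<bullet> (X *v h) + k \<bullet> (Y *v k) \<le> 3 * \<alpha> * (norm (h - k))\<^sup>2) \<and>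
      l * (exp (- (l * t)) * u (t, x) + exp (- (l * t)) * v (t, y)) \<le>
        exp (- (l * t)) * F t x (u (t, x)) (exp (l * t) *\<^sub>R (\<alpha> *\<^sub>R (x - y) + (2 * \<delta>) *\<^sub>R x)) (exp (l * t) *\<^sub>R (X + (2 * \<delta>) *\<^sub>R mat 1)) +
        exp (- (l * t)) * F' t y (v (t, y)) (exp (l * t) *\<^sub>R (\<alpha> *\<^sub>R (y - x) + (2 * \<delta>) *\<^sub>R y)) (exp (l * t) *\<^sub>R (Y + (2 * \<delta>) *\<^sub>R mat 1))))"
proof -
  define \<mu> where "\<mu> n = 1 / real (Suc n)" for n
  have \<mu>: "0 < \<mu> n" "\<mu> n \<le> 1" for n by (auto simp: \<mu>_def)
  have \<mu>lim: "\<mu> \<longlonglongrightarrow> 0" unfolding \<mu>_def by (rule LIMSEQ_Suc[OF lim_1_over_n])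
  define R where "R = sqrt ((4 * C + 1) / \<delta>)"
  note ex = doubled_time_touching[OF T l \<alpha> \<delta> \<mu> u v, folded f_def g_def R_def]
  from ex have "\<forall>n. \<exists>t x s y t' x' s' y' p q a b X Y.
    t \<in> {0..T} \<and> s \<in> {0..T} \<and> norm x \<le> R \<and> norm y \<le> R \<and>
    (\<forall>r\<in>{0..T}. \<forall>\<xi> \<eta>. f (r, \<xi>) + g (r, \<eta>) - \<alpha> / 2 * (norm (\<xi> - \<eta>))\<^sup>2
      \<le> f (t, x) + g (s, y) - \<alpha> / 2 * (norm (x - y))\<^sup>2 - \<alpha> / (2 * (\<mu> n)\<^sup>2) * (t - s)\<^sup>2) \<and>
    t' \<in> {0..T} \<and> s' \<in> {0..T} \<and> \<bar>t' - t\<bar> \<le> \<mu> n \<and> \<bar>s' - s\<bar> \<le> \<mu> n \<and> norm (x' - x) \<le> \<mu> n \<and> norm (y' - y) \<le> \<mu> n \<and>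
    f (t, x) + g (s, y) - \<mu> n \<le> f (t', x') + g (s', y') \<and>
    norm (p - \<alpha> *\<^sub>R (x - y)) \<le> \<mu> n \<and> norm (q - \<alpha> *\<^sub>R (y - x)) \<le> \<mu> n \<and> \<bar>a + b\<bar> \<le> 2 * \<mu> n \<and>
    X \<in> sym_matrices \<and> Y \<in> sym_matrices \<and>
    (\<forall>h k. - (3 * \<alpha> + \<mu> n) * ((norm h)\<^sup>2 + (norm k)\<^sup>2) \<le> h \<bullet> (X *v h) + k \<bullet> (Y *v k)) \<and>
    (\<forall>h k. h \<bullet> (X *v h) + k \<bullet> (Y *v k) \<le> 3 * \<alpha> * (norm (h - k))\<^sup>2 + \<mu> n * ((norm h)\<^sup>2 + (norm k)\<^sup>2)) \<and>
    (t' > 0 \<longrightarrow> a + l * (exp (- (l * t')) * u (t', x')) \<le> exp (- (l * t')) * F t' x' (u (t', x'))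
      (exp (l * t') *\<^sub>R (p + (2 * \<delta>) *\<^sub>R x')) (exp (l * t') *\<^sub>R (X + (\<mu> n + 2 * \<delta>) *\<^sub>R mat 1))) \<and>
    (s' > 0 \<longrightarrow> b + l * (exp (- (l * s')) * v (s', y')) \<le> exp (- (l * s')) * F' s' y' (v (s', y'))
      (exp (l * s') *\<^sub>R (q + (2 * \<delta>) *\<^sub>R y')) (exp (l * s') *\<^sub>R (Y + (\<mu> n + 2 * \<delta>) *\<^sub>R mat 1)))"
    by (intro allI)
  then obtain t x s y t' x' s' y' p q a b X Y where S: "\<forall>n.
    t n \<in> {0..T} \<and> s n \<in> {0..T} \<and> norm (x n) \<le> R \<and> norm (y n) \<le> R \<and>
    (\<forall>r\<in>{0..T}. \<forall>\<xi> \<eta>. f (r, \<xi>) + g (r, \<eta>) - \<alpha> / 2 * (norm (\<xi> - \<eta>))\<^sup>2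
      \<le> f (t n, x n) + g (s n, y n) - \<alpha> / 2 * (norm (x n - y n))\<^sup>2 - \<alpha> / (2 * (\<mu> n)\<^sup>2) * (t n - s n)\<^sup>2) \<and>
    t' n \<in> {0..T} \<and> s' n \<in> {0..T} \<and> \<bar>t' n - t n\<bar> \<le> \<mu> n \<and> \<bar>s' n - s n\<bar> \<le> \<mu> n \<and> norm (x' n - x n) \<le> \<mu> n \<and> norm (y' n - y n) \<le> \<mu> n \<and>
    f (t n, x n) + g (s n, y n) - \<mu> n \<le> f (t' n, x' n) + g (s' n, y' n) \<and>
    norm (p n - \<alpha> *\<^sub>R (x n - y n)) \<le> \<mu> n \<and> norm (q n - \<alpha> *\<^sub>R (y n - x n)) \<le> \<mu> n \<and> \<bar>a n + b n\<bar> \<le> 2 * \<mu> n \<and>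
    X n \<in> sym_matrices \<and> Y n \<in> sym_matrices \<and>
    (\<forall>h k. - (3 * \<alpha> + \<mu> n) * ((norm h)\<^sup>2 + (norm k)\<^sup>2) \<le> h \<bullet> (X n *v h) + k \<bullet> (Y n *v k)) \<and>
    (\<forall>h k. h \<bullet> (X n *v h) + k \<bullet> (Y n *v k) \<le> 3 * \<alpha> * (norm (h - k))\<^sup>2 + \<mu> n * ((norm h)\<^sup>2 + (norm k)\<^sup>2)) \<and>
    (t' n > 0 \<longrightarrow> a n + l * (exp (- (l * t' n)) * u (t' n, x' n)) \<le> exp (- (l * t' n)) * F (t' n) (x' n) (u (t' n, x' n))
      (exp (l * t' n) *\<^sub>R (p n + (2 * \<delta>) *\<^sub>R x' n)) (exp (l * t' n) *\<^sub>R (X n + (\<mu> n + 2 * \<delta>) *\<^sub>R mat 1))) \<and>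
    (s' n > 0 \<longrightarrow> b n + l * (exp (- (l * s' n)) * v (s' n, y' n)) \<le> exp (- (l * s' n)) * F' (s' n) (y' n) (v (s' n, y' n))
      (exp (l * s' n) *\<^sub>R (q n + (2 * \<delta>) *\<^sub>R y' n)) (exp (l * s' n) *\<^sub>R (Y n + (\<mu> n + 2 * \<delta>) *\<^sub>R mat 1)))"
    unfolding choice_iff by (elim exE) (rule that)
  note c = spec[OF S]
  note tS = conjunct1[OF c] note c = conjunct2[OF c]
  note sS = conjunct1[OF c] note c = conjunct2[OF c]
  note xR = conjunct1[OF c] note c = conjunct2[OF c]
  note yR = conjunct1[OF c] note c = conjunct2[OF c]
  note max = conjunct1[OF c, rule_format] note c = conjunct2[OF c]
  note t'S = conjunct1[OF c] note c = conjunct2[OF c]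
  note s'S = conjunct1[OF c] note c = conjunct2[OF c]
  note td = conjunct1[OF c] note c = conjunct2[OF c]
  note sd = conjunct1[OF c] note c = conjunct2[OF c]
  note xd = conjunct1[OF c] note c = conjunct2[OF c]
  note yd = conjunct1[OF c] note c = conjunct2[OF c]
  note val = conjunct1[OF c] note c = conjunct2[OF c]
  note pd = conjunct1[OF c] note c = conjunct2[OF c]
  note qd = conjunct1[OF c] note c = conjunct2[OF c]
  note ab = conjunct1[OF c] note c = conjunct2[OF c]
  note Xs = conjunct1[OF c] note c = conjunct2[OF c]
  note Ys = conjunct1[OF c] note c = conjunct2[OF c]
  note lo = conjunct1[OF c, rule_format] note c = conjunct2[OF c]
  note hi = conjunct1[OF c, rule_format] note c = conjunct2[OF c]
  note pu = conjunct1[OF c, rule_format] note pv = conjunct2[OF c, rule_format]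
  define B where "B = real CARD('n) * real CARD('n) * (3 * \<alpha> + 1)"
  have XB: "norm (X n) \<le> B" "norm (Y n) \<le> B" for n
  proof -
    have m: "\<mu> n * (norm h)\<^sup>2 \<le> (norm h)\<^sup>2" for h :: "real ^ 'n"
      using mult_right_mono[OF \<mu>(2)[of n], of "(norm h)\<^sup>2"] by simp
    show "norm (X n) \<le> B"
      unfolding B_def
    proof (rule sym_matrix_norm_le[OF Xs])
      show "\<bar>h \<bullet> (X n *v h)\<bar> \<le> (3 * \<alpha> + 1) * (norm h)\<^sup>2" for h
        using lo[of n h 0] hi[of h n 0] m[of h] by (simp add: abs_le_iff algebra_simps)
    qed
    show "norm (Y n) \<le> B"
      unfolding B_def
    proof (rule sym_matrix_norm_le[OF Ys])
      show "\<bar>h \<bullet> (Y n *v h)\<bar> \<le> (3 * \<alpha> + 1) * (norm h)\<^sup>2" for h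
        using lo[of n 0 h] hi[of 0 n h] m[of h] by (simp add: abs_le_iff algebra_simps)
    qed
  qed
  let ?K = "{0..T} \<times> cball (0 :: real ^ 'n) R \<times> {0..T} \<times> cball (0 :: real ^ 'n) R \<times>
    cball (0 :: real ^ 'n ^ 'n) B \<times> cball (0 :: real ^ 'n ^ 'n) B"
  have "seq_compact ?K" by (intro compact_imp_seq_compact compact_Times) auto
  moreover have "\<forall>n. (t n, x n, s n, y n, X n, Y n) \<in> ?K" using tS sS xR yR XB by simp
  ultimately obtain z \<sigma> where "z \<in> ?K" and \<sigma>: "strict_mono \<sigma>"
    and zlim: "((\<lambda>n. (t n, x n, s n, y n, X n, Y n)) \<circ> \<sigma>) \<longlonglongrightarrow> z"
    by (rule seq_compactE)
  then obtain t0 x0 s0 y0 X0 Y0 where z: "z = (t0, x0, s0, y0, X0, Y0)" and t0: "t0 \<in> {0..T}" by auto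
  have tl: "(\<lambda>n. t (\<sigma> n)) \<longlonglongrightarrow> t0"
    using tendsto_fst[OF zlim] by (simp add: z comp_def)
  have xl: "(\<lambda>n. x (\<sigma> n)) \<longlonglongrightarrow> x0"
    using tendsto_fst[OF tendsto_snd[OF zlim]] by (simp add: z comp_def)
  have sl: "(\<lambda>n. s (\<sigma> n)) \<longlonglongrightarrow> s0"
    using tendsto_fst[OF tendsto_snd[OF tendsto_snd[OF zlim]]] by (simp add: z comp_def)
  have yl: "(\<lambda>n. y (\<sigma> n)) \<longlonglongrightarrow> y0"
    using tendsto_fst[OF tendsto_snd[OF tendsto_snd[OF tendsto_snd[OF zlim]]]] by (simp add: z comp_def)
  have Xl: "(\<lambda>n. X (\<sigma> n)) \<longlonglongrightarrow> X0"
    using tendsto_fst[OF tendsto_snd[OF tendsto_snd[OF tendsto_snd[OF tendsto_snd[OF zlim]]]]] by (simp add: z comp_def)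
  have Yl: "(\<lambda>n. Y (\<sigma> n)) \<longlonglongrightarrow> Y0"
    using tendsto_snd[OF tendsto_snd[OF tendsto_snd[OF tendsto_snd[OF tendsto_snd[OF zlim]]]]] by (simp add: z comp_def)
  have ml: "(\<lambda>n. \<mu> (\<sigma> n)) \<longlonglongrightarrow> 0" using LIMSEQ_subseq_LIMSEQ[OF \<mu>lim \<sigma>] by (simp add: comp_def)
  have near: "(\<lambda>n. w' (\<sigma> n)) \<longlonglongrightarrow> w0" if "\<And>n. norm (w' n - w n) \<le> \<mu> n" "(\<lambda>n. w (\<sigma> n)) \<longlonglongrightarrow> w0"
    for w w' :: "nat \<Rightarrow> 'b::real_normed_vector" and w0
  proof -
    have "(\<lambda>n. w' (\<sigma> n) - w (\<sigma> n)) \<longlonglongrightarrow> 0"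
      by (rule Lim_null_comparison[OF _ ml]) (use that(1) in \<open>auto intro: always_eventually\<close>)
    from tendsto_add[OF this that(2)] show ?thesis by simp
  qed
  have fC: "f (r, \<xi>) \<le> C" "g (r, \<xi>) \<le> C" "- C \<le> f (r, 0)" "- C \<le> g (r, 0)" if r: "r \<in> {0..T}" for r \<xi>
  proof -
    have d: "0 \<le> \<delta> * (norm \<xi>)\<^sup>2" using \<delta> by simp
    have r0: "0 \<le> r" using r by simp
    have in_dom: "(r, x) \<in> {0..T} \<times> UNIV" for x :: "real ^ 'n" using r by simp
    have pu: "\<bar>exp (- (l * r)) * u (r, x)\<bar> \<le> C" for x using penalised_le[where u = u and x = x, OF l r0] u(2)[OF in_dom] by blast
    have pv: "\<bar>exp (- (l * r)) * v (r, x)\<bar> \<le> C" for x using penalised_le[where u = v and x = x, OF l r0] v(2)[OF in_dom] by blast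
    show "f (r, \<xi>) \<le> C" "g (r, \<xi>) \<le> C" "- C \<le> f (r, 0)" "- C \<le> g (r, 0)"
      using d pu[of \<xi>] pv[of \<xi>] pu[of 0] pv[of 0] by (simp_all add: f_def g_def penalised_def abs_le_iff)
  qed
  have ts: "\<bar>t n - s n\<bar> \<le> sqrt (8 * C / \<alpha>) * \<mu> n" for n
  proof -
    have "f (0, 0) + g (0, 0) \<le> f (t n, x n) + g (s n, y n) - \<alpha> / 2 * (norm (x n - y n))\<^sup>2 - \<alpha> / (2 * (\<mu> n)\<^sup>2) * (t n - s n)\<^sup>2"
      using max[of 0 0 0 n] T by simp
    moreover have "0 \<le> \<alpha> / 2 * (norm (x n - y n))\<^sup>2" using \<alpha> by simp
    moreover have "- C \<le> f (0, 0)" "- C \<le> g (0, 0)" using T by (auto intro: fC)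
    ultimately have "\<alpha> / (2 * (\<mu> n)\<^sup>2) * (t n - s n)\<^sup>2 \<le> 4 * C"
      using fC(1)[OF tS, of n "x n"] fC(2)[OF sS, of n "y n"] by linarith
    then have "(t n - s n)\<^sup>2 \<le> 8 * C / \<alpha> * (\<mu> n)\<^sup>2" using \<alpha> \<mu>(1)[of n] by (simp add: field_simps)
    then have "sqrt ((t n - s n)\<^sup>2) \<le> sqrt (8 * C / \<alpha> * (\<mu> n)\<^sup>2)" by (rule real_sqrt_le_mono)
    then show ?thesis using \<mu>(1)[of n] unfolding real_sqrt_mult real_sqrt_abs by simp
  qed
  have "(\<lambda>n. sqrt (8 * C / \<alpha>) * \<mu> (\<sigma> n)) \<longlonglongrightarrow> sqrt (8 * C / \<alpha>) * 0" by (intro tendsto_intros ml)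
  then have "(\<lambda>n. sqrt (8 * C / \<alpha>) * \<mu> (\<sigma> n)) \<longlonglongrightarrow> 0" by simp
  then have "(\<lambda>n. t (\<sigma> n) - s (\<sigma> n)) \<longlonglongrightarrow> 0"
    by (rule Lim_null_comparison[rotated]) (use ts in \<open>auto intro: always_eventually\<close>)
  from tendsto_diff[OF tl this] have "(\<lambda>n. s (\<sigma> n)) \<longlonglongrightarrow> t0" by simp
  then have s0: "s0 = t0" using sl LIMSEQ_unique by blast
  have t'l: "(\<lambda>n. t' (\<sigma> n)) \<longlonglongrightarrow> t0" by (rule near[OF _ tl]) (use td in simp)
  have s'l: "(\<lambda>n. s' (\<sigma> n)) \<longlonglongrightarrow> t0" by (rule near[OF _ sl[unfolded s0]]) (use sd in simp)
  have x'l: "(\<lambda>n. x' (\<sigma> n)) \<longlonglongrightarrow> x0" by (rule near[OF _ xl]) (use xd in simp)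
  have y'l: "(\<lambda>n. y' (\<sigma> n)) \<longlonglongrightarrow> y0" by (rule near[OF _ yl]) (use yd in simp)
  have ul: "(\<lambda>n. (t' (\<sigma> n), x' (\<sigma> n))) \<longlonglongrightarrow> (t0, x0)" "(\<lambda>n. (s' (\<sigma> n), y' (\<sigma> n))) \<longlonglongrightarrow> (t0, y0)"
    by (intro tendsto_Pair t'l x'l s'l y'l)+
  have fe: "\<forall>\<^sub>F n in sequentially. f (t' (\<sigma> n), x' (\<sigma> n)) < f (t0, x0) + e"
    "\<forall>\<^sub>F n in sequentially. g (s' (\<sigma> n), y' (\<sigma> n)) < g (t0, y0) + e" if "e > 0" for e
    unfolding f_def g_def
    by (rule usc_on_sequentially[OF usc_on_penalised[OF u(1)] _ _ ul(1)] usc_on_sequentially[OF usc_on_penalised[OF v(1)] _ _ ul(2)];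
        use that t0 t'S s'S in auto)+
  have J: "f (r, \<xi>) + g (r, \<eta>) - \<alpha> / 2 * (norm (\<xi> - \<eta>))\<^sup>2 + \<alpha> / 2 * (norm (x n - y n))\<^sup>2 - \<mu> n
      \<le> f (t' n, x' n) + g (s' n, y' n)" if r: "r \<in> {0..T}" for r \<xi> \<eta> n
  proof -
    have "0 \<le> \<alpha> / (2 * (\<mu> n)\<^sup>2) * (t n - s n)\<^sup>2" using \<alpha> by simp
    then show ?thesis using max[OF r, of \<xi> \<eta> n] val[of n] by linarith
  qed
  have Jlim: "(\<lambda>n. c + \<alpha> / 2 * (norm (x (\<sigma> n) - y (\<sigma> n)))\<^sup>2 - \<mu> (\<sigma> n)) \<longlonglongrightarrow> c + \<alpha> / 2 * (norm (x0 - y0))\<^sup>2 - 0" for c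
    by (intro tendsto_intros xl yl ml)
  have maximum: "f (r, \<xi>) + g (r, \<eta>) - \<alpha> / 2 * (norm (\<xi> - \<eta>))\<^sup>2
      \<le> f (t0, x0) + g (t0, y0) - \<alpha> / 2 * (norm (x0 - y0))\<^sup>2" (is "?J \<le> _") if r: "r \<in> {0..T}" for r \<xi> \<eta>
  proof (rule field_le_epsilon)
    fix e :: real assume e: "e > 0"
    have "\<forall>\<^sub>F n in sequentially. ?J + \<alpha> / 2 * (norm (x (\<sigma> n) - y (\<sigma> n)))\<^sup>2 - \<mu> (\<sigma> n) \<le> f (t0, x0) + g (t0, y0) + e"
      using fe(1)[OF half_gt_zero[OF e]] fe(2)[OF half_gt_zero[OF e]]
    proof eventually_elim
      case (elim n)
      then show ?case using J[OF r, of \<xi> \<eta> "\<sigma> n"] by linarith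
    qed
    from tendsto_upperbound[OF Jlim this sequentially_bot]
    show "?J \<le> f (t0, x0) + g (t0, y0) - \<alpha> / 2 * (norm (x0 - y0))\<^sup>2 + e" by simp
  qed
  let ?d = "\<lambda>n. (f (t0, x0) + g (t0, y0) - \<alpha> / 2 * (norm (x0 - y0))\<^sup>2) + \<alpha> / 2 * (norm (x (\<sigma> n) - y (\<sigma> n)))\<^sup>2 - \<mu> (\<sigma> n)"
  have dl: "?d \<longlonglongrightarrow> f (t0, x0) + g (t0, y0)" "?d \<longlonglongrightarrow> g (t0, y0) + f (t0, x0)"
    using Jlim[of "f (t0, x0) + g (t0, y0) - \<alpha> / 2 * (norm (x0 - y0))\<^sup>2"] by (simp_all add: add.commute)
  have fl: "(\<lambda>n. f (t' (\<sigma> n), x' (\<sigma> n))) \<longlonglongrightarrow> f (t0, x0)"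
    by (rule tendsto_of_split_bounds[OF fe(1) fe(2) dl(1)]) (use J[OF t0] in simp_all)
  have gl: "(\<lambda>n. g (s' (\<sigma> n), y' (\<sigma> n))) \<longlonglongrightarrow> g (t0, y0)"
    by (rule tendsto_of_split_bounds[OF fe(2) fe(1) dl(2)]) (use J[OF t0, of x0 y0] in \<open>simp_all add: add.commute\<close>)
  have recover: "exp (l * fst w) * (penalised l \<delta> h w + \<delta> * (norm (snd w))\<^sup>2) = h w" for h and w :: "real \<times> (real ^ 'n)"
    by (simp add: penalised_def exp_minus)
  have uval: "(\<lambda>n. u (t' (\<sigma> n), x' (\<sigma> n))) \<longlonglongrightarrow> u (t0, x0)"
  proof -
    have "(\<lambda>n. exp (l * t' (\<sigma> n)) * (f (t' (\<sigma> n), x' (\<sigma> n)) + \<delta> * (norm (x' (\<sigma> n)))\<^sup>2))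
        \<longlonglongrightarrow> exp (l * t0) * (f (t0, x0) + \<delta> * (norm x0)\<^sup>2)"
      by (intro tendsto_intros t'l x'l fl)
    then show ?thesis using recover[of "(_, _)" u] unfolding f_def by simp
  qed
  have vval: "(\<lambda>n. v (s' (\<sigma> n), y' (\<sigma> n))) \<longlonglongrightarrow> v (t0, y0)"
  proof -
    have "(\<lambda>n. exp (l * s' (\<sigma> n)) * (g (s' (\<sigma> n), y' (\<sigma> n)) + \<delta> * (norm (y' (\<sigma> n)))\<^sup>2))
        \<longlonglongrightarrow> exp (l * t0) * (g (t0, y0) + \<delta> * (norm y0)\<^sup>2)"
      by (intro tendsto_intros s'l y'l gl)
    then show ?thesis using recover[of "(_, _)" v] unfolding g_def by simp
  qed
  have pl: "(\<lambda>n. p (\<sigma> n)) \<longlonglongrightarrow> \<alpha> *\<^sub>R (x0 - y0)"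
    by (rule near[OF pd]) (intro tendsto_intros xl yl)
  have ql: "(\<lambda>n. q (\<sigma> n)) \<longlonglongrightarrow> \<alpha> *\<^sub>R (y0 - x0)"
    by (rule near[OF qd]) (intro tendsto_intros xl yl)
  have sym: "X0 \<in> sym_matrices" "Y0 \<in> sym_matrices"
    by (rule closed_sequentially[OF closed_sym_matrices _ Xl] closed_sequentially[OF closed_sym_matrices _ Yl]; simp add: Xs Ys)+
  have form: "(\<lambda>n. h \<bullet> (X (\<sigma> n) *v h) + k \<bullet> (Y (\<sigma> n) *v k)) \<longlonglongrightarrow> h \<bullet> (X0 *v h) + k \<bullet> (Y0 *v k)" for h k
    by (intro tendsto_intros tendsto_matrix_vector Xl Yl)
  have lower: "- (3 * \<alpha>) * ((norm h)\<^sup>2 + (norm k)\<^sup>2) \<le> h \<bullet> (X0 *v h) + k \<bullet> (Y0 *v k)" for h k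
  proof (rule LIMSEQ_le[OF _ form])
    have "(\<lambda>n. - (3 * \<alpha> + \<mu> (\<sigma> n)) * ((norm h)\<^sup>2 + (norm k)\<^sup>2)) \<longlonglongrightarrow> - (3 * \<alpha> + 0) * ((norm h)\<^sup>2 + (norm k)\<^sup>2)"
      by (intro tendsto_intros ml)
    then show "(\<lambda>n. - (3 * \<alpha> + \<mu> (\<sigma> n)) * ((norm h)\<^sup>2 + (norm k)\<^sup>2)) \<longlonglongrightarrow> - (3 * \<alpha>) * ((norm h)\<^sup>2 + (norm k)\<^sup>2)"
      by simp
    show "\<exists>N. \<forall>n\<ge>N. - (3 * \<alpha> + \<mu> (\<sigma> n)) * ((norm h)\<^sup>2 + (norm k)\<^sup>2) \<le> h \<bullet> (X (\<sigma> n) *v h) + k \<bullet> (Y (\<sigma> n) *v k)"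
      by (intro exI[of _ 0] allI impI lo)
  qed
  have upper: "h \<bullet> (X0 *v h) + k \<bullet> (Y0 *v k) \<le> 3 * \<alpha> * (norm (h - k))\<^sup>2" for h k
  proof (rule LIMSEQ_le[OF form])
    have "(\<lambda>n. 3 * \<alpha> * (norm (h - k))\<^sup>2 + \<mu> (\<sigma> n) * ((norm h)\<^sup>2 + (norm k)\<^sup>2))
        \<longlonglongrightarrow> 3 * \<alpha> * (norm (h - k))\<^sup>2 + 0 * ((norm h)\<^sup>2 + (norm k)\<^sup>2)"
      by (intro tendsto_intros ml)
    then show "(\<lambda>n. 3 * \<alpha> * (norm (h - k))\<^sup>2 + \<mu> (\<sigma> n) * ((norm h)\<^sup>2 + (norm k)\<^sup>2)) \<longlonglongrightarrow> 3 * \<alpha> * (norm (h - k))\<^sup>2"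
      by simp
    show "\<exists>N. \<forall>n\<ge>N. h \<bullet> (X (\<sigma> n) *v h) + k \<bullet> (Y (\<sigma> n) *v k) \<le> 3 * \<alpha> * (norm (h - k))\<^sup>2 + \<mu> (\<sigma> n) * ((norm h)\<^sup>2 + (norm k)\<^sup>2)"
      by (intro exI[of _ 0] allI impI hi)
  qed
  have pde: "l * (exp (- (l * t0)) * u (t0, x0) + exp (- (l * t0)) * v (t0, y0)) \<le>
      exp (- (l * t0)) * F t0 x0 (u (t0, x0)) (exp (l * t0) *\<^sub>R (\<alpha> *\<^sub>R (x0 - y0) + (2 * \<delta>) *\<^sub>R x0))
        (exp (l * t0) *\<^sub>R (X0 + (2 * \<delta>) *\<^sub>R mat 1)) +
      exp (- (l * t0)) * F' t0 y0 (v (t0, y0)) (exp (l * t0) *\<^sub>R (\<alpha> *\<^sub>R (y0 - x0) + (2 * \<delta>) *\<^sub>R y0))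
        (exp (l * t0) *\<^sub>R (Y0 + (2 * \<delta>) *\<^sub>R mat 1))" (is "?l \<le> ?r") if t0pos: "t0 > 0"
  proof (rule tendsto_le[OF sequentially_bot])
    let ?ln = "\<lambda>n. l * (exp (- (l * t' (\<sigma> n))) * u (t' (\<sigma> n), x' (\<sigma> n))) + l * (exp (- (l * s' (\<sigma> n))) * v (s' (\<sigma> n), y' (\<sigma> n)))
      - 2 * \<mu> (\<sigma> n)"
    let ?rn = "\<lambda>n. exp (- (l * t' (\<sigma> n))) * F (t' (\<sigma> n)) (x' (\<sigma> n)) (u (t' (\<sigma> n), x' (\<sigma> n)))
        (exp (l * t' (\<sigma> n)) *\<^sub>R (p (\<sigma> n) + (2 * \<delta>) *\<^sub>R x' (\<sigma> n))) (exp (l * t' (\<sigma> n)) *\<^sub>R (X (\<sigma> n) + (\<mu> (\<sigma> n) + 2 * \<delta>) *\<^sub>R mat 1)) +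
      exp (- (l * s' (\<sigma> n))) * F' (s' (\<sigma> n)) (y' (\<sigma> n)) (v (s' (\<sigma> n), y' (\<sigma> n)))
        (exp (l * s' (\<sigma> n)) *\<^sub>R (q (\<sigma> n) + (2 * \<delta>) *\<^sub>R y' (\<sigma> n))) (exp (l * s' (\<sigma> n)) *\<^sub>R (Y (\<sigma> n) + (\<mu> (\<sigma> n) + 2 * \<delta>) *\<^sub>R mat 1))"
    have "?ln \<longlonglongrightarrow> l * (exp (- (l * t0)) * u (t0, x0)) + l * (exp (- (l * t0)) * v (t0, y0)) - 2 * 0"
      by (intro tendsto_intros uval vval t'l s'l ml)
    then show "?ln \<longlonglongrightarrow> ?l" by (simp add: distrib_left)
    have shift: "(\<lambda>n. Z (\<sigma> n) + (\<mu> (\<sigma> n) + 2 * \<delta>) *\<^sub>R mat 1) \<longlonglongrightarrow> Z0 + (2 * \<delta>) *\<^sub>R mat 1"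
      if "(\<lambda>n. Z (\<sigma> n)) \<longlonglongrightarrow> Z0" for Z and Z0 :: "real ^ 'n ^ 'n"
    proof -
      have "(\<lambda>n. Z (\<sigma> n) + (\<mu> (\<sigma> n) + 2 * \<delta>) *\<^sub>R mat 1) \<longlonglongrightarrow> Z0 + (0 + 2 * \<delta>) *\<^sub>R mat 1"
        by (intro tendsto_intros that ml)
      then show ?thesis by simp
    qed
    show "?rn \<longlonglongrightarrow> ?r"
      by (intro tendsto_add tendsto_mult nonlinearity_tendsto[OF F] nonlinearity_tendsto[OF F'] tendsto_scaleR
          tendsto_exp tendsto_minus tendsto_const shift t'l s'l x'l y'l uval vval pl ql Xl Yl t0 sym_matrices_shift sym
          always_eventually allI t'S s'S Xs Ys)
    have "\<forall>\<^sub>F n in sequentially. 0 < t' (\<sigma> n)" "\<forall>\<^sub>F n in sequentially. 0 < s' (\<sigma> n)"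
      using order_tendstoD(1)[OF t'l t0pos] order_tendstoD(1)[OF s'l t0pos] by auto
    then show "\<forall>\<^sub>F n in sequentially. ?ln n \<le> ?rn n"
    proof eventually_elim
      case (elim n)
      show ?case using pu[OF elim(1)] pv[OF elim(2)] ab[of "\<sigma> n"] by linarith
    qed
  qed
  show ?thesis
    by (rule exI[of _ t0], rule exI[of _ x0], rule exI[of _ y0],
        intro conjI impI t0 ballI allI maximum exI[of _ X0] exI[of _ Y0] sym lower upper pde)
qed

section \<open>Comparison\<close>

text \<open>
  The penalty \<open>\<delta> |x|\<^sup>2\<close> changes only the gradient and the Hessian at which the nonlinearity is
  evaluated; this lemma removes it again.
\<close>

lemma uniform_gradient_hessian_modulus:
  fixes F :: "'n::finite nonlinearity"
  assumes A3: "assumption_A3 T F" and R: "R > 0" and e: "e > 0"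
  obtains \<eta> where "\<eta> > 0"
    "\<And>t x r p p' X X'. t \<in> {0..T} \<Longrightarrow> r \<in> {-R..R} \<Longrightarrow> norm p < R \<Longrightarrow> norm p' < R \<Longrightarrow> norm X < R \<Longrightarrow> norm X' < R \<Longrightarrow>
      X \<in> sym_matrices \<Longrightarrow> X' \<in> sym_matrices \<Longrightarrow> norm (p - p') + norm (X - X') < \<eta> \<Longrightarrow>
      \<bar>F t x r p X - F t x r p' X'\<bar> < e"
proof -
  let ?S = "{0..T} \<times> (UNIV :: (real ^ 'n) set) \<times> {-R..R} \<times> ball (0 :: real ^ 'n) R \<times> (ball (0 :: real ^ 'n ^ 'n) R \<inter> sym_matrices)"
  have "uniformly_continuous_on ?S (\<lambda>(t, x, u, p, X). F t x u p X)"
    using A3 R unfolding assumption_A3_def by blast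
  then obtain \<eta> where \<eta>: "\<eta> > 0" and c: "\<And>w w'. w \<in> ?S \<Longrightarrow> w' \<in> ?S \<Longrightarrow> dist w' w < \<eta> \<Longrightarrow>
      dist ((\<lambda>(t, x, u, p, X). F t x u p X) w') ((\<lambda>(t, x, u, p, X). F t x u p X) w) < e"
    unfolding uniformly_continuous_on_def using e by meson
  show ?thesis
  proof (rule that[OF \<eta>])
    fix t r :: real and x p p' :: "real ^ 'n" and X X' :: "real ^ 'n ^ 'n"
    assume *: "t \<in> {0..T}" "r \<in> {-R..R}" "norm p < R" "norm p' < R" "norm X < R" "norm X' < R"
      "X \<in> sym_matrices" "X' \<in> sym_matrices" "norm (p - p') + norm (X - X') < \<eta>"
    have "dist (t, x, r, p, X) (t, x, r, p', X') = sqrt ((norm (p - p'))\<^sup>2 + (norm (X - X'))\<^sup>2)"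
      by (simp add: dist_Pair_Pair norm_Pair dist_norm)
    also have "\<dots> \<le> norm (p - p') + norm (X - X')" by (rule sqrt_sum_squares_le_sum) auto
    finally have "dist (t, x, r, p, X) (t, x, r, p', X') < \<eta>" using *(9) by simp
    with c[of "(t, x, r, p', X')" "(t, x, r, p, X)"] * show "\<bar>F t x r p X - F t x r p' X'\<bar> < e"
      by (simp add: dist_real_def)
  qed
qed

text \<open>
  Otherwise \<open>M\<close> would drop by more than \<open>\<tau>\<close> with every doubling of \<open>\<alpha>\<close>.
\<close>

lemma decreasing_bounded_small_step:
  fixes M :: "real \<Rightarrow> real"
  assumes low: "\<And>\<alpha>. \<alpha> > 0 \<Longrightarrow> M \<alpha> \<ge> 0" and \<tau>: "\<tau> > 0" and \<beta>: "\<beta> > 0"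
  shows "\<exists>\<alpha>\<ge>\<beta>. M (\<alpha> / 2) \<le> M \<alpha> + \<tau>"
proof (rule ccontr)
  assume "\<not> ?thesis"
  then have neg: "M (\<alpha> / 2) > M \<alpha> + \<tau>" if "\<alpha> \<ge> \<beta>" for \<alpha> using that by force
  have "M (\<beta> * 2 ^ k) + real k * \<tau> \<le> M \<beta>" for k
  proof (induction k)
    case (Suc k)
    have "1 \<le> (2 :: real) ^ Suc k" by (rule one_le_power) simp
    then have "\<beta> \<le> \<beta> * 2 ^ Suc k" using mult_left_mono[of 1 "2 ^ Suc k" \<beta>] \<beta> by simp
    from neg[OF this] have "M (\<beta> * 2 ^ Suc k) + \<tau> < M (\<beta> * 2 ^ k)" by simp
    then show ?case using Suc by (simp add: distrib_right)
  qed simp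
  moreover have "M (\<beta> * 2 ^ k) \<ge> 0" for k by (rule low) (use \<beta> in simp)
  ultimately have "real k * \<tau> \<le> M \<beta>" for k by (smt (verit))
  moreover obtain k :: nat where "M \<beta> < real k * \<tau>" using reals_Archimedean3[OF \<tau>] by blast
  ultimately show False by (meson not_less)
qed

text \<open>
  The structural assumptions meet in this estimate. The difference of the two nonlinearities is
  split into three parts: passing from the value \<open>a\<close> to \<open>b\<close> at \<open>x\<close> gains \<open>- \<gamma> (a - b)\<close>, removing the
  penalty \<open>\<delta> |x|\<^sup>2\<close> costs little by uniform continuity, and passing from \<open>x\<close> to \<open>y\<close> is controlled by
  the structure condition with the parameter \<open>E \<alpha>\<close> and the matrices \<open>E X\<close> and \<open>- E Y\<close>; the factor
  \<open>E\<close> comes from undoing the discount.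
\<close>

lemma proper_gap_estimate:
  fixes F :: "'n::finite nonlinearity" and X Y :: "real ^ 'n ^ 'n"
  assumes t: "t \<in> {0..T}" and l: "l + \<gamma> \<ge> 1" and \<alpha>: "\<alpha> > 0" and E: "E = exp (l * t)" "E \<le> E'"
    and X: "X \<in> sym_matrices" and Y: "Y \<in> sym_matrices"
    and lower: "\<And>h k. - (3 * \<alpha>) * ((norm h)\<^sup>2 + (norm k)\<^sup>2) \<le> h \<bullet> (X *v h) + k \<bullet> (Y *v k)"
    and upper: "\<And>h k. h \<bullet> (X *v h) + k \<bullet> (Y *v k) \<le> 3 * \<alpha> * (norm (h - k))\<^sup>2"
    and ab: "b \<le> a" "\<bar>b\<bar> \<le> C"
    and monotone: "\<And>p X. X \<in> sym_matrices \<Longrightarrow> \<gamma> * (a - b) \<le> F t x b p X - F t x a p X"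
    and modulus: "\<And>t x x' r \<alpha> X Y. t \<in> {0..T} \<Longrightarrow> r \<in> {- (C + 1)..C + 1} \<Longrightarrow> \<alpha> > 0 \<Longrightarrow> X \<in> sym_matrices \<Longrightarrow> Y \<in> sym_matrices \<Longrightarrow>
      (\<And>h k. - (3 * \<alpha>) * ((norm h)\<^sup>2 + (norm k)\<^sup>2) \<le> h \<bullet> (X *v h) - k \<bullet> (Y *v k)) \<Longrightarrow>
      (\<And>h k. h \<bullet> (X *v h) - k \<bullet> (Y *v k) \<le> 3 * \<alpha> * (norm (h - k))\<^sup>2) \<Longrightarrow>
      \<alpha> * (norm (x - x'))\<^sup>2 + norm (x - x') < d \<Longrightarrow>
      F t x r (\<alpha> *\<^sub>R (x - x')) X - F t x' r (\<alpha> *\<^sub>R (x - x')) Y < \<sigma> / 2"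
    and R: "R = E' * (\<alpha> + real CARD('n) * real CARD('n) * (3 * \<alpha>)) + C + 2"
    and uniform: "\<And>t x r p p' X X'. t \<in> {0..T} \<Longrightarrow> r \<in> {-R..R} \<Longrightarrow> norm p < R \<Longrightarrow> norm p' < R \<Longrightarrow> norm X < R \<Longrightarrow> norm X' < R \<Longrightarrow>
      X \<in> sym_matrices \<Longrightarrow> X' \<in> sym_matrices \<Longrightarrow> norm (p - p') + norm (X - X') < \<eta> \<Longrightarrow>
      \<bar>F t x r p X - F t x r p' X'\<bar> < \<sigma> / 8"
    and close: "E * \<alpha> * (norm (x - y))\<^sup>2 + norm (x - y) < d" "norm (x - y) \<le> 1"
    and small: "\<delta> > 0" "\<eta> \<le> 1" "E' * (c + 2 * \<delta> * norm (mat 1 :: real ^ 'n ^ 'n)) < \<eta>"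
      "2 * \<delta> * norm x \<le> c" "2 * \<delta> * norm y \<le> c"
    and pde: "l * (a - b) \<le> F t x a (E *\<^sub>R (\<alpha> *\<^sub>R (x - y) + (2 * \<delta>) *\<^sub>R x)) (E *\<^sub>R (X + (2 * \<delta>) *\<^sub>R mat 1)) -
      F t y b (E *\<^sub>R (\<alpha> *\<^sub>R (x - y) - (2 * \<delta>) *\<^sub>R y)) (- (E *\<^sub>R (Y + (2 * \<delta>) *\<^sub>R mat 1)))"
  shows "a - b < 3 / 4 * \<sigma>"
proof -
  let ?N = "real CARD('n) * real CARD('n) * (3 * \<alpha>)"
  let ?p = "(E * \<alpha>) *\<^sub>R (x - y)"
  have E0: "E > 0" "E' > 0" using E by (simp_all add: less_le_trans[OF exp_gt_zero])
  have C0: "C \<ge> 0" using ab(2) by simp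
  have XN: "norm X \<le> ?N" "norm Y \<le> ?N"
  proof -
    have "\<bar>h \<bullet> (X *v h)\<bar> \<le> 3 * \<alpha> * (norm h)\<^sup>2" for h
      using lower[of h 0] upper[of h 0] by (simp add: abs_le_iff)
    then show "norm X \<le> ?N" by (rule sym_matrix_norm_le[OF X])
    have "\<bar>h \<bullet> (Y *v h)\<bar> \<le> 3 * \<alpha> * (norm h)\<^sup>2" for h
      using lower[of 0 h] upper[of 0 h] by (simp add: abs_le_iff)
    then show "norm Y \<le> ?N" by (rule sym_matrix_norm_le[OF Y])
  qed
  have N0: "0 \<le> ?N" using \<alpha> by simp
  have symneg: "- Z \<in> sym_matrices" if "Z \<in> sym_matrices" for Z :: "real ^ 'n ^ 'n"
    using that by (auto simp: sym_matrices_def transpose_def vec_eq_iff)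
  have symE: "E *\<^sub>R Z \<in> sym_matrices" if "Z \<in> sym_matrices" for Z :: "real ^ 'n ^ 'n"
    using sym_matrices_shift[OF that, of E 0] by simp
  have sizes: "norm ?p < R - 1" "norm (E *\<^sub>R Z) < R - 1" if Z: "norm Z \<le> ?N" for Z :: "real ^ 'n ^ 'n"
  proof -
    have "\<alpha> * norm (x - y) \<le> \<alpha>" using close(2) \<alpha> by (intro mult_left_le) auto
    then have "E * (\<alpha> * norm (x - y)) \<le> E' * \<alpha>" using E E0 \<alpha> by (intro mult_mono) auto
    moreover have "E * norm Z \<le> E' * ?N" using E E0 Z by (intro mult_mono) auto
    moreover have "0 \<le> E' * ?N" "0 \<le> E' * \<alpha>" using E0 \<alpha> by auto
    moreover have "norm ?p = E * (\<alpha> * norm (x - y))" "norm (E *\<^sub>R Z) = E * norm Z"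
      using E0 \<alpha> by (simp_all add: mult.assoc)
    ultimately show "norm ?p < R - 1" "norm (E *\<^sub>R Z) < R - 1"
      unfolding R distrib_left using C0 by linarith+
  qed
  have perturbed: "\<bar>F t z b (?p + (E * (2 * \<delta>)) *\<^sub>R w) (s *\<^sub>R (E *\<^sub>R (Z + (2 * \<delta>) *\<^sub>R mat 1))) - F t z b ?p (s *\<^sub>R (E *\<^sub>R Z))\<bar> < \<sigma> / 8"
    if w: "2 * \<delta> * norm w \<le> c" and Z: "Z \<in> sym_matrices" "norm Z \<le> ?N" and s: "\<bar>s\<bar> = 1"
    for z w :: "real ^ 'n" and Z :: "real ^ 'n ^ 'n" and s :: real
  proof -
    let ?Z = "s *\<^sub>R (E *\<^sub>R Z)" and ?Z' = "s *\<^sub>R (E *\<^sub>R (Z + (2 * \<delta>) *\<^sub>R mat 1))" and ?p' = "?p + (E * (2 * \<delta>)) *\<^sub>R w"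
    have dp: "norm (?p' - ?p) = E * (2 * \<delta> * norm w)" using E0 small(1) by (simp add: abs_mult)
    have "?Z' - ?Z = (s * (E * (2 * \<delta>))) *\<^sub>R mat 1" by (simp add: scaleR_add_right)
    then have "norm (?Z' - ?Z) = \<bar>s * (E * (2 * \<delta>))\<bar> * norm (mat 1 :: real ^ 'n ^ 'n)" by simp
    then have dZ: "norm (?Z' - ?Z) = E * (2 * \<delta> * norm (mat 1 :: real ^ 'n ^ 'n))"
      using E0 small(1) s by (simp add: abs_mult)
    have "norm (?p' - ?p) + norm (?Z' - ?Z) \<le> E * (c + 2 * \<delta> * norm (mat 1 :: real ^ 'n ^ 'n))"
      unfolding dp dZ distrib_left using w E0 by simp
    also have "\<dots> \<le> E' * (c + 2 * \<delta> * norm (mat 1 :: real ^ 'n ^ 'n))"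
    proof (rule mult_right_mono[OF E(2)])
      have "0 \<le> 2 * \<delta> * norm w" using small(1) by simp
      then have "0 \<le> c" using w by linarith
      then show "0 \<le> c + 2 * \<delta> * norm (mat 1 :: real ^ 'n ^ 'n)" using small(1) by simp
    qed
    finally have diff: "norm (?p' - ?p) + norm (?Z' - ?Z) < \<eta>" using small(3) by simp
    have nZ: "norm ?Z < R - 1" using sizes(2)[OF Z(2)] s by (simp add: abs_mult)
    have np: "norm ?p < R - 1" by (rule sizes(1)[OF Z(2)])
    have tri: "norm ?p' \<le> norm ?p + norm (?p' - ?p)" "norm ?Z' \<le> norm ?Z + norm (?Z' - ?Z)"
      by (rule norm_triangle_sub)+
    have "0 \<le> norm (?p' - ?p)" "0 \<le> norm (?Z' - ?Z)" by simp_all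
    then have np': "norm ?p' < R" and nZ': "norm ?Z' < R" using tri diff np nZ small(2) by linarith+
    have "R > C" unfolding R using E0 \<alpha> C0 by (simp add: add_nonneg_pos)
    then have bR: "b \<in> {-R..R}" using ab(2) by auto
    have "s = 1 \<or> s = - 1" using s by linarith
    then have sym: "?Z \<in> sym_matrices" "?Z' \<in> sym_matrices"
      using symE[OF Z(1)] symneg[OF symE[OF Z(1)]] sym_matrices_shift[OF Z(1), of E "2 * \<delta>"]
        symneg[OF sym_matrices_shift[OF Z(1), of E "2 * \<delta>"]] by (elim disjE; simp)+
    show ?thesis
      by (rule uniform[OF t bR np' _ nZ' _ sym(2,1) diff]) (use np nZ in linarith)+
  qed
  have pert_x: "\<bar>F t x b (E *\<^sub>R (\<alpha> *\<^sub>R (x - y) + (2 * \<delta>) *\<^sub>R x)) (E *\<^sub>R (X + (2 * \<delta>) *\<^sub>R mat 1)) - F t x b ?p (E *\<^sub>R X)\<bar> < \<sigma> / 8"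
    using perturbed[OF small(4) X XN(1), of 1 x] by (simp add: scaleR_add_right)
  have pert_y: "\<bar>F t y b (E *\<^sub>R (\<alpha> *\<^sub>R (x - y) - (2 * \<delta>) *\<^sub>R y)) (- (E *\<^sub>R (Y + (2 * \<delta>) *\<^sub>R mat 1))) - F t y b ?p (- (E *\<^sub>R Y))\<bar> < \<sigma> / 8"
    using perturbed[of "- y" Y "- 1" y] small(5) Y XN(2) by (simp add: scaleR_add_right scaleR_diff_right)
  have form: "h \<bullet> ((E *\<^sub>R X) *v h) - k \<bullet> ((- (E *\<^sub>R Y)) *v k) = E * (h \<bullet> (X *v h) + k \<bullet> (Y *v k))" for h k
    by (simp add: matrix_uminus_vector scaleR_matrix_vector_assoc[symmetric] distrib_left)
  have main: "F t x b ?p (E *\<^sub>R X) - F t y b ?p (- (E *\<^sub>R Y)) < \<sigma> / 2"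
  proof (rule modulus[OF t])
    show "b \<in> {- (C + 1)..C + 1}" "E * \<alpha> > 0" using ab(2) E0 \<alpha> by auto
    show "E *\<^sub>R X \<in> sym_matrices" "- (E *\<^sub>R Y) \<in> sym_matrices" by (intro symneg symE X Y)+
    fix h k :: "real ^ 'n"
    show "- (3 * (E * \<alpha>)) * ((norm h)\<^sup>2 + (norm k)\<^sup>2) \<le> h \<bullet> ((E *\<^sub>R X) *v h) - k \<bullet> ((- (E *\<^sub>R Y)) *v k)"
      unfolding form using mult_left_mono[OF lower[of h k], of E] E0 by (simp add: algebra_simps)
    show "h \<bullet> ((E *\<^sub>R X) *v h) - k \<bullet> ((- (E *\<^sub>R Y)) *v k) \<le> 3 * (E * \<alpha>) * (norm (h - k))\<^sup>2"
      unfolding form using mult_left_mono[OF upper[of h k], of E] E0 by (simp only: mult.assoc mult.left_commute) 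
  qed (use close(1) in simp)
  have "\<gamma> * (a - b) \<le> F t x b (E *\<^sub>R (\<alpha> *\<^sub>R (x - y) + (2 * \<delta>) *\<^sub>R x)) (E *\<^sub>R (X + (2 * \<delta>) *\<^sub>R mat 1)) -
      F t x a (E *\<^sub>R (\<alpha> *\<^sub>R (x - y) + (2 * \<delta>) *\<^sub>R x)) (E *\<^sub>R (X + (2 * \<delta>) *\<^sub>R mat 1))"
    by (rule monotone[OF sym_matrices_shift[OF X]])
  then have "l * (a - b) + \<gamma> * (a - b) < 3 / 4 * \<sigma>"
    using pde pert_x pert_y main unfolding abs_less_iff by linarith
  moreover have "1 * (a - b) \<le> (l + \<gamma>) * (a - b)" using l ab(1) by (intro mult_right_mono) auto
  ultimately show ?thesis by (simp add: distrib_right)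
qed

text \<open>
  If the discounted gap exceeded \<open>\<alpha> / 2 |x - y|\<^sup>2 + \<sigma>\<close> somewhere for every \<open>\<alpha>\<close>, one could choose \<open>\<alpha>\<close>
  such that the supremum \<open>M\<close> of the penalised gap changes little when \<open>\<alpha>\<close> is halved; then the
  penalty is small at near-maximum points, as the structure condition demands. The parameter \<open>\<delta>\<close> is
  fixed after \<open>\<alpha>\<close>, because the gradients and Hessians that occur are bounded in terms of \<open>\<alpha>\<close>. At the
  resulting maximum the gap is at least \<open>7 \<sigma> / 8\<close>, which excludes the initial time, and less than
  \<open>3 \<sigma> / 4\<close> by the equation.
\<close>

lemma comparison_discounted:
  fixes F :: "'n::finite nonlinearity" and u v :: "real \<times> (real ^ 'n) \<Rightarrow> real"
  assumes T: "T > 0" and A0: "assumption_A0 T F" and A2: "assumption_A2 T F" and A3: "assumption_A3 T F"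
    and \<gamma>: "\<And>t x p X a b. t \<in> {0..T} \<Longrightarrow> X \<in> sym_matrices \<Longrightarrow> b \<le> a \<Longrightarrow> \<gamma> * (a - b) \<le> F t x b p X - F t x a p X"
    and l: "l \<ge> 0" "l + \<gamma> \<ge> 1"
    and u: "usc_on ({0..T} \<times> UNIV) u" "\<And>w. w \<in> {0..T} \<times> UNIV \<Longrightarrow> \<bar>u w\<bar> \<le> C"
      "viscosity_subsolution F ({0<..T} \<times> UNIV) u"
    and v: "usc_on ({0..T} \<times> UNIV) (\<lambda>w. - v w)" "\<And>w. w \<in> {0..T} \<times> UNIV \<Longrightarrow> \<bar>v w\<bar> \<le> C"
      "viscosity_subsolution (dual_nonlinearity F) ({0<..T} \<times> UNIV) (\<lambda>w. - v w)"
    and \<sigma>: "\<sigma> > 0" and \<alpha>0: "\<alpha>0 > 0"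
    and initial: "\<And>x y. u (0, x) - v (0, y) \<le> \<alpha>0 / 2 * (norm (x - y))\<^sup>2 + \<sigma> / 2"
  shows "\<exists>\<alpha>>0. \<forall>t\<in>{0..T}. \<forall>x y. exp (- (l * t)) * (u (t, x) - v (t, y)) \<le> \<alpha> / 2 * (norm (x - y))\<^sup>2 + \<sigma>"
proof (rule ccontr)
  assume neg: "\<not> ?thesis"
  define w where "w \<alpha> = (\<lambda>(t, x, y). exp (- (l * t)) * (u (t, x) - v (t, y)) - \<alpha> / 2 * (norm (x - y))\<^sup>2)" for \<alpha>
  let ?D = "{0..T} \<times> (UNIV :: (real ^ 'n) set) \<times> (UNIV :: (real ^ 'n) set)"
  define M where "M \<alpha> = (SUP z\<in>?D. w \<alpha> z)" for \<alpha>
  have C0: "C \<ge> 0" using u(2)[of "(0, 0)"] T by fastforce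
  have gap_le: "exp (- (l * t)) * (u (t, x) - v (t, y)) \<le> 2 * C" if t: "t \<in> {0..T}" for t x y
  proof -
    have t0: "0 \<le> t" and in_dom: "(t, z) \<in> {0..T} \<times> UNIV" for z :: "real ^ 'n" using t by auto
    have "\<bar>exp (- (l * t)) * u (t, x)\<bar> \<le> C" "\<bar>exp (- (l * t)) * v (t, y)\<bar> \<le> C"
      using penalised_le[where u = u and x = x, OF l(1) t0] u(2)[OF in_dom]
        penalised_le[where u = v and x = y, OF l(1) t0] v(2)[OF in_dom] by blast+
    then show ?thesis unfolding right_diff_distrib by linarith
  qed
  have w_le: "w \<alpha> z \<le> 2 * C" if \<alpha>: "\<alpha> > 0" and z: "z \<in> ?D" for \<alpha> z
  proof -
    obtain t x y where z: "z = (t, x, y)" "t \<in> {0..T}" using z by auto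
    have "0 \<le> \<alpha> / 2 * (norm (x - y))\<^sup>2" using \<alpha> by simp
    then show ?thesis using gap_le[OF z(2), of x y] by (simp add: w_def z(1))
  qed
  have bdd: "bdd_above (w \<alpha> ` ?D)" if "\<alpha> > 0" for \<alpha>
    by (rule bdd_aboveI2) (rule w_le[OF that])
  have w_M: "w \<alpha> z \<le> M \<alpha>" if "\<alpha> > 0" "z \<in> ?D" for \<alpha> z
    unfolding M_def by (rule cSUP_upper[OF that(2) bdd[OF that(1)]])
  have M_gt: "M \<alpha> > \<sigma>" if \<alpha>: "\<alpha> > 0" for \<alpha>
  proof -
    obtain t x y where "t \<in> {0..T}" "\<not> exp (- (l * t)) * (u (t, x) - v (t, y)) \<le> \<alpha> / 2 * (norm (x - y))\<^sup>2 + \<sigma>"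
      using neg \<alpha> by blast
    then have "w \<alpha> (t, x, y) > \<sigma>" "(t, x, y) \<in> ?D" by (simp_all add: w_def)
    then show ?thesis using w_M[OF \<alpha>] by fastforce
  qed
  define E where "E = exp (l * T)"
  have E0: "E > 0" unfolding E_def by simp
  have E_le: "exp (l * t) \<le> E" if "t \<in> {0..T}" for t using that l(1) unfolding E_def by (auto intro: mult_left_mono)
  have Cpos: "C + 1 > 0" using C0 by simp
  obtain d where d: "d > 0" and modulus: "\<And>t x x' r \<alpha> X Y. t \<in> {0..T} \<Longrightarrow> r \<in> {- (C + 1)..C + 1} \<Longrightarrow> \<alpha> > 0 \<Longrightarrow>
      X \<in> sym_matrices \<Longrightarrow> Y \<in> sym_matrices \<Longrightarrow>
      (\<And>h k. - (3 * \<alpha>) * ((norm h)\<^sup>2 + (norm k)\<^sup>2) \<le> h \<bullet> (X *v h) - k \<bullet> (Y *v k)) \<Longrightarrow>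
      (\<And>h k. h \<bullet> (X *v h) - k \<bullet> (Y *v k) \<le> 3 * \<alpha> * (norm (h - k))\<^sup>2) \<Longrightarrow>
      \<alpha> * (norm (x - x'))\<^sup>2 + norm (x - x') < d \<Longrightarrow>
      F t x r (\<alpha> *\<^sub>R (x - x')) X - F t x' r (\<alpha> *\<^sub>R (x - x')) Y < \<sigma> / 2"
    by (rule structure_condition_modulus[OF A0 A2 Cpos half_gt_zero[OF \<sigma>]]) blast
  (* \<alpha> |x - y|^2 \<le> \<rho>^2 with \<alpha> \<ge> 1 brings the argument of the modulus below d. *)
  define \<rho> where "\<rho> = min 1 (d / (2 * (E + 1)))"
  have \<rho>: "0 < \<rho>" "\<rho> \<le> 1" "(E + 1) * \<rho> < d"
  proof -
    show "0 < \<rho>" "\<rho> \<le> 1" using d E0 by (auto simp: \<rho>_def)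
    have "(E + 1) * \<rho> \<le> (E + 1) * (d / (2 * (E + 1)))" using E0 by (intro mult_left_mono) (auto simp: \<rho>_def)
    also have "\<dots> = d / 2" using E0 by (simp add: field_simps)
    finally show "(E + 1) * \<rho> < d" using d by simp
  qed
  define \<tau> where "\<tau> = min (\<rho>\<^sup>2 / 8) (\<sigma> / 8)"
  have \<tau>: "\<tau> > 0" "8 * \<tau> \<le> \<rho>\<^sup>2" "8 * \<tau> \<le> \<sigma>" using \<rho>(1) \<sigma> by (auto simp: \<tau>_def)
  have M_nonneg: "0 \<le> M \<alpha>" if "\<alpha> > 0" for \<alpha> using M_gt[OF that] \<sigma> by linarith
  have max_pos: "0 < max \<alpha>0 1" by simp
  obtain \<alpha> where \<alpha>_ge: "\<alpha> \<ge> max \<alpha>0 1" and step: "M (\<alpha> / 2) \<le> M \<alpha> + \<tau>"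
    using decreasing_bounded_small_step[where M = M, OF M_nonneg \<tau>(1) max_pos] by blast
  have \<alpha>: "\<alpha> > 0" "\<alpha> \<ge> 1" "\<alpha> \<ge> \<alpha>0" using \<alpha>_ge by auto
  have "M \<alpha> - \<tau> / 2 < M \<alpha>" using \<tau>(1) by simp
  moreover have "?D \<noteq> {}" using T by auto
  ultimately obtain z where "z \<in> ?D" "M \<alpha> - \<tau> / 2 < w \<alpha> z"
    using less_cSUP_iff[OF _ bdd[OF \<alpha>(1)], of "M \<alpha> - \<tau> / 2"] unfolding M_def by blast
  then obtain t1 x1 y1 where t1: "t1 \<in> {0..T}" and w1: "M \<alpha> - \<tau> / 2 < w \<alpha> (t1, x1, y1)" by auto
  define R where "R = E * (\<alpha> + real CARD('n) * real CARD('n) * (3 * \<alpha>)) + C + 2"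
  have R0: "R > 0" unfolding R_def using E0 \<alpha>(1) C0 by (simp add: add_nonneg_pos)
  have \<sigma>8: "\<sigma> / 8 > 0" using \<sigma> by simp
  obtain \<eta>' where \<eta>': "\<eta>' > 0" and uniform': "\<And>t x r p p' X X'. t \<in> {0..T} \<Longrightarrow> r \<in> {-R..R} \<Longrightarrow> norm p < R \<Longrightarrow> norm p' < R \<Longrightarrow>
      norm X < R \<Longrightarrow> norm X' < R \<Longrightarrow> X \<in> sym_matrices \<Longrightarrow> X' \<in> sym_matrices \<Longrightarrow> norm (p - p') + norm (X - X') < \<eta>' \<Longrightarrow>
      \<bar>F t x r p X - F t x r p' X'\<bar> < \<sigma> / 8"
    by (rule uniform_gradient_hessian_modulus[OF A3 R0 \<sigma>8]) blast
  define \<eta> where "\<eta> = min 1 \<eta>'"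
  have \<eta>: "\<eta> > 0" "\<eta> \<le> 1" "\<eta> \<le> \<eta>'" using \<eta>' by (auto simp: \<eta>_def)
  let ?I = "norm (mat 1 :: real ^ 'n ^ 'n)"
  have "\<exists>\<delta>>0. \<delta> * ((norm x1)\<^sup>2 + (norm y1)\<^sup>2) < \<tau> / 2 \<and> E * (sqrt (8 * C * \<delta>) + 2 * \<delta> * ?I) < \<eta>"
  proof -
    have "((\<lambda>\<delta>. \<delta> * ((norm x1)\<^sup>2 + (norm y1)\<^sup>2)) \<longlongrightarrow> 0 * ((norm x1)\<^sup>2 + (norm y1)\<^sup>2)) (at_right 0)"
      by (intro tendsto_intros)
    then have "\<forall>\<^sub>F \<delta> in at_right 0. \<delta> * ((norm x1)\<^sup>2 + (norm y1)\<^sup>2) < \<tau> / 2"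
      by (rule order_tendstoD(2)) (use \<tau>(1) in simp)
    moreover have "((\<lambda>\<delta>. E * (sqrt (8 * C * \<delta>) + 2 * \<delta> * ?I)) \<longlongrightarrow> E * (sqrt (8 * C * 0) + 2 * 0 * ?I)) (at_right 0)"
      by (intro tendsto_intros)
    then have "\<forall>\<^sub>F \<delta> in at_right 0. E * (sqrt (8 * C * \<delta>) + 2 * \<delta> * ?I) < \<eta>"
      by (rule order_tendstoD(2)) (use \<eta>(1) in simp)
    moreover have "\<forall>\<^sub>F \<delta> in at_right (0 :: real). \<delta> > 0" by (rule eventually_at_right_less)
    ultimately have "\<forall>\<^sub>F \<delta> in at_right 0. \<delta> > 0 \<and> \<delta> * ((norm x1)\<^sup>2 + (norm y1)\<^sup>2) < \<tau> / 2 \<and> E * (sqrt (8 * C * \<delta>) + 2 * \<delta> * ?I) < \<eta>"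
      by eventually_elim blast
    then show ?thesis using eventually_happens' trivial_limit_at_right_real by blast
  qed
  then obtain \<delta> where \<delta>: "\<delta> > 0" and \<delta>1: "\<delta> * ((norm x1)\<^sup>2 + (norm y1)\<^sup>2) < \<tau> / 2"
    and \<delta>2: "E * (sqrt (8 * C * \<delta>) + 2 * \<delta> * ?I) < \<eta>" by blast
  have Fc: "continuous_on ({0..T} \<times> UNIV \<times> UNIV \<times> UNIV \<times> sym_matrices) (\<lambda>(t, x, u, p, X). F t x u p X)"
    using A0 unfolding assumption_A0_def by blast
  have v': "\<bar>- v w\<bar> \<le> C" if "w \<in> {0..T} \<times> UNIV" for w using v(2)[OF that] by simp
  obtain t x y where t: "t \<in> {0..T}" and max: "\<And>r \<xi> \<eta>. r \<in> {0..T} \<Longrightarrow>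
      penalised l \<delta> u (r, \<xi>) + penalised l \<delta> (\<lambda>w. - v w) (r, \<eta>) - \<alpha> / 2 * (norm (\<xi> - \<eta>))\<^sup>2
      \<le> penalised l \<delta> u (t, x) + penalised l \<delta> (\<lambda>w. - v w) (t, y) - \<alpha> / 2 * (norm (x - y))\<^sup>2"
    and pde: "t > 0 \<longrightarrow> (\<exists>X Y. X \<in> sym_matrices \<and> Y \<in> sym_matrices \<and>
      (\<forall>h k. - (3 * \<alpha>) * ((norm h)\<^sup>2 + (norm k)\<^sup>2) \<le> h \<bullet> (X *v h) + k \<bullet> (Y *v k)) \<and>
      (\<forall>h k. h \<bullet> (X *v h) + k \<bullet> (Y *v k) \<le> 3 * \<alpha> * (norm (h - k))\<^sup>2) \<and>
      l * (exp (- (l * t)) * u (t, x) + exp (- (l * t)) * (- v (t, y))) \<le>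
        exp (- (l * t)) * F t x (u (t, x)) (exp (l * t) *\<^sub>R (\<alpha> *\<^sub>R (x - y) + (2 * \<delta>) *\<^sub>R x)) (exp (l * t) *\<^sub>R (X + (2 * \<delta>) *\<^sub>R mat 1)) +
        exp (- (l * t)) * dual_nonlinearity F t y (- v (t, y)) (exp (l * t) *\<^sub>R (\<alpha> *\<^sub>R (y - x) + (2 * \<delta>) *\<^sub>R y)) (exp (l * t) *\<^sub>R (Y + (2 * \<delta>) *\<^sub>R mat 1)))"
    using equal_time_maximum[OF T l(1) \<alpha>(1) \<delta> u v(1) v' v(3) Fc dual_nonlinearity_continuous[OF Fc]] by blast
  let ?g = "exp (- (l * t)) * (u (t, x) - v (t, y))"
  let ?\<delta> = "\<delta> * ((norm x)\<^sup>2 + (norm y)\<^sup>2)"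
  have pen: "penalised l \<delta> u (r, \<xi>) + penalised l \<delta> (\<lambda>w. - v w) (r, \<eta>) - \<alpha> / 2 * (norm (\<xi> - \<eta>))\<^sup>2
      = w \<alpha> (r, \<xi>, \<eta>) - \<delta> * ((norm \<xi>)\<^sup>2 + (norm \<eta>)\<^sup>2)" for r \<xi> \<eta>
    by (simp add: penalised_def w_def algebra_simps)
  have near_max: "w \<alpha> (t, x, y) - ?\<delta> > M \<alpha> - \<tau>"
    using max[OF t1, of x1 y1] w1 \<delta>1 unfolding pen by linarith
  have in_D: "(t, x, y) \<in> ?D" using t by simp
  have \<delta>0: "0 \<le> ?\<delta>" using \<delta> by simp
  have g: "7 / 8 * \<sigma> < ?g" and g0: "7 / 8 * \<sigma> < ?g - \<alpha> / 2 * (norm (x - y))\<^sup>2"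
  proof -
    show *: "7 / 8 * \<sigma> < ?g - \<alpha> / 2 * (norm (x - y))\<^sup>2"
      using near_max \<delta>0 M_gt[OF \<alpha>(1)] \<tau>(3) by (simp add: w_def)
    have "0 \<le> \<alpha> / 2 * (norm (x - y))\<^sup>2" using \<alpha>(1) by simp
    with * show "7 / 8 * \<sigma> < ?g" by linarith
  qed
  have \<delta>C: "?\<delta> \<le> 2 * C"
    using near_max w_le[OF \<alpha>(1) in_D] M_gt[OF \<alpha>(1)] \<tau>(3) \<sigma> by linarith
  have grad: "2 * \<delta> * norm \<xi> \<le> sqrt (8 * C * \<delta>)" if "\<delta> * (norm \<xi>)\<^sup>2 \<le> 2 * C" for \<xi> :: "real ^ 'n"
  proof (rule real_le_rsqrt)
    have "4 * \<delta> * (\<delta> * (norm \<xi>)\<^sup>2) \<le> 4 * \<delta> * (2 * C)" using that \<delta> by (intro mult_left_mono) auto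
    then show "(2 * \<delta> * norm \<xi>)\<^sup>2 \<le> 8 * C * \<delta>" by (simp add: power_mult_distrib power2_eq_square algebra_simps)
  qed
  have gx: "2 * \<delta> * norm x \<le> sqrt (8 * C * \<delta>)" and gy: "2 * \<delta> * norm y \<le> sqrt (8 * C * \<delta>)"
  proof -
    have "0 \<le> \<delta> * (norm x)\<^sup>2" "0 \<le> \<delta> * (norm y)\<^sup>2" using \<delta> by simp_all
    then show "2 * \<delta> * norm x \<le> sqrt (8 * C * \<delta>)" "2 * \<delta> * norm y \<le> sqrt (8 * C * \<delta>)"
      using \<delta>C by (auto intro!: grad simp: distrib_left)
  qed
  (* Halving \<alpha> raises the maximum by at most \<tau>, which bounds the part of the penalty that is gained. *)
  have close: "\<alpha> * (norm (x - y))\<^sup>2 \<le> \<rho>\<^sup>2"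
  proof -
    have "w (\<alpha> / 2) (t, x, y) \<le> M (\<alpha> / 2)" by (rule w_M) (use \<alpha>(1) in_D in auto)
    then have "w (\<alpha> / 2) (t, x, y) \<le> w \<alpha> (t, x, y) + 2 * \<tau>" using step near_max \<delta>0 by linarith
    then have "\<alpha> * (norm (x - y))\<^sup>2 \<le> 8 * \<tau>" by (simp add: w_def)
    then show ?thesis using \<tau>(2) by linarith
  qed
  have dist_le: "norm (x - y) \<le> \<rho>"
  proof (rule power2_le_imp_le)
    have "1 * (norm (x - y))\<^sup>2 \<le> \<alpha> * (norm (x - y))\<^sup>2" using \<alpha>(2) by (intro mult_right_mono) auto
    then show "(norm (x - y))\<^sup>2 \<le> \<rho>\<^sup>2" using close by linarith
  qed (use \<rho>(1) in simp)
  have tpos: "t > 0"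
  proof (rule ccontr)
    assume "\<not> t > 0"
    then have "t = 0" using t by simp
    then have "?g \<le> \<alpha>0 / 2 * (norm (x - y))\<^sup>2 + \<sigma> / 2" using initial[of x y] by simp
    also have "\<dots> \<le> \<alpha> / 2 * (norm (x - y))\<^sup>2 + \<sigma> / 2"
      using \<alpha>(3) by (intro add_right_mono mult_right_mono) auto
    finally show False using g0 \<sigma> by simp
  qed
  obtain X Y where X: "X \<in> sym_matrices" and Y: "Y \<in> sym_matrices"
    and lower: "\<And>h k. - (3 * \<alpha>) * ((norm h)\<^sup>2 + (norm k)\<^sup>2) \<le> h \<bullet> (X *v h) + k \<bullet> (Y *v k)"
    and upper: "\<And>h k. h \<bullet> (X *v h) + k \<bullet> (Y *v k) \<le> 3 * \<alpha> * (norm (h - k))\<^sup>2"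
    and ineq: "l * (exp (- (l * t)) * u (t, x) + exp (- (l * t)) * (- v (t, y))) \<le>
        exp (- (l * t)) * F t x (u (t, x)) (exp (l * t) *\<^sub>R (\<alpha> *\<^sub>R (x - y) + (2 * \<delta>) *\<^sub>R x)) (exp (l * t) *\<^sub>R (X + (2 * \<delta>) *\<^sub>R mat 1)) +
        exp (- (l * t)) * dual_nonlinearity F t y (- v (t, y)) (exp (l * t) *\<^sub>R (\<alpha> *\<^sub>R (y - x) + (2 * \<delta>) *\<^sub>R y)) (exp (l * t) *\<^sub>R (Y + (2 * \<delta>) *\<^sub>R mat 1))"
    using pde tpos by blast
  have neg_grad: "- (exp (l * t) *\<^sub>R (\<alpha> *\<^sub>R (y - x) + (2 * \<delta>) *\<^sub>R y)) = exp (l * t) *\<^sub>R (\<alpha> *\<^sub>R (x - y) - (2 * \<delta>) *\<^sub>R y)"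
    by (simp add: scaleR_diff_right scaleR_add_right)
  have ineq': "l * (u (t, x) - v (t, y)) \<le>
      F t x (u (t, x)) (exp (l * t) *\<^sub>R (\<alpha> *\<^sub>R (x - y) + (2 * \<delta>) *\<^sub>R x)) (exp (l * t) *\<^sub>R (X + (2 * \<delta>) *\<^sub>R mat 1)) -
      F t y (v (t, y)) (exp (l * t) *\<^sub>R (\<alpha> *\<^sub>R (x - y) - (2 * \<delta>) *\<^sub>R y)) (- (exp (l * t) *\<^sub>R (Y + (2 * \<delta>) *\<^sub>R mat 1)))"
    (is "_ \<le> ?F1 - ?F2")
  proof -
    have "exp (- (l * t)) * (l * (u (t, x) - v (t, y))) \<le> exp (- (l * t)) * (?F1 - ?F2)"
      using ineq unfolding dual_nonlinearity_def minus_minus neg_grad by (simp add: algebra_simps)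
    then show ?thesis by simp
  qed
  have uv: "v (t, y) \<le> u (t, x)"
  proof -
    have "0 < ?g" using g \<sigma> by linarith
    then show ?thesis by (simp add: zero_less_mult_iff)
  qed
  have "u (t, x) - v (t, y) < 3 / 4 * \<sigma>"
  proof (rule proper_gap_estimate[where F = F and T = T and t = t and x = x and y = y and C = C and d = d and \<sigma> = \<sigma>
        and \<gamma> = \<gamma> and l = l and E = "exp (l * t)" and R = R and \<eta> = \<eta> and a = "u (t, x)" and b = "v (t, y)",
        OF t l(2) \<alpha>(1) refl E_le[OF t] X Y lower upper uv _ \<gamma>[OF t _ uv] modulus R_def
        uniform' _ _ \<delta> \<eta>(2) \<delta>2 gx gy ineq'])
    show "\<bar>v (t, y)\<bar> \<le> C" using v(2)[of "(t, y)"] t by simp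
    show "norm (x - y) \<le> 1" using dist_le \<rho>(2) by simp
    have "exp (l * t) * \<alpha> * (norm (x - y))\<^sup>2 = exp (l * t) * (\<alpha> * (norm (x - y))\<^sup>2)" by simp
    also have "\<dots> \<le> E * \<rho>\<^sup>2" using E_le[OF t] close E0 \<alpha>(1) by (intro mult_mono) auto
    also have "\<dots> \<le> E * \<rho>" using E0 \<rho> by (intro mult_left_mono) (auto simp: power2_eq_square mult_left_le)
    finally show "exp (l * t) * \<alpha> * (norm (x - y))\<^sup>2 + norm (x - y) < d"
      using dist_le \<rho>(3) by (simp add: distrib_right)
  qed (use \<eta>(3) in auto)
  moreover have "?g \<le> u (t, x) - v (t, y)"
    using uv l(1) t by (intro mult_left_le_one_le) auto
  ultimately show False using g \<sigma> by linarith
qed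

text \<open>
  Multiplication by \<open>exp (l T)\<close> undoes the discount, so the discounted comparison is used with the
  error \<open>\<sigma> / exp (l T)\<close>. Its initial condition follows from the uniform continuity of \<open>v\<close> at time
  \<open>0\<close>.
\<close>

lemma comparison_up_to_error:
  fixes F :: "'n::finite nonlinearity" and u v :: "real \<times> (real ^ 'n) \<Rightarrow> real"
  assumes T: "T > 0" and A: "assumption_A0 T F" "assumption_A1 T F" "assumption_A2 T F" "assumption_A3 T F"
    and u: "usc_on ({0..T} \<times> UNIV) u" "\<And>w. w \<in> {0..T} \<times> UNIV \<Longrightarrow> \<bar>u w\<bar> \<le> C"
      "viscosity_subsolution F ({0<..T} \<times> UNIV) u"
    and v: "usc_on ({0..T} \<times> UNIV) (\<lambda>w. - v w)" "\<And>w. w \<in> {0..T} \<times> UNIV \<Longrightarrow> \<bar>v w\<bar> \<le> C"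
      "viscosity_subsolution (dual_nonlinearity F) ({0<..T} \<times> UNIV) (\<lambda>w. - v w)"
    and v0: "uniformly_continuous_on UNIV (\<lambda>x. v (0, x))" and uv0: "\<And>x. u (0, x) \<le> v (0, x)"
    and \<sigma>: "\<sigma> > 0"
  shows "\<exists>\<alpha>>0. \<forall>t\<in>{0..T}. \<forall>x y. u (t, x) - v (t, y) \<le> \<alpha> / 2 * (norm (x - y))\<^sup>2 + \<sigma>"
proof -
  obtain \<gamma> where \<gamma>: "\<And>t x p X a b. t \<in> {0..T} \<Longrightarrow> X \<in> sym_matrices \<Longrightarrow> b \<le> a \<Longrightarrow> \<gamma> * (a - b) \<le> F t x b p X - F t x a p X"
    using A(2) unfolding assumption_A1_def by blast
  define l where "l = max 0 (1 - \<gamma>)"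
  have l: "l \<ge> 0" "l + \<gamma> \<ge> 1" by (auto simp: l_def)
  define E where "E = exp (l * T)"
  have E: "E > 0" unfolding E_def by simp
  have \<sigma>E: "\<sigma> / E > 0" using \<sigma> E by simp
  then have \<sigma>E2: "\<sigma> / E / 2 > 0" by simp
  have C0: "C \<ge> 0" using u(2)[of "(0, 0)"] T by fastforce
  obtain \<kappa> where \<kappa>: "\<kappa> > 0" and v0\<kappa>: "\<And>x y. norm (x - y) < \<kappa> \<Longrightarrow> \<bar>v (0, x) - v (0, y)\<bar> < \<sigma> / E / 2"
    using v0 \<sigma>E2 unfolding uniformly_continuous_on_def dist_real_def dist_norm by (metis UNIV_I)
  define \<alpha>0 where "\<alpha>0 = 4 * C / \<kappa>\<^sup>2 + 1"
  have \<alpha>0: "\<alpha>0 > 0" using C0 by (simp add: \<alpha>0_def add_nonneg_pos)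
  (* Points further apart than \<kappa> are separated by the penalty, which there exceeds the bound 2 C of the gap. *)
  have initial: "u (0, x) - v (0, y) \<le> \<alpha>0 / 2 * (norm (x - y))\<^sup>2 + \<sigma> / E / 2" for x y
  proof (cases "norm (x - y) < \<kappa>")
    case True
    have "0 \<le> \<alpha>0 / 2 * (norm (x - y))\<^sup>2" using \<alpha>0 by simp
    then show ?thesis using v0\<kappa>[OF True] uv0[of x] by linarith
  next
    case False
    have "2 * C \<le> \<alpha>0 / 2 * \<kappa>\<^sup>2" using \<kappa> by (simp add: \<alpha>0_def field_simps)
    also have "\<dots> \<le> \<alpha>0 / 2 * (norm (x - y))\<^sup>2"
      using False \<kappa> \<alpha>0 by (intro mult_left_mono power_mono) auto
    finally show ?thesis using u(2)[of "(0, x)"] v(2)[of "(0, y)"] T \<sigma>E2 by fastforce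
  qed
  obtain \<alpha> where \<alpha>: "\<alpha> > 0" and gap: "\<And>t x y. t \<in> {0..T} \<Longrightarrow>
      exp (- (l * t)) * (u (t, x) - v (t, y)) \<le> \<alpha> / 2 * (norm (x - y))\<^sup>2 + \<sigma> / E"
    using comparison_discounted[OF T A(1,3,4) \<gamma> l u v \<sigma>E \<alpha>0 initial] by blast
  show ?thesis
  proof (intro exI[of _ "E * \<alpha>"] conjI ballI allI)
    show "E * \<alpha> > 0" using E \<alpha> by simp
    fix t x y assume t: "t \<in> {0..T}"
    have "u (t, x) - v (t, y) = exp (l * t) * (exp (- (l * t)) * (u (t, x) - v (t, y)))"
      by (simp add: exp_minus)
    also have "\<dots> \<le> exp (l * t) * (\<alpha> / 2 * (norm (x - y))\<^sup>2 + \<sigma> / E)"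
      by (rule mult_left_mono[OF gap[OF t]]) simp
    also have "\<dots> \<le> E * (\<alpha> / 2 * (norm (x - y))\<^sup>2 + \<sigma> / E)"
      using t l(1) \<alpha> \<sigma>E unfolding E_def by (intro mult_right_mono) (auto intro: mult_left_mono)
    also have "\<dots> = E * \<alpha> / 2 * (norm (x - y))\<^sup>2 + \<sigma>" using E by (simp add: distrib_left)
    finally show "u (t, x) - v (t, y) \<le> E * \<alpha> / 2 * (norm (x - y))\<^sup>2 + \<sigma>" .
  qed
qed

text \<open>
  The witness is the smallest nonnegative function that satisfies the inequality. It tends to \<open>0\<close> because the
  penalised supremum does not increase with \<open>\<alpha>\<close>.
\<close>

lemma vanishing_penalised_supremum:
  fixes G N :: "'z \<Rightarrow> real"
  assumes N: "\<And>z. z \<in> D \<Longrightarrow> N z \<ge> 0" and K: "\<And>z. z \<in> D \<Longrightarrow> G z \<le> K"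
    and small: "\<And>\<sigma>. \<sigma> > 0 \<Longrightarrow> \<exists>\<alpha>>0. \<forall>z\<in>D. G z \<le> \<alpha> / 2 * N z + \<sigma>"
  obtains l :: "real \<Rightarrow> real" where "(l \<longlongrightarrow> 0) at_top" "\<And>z \<alpha>. z \<in> D \<Longrightarrow> \<alpha> > 0 \<Longrightarrow> G z \<le> \<alpha> / 2 * N z + l \<alpha>"
proof -
  define S where "S \<alpha> = insert 0 ((\<lambda>z. G z - \<alpha> / 2 * N z) ` D)" for \<alpha>
  have bdd: "bdd_above (S \<alpha>)" if \<alpha>: "\<alpha> > 0" for \<alpha>
  proof (rule bdd_aboveI)
    fix s assume "s \<in> S \<alpha>"
    then consider "s = 0" | z where "z \<in> D" "s = G z - \<alpha> / 2 * N z" by (auto simp: S_def)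
    then show "s \<le> max 0 K"
    proof cases
      case (2 z)
      have "0 \<le> \<alpha> / 2 * N z" using N[OF 2(1)] \<alpha> by simp
      then show ?thesis using K[OF 2(1)] 2(2) by linarith
    qed simp
  qed
  show thesis
  proof (rule that[of "\<lambda>\<alpha>. Sup (S \<alpha>)"])
    show "((\<lambda>\<alpha>. Sup (S \<alpha>)) \<longlongrightarrow> 0) at_top"
    proof (rule tendstoI)
      fix e :: real assume "e > 0"
      then have e2: "e / 2 > 0" by simp
      obtain \<beta> where \<beta>: "\<beta> > 0" and G: "\<And>z. z \<in> D \<Longrightarrow> G z \<le> \<beta> / 2 * N z + e / 2"
        using small[OF e2] by blast
      show "\<forall>\<^sub>F \<alpha> in at_top. dist (Sup (S \<alpha>)) 0 < e"
        using eventually_ge_at_top[of \<beta>]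
      proof eventually_elim
        case (elim \<alpha>)
        have "Sup (S \<alpha>) \<le> e / 2"
        proof (rule cSup_least)
          show "S \<alpha> \<noteq> {}" by (simp add: S_def)
          fix s assume "s \<in> S \<alpha>"
          then consider "s = 0" | z where "z \<in> D" "s = G z - \<alpha> / 2 * N z" by (auto simp: S_def)
          then show "s \<le> e / 2"
          proof cases
            case (2 z)
            have "\<beta> / 2 * N z \<le> \<alpha> / 2 * N z" using elim N[OF 2(1)] by (intro mult_right_mono) auto
            then show ?thesis using G[OF 2(1)] 2(2) by linarith
          qed (use e2 in simp)
        qed
        moreover have "0 \<le> Sup (S \<alpha>)" using elim \<beta> by (intro cSup_upper bdd) (auto simp: S_def)
        ultimately show ?case using e2 by (simp add: dist_real_def)
      qed
    qed
    fix z and \<alpha> :: real assume z: "z \<in> D" and \<alpha>: "\<alpha> > 0"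
    have "G z - \<alpha> / 2 * N z \<le> Sup (S \<alpha>)" using z by (intro cSup_upper bdd \<alpha>) (auto simp: S_def)
    then show "G z \<le> \<alpha> / 2 * N z + Sup (S \<alpha>)" by linarith
  qed
qed

theorem theorem1:
  fixes T :: real
    and F :: "real \<Rightarrow> real ^ 'n \<Rightarrow> real \<Rightarrow> real ^ 'n \<Rightarrow> real ^ 'n ^ 'n \<Rightarrow> real"
    and u v :: "real \<times> (real ^ 'n) \<Rightarrow> real"
  assumes "T > 0"
    and "assumption_A0 T F" and "assumption_A1 T F"
    and "assumption_A2 T F" and "assumption_A3 T F"
    and "bounded (u ` ({0..<T} \<times> UNIV))" and "usc_on ({0..<T} \<times> UNIV) u"
    and "bounded (v ` ({0..<T} \<times> UNIV))" and "lsc_on ({0..<T} \<times> UNIV) v"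
    and "\<And>x. ereal (u (T, x)) = Limsup (at (T, x) within {0..<T} \<times> UNIV) (\<lambda>w. ereal (u w))"
    and "\<And>x. ereal (v (T, x)) = Liminf (at (T, x) within {0..<T} \<times> UNIV) (\<lambda>w. ereal (v w))"
    and "viscosity_subsolution F ({0<..<T} \<times> UNIV) u"
    and "viscosity_supersolution F ({0<..<T} \<times> UNIV) v"
  shows "(viscosity_subsolution F ({0<..T} \<times> UNIV) u \<and>
          viscosity_supersolution F ({0<..T} \<times> UNIV) v) \<and>
         (bounded (range (\<lambda>x. u (0, x))) \<and> uniformly_continuous_on UNIV (\<lambda>x. u (0, x)) \<and>
          bounded (range (\<lambda>x. v (0, x))) \<and> uniformly_continuous_on UNIV (\<lambda>x. v (0, x)) \<and>
          (\<forall>x. u (0, x) \<le> v (0, x)) \<longrightarrow>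
          (\<exists>l :: real \<Rightarrow> real. (l \<longlongrightarrow> 0) at_top \<and>
             (\<forall>t\<in>{0..T}. \<forall>x y. ereal (u (t, x) - v (t, y))
                \<le> (INF \<alpha>\<in>{0<..}. ereal (\<alpha> / 2 * (norm (x - y))\<^sup>2 + l \<alpha>)))))"
proof -
  note T = assms(1) and A = assms(2-5)
  have Fc: "continuous_on ({0..T} \<times> UNIV \<times> UNIV \<times> UNIV \<times> sym_matrices) (\<lambda>(t, x, u, p, X). F t x u p X)"
    using A(1) unfolding assumption_A0_def by blast
  have v_usc: "usc_on ({0..<T} \<times> UNIV) (\<lambda>w. - v w)" using assms(9) by (simp add: usc_on_uminus_iff)
  have v_lim: "ereal (- v (T, x)) = Limsup (at (T, x) within {0..<T} \<times> UNIV) (\<lambda>w. ereal (- v w))" for x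
    using ereal_Limsup_uminus[of "at (T, x) within {0..<T} \<times> UNIV" "\<lambda>w. ereal (v w)"]
    by (simp add: assms(11)[symmetric])
  have u_sub: "viscosity_subsolution F ({0<..T} \<times> UNIV) u"
    by (rule subsolution_up_to_terminal_time[OF T Fc assms(7,10,12)])
  have v_sub: "viscosity_subsolution (dual_nonlinearity F) ({0<..T} \<times> UNIV) (\<lambda>w. - v w)"
    by (rule subsolution_up_to_terminal_time[OF T dual_nonlinearity_continuous[OF Fc] v_usc v_lim])
      (use assms(13) in \<open>simp add: viscosity_supersolution_iff_dual\<close>)
  have v_super: "viscosity_supersolution F ({0<..T} \<times> UNIV) v"
    using v_sub by (simp add: viscosity_supersolution_iff_dual)
  have "\<exists>l :: real \<Rightarrow> real. (l \<longlongrightarrow> 0) at_top \<and> (\<forall>t\<in>{0..T}. \<forall>x y. ereal (u (t, x) - v (t, y))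
      \<le> (INF \<alpha>\<in>{0<..}. ereal (\<alpha> / 2 * (norm (x - y))\<^sup>2 + l \<alpha>)))"
    if v0: "uniformly_continuous_on UNIV (\<lambda>x. v (0, x))" and uv0: "\<forall>x. u (0, x) \<le> v (0, x)"
  proof -
    obtain Cu where Cu: "\<forall>s\<in>u ` ({0..<T} \<times> UNIV). norm s \<le> Cu" using assms(6) unfolding bounded_iff by blast
    obtain Cv where Cv: "\<forall>s\<in>v ` ({0..<T} \<times> UNIV). norm s \<le> Cv" using assms(8) unfolding bounded_iff by blast
    have C_open: "\<bar>u w\<bar> \<le> max Cu Cv" "\<bar>- v w\<bar> \<le> max Cu Cv" if w: "w \<in> {0..<T} \<times> UNIV" for w
      using bspec[OF Cu imageI[OF w]] bspec[OF Cv imageI[OF w]] by simp_all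
    have split: "(\<exists>x. w = (T, x)) \<or> w \<in> {0..<T} \<times> UNIV" if "w \<in> {0..T} \<times> UNIV" for w :: "real \<times> (real ^ 'n)"
      using that by (cases w) auto
    have uC: "\<bar>u w\<bar> \<le> max Cu Cv" if "w \<in> {0..T} \<times> UNIV" for w
      using split[OF that] C_open(1) Limsup_terminal_bounded[OF T assms(10) C_open(1)] by blast
    have vC: "\<bar>v w\<bar> \<le> max Cu Cv" if "w \<in> {0..T} \<times> UNIV" for w
      using split[OF that] C_open(2) Limsup_terminal_bounded[where u = "\<lambda>w. - v w", OF T v_lim C_open(2)] by auto
    have usc: "usc_on ({0..T} \<times> UNIV) u" "usc_on ({0..T} \<times> UNIV) (\<lambda>w. - v w)"
      by (rule usc_on_terminal_extension[OF assms(7,10)] usc_on_terminal_extension[OF v_usc v_lim])+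
    let ?D = "{0..T} \<times> (UNIV :: (real ^ 'n) set) \<times> (UNIV :: (real ^ 'n) set)"
    let ?G = "\<lambda>(t, x, y). u (t, x) - v (t, y)" and ?N = "\<lambda>(t :: real, x :: real ^ 'n, y). (norm (x - y))\<^sup>2"
    have G_le: "?G z \<le> 2 * max Cu Cv" if "z \<in> ?D" for z
    proof -
      obtain t x y where "z = (t, x, y)" "t \<in> {0..T}" using \<open>z \<in> ?D\<close> by auto
      then show ?thesis using uC[of "(t, x)"] vC[of "(t, y)"] by (simp add: abs_le_iff)
    qed
    have small: "\<exists>\<alpha>>0. \<forall>z\<in>?D. ?G z \<le> \<alpha> / 2 * ?N z + \<sigma>" if \<sigma>: "\<sigma> > 0" for \<sigma>
      using comparison_up_to_error[OF T A usc(1) uC u_sub usc(2) vC v_sub v0 uv0[rule_format] \<sigma>] by auto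
    obtain l where l: "(l \<longlongrightarrow> 0) at_top"
      and bound: "\<And>z \<alpha>. z \<in> ?D \<Longrightarrow> \<alpha> > 0 \<Longrightarrow> ?G z \<le> \<alpha> / 2 * ?N z + l \<alpha>"
      by (rule vanishing_penalised_supremum[of ?D ?N ?G "2 * max Cu Cv", OF _ G_le small]) (auto split: prod.splits)
    show ?thesis
    proof (intro exI[of _ l] conjI l ballI allI INF_greatest)
      fix t x y and \<alpha> :: real assume "t \<in> {0..T}" "\<alpha> \<in> {0<..}"
      then show "ereal (u (t, x) - v (t, y)) \<le> ereal (\<alpha> / 2 * (norm (x - y))\<^sup>2 + l \<alpha>)"
        using bound[of "(t, x, y)" \<alpha>] by simp
    qed
  qed
  with u_sub v_super show ?thesis by blast
qed

end
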